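(* Let $n,k,m$ be integers with $0\le m\le k\le\lfloor n/2\rfloor$. Let $\mathcal{B}^{\Delta}_{(n-k,k),m}\subseteq Y_{n-m}$ be the (embedded) two-row $\Delta$-Springer variety, let $\mathbb{B}_{n-k,k,m}$ be the set of $\Delta$-cup diagrams on $n$ vertices with $k$ cups and $m$ vertices to the right of the cut line, and for $\mathbf{a}\in\mathbb{B}_{n-k,k,m}$ let $K_{\mathbf a}\subseteq Y_{n-m}$ be the subvariety of all flags $(F_1,\dots,F_{n-m})\in Y_{n-m}$ such that: (i) $F_j=z^{-\frac12(j-i+1)}F_{i-1}$ whenever $i<j$ in $\{1,\dots,n-m\}$ are connected by a cup of $\mathbf a$; (ii) $F_i=F_{i-1}+\mathrm{span}\bigl(e_{\frac12(i+\rho_{\mathbf a}(i))}\bigr)$ whenever $i\in\{1,\dots,n-m\}$ is connected to a ray of $\mathbf a$, where $\rho_{\mathbf a}(i)$ is the number of rays of $\mathbf a$ attached to vertices $\le i$. (No condition is attached to a cup whose right endpoint is in $\{n-m+1,\dots,n\}$.) Then: (a) for each $\mathbf a\in\mathbb{B}_{n-k,k,m}$, $K_{\mathbf a}$ is an irreducible component of $\mathcal{B}^{\Delta}_{(n-k,k),m}$; (b) each $K_{\mathbf a}$ is a $k$-fold iterated fiber bundle over $\mathbb{P}^1$: there exist spaces $K_{\mathbf a}=X_1,X_2,\dots,X_k,X_{k+1}=\mathrm{pt}$ and maps $p_1,\dots,p_k$ such that $p_j\colon X_j\to\mathbb{P}^1$ is a fiber bundle with typical fiber $X_{j+1}$;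 in particular $K_{\mathbf a}$ is smooth; (c) the map $\mathbf a\mapsto K_{\mathbf a}$ is a bijection from $\mathbb{B}_{n-k,k,m}$ onto the set of irreducible components of $\mathcal{B}^{\Delta}_{(n-k,k),m}$.
   Context: All varieties and vector spaces are over $\mathbb{C}$. Fix a large integer $N>n$ and let $\mathbb{C}^{2N}$ have basis $e_1,\dots,e_N,f_1,\dots,f_N$; $z$ is the nilpotent endomorphism with $ze_i=e_{i-1}$, $zf_i=f_{i-1}$, where $e_0=f_0=0$. For a subspace $W$, $z^{-j}W$ denotes the preimage of $W$ under $z^j$. For $r\le N$, $Y_r$ is the smooth projective variety of partial flags $F_1\subseteq F_2\subseteq\dots\subseteq F_r\subseteq\mathbb{C}^{2N}$ with $\dim F_i=i$ and $zF_i\subseteq F_{i-1}$ for all $i$, where $F_0=\{0\}$. Put $E_{n-k,k}=\mathrm{span}(e_1,\dots,e_{n-k},f_1,\dots,f_k)$. The $\Delta$-Springer variety $\mathcal{B}^{\Delta}_{(n-k,k),m}$ attached to a nilpotent $x\in\mathfrak{gl}_n(\mathbb{C})$ of Jordan type $(n-k,k)$ is the variety of flags $F_1\subseteq\dots\subseteq F_{n-m}\subseteq\mathbb{C}^n$ with $\dim F_i=i$, $xF_i\subseteq F_{i-1}$ for $1\le i\le n-m$ and $\mathrm{im}\,x^m\subseteq F_{n-m}$. Taking $x=z|_{E_{n-k,k}}$ it is identified with the embedded variety $$\mathcal{B}^{\Delta}_{(n-k,k),m}=\{F_\bullet\in Y_{n-m}\mid z^m(E_{n-k,k})\subseteq F_{n-m}\subseteq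 E_{n-k,k}\}.$$ Cup diagrams: place vertices $1,\dots,n$ on a horizontal line from left to right. A cup diagram is a crossingless diagram below the line in which every vertex is either an endpoint of exactly one cup (an arc joining two vertices) or is attached to a vertical ray going down to infinity. A cup joining $i<j$ has left endpoint $i$ and right endpoint $j$. $\mathbb{B}_{n-k,k,m}$ (the set of $\Delta$-cup diagrams) is the set of cup diagrams on $n$ vertices with exactly $k$ cups such that each of the $m$ rightmost vertices $n-m+1,\dots,n$ is attached to a ray or is the right endpoint of a cup. The cut line is a vertical line between vertices $n-m$ and $n-m+1$. *)

theory Defs
  imports "HOL-Analysis.Analysis"
begin

(* Complex varieties are handled as spaces with functions: a topological space (carrying the
   Zariski topology) together with, for every open set U, the regular functions on U.
   A regular function on U is represented by a total function whose values off U are irrelevant. *)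

record 'a fspace =
  zar :: "'a topology"
  regular :: "'a set \<Rightarrow> ('a \<Rightarrow> complex) set"

abbreviation points :: "'a fspace \<Rightarrow> 'a set" where
  "points X \<equiv> topspace (zar X)"

definition morphism :: "'a fspace \<Rightarrow> 'b fspace \<Rightarrow> ('a \<Rightarrow> 'b) \<Rightarrow> bool" where
  "morphism X Y \<phi> \<longleftrightarrow> continuous_map (zar X) (zar Y) \<phi> \<and>
     (\<forall>V g. openin (zar Y) V \<longrightarrow> g \<in> regular Y V \<longrightarrow> g \<circ> \<phi> \<in> regular X {x \<in> points X. \<phi> x \<in> V})"

definition isomorphism :: "'a fspace \<Rightarrow> 'b fspace \<Rightarrow> ('a \<Rightarrow> 'b) \<Rightarrow> bool" where
  "isomorphism X Y \<phi> \<longleftrightarrow> morphism X Y \<phi> \<and>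
     (\<exists>\<psi>. morphism Y X \<psi> \<and> (\<forall>x \<in> points X. \<psi> (\<phi> x) = x) \<and> (\<forall>y \<in> points Y. \<phi> (\<psi> y) = y))"

text \<open>The reduced structure induced on a subset: regular functions are those that locally extend
  to regular functions of the ambient space.\<close>

definition induced :: "'a fspace \<Rightarrow> 'a set \<Rightarrow> 'a fspace" where
  "induced X S = \<lparr> zar = subtopology (zar X) S,
     regular = (\<lambda>U. {f. \<forall>x\<in>U. \<exists>V g. openin (zar X) V \<and> x \<in> V \<and> g \<in> regular X V \<and>
                              (\<forall>y \<in> U \<inter> V. f y = g y)}) \<rparr>"

text \<open>The product of two varieties. Its basic open sets are the loci inside \<open>U \<times> V\<close> where some
  \<open>\<Sum>i. a\<^sub>i(x) b\<^sub>i(y)\<close> with \<open>a\<^sub>i\<close>, \<open>b\<^sub>i\<close> regular does not vanish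
  (this is finer than the product topology), and its regular functions
  are locally quotients of such sums.\<close>

definition tensor_functions ::
  "'a fspace \<Rightarrow> 'b fspace \<Rightarrow> 'a set \<Rightarrow> 'b set \<Rightarrow> ('a \<times> 'b \<Rightarrow> complex) set" where
  "tensor_functions X Y U V = {h. \<exists>(s::nat) a b.
     (\<forall>i<s. a i \<in> regular X U \<and> b i \<in> regular Y V) \<and> h = (\<lambda>(x, y). \<Sum>i<s. a i x * b i y)}"

definition product_fspace :: "'a fspace \<Rightarrow> 'b fspace \<Rightarrow> ('a \<times> 'b) fspace" where
  "product_fspace X Y = \<lparr>
     zar = topology_generated_by {{w \<in> U \<times> V. h w \<noteq> 0} | U V h.
             openin (zar X) U \<and> openin (zar Y) V \<and> h \<in> tensor_functions X Y U V},
     regular = (\<lambda>W. {f. \<forall>w\<in>W. \<exists>U V. openin (zar X) U \<and> openin (zar Y) V \<and> w \<in> U \<times> V \<and>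
             (\<exists>p \<in> tensor_functions X Y U V. \<exists>q \<in> tensor_functions X Y U V. q w \<noteq> 0 \<and>
                (\<forall>w' \<in> W \<inter> (U \<times> V). q w' \<noteq> 0 \<longrightarrow> f w' = p w' / q w'))}) \<rparr>"

text \<open>The quotient structure on the image of a map: both open sets and regular functions are
  tested after pulling back.\<close>

definition quotient_fspace :: "'a fspace \<Rightarrow> ('a \<Rightarrow> 'b) \<Rightarrow> 'b fspace" where
  "quotient_fspace X \<pi> = \<lparr>
     zar = topology (\<lambda>U. U \<subseteq> \<pi> ` points X \<and> openin (zar X) {x \<in> points X. \<pi> x \<in> U}),
     regular = (\<lambda>U. {f. f \<circ> \<pi> \<in> regular X {x \<in> points X. \<pi> x \<in> U}}) \<rparr>"

lemma openin_quotient_fspace: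
  "openin (zar (quotient_fspace X \<pi>)) U \<longleftrightarrow>
     U \<subseteq> \<pi> ` points X \<and> openin (zar X) {x \<in> points X. \<pi> x \<in> U}"
proof -
  have "istopology (\<lambda>U. U \<subseteq> \<pi> ` points X \<and> openin (zar X) {x \<in> points X. \<pi> x \<in> U})"
    unfolding istopology_def
  proof (intro conjI allI impI)
    fix S T
    assume S: "S \<subseteq> \<pi> ` points X \<and> openin (zar X) {x \<in> points X. \<pi> x \<in> S}"
      and T: "T \<subseteq> \<pi> ` points X \<and> openin (zar X) {x \<in> points X. \<pi> x \<in> T}"
    show "S \<inter> T \<subseteq> \<pi> ` points X" using S by blast
    have "{x \<in> points X. \<pi> x \<in> S \<inter> T} = {x \<in> points X. \<pi> x \<in> S} \<inter> {x \<in> points X. \<pi> x \<in> T}"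
      by blast
    then show "openin (zar X) {x \<in> points X. \<pi> x \<in> S \<inter> T}" using S T by auto
  next
    fix \<K>
    assume K: "\<forall>K\<in>\<K>. K \<subseteq> \<pi> ` points X \<and> openin (zar X) {x \<in> points X. \<pi> x \<in> K}"
    show "\<Union>\<K> \<subseteq> \<pi> ` points X" using K by blast
    have "{x \<in> points X. \<pi> x \<in> \<Union>\<K>} = (\<Union>K\<in>\<K>. {x \<in> points X. \<pi> x \<in> K})"
      by blast
    then show "openin (zar X) {x \<in> points X. \<pi> x \<in> \<Union>\<K>}" using K by auto
  qed
  then show ?thesis by (simp add: quotient_fspace_def)
qed

lemma points_quotient_fspace: "points (quotient_fspace X \<pi>) = \<pi> ` points X"
proof
  show "points (quotient_fspace X \<pi>) \<subseteq> \<pi> ` points X"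
    by (auto simp: topspace_def openin_quotient_fspace)
  have "{x \<in> points X. \<pi> x \<in> \<pi> ` points X} = points X" by blast
  then have "openin (zar (quotient_fspace X \<pi>)) (\<pi> ` points X)"
    by (simp add: openin_quotient_fspace)
  then show "\<pi> ` points X \<subseteq> points (quotient_fspace X \<pi>)"
    by (rule openin_subset)
qed


inductive_set poly_functions :: "('x \<Rightarrow> complex) set \<Rightarrow> ('x \<Rightarrow> complex) set"
  for C :: "('x \<Rightarrow> complex) set" where
  const: "(\<lambda>x. c) \<in> poly_functions C"
| coord: "f \<in> C \<Longrightarrow> f \<in> poly_functions C"
| add: "f \<in> poly_functions C \<Longrightarrow> g \<in> poly_functions C \<Longrightarrow> (\<lambda>x. f x + g x) \<in> poly_functions C"
| mult: "f \<in> poly_functions C \<Longrightarrow> g \<in> poly_functions C \<Longrightarrow> (\<lambda>x. f x * g x) \<in> poly_functions C"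

text \<open>A set \<open>P\<close> with coordinate functions \<open>C\<close>, viewed as a subset of an affine space.\<close>

definition coordinate_space :: "('x \<Rightarrow> complex) set \<Rightarrow> 'x set \<Rightarrow> 'x fspace" where
  "coordinate_space C P = \<lparr>
     zar = topology_generated_by {{x \<in> P. p x \<noteq> 0} | p. p \<in> poly_functions C},
     regular = (\<lambda>U. {f. \<forall>x\<in>U. \<exists>p \<in> poly_functions C. \<exists>q \<in> poly_functions C. q x \<noteq> 0 \<and>
                 (\<forall>y\<in>U. q y \<noteq> 0 \<longrightarrow> f y = p y / q y)}) \<rparr>"

lemma points_coordinate_space [simp]: "points (coordinate_space C P) = P"
proof -
  let ?B = "{{x \<in> P. p x \<noteq> 0} | p. p \<in> poly_functions C}"
  have "P \<in> ?B"
    using poly_functions.const[of 1 C] by (intro CollectI exI[of _ "\<lambda>x. 1"]) simp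
  then have "\<Union>?B = P" by blast
  then show ?thesis
    unfolding coordinate_space_def fspace.simps topology_generated_by_topspace .
qed

definition affine_coords :: "nat \<Rightarrow> (complex list \<Rightarrow> complex) set" where
  "affine_coords n = {\<lambda>a. a ! i | i. i < n}"

definition affine_fspace :: "nat \<Rightarrow> complex list fspace" where
  "affine_fspace n = coordinate_space (affine_coords n) {a. length a = n}"


definition irreducible_in :: "'a topology \<Rightarrow> 'a set \<Rightarrow> bool" where
  "irreducible_in T S \<longleftrightarrow> S \<subseteq> topspace T \<and> S \<noteq> {} \<and>
     (\<forall>A B. closedin T A \<longrightarrow> closedin T B \<longrightarrow> S \<subseteq> A \<union> B \<longrightarrow> S \<subseteq> A \<or> S \<subseteq> B)"

definition irreducible_components :: "'a fspace \<Rightarrow> 'a set set" where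
  "irreducible_components X = {S. irreducible_in (zar X) S \<and>
     (\<forall>S'. irreducible_in (zar X) S' \<longrightarrow> S \<subseteq> S' \<longrightarrow> S' = S)}"

definition partial_deriv :: "nat \<Rightarrow> (complex list \<Rightarrow> complex) \<Rightarrow> complex list \<Rightarrow> complex" where
  "partial_deriv i p a = deriv (\<lambda>t. p (a[i := t])) (a ! i)"

text \<open>Smoothness over the complex numbers: locally isomorphic to the locus
  \<open>h\<^sub>0 = \<dots> = h\<^bsub>c-1\<^esub> = 0\<close> in a principal open subset \<open>g \<noteq> 0\<close> of an affine space,
  where the gradients of \<open>h\<^sub>0, \<dots>, h\<^bsub>c-1\<^esub>\<close> are linearly independent
  at each point of the locus.\<close>

definition smooth_locus ::
  "nat \<Rightarrow> nat \<Rightarrow> (complex list \<Rightarrow> complex) \<Rightarrow> (nat \<Rightarrow> complex list \<Rightarrow> complex) \<Rightarrow>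
   complex list set \<Rightarrow> bool" where
  "smooth_locus n c g h S \<longleftrightarrow>
     g \<in> poly_functions (affine_coords n) \<and> (\<forall>j<c. h j \<in> poly_functions (affine_coords n)) \<and>
     S = {a. length a = n \<and> g a \<noteq> 0 \<and> (\<forall>j<c. h j a = 0)} \<and>
     (\<forall>a\<in>S. \<forall>u. (\<forall>i<n. (\<Sum>j<c. u j * partial_deriv i (h j) a) = 0) \<longrightarrow> (\<forall>j<c. u j = 0))"

definition smooth_fspace :: "'a fspace \<Rightarrow> bool" where
  "smooth_fspace X \<longleftrightarrow> (\<forall>x \<in> points X. \<exists>U n c g h S \<phi>.
     openin (zar X) U \<and> x \<in> U \<and> smooth_locus n c g h S \<and>
     isomorphism (induced X U) (induced (affine_fspace n) S) \<phi>)"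

definition fiber_bundle :: "'a fspace \<Rightarrow> 'b fspace \<Rightarrow> 'c fspace \<Rightarrow> ('a \<Rightarrow> 'b) \<Rightarrow> bool" where
  "fiber_bundle X B F p \<longleftrightarrow> morphism X B p \<and>
     (\<forall>b \<in> points B. \<exists>U \<phi>. openin (zar B) U \<and> b \<in> U \<and>
        isomorphism (induced X {x \<in> points X. p x \<in> U}) (product_fspace (induced B U) F) \<phi> \<and>
        (\<forall>x \<in> points X. p x \<in> U \<longrightarrow> fst (\<phi> x) = p x))"


text \<open>A flag \<open>F\<^sub>1 \<subseteq> \<dots> \<subseteq> F\<^sub>r\<close> is the list \<open>[F\<^sub>1, \<dots>, F\<^sub>r]\<close>.\<close>

type_synonym 'd flag = "(complex ^ 'd) set list"

definition flag_part :: "'d flag \<Rightarrow> nat \<Rightarrow> (complex ^ 'd) set" where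
  "flag_part F i = (if i = 0 then {0} else F ! (i - 1))"

definition partial_flags :: "nat \<Rightarrow> ('d::finite) flag set" where
  "partial_flags r = {F. length F = r \<and>
     (\<forall>i\<in>{1..r}. vec.subspace (flag_part F i) \<and> vec.dim (flag_part F i) = i \<and>
        flag_part F (i - 1) \<subseteq> flag_part F i)}"

text \<open>The variety structure on partial flags is the one of the homogeneous space
  \<open>{linearly independent r-tuples} / {invertible triangular r \<times> r matrices}\<close>;
  for \<open>r = 1\<close> this is projective space with its usual Zariski topology and regular functions.\<close>

definition frames :: "nat \<Rightarrow> (complex ^ 'd::finite) list set" where
  "frames r = {vs. length vs = r \<and> distinct vs \<and> vec.independent (set vs)}"

definition frame_space :: "nat \<Rightarrow> (complex ^ 'd::finite) list fspace" where
  "frame_space r = coordinate_space {\<lambda>vs. vs ! i $ j | i j. i < r} (frames r)"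

definition flag_of_frame :: "(complex ^ 'd::finite) list \<Rightarrow> 'd flag" where
  "flag_of_frame vs = map (\<lambda>i. vec.span (set (take i vs))) [1..<Suc (length vs)]"

definition flag_variety :: "nat \<Rightarrow> ('d::finite) flag fspace" where
  "flag_variety r = quotient_fspace (frame_space r) flag_of_frame"

lemma flag_part_of_frame:
  "i \<le> length vs \<Longrightarrow> flag_part (flag_of_frame vs) i = vec.span (set (take i vs))"
  by (cases i) (auto simp: flag_part_def flag_of_frame_def simp del: upt_Suc)

lemma points_flag_variety: "points (flag_variety r :: ('d::finite) flag fspace) = partial_flags r"
proof -
  have "flag_of_frame ` frames r = (partial_flags r :: 'd flag set)"
  proof (intro equalityI subsetI)
    fix F :: "'d flag"
    assume "F \<in> flag_of_frame ` frames r"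
    then obtain vs where vs: "length vs = r" "distinct vs" "vec.independent (set vs)"
      and F: "F = flag_of_frame vs"
      by (auto simp: frames_def)
    have P: "flag_part F i = vec.span (set (take i vs))" if "i \<le> r" for i
      using flag_part_of_frame[of i vs] that vs(1) F by simp
    have "vec.dim (flag_part F i) = i" if "i \<le> r" for i
    proof -
      have "vec.independent (set (take i vs))"
        by (rule vec.independent_mono[OF vs(3) set_take_subset])
      then have "vec.dim (flag_part F i) = card (set (take i vs))"
        unfolding P[OF that] by (rule vec.dim_span_eq_card_independent)
      also have "\<dots> = i"
        using that vs(1,2) by (simp add: distinct_card)
      finally show ?thesis .
    qed
    moreover have "flag_part F (i - 1) \<subseteq> flag_part F i" if "i \<le> r" for i
      using P[of i] P[of "i - 1"] that
      by (simp add: vec.span_mono set_take_subset_set_take)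
    moreover have "vec.subspace (flag_part F i)" if "i \<le> r" for i
      using P[OF that] by simp
    moreover have "length F = r" by (simp add: F flag_of_frame_def vs)
    ultimately show "F \<in> partial_flags r" by (auto simp: partial_flags_def)
  next
    fix F :: "'d flag"
    assume F: "F \<in> partial_flags r"
    have Fi: "vec.subspace (flag_part F i) \<and> vec.dim (flag_part F i) = i \<and>
        flag_part F (i - 1) \<subseteq> flag_part F i" if "1 \<le> i" "i \<le> r" for i
      using F that unfolding partial_flags_def mem_Collect_eq by (meson atLeastAtMost_iff)
    have "\<exists>vs. vs \<in> frames i \<and> (\<forall>l\<le>i. vec.span (set (take l vs)) = flag_part F l)" if "i \<le> r" for i
      using that
    proof (induction i)
      case 0
      show ?case
        by (rule exI[of _ "[]"]) (simp add: frames_def flag_part_def vec.independent_empty)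
    next
      case (Suc i)
      then obtain vs where vs: "vs \<in> frames i" "\<forall>l\<le>i. vec.span (set (take l vs)) = flag_part F l"
        by auto
      then have len: "length vs = i" and sp: "vec.span (set vs) = flag_part F i"
        by (auto simp: frames_def)
      have ind: "vec.independent (set vs)" "distinct vs" using vs by (auto simp: frames_def)
      have F': "vec.subspace (flag_part F (Suc i))" "vec.dim (flag_part F (Suc i)) = Suc i"
          "flag_part F i \<subseteq> flag_part F (Suc i)"
        using Fi[of "Suc i"] Suc.prems by simp_all
      have "vec.dim (flag_part F i) = i"
        using vec.dim_span_eq_card_independent[OF ind(1)] distinct_card[OF ind(2)] sp len by metis
      then obtain x where x: "x \<in> flag_part F (Suc i)" "x \<notin> flag_part F i"
        using F'(2,3) n_not_Suc_n[of i] by (cases "flag_part F (Suc i) = flag_part F i") auto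
      have x': "x \<notin> vec.span (set vs)" using x sp by simp
      have ind': "vec.independent (set (vs @ [x]))"
        using vec.independent_insertI[OF x' ind(1)] by simp
      have "x \<notin> set vs" using x' vec.span_base by metis
      then have dis': "distinct (vs @ [x])" using ind(2) by simp
      have "vec.span (set (vs @ [x])) = flag_part F (Suc i)"
      proof (rule vec.subspace_dim_equal)
        have "set vs \<subseteq> flag_part F (Suc i)"
          using vec.span_superset[of "set vs"] sp F'(3) by simp
        then show "vec.span (set (vs @ [x])) \<subseteq> flag_part F (Suc i)"
          using x(1) F'(1) by (intro vec.span_minimal) auto
        have "vec.dim (vec.span (set (vs @ [x]))) = card (set (vs @ [x]))"
          by (rule vec.dim_span_eq_card_independent[OF ind'])
        also have "\<dots> = Suc i" using distinct_card[OF dis'] len by simp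
        finally show "vec.dim (flag_part F (Suc i)) \<le> vec.dim (vec.span (set (vs @ [x])))"
          using F'(2) by simp
      qed (use F' in auto)
      then have "\<forall>l\<le>Suc i. vec.span (set (take l (vs @ [x]))) = flag_part F l"
        using vs(2) len by (auto simp: le_Suc_eq)
      moreover have "vs @ [x] \<in> frames (Suc i)" using ind' dis' len by (simp add: frames_def)
      ultimately show ?case by blast
    qed
    from this[OF order_refl] obtain vs where vs: "vs \<in> frames r"
      "\<forall>l\<le>r. vec.span (set (take l vs)) = flag_part F l" by blast
    have lens: "length vs = r" "length F = r"
      using vs(1) F unfolding frames_def partial_flags_def mem_Collect_eq by blast+
    have "F = flag_of_frame vs"
    proof (rule nth_equalityI)
      show "length F = length (flag_of_frame vs)" by (simp add: flag_of_frame_def lens)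
      fix l assume "l < length F"
      then show "F ! l = flag_of_frame vs ! l"
        using vs(2) flag_part_of_frame[of "Suc l" vs] lens by (simp add: flag_part_def)
    qed
    then show "F \<in> flag_of_frame ` frames r" using vs by blast
  qed
  then show ?thesis
    by (simp add: flag_variety_def points_quotient_fspace frame_space_def)
qed

definition projective_line :: "2 flag fspace" where
  "projective_line = flag_variety 1"

text \<open>The total spaces in the tower may be taken to be closed subvarieties of one ambient variety,
  since each of them is isomorphic to a fiber of the preceding bundle.\<close>

definition iterated_P1_bundle :: "'a fspace \<Rightarrow> nat \<Rightarrow> 'a set \<Rightarrow> bool" where
  "iterated_P1_bundle A k K \<longleftrightarrow> (\<exists>X p.
     X 1 = K \<and> (\<exists>pt. X (k + 1) = {pt}) \<and>
     (\<forall>j\<in>{1..k + 1}. closedin (zar A) (X j)) \<and>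
     (\<forall>j\<in>{1..k}. fiber_bundle (induced A (X j)) projective_line (induced A (X (j + 1))) (p j)))"


definition Y_flags :: "(complex ^ 'd \<Rightarrow> complex ^ 'd) \<Rightarrow> nat \<Rightarrow> ('d::finite) flag set" where
  "Y_flags z r = {F \<in> partial_flags r. \<forall>i\<in>{1..r}. z ` flag_part F i \<subseteq> flag_part F (i - 1)}"

definition E_space ::
  "(nat \<Rightarrow> complex ^ 'd) \<Rightarrow> (nat \<Rightarrow> complex ^ 'd) \<Rightarrow> nat \<Rightarrow> nat \<Rightarrow> (complex ^ 'd::finite) set" where
  "E_space e f a b = vec.span (e ` {1..a} \<union> f ` {1..b})"

definition delta_springer ::
  "(nat \<Rightarrow> complex ^ 'd) \<Rightarrow> (nat \<Rightarrow> complex ^ 'd) \<Rightarrow> (complex ^ 'd \<Rightarrow> complex ^ 'd) \<Rightarrow>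
   nat \<Rightarrow> nat \<Rightarrow> nat \<Rightarrow> ('d::finite) flag set" where
  "delta_springer e f z n k m = {F \<in> Y_flags z (n - m).
     (z ^^ m) ` E_space e f (n - k) k \<subseteq> flag_part F (n - m) \<and>
     flag_part F (n - m) \<subseteq> E_space e f (n - k) k}"


text \<open>A cup diagram on vertices \<open>1, \<dots>, n\<close> is the set of its cups \<open>(i, j)\<close>, \<open>i < j\<close>;
  the vertices on no cup carry the rays. A ray crosses every cup that passes below its vertex.\<close>

definition ray_vertices :: "nat \<Rightarrow> (nat \<times> nat) set \<Rightarrow> nat set" where
  "ray_vertices n a = {v \<in> {1..n}. \<forall>(i, j)\<in>a. v \<noteq> i \<and> v \<noteq> j}"

definition cup_diagram :: "nat \<Rightarrow> (nat \<times> nat) set \<Rightarrow> bool" where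
  "cup_diagram n a \<longleftrightarrow>
     (\<forall>(i, j)\<in>a. 1 \<le> i \<and> i < j \<and> j \<le> n) \<and>
     (\<forall>(i, j)\<in>a. \<forall>(i', j')\<in>a. (i, j) \<noteq> (i', j') \<longrightarrow> {i, j} \<inter> {i', j'} = {}) \<and>
     (\<forall>(i, j)\<in>a. \<forall>(i', j')\<in>a. \<not> (i < i' \<and> i' < j \<and> j < j')) \<and>
     (\<forall>(i, j)\<in>a. \<forall>v \<in> ray_vertices n a. \<not> (i < v \<and> v < j))"

definition delta_cup_diagrams :: "nat \<Rightarrow> nat \<Rightarrow> nat \<Rightarrow> (nat \<times> nat) set set" where
  "delta_cup_diagrams n k m = {a. cup_diagram n a \<and> card a = k \<and>
     (\<forall>v\<in>{n - m + 1..n}. v \<in> ray_vertices n a \<or> (\<exists>i. (i, v) \<in> a))}"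

definition ray_count :: "nat \<Rightarrow> (nat \<times> nat) set \<Rightarrow> nat \<Rightarrow> nat" where
  "ray_count n a i = card {v \<in> ray_vertices n a. v \<le> i}"

text \<open>The divisions by \<open>2\<close> below are exact on every cup diagram.\<close>

definition K_component ::
  "(nat \<Rightarrow> complex ^ 'd) \<Rightarrow> (complex ^ 'd \<Rightarrow> complex ^ 'd) \<Rightarrow>
   nat \<Rightarrow> nat \<Rightarrow> (nat \<times> nat) set \<Rightarrow> ('d::finite) flag set" where
  "K_component e z n m a = {F \<in> Y_flags z (n - m).
     (\<forall>(i, j)\<in>a. j \<le> n - m \<longrightarrow>
        flag_part F j = (z ^^ ((j - i + 1) div 2)) -` flag_part F (i - 1)) \<and>
     (\<forall>i \<in> ray_vertices n a. i \<le> n - m \<longrightarrow>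
        flag_part F i = {x + y | x y. x \<in> flag_part F (i - 1) \<and>
                      y \<in> vec.span {e ((i + ray_count n a i) div 2)}})}"

end

theory Submission
  imports Defs
begin

text \<open>
  Every flag of the \<open>\<Delta>\<close>-Springer variety lies in some \<open>K\<^sub>a\<close>, by induction on its length. If \<open>F\<^sub>r\<close> contains
  \<open>ker z\<close>, the first \<open>F\<^bsub>i+1\<^esub>\<close> that does so is \<open>z\<^sup>-\<^sup>1 F\<^bsub>i-1\<^esub>\<close>; removing \<open>F\<^sub>i\<close>, \<open>F\<^bsub>i+1\<^esub>\<close> and applying \<open>z\<close> to the
  later terms removes a cup \<open>(i, i+1)\<close> from \<open>a\<close>. Otherwise \<open>z\<close> is a single Jordan block on \<open>F\<^sub>r\<close>, and the diagram consists
  of rays followed by cups that cross the cut line. The \<open>K\<^sub>a\<close> are not contained in one another because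
  the coordinate flags in \<open>K\<^sub>a\<close>, indexed by words in \<open>e\<close> and \<open>f\<close>, already determine \<open>a\<close>.

  Everything left of the first left endpoint \<open>l\<close> is a fixed coordinate flag, so \<open>F \<mapsto> F\<^sub>l / F\<^bsub>l-1\<^esub>\<close> maps \<open>K\<^sub>a\<close> to the
  projective line. Square-zero endomorphisms \<open>M\<close> commuting with \<open>z\<close> modulo \<open>F\<^bsub>l-1\<^esub>\<close> give one-parameter groups
  \<open>1 + t M\<close>, acting on the part of the flag below the cup at \<open>l\<close>, which trivialise this map over the complement of a point.
  Two of them cover the line. Fixing \<open>F\<^sub>l\<close> to be a coordinate subspace and going on to the next left endpoint gives the
  tower; irreducibility and charts isomorphic to affine spaces are carried up it.
  Functions on the flag variety are made regular by local sections of the frame bundle, obtained from Gaussian elimination.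
\<close>

section \<open>Spaces with functions\<close>

text \<open>Two restrictions let \<open>1 + t M\<close> act on flags. \<open>M\<close> mixes
  e_(\<alpha>+j) with f_(\<beta>+j), where \<open>E \<alpha> \<beta>\<close> is the term just before
  l. It fails to commute with \<open>z\<close> only by vectors of \<open>E \<alpha> \<beta>\<close>,
  and these lie in every later term. At the right endpoint the term is the preimage of
  \<open>E \<alpha> \<beta>\<close> under a power of \<open>z\<close>, which \<open>1 + t M\<close>
  preserves; the terms beyond it, bound to coordinate subspaces that \<open>M\<close> need not
  respect, can therefore stay put. The parameter c of \<open>M\<close> selects the omitted point (c
  : 1) of the projective line; c = 0 and c = 1 suffice. Closedness comes from writing every
  condition as A(F_j) \<subseteq> F_i. An equality with a preimage becomes such an inclusion because
  the dimensions agree, which uses the room left by n < N. No dimension theory enters: a finite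
  irredundant cover by closed irreducible sets is the list of components. Irreducibility climbs the
  tower because the field is infinite: of two closed sets that cover, one contains the translates
  for infinitely many t, and then whole orbit curves.\<close>

definition function_sheaf :: "'a fspace \<Rightarrow> bool" where
  "function_sheaf X \<longleftrightarrow>
     (\<forall>U c. openin (zar X) U \<longrightarrow> (\<lambda>x. c) \<in> regular X U) \<and>
     (\<forall>U f g. openin (zar X) U \<longrightarrow> f \<in> regular X U \<longrightarrow> g \<in> regular X U \<longrightarrow>
        (\<lambda>x. f x + g x) \<in> regular X U \<and> (\<lambda>x. f x * g x) \<in> regular X U) \<and>
     (\<forall>U f. openin (zar X) U \<longrightarrow> f \<in> regular X U \<longrightarrow>
        openin (zar X) {x \<in> U. f x \<noteq> 0} \<and> (\<lambda>x. inverse (f x)) \<in> regular X {x \<in> U. f x \<noteq> 0}) \<and>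
     (\<forall>U f. openin (zar X) U \<longrightarrow>
        (\<forall>x\<in>U. \<exists>V g. openin (zar X) V \<and> x \<in> V \<and> g \<in> regular X V \<and> (\<forall>y \<in> U \<inter> V. f y = g y)) \<longrightarrow>
        f \<in> regular X U)"

lemma sheaf_const: "function_sheaf X \<Longrightarrow> openin (zar X) U \<Longrightarrow> (\<lambda>x. c) \<in> regular X U"
  by (simp add: function_sheaf_def)

lemma sheaf_add:
  "function_sheaf X \<Longrightarrow> openin (zar X) U \<Longrightarrow> f \<in> regular X U \<Longrightarrow> g \<in> regular X U \<Longrightarrow>
    (\<lambda>x. f x + g x) \<in> regular X U"
  by (simp add: function_sheaf_def)

lemma sheaf_mult:
  "function_sheaf X \<Longrightarrow> openin (zar X) U \<Longrightarrow> f \<in> regular X U \<Longrightarrow> g \<in> regular X U \<Longrightarrow>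
    (\<lambda>x. f x * g x) \<in> regular X U"
  by (simp add: function_sheaf_def)

lemma sheaf_nonzero_open:
  "function_sheaf X \<Longrightarrow> openin (zar X) U \<Longrightarrow> f \<in> regular X U \<Longrightarrow> openin (zar X) {x \<in> U. f x \<noteq> 0}"
  by (simp add: function_sheaf_def)

lemma sheaf_inverse:
  "function_sheaf X \<Longrightarrow> openin (zar X) U \<Longrightarrow> f \<in> regular X U \<Longrightarrow>
    (\<lambda>x. inverse (f x)) \<in> regular X {x \<in> U. f x \<noteq> 0}"
  by (simp add: function_sheaf_def)

lemma sheaf_local:
  assumes "function_sheaf X" "openin (zar X) U"
    and "\<And>x. x \<in> U \<Longrightarrow> \<exists>V g. openin (zar X) V \<and> x \<in> V \<and> g \<in> regular X V \<and> (\<forall>y \<in> U \<inter> V. f y = g y)"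
  shows "f \<in> regular X U"
proof -
  have "\<forall>U f. openin (zar X) U \<longrightarrow>
        (\<forall>x\<in>U. \<exists>V g. openin (zar X) V \<and> x \<in> V \<and> g \<in> regular X V \<and> (\<forall>y \<in> U \<inter> V. f y = g y)) \<longrightarrow>
        f \<in> regular X U" using assms(1) by (simp add: function_sheaf_def)
  then show ?thesis using assms(2,3) by simp
qed

text \<open>Taking the one neighbourhood V for every point turns the gluing axiom into restriction.
  Since only values on U are compared, it also replaces a regular function by any formula that
  agrees with it on U, which is how it is mostly applied.\<close>

lemma sheaf_restrict:
  assumes "function_sheaf X" "openin (zar X) U" "openin (zar X) V" "f \<in> regular X V"
    and "U \<subseteq> V" "\<And>x. x \<in> U \<Longrightarrow> f x = g x"
  shows "g \<in> regular X U"
proof (rule sheaf_local[OF assms(1,2)])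
  fix x assume "x \<in> U"
  then show "\<exists>V' h. openin (zar X) V' \<and> x \<in> V' \<and> h \<in> regular X V' \<and> (\<forall>y \<in> U \<inter> V'. g y = h y)"
    using assms by (intro exI[of _ V] exI[of _ f]) auto
qed

lemma sheaf_sum:
  assumes "function_sheaf X" "openin (zar X) U" "\<And>i. i \<in> I \<Longrightarrow> f i \<in> regular X U"
  shows "(\<lambda>x. \<Sum>i\<in>I. f i x) \<in> regular X U"
proof (cases "finite I")
  case True
  then show ?thesis using assms(3)
    by (induction I) (auto intro: sheaf_const sheaf_add assms)
next
  case False
  then show ?thesis by (simp add: sheaf_const assms)
qed

lemma sheaf_diff:
  assumes "function_sheaf X" "openin (zar X) U" "f \<in> regular X U" "g \<in> regular X U"
  shows "(\<lambda>x. f x - g x) \<in> regular X U"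
  using sheaf_add[OF assms(1-3) sheaf_mult[OF assms(1,2) sheaf_const[OF assms(1,2), of "-1"] assms(4)]]
  by simp

lemma sheaf_divide:
  assumes X: "function_sheaf X" and U: "openin (zar X) U" and f: "f \<in> regular X U" and g: "g \<in> regular X U"
    and nz: "\<And>x. x \<in> U \<Longrightarrow> g x \<noteq> 0"
  shows "(\<lambda>x. f x / g x) \<in> regular X U"
proof -
  have "{x \<in> U. g x \<noteq> 0} = U" using nz by blast
  then have "(\<lambda>x. inverse (g x)) \<in> regular X U" using sheaf_inverse[OF X U g] by simp
  from sheaf_mult[OF X U f this] show ?thesis by (simp add: divide_inverse)
qed

lemma sheaf_poly:
  assumes "function_sheaf X" "openin (zar X) U" "\<And>c. c \<in> C \<Longrightarrow> (\<lambda>x. c (l x)) \<in> regular X U"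
    and "p \<in> poly_functions C"
  shows "(\<lambda>x. p (l x)) \<in> regular X U"
  using assms(4) by induction (auto intro: assms sheaf_const sheaf_add sheaf_mult)

subsection \<open>Coordinate spaces\<close>

text \<open>Nonvanishing loci of polynomials are closed under intersection, by multiplying the
  polynomials, so the generating sets are already a basis.\<close>

lemma openin_coordinate_space_basis:
  assumes "openin (zar (coordinate_space C P)) W" "x \<in> W"
  shows "\<exists>p \<in> poly_functions C. p x \<noteq> 0 \<and> {y \<in> P. p y \<noteq> 0} \<subseteq> W"
proof -
  have "generate_topology_on {{x \<in> P. p x \<noteq> 0} | p. p \<in> poly_functions C} W"
    using assms(1) unfolding coordinate_space_def by (simp add: openin_topology_generated_by_iff)
  then show ?thesis using assms(2)
  proof (induction arbitrary: x)
    case Empty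
    then show ?case by simp
  next
    case (Int a b)
    then obtain p q where "p \<in> poly_functions C" "p x \<noteq> 0" "{y \<in> P. p y \<noteq> 0} \<subseteq> a"
      "q \<in> poly_functions C" "q x \<noteq> 0" "{y \<in> P. q y \<noteq> 0} \<subseteq> b" by (meson IntD1 IntD2)
    then show ?case
      by (intro bexI[of _ "\<lambda>y. p y * q y"]) (auto intro: poly_functions.mult)
  next
    case (UN K)
    then obtain k where "k \<in> K" "x \<in> k" by blast
    with UN.IH[of k x] show ?case by blast
  next
    case (Basis s)
    then show ?case by auto
  qed
qed

lemma openin_coordinate_space_nonzero:
  "p \<in> poly_functions C \<Longrightarrow> openin (zar (coordinate_space C P)) {y \<in> P. p y \<noteq> 0}"
  unfolding coordinate_space_def by (auto intro!: topology_generated_by_Basis)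

lemma regular_coordinate_spaceI:
  assumes "\<And>x. x \<in> U \<Longrightarrow> \<exists>p \<in> poly_functions C. \<exists>q \<in> poly_functions C. q x \<noteq> 0 \<and>
                 (\<forall>y\<in>U. q y \<noteq> 0 \<longrightarrow> f y = p y / q y)"
  shows "f \<in> regular (coordinate_space C P) U"
  using assms by (simp add: coordinate_space_def)

lemma regular_coordinate_spaceE:
  assumes "f \<in> regular (coordinate_space C P) U" "x \<in> U"
  obtains p q where "p \<in> poly_functions C" "q \<in> poly_functions C" "q x \<noteq> 0"
    "\<And>y. y \<in> U \<Longrightarrow> q y \<noteq> 0 \<Longrightarrow> f y = p y / q y"
  using assms by (auto simp: coordinate_space_def)

lemma regular_coordinate_space_poly:
  assumes "p \<in> poly_functions C"
  shows "p \<in> regular (coordinate_space C P) U"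
  using assms poly_functions.const[of 1 C]
  by (intro regular_coordinate_spaceI bexI[of _ p] bexI[of _ "\<lambda>x. 1"]) auto

lemma function_sheaf_coordinate_space: "function_sheaf (coordinate_space C P)"
  unfolding function_sheaf_def
proof (intro conjI allI impI)
  let ?X = "coordinate_space C P"
  note pf = poly_functions.intros
  fix U assume U: "openin (zar ?X) U"
  then have UP: "U \<subseteq> P" using openin_subset[OF U] by simp
  show "(\<lambda>x. c) \<in> regular ?X U" for c
    by (rule regular_coordinate_space_poly) (rule pf)
  fix f assume f: "f \<in> regular ?X U"
  { fix g assume g: "g \<in> regular ?X U"
    show "(\<lambda>x. f x + g x) \<in> regular ?X U"
    proof (rule regular_coordinate_spaceI)
      fix x assume x: "x \<in> U"
      obtain p q where 1: "p \<in> poly_functions C" "q \<in> poly_functions C" "q x \<noteq> 0"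
        "\<And>y. y \<in> U \<Longrightarrow> q y \<noteq> 0 \<Longrightarrow> f y = p y / q y" by (rule regular_coordinate_spaceE[OF f x]) auto
      obtain p' q' where 2: "p' \<in> poly_functions C" "q' \<in> poly_functions C" "q' x \<noteq> 0"
        "\<And>y. y \<in> U \<Longrightarrow> q' y \<noteq> 0 \<Longrightarrow> g y = p' y / q' y" by (rule regular_coordinate_spaceE[OF g x]) auto
      show "\<exists>p \<in> poly_functions C. \<exists>q \<in> poly_functions C. q x \<noteq> 0 \<and>
                 (\<forall>y\<in>U. q y \<noteq> 0 \<longrightarrow> f y + g y = p y / q y)"
        by (rule bexI[of _ "\<lambda>y. p y * q' y + p' y * q y"], rule bexI[of _ "\<lambda>y. q y * q' y"])
           (use 1 2 in \<open>auto intro: pf simp: add_frac_eq\<close>)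
    qed
    show "(\<lambda>x. f x * g x) \<in> regular ?X U"
    proof (rule regular_coordinate_spaceI)
      fix x assume x: "x \<in> U"
      obtain p q where 1: "p \<in> poly_functions C" "q \<in> poly_functions C" "q x \<noteq> 0"
        "\<And>y. y \<in> U \<Longrightarrow> q y \<noteq> 0 \<Longrightarrow> f y = p y / q y" by (rule regular_coordinate_spaceE[OF f x]) auto
      obtain p' q' where 2: "p' \<in> poly_functions C" "q' \<in> poly_functions C" "q' x \<noteq> 0"
        "\<And>y. y \<in> U \<Longrightarrow> q' y \<noteq> 0 \<Longrightarrow> g y = p' y / q' y" by (rule regular_coordinate_spaceE[OF g x]) auto
      show "\<exists>p \<in> poly_functions C. \<exists>q \<in> poly_functions C. q x \<noteq> 0 \<and>
                 (\<forall>y\<in>U. q y \<noteq> 0 \<longrightarrow> f y * g y = p y / q y)"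
        by (rule bexI[of _ "\<lambda>y. p y * p' y"], rule bexI[of _ "\<lambda>y. q y * q' y"])
           (use 1 2 in \<open>auto intro: pf\<close>)
    qed }
  show "openin (zar ?X) {x \<in> U. f x \<noteq> 0}"
  proof (subst openin_subopen, intro ballI)
    fix x assume x: "x \<in> {x \<in> U. f x \<noteq> 0}"
    then have xU: "x \<in> U" by simp
    obtain p q where 1: "p \<in> poly_functions C" "q \<in> poly_functions C" "q x \<noteq> 0"
      "\<And>y. y \<in> U \<Longrightarrow> q y \<noteq> 0 \<Longrightarrow> f y = p y / q y" by (rule regular_coordinate_spaceE[OF f xU]) auto
    \<comment> \<open>The factor q keeps the point where f = p / q is known; there f is nonzero
      exactly when p is.\<close>
    have "openin (zar ?X) (U \<inter> {y \<in> P. p y * q y \<noteq> 0})"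
      by (intro openin_Int U openin_coordinate_space_nonzero pf 1)
    moreover have "x \<in> U \<inter> {y \<in> P. p y * q y \<noteq> 0}" using x 1 UP by auto
    moreover have "U \<inter> {y \<in> P. p y * q y \<noteq> 0} \<subseteq> {x \<in> U. f x \<noteq> 0}" using 1 by auto
    ultimately show "\<exists>T. openin (zar ?X) T \<and> x \<in> T \<and> T \<subseteq> {x \<in> U. f x \<noteq> 0}" by blast
  qed
  show "(\<lambda>x. inverse (f x)) \<in> regular ?X {x \<in> U. f x \<noteq> 0}"
  proof (rule regular_coordinate_spaceI)
    fix x assume x: "x \<in> {x \<in> U. f x \<noteq> 0}"
    then have xU: "x \<in> U" by simp
    obtain p q where 1: "p \<in> poly_functions C" "q \<in> poly_functions C" "q x \<noteq> 0"
      "\<And>y. y \<in> U \<Longrightarrow> q y \<noteq> 0 \<Longrightarrow> f y = p y / q y" by (rule regular_coordinate_spaceE[OF f xU]) auto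
    show "\<exists>p \<in> poly_functions C. \<exists>q \<in> poly_functions C. q x \<noteq> 0 \<and>
       (\<forall>y\<in>{x \<in> U. f x \<noteq> 0}. q y \<noteq> 0 \<longrightarrow> inverse (f y) = p y / q y)"
      by (rule bexI[of _ "\<lambda>y. q y * q y"], rule bexI[of _ "\<lambda>y. p y * q y"])
         (use 1 x in \<open>auto intro: pf\<close>)
  qed
next
  let ?X = "coordinate_space C P"
  note pf = poly_functions.intros
  fix U f assume U: "openin (zar ?X) U"
    and loc: "\<forall>x\<in>U. \<exists>V g. openin (zar ?X) V \<and> x \<in> V \<and> g \<in> regular ?X V \<and> (\<forall>y \<in> U \<inter> V. f y = g y)"
  then have UP: "U \<subseteq> P" using openin_subset[OF U] by simp
  show "f \<in> regular ?X U"
  proof (rule regular_coordinate_spaceI)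
    fix x assume x: "x \<in> U"
    then obtain V g where V: "openin (zar ?X) V" "x \<in> V" and g: "g \<in> regular ?X V" and fg: "\<forall>y \<in> U \<inter> V. f y = g y"
      using loc by blast
    obtain h where h: "h \<in> poly_functions C" "h x \<noteq> 0" "{y \<in> P. h y \<noteq> 0} \<subseteq> V"
      using openin_coordinate_space_basis[OF V] by blast
    obtain p q where 1: "p \<in> poly_functions C" "q \<in> poly_functions C" "q x \<noteq> 0"
      "\<And>y. y \<in> V \<Longrightarrow> q y \<noteq> 0 \<Longrightarrow> g y = p y / q y" by (rule regular_coordinate_spaceE[OF g V(2)]) auto
    \<comment> \<open>Multiplying through by h makes the denominator vanish off V, so the local
      quotient for g serves on all of U.\<close>
    have "f y = p y * h y / (q y * h y)" if "y \<in> U" "q y * h y \<noteq> 0" for y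
    proof -
      have "y \<in> V" using that h(3) UP by auto
      then show ?thesis using that 1(4)[of y] fg by auto
    qed
    then show "\<exists>p \<in> poly_functions C. \<exists>q \<in> poly_functions C. q x \<noteq> 0 \<and>
                 (\<forall>y\<in>U. q y \<noteq> 0 \<longrightarrow> f y = p y / q y)"
      by (intro bexI[of _ "\<lambda>y. p y * h y"] bexI[of _ "\<lambda>y. q y * h y"])
         (use 1 h in \<open>auto intro: pf\<close>)
  qed
qed

text \<open>A map into a subset of affine space is tested on its coordinates. The source is an open
  U rather than all of X because frames are only available locally.\<close>

lemma coordinate_space_pull:
  assumes X: "function_sheaf X" and U: "openin (zar X) U" and l: "\<And>x. x \<in> U \<Longrightarrow> l x \<in> P"
    and c: "\<And>c. c \<in> C \<Longrightarrow> (\<lambda>x. c (l x)) \<in> regular X U"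
    and V: "openin (zar (coordinate_space C P)) V"
  shows "openin (zar X) {x \<in> U. l x \<in> V}"
    and "g \<in> regular (coordinate_space C P) V \<Longrightarrow> (\<lambda>x. g (l x)) \<in> regular X {x \<in> U. l x \<in> V}"
proof -
  have pol: "(\<lambda>x. p (l x)) \<in> regular X U" if "p \<in> poly_functions C" for p
    by (rule sheaf_poly[OF X U c that])
  show op: "openin (zar X) {x \<in> U. l x \<in> V}"
  proof (subst openin_subopen, intro ballI)
    fix x assume x: "x \<in> {x \<in> U. l x \<in> V}"
    then obtain p where p: "p \<in> poly_functions C" "p (l x) \<noteq> 0" "{y \<in> P. p y \<noteq> 0} \<subseteq> V"
      using openin_coordinate_space_basis[OF V] by blast
    show "\<exists>T. openin (zar X) T \<and> x \<in> T \<and> T \<subseteq> {x \<in> U. l x \<in> V}"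
      by (rule exI[of _ "{x \<in> U. p (l x) \<noteq> 0}"])
         (use sheaf_nonzero_open[OF X U pol[OF p(1)]] x p l in auto)
  qed
  assume g: "g \<in> regular (coordinate_space C P) V"
  show "(\<lambda>x. g (l x)) \<in> regular X {x \<in> U. l x \<in> V}"
  proof (rule sheaf_local[OF X op])
    fix x assume x: "x \<in> {x \<in> U. l x \<in> V}"
    then have lx: "l x \<in> V" by simp
    obtain p q where 1: "p \<in> poly_functions C" "q \<in> poly_functions C" "q (l x) \<noteq> 0"
      "\<And>y. y \<in> V \<Longrightarrow> q y \<noteq> 0 \<Longrightarrow> g y = p y / q y" by (rule regular_coordinate_spaceE[OF g lx]) auto
    let ?V = "{x \<in> U. q (l x) \<noteq> 0}"
    have oV: "openin (zar X) ?V" by (rule sheaf_nonzero_open[OF X U pol[OF 1(2)]])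
    have "(\<lambda>x. p (l x) / q (l x)) \<in> regular X ?V"
      by (rule sheaf_divide[OF X oV]) (auto intro: sheaf_restrict[OF X oV U pol[OF 1(1)]] sheaf_restrict[OF X oV U pol[OF 1(2)]])
    then show "\<exists>V' h. openin (zar X) V' \<and> x \<in> V' \<and> h \<in> regular X V' \<and> (\<forall>y \<in> {x \<in> U. l x \<in> V} \<inter> V'. g (l y) = h y)"
      by (intro exI[of _ ?V] exI[of _ "\<lambda>x. p (l x) / q (l x)"]) (use oV x 1 in auto)
  qed
qed

subsection \<open>Induced, quotient and product spaces\<close>

lemma points_induced [simp]: "points (induced X S) = points X \<inter> S"
  by (simp add: induced_def)

lemma openin_induced: "openin (zar (induced X S)) U \<longleftrightarrow> (\<exists>T. openin (zar X) T \<and> U = T \<inter> S)"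
  by (simp add: induced_def openin_subtopology)

lemma regular_inducedI:
  assumes "\<And>x. x \<in> U \<Longrightarrow> \<exists>V g. openin (zar X) V \<and> x \<in> V \<and> g \<in> regular X V \<and> (\<forall>y \<in> U \<inter> V. f y = g y)"
  shows "f \<in> regular (induced X S) U"
  using assms by (simp add: induced_def)

lemma regular_inducedE:
  assumes "f \<in> regular (induced X S) U" "x \<in> U"
  obtains V g where "openin (zar X) V" "x \<in> V" "g \<in> regular X V" "\<And>y. y \<in> U \<Longrightarrow> y \<in> V \<Longrightarrow> f y = g y"
  using assms by (auto simp: induced_def)

lemma function_sheaf_induced:
  assumes X: "function_sheaf X"
  shows "function_sheaf (induced X S)"
  unfolding function_sheaf_def
proof (intro conjI allI impI)
  let ?Y = "induced X S"
  fix U assume U: "openin (zar ?Y) U"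
  then have US: "U \<subseteq> S" "U \<subseteq> points X" using openin_subset[OF U] by auto
  show "(\<lambda>x. c) \<in> regular ?Y U" for c
    by (rule regular_inducedI, rule exI[of _ "points X"], rule exI[of _ "\<lambda>x. c"])
       (use US sheaf_const[OF X] in auto)
  fix f assume f: "f \<in> regular ?Y U"
  { fix g assume g: "g \<in> regular ?Y U"
    have "\<exists>V h h'. openin (zar X) V \<and> x \<in> V \<and> h \<in> regular X V \<and> h' \<in> regular X V \<and> (\<forall>y \<in> U \<inter> V. f y = h y \<and> g y = h' y)"
      if x: "x \<in> U" for x
    proof -
      obtain V h where 1: "openin (zar X) V" "x \<in> V" "h \<in> regular X V" "\<And>y. y \<in> U \<Longrightarrow> y \<in> V \<Longrightarrow> f y = h y"
        by (rule regular_inducedE[OF f x]) auto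
      obtain V' h' where 2: "openin (zar X) V'" "x \<in> V'" "h' \<in> regular X V'" "\<And>y. y \<in> U \<Longrightarrow> y \<in> V' \<Longrightarrow> g y = h' y"
        by (rule regular_inducedE[OF g x]) auto
      have o: "openin (zar X) (V \<inter> V')" using 1 2 by blast
      have "h \<in> regular X (V \<inter> V')" by (rule sheaf_restrict[OF X o 1(1,3)]) auto
      moreover have "h' \<in> regular X (V \<inter> V')" by (rule sheaf_restrict[OF X o 2(1,3)]) auto
      ultimately show ?thesis using o 1 2
        by (intro exI[of _ "V \<inter> V'"] exI[of _ h] exI[of _ h']) auto
    qed note loc = this
    show "(\<lambda>x. f x + g x) \<in> regular ?Y U"
    proof (rule regular_inducedI)
      fix x assume "x \<in> U"
      from loc[OF this] obtain V h h' where "openin (zar X) V" "x \<in> V" "h \<in> regular X V" "h' \<in> regular X V" "\<forall>y \<in> U \<inter> V. f y = h y \<and> g y = h' y" by blast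
      then show "\<exists>V k. openin (zar X) V \<and> x \<in> V \<and> k \<in> regular X V \<and> (\<forall>y \<in> U \<inter> V. f y + g y = k y)"
        by (intro exI[of _ V] exI[of _ "\<lambda>x. h x + h' x"]) (auto intro: sheaf_add X)
    qed
    show "(\<lambda>x. f x * g x) \<in> regular ?Y U"
    proof (rule regular_inducedI)
      fix x assume "x \<in> U"
      from loc[OF this] obtain V h h' where "openin (zar X) V" "x \<in> V" "h \<in> regular X V" "h' \<in> regular X V" "\<forall>y \<in> U \<inter> V. f y = h y \<and> g y = h' y" by blast
      then show "\<exists>V k. openin (zar X) V \<and> x \<in> V \<and> k \<in> regular X V \<and> (\<forall>y \<in> U \<inter> V. f y * g y = k y)"
        by (intro exI[of _ V] exI[of _ "\<lambda>x. h x * h' x"]) (auto intro: sheaf_mult X)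
    qed }
  show "openin (zar ?Y) {x \<in> U. f x \<noteq> 0}"
  proof (subst openin_subopen, intro ballI)
    fix x assume x: "x \<in> {x \<in> U. f x \<noteq> 0}"
    then have xU: "x \<in> U" by simp
    obtain V h where 1: "openin (zar X) V" "x \<in> V" "h \<in> regular X V" "\<And>y. y \<in> U \<Longrightarrow> y \<in> V \<Longrightarrow> f y = h y"
      by (rule regular_inducedE[OF f xU]) auto
    have "openin (zar ?Y) ({x \<in> V. h x \<noteq> 0} \<inter> S)"
      using sheaf_nonzero_open[OF X 1(1,3)] by (auto simp: openin_induced)
    then have "openin (zar ?Y) (({x \<in> V. h x \<noteq> 0} \<inter> S) \<inter> U)" using U by blast
    then show "\<exists>T. openin (zar ?Y) T \<and> x \<in> T \<and> T \<subseteq> {x \<in> U. f x \<noteq> 0}"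
      using x 1 US by (intro exI[of _ "({x \<in> V. h x \<noteq> 0} \<inter> S) \<inter> U"]) auto
  qed
  show "(\<lambda>x. inverse (f x)) \<in> regular ?Y {x \<in> U. f x \<noteq> 0}"
  proof (rule regular_inducedI)
    fix x assume x: "x \<in> {x \<in> U. f x \<noteq> 0}"
    then have xU: "x \<in> U" by simp
    obtain V h where 1: "openin (zar X) V" "x \<in> V" "h \<in> regular X V" "\<And>y. y \<in> U \<Longrightarrow> y \<in> V \<Longrightarrow> f y = h y"
      by (rule regular_inducedE[OF f xU]) auto
    then show "\<exists>V k. openin (zar X) V \<and> x \<in> V \<and> k \<in> regular X V \<and> (\<forall>y \<in> {x \<in> U. f x \<noteq> 0} \<inter> V. inverse (f y) = k y)"
      by (intro exI[of _ "{x \<in> V. h x \<noteq> 0}"] exI[of _ "\<lambda>x. inverse (h x)"])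
         (use sheaf_nonzero_open[OF X 1(1,3)] sheaf_inverse[OF X 1(1,3)] x in auto)
  qed
next
  let ?Y = "induced X S"
  fix U f assume U: "openin (zar ?Y) U"
    and loc: "\<forall>x\<in>U. \<exists>V g. openin (zar ?Y) V \<and> x \<in> V \<and> g \<in> regular ?Y V \<and> (\<forall>y \<in> U \<inter> V. f y = g y)"
  have US: "U \<subseteq> S" using openin_subset[OF U] by auto
  show "f \<in> regular ?Y U"
  proof (rule regular_inducedI)
    fix x assume x: "x \<in> U"
    then obtain V g where V: "openin (zar ?Y) V" "x \<in> V" and g: "g \<in> regular ?Y V" and fg: "\<forall>y \<in> U \<inter> V. f y = g y"
      using loc by blast
    obtain T where T: "openin (zar X) T" "V = T \<inter> S" using V by (auto simp: openin_induced)
    obtain V' h where 1: "openin (zar X) V'" "x \<in> V'" "h \<in> regular X V'" "\<And>y. y \<in> V \<Longrightarrow> y \<in> V' \<Longrightarrow> g y = h y"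
        by (rule regular_inducedE[OF g V(2)]) auto
    have o: "openin (zar X) (V' \<inter> T)" using 1 T by blast
    have "h \<in> regular X (V' \<inter> T)" by (rule sheaf_restrict[OF X o 1(1,3)]) auto
    then show "\<exists>V g. openin (zar X) V \<and> x \<in> V \<and> g \<in> regular X V \<and> (\<forall>y \<in> U \<inter> V. f y = g y)"
      by (intro exI[of _ "V' \<inter> T"] exI[of _ h]) (use o 1 T V fg US in auto)
  qed
qed

lemma function_sheaf_quotient_fspace:
  assumes X: "function_sheaf X"
  shows "function_sheaf (quotient_fspace X \<pi>)"
  unfolding function_sheaf_def
proof (intro conjI allI impI)
  let ?Y = "quotient_fspace X \<pi>"
  have reg: "g \<in> regular ?Y W \<longleftrightarrow> (\<lambda>x. g (\<pi> x)) \<in> regular X {x \<in> points X. \<pi> x \<in> W}" for g W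
    by (simp add: quotient_fspace_def o_def)
  fix U f assume U: "openin (zar ?Y) U"
  let ?U = "{x \<in> points X. \<pi> x \<in> U}"
  have U': "openin (zar X) ?U" using U by (simp add: openin_quotient_fspace)
  show "(\<lambda>x. c) \<in> regular ?Y U" for c
    by (simp add: reg sheaf_const[OF X U'])
  { fix f g assume "f \<in> regular ?Y U" "g \<in> regular ?Y U"
    then show "(\<lambda>x. f x + g x) \<in> regular ?Y U" "(\<lambda>x. f x * g x) \<in> regular ?Y U"
      by (auto simp: reg intro: sheaf_add[OF X U'] sheaf_mult[OF X U']) }
  { fix f assume f: "f \<in> regular ?Y U"
    have eq: "{x \<in> points X. \<pi> x \<in> {x \<in> U. f x \<noteq> 0}} = {x \<in> ?U. f (\<pi> x) \<noteq> 0}" by blast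
    show "openin (zar ?Y) {x \<in> U. f x \<noteq> 0}"
      unfolding openin_quotient_fspace eq
      using sheaf_nonzero_open[OF X U'] f U by (auto simp: reg openin_quotient_fspace)
    show "(\<lambda>x. inverse (f x)) \<in> regular ?Y {x \<in> U. f x \<noteq> 0}"
      unfolding reg eq using sheaf_inverse[OF X U'] f by (auto simp: reg) }
  assume loc: "\<forall>x\<in>U. \<exists>V g. openin (zar ?Y) V \<and> x \<in> V \<and> g \<in> regular ?Y V \<and> (\<forall>y \<in> U \<inter> V. f y = g y)"
  show "f \<in> regular ?Y U" unfolding reg
  proof (rule sheaf_local[OF X U'])
    fix x assume x: "x \<in> ?U"
    then obtain V g where "openin (zar ?Y) V" "\<pi> x \<in> V" "g \<in> regular ?Y V" "\<forall>y \<in> U \<inter> V. f y = g y"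
      using loc by blast
    then show "\<exists>V g. openin (zar X) V \<and> x \<in> V \<and> g \<in> regular X V \<and> (\<forall>y \<in> ?U \<inter> V. f (\<pi> y) = g y)"
      using x by (intro exI[of _ "{x \<in> points X. \<pi> x \<in> V}"] exI[of _ "\<lambda>x. g (\<pi> x)"]) (auto simp: reg openin_quotient_fspace)
  qed
qed

text \<open>Arbitrary finite index sets allow disjoint unions for sums, and cartesian products for
  products, of tensors.\<close>

lemma tensor_functionsI:
  assumes "finite I" "\<And>i. i \<in> I \<Longrightarrow> a i \<in> regular X U" "\<And>i. i \<in> I \<Longrightarrow> b i \<in> regular Y V"
    and "h = (\<lambda>(x, y). \<Sum>i\<in>I. a i x * b i y)"
  shows "h \<in> tensor_functions X Y U V"
proof -
  obtain \<sigma> where \<sigma>: "bij_betw \<sigma> {..<card I} I"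
    using ex_bij_betw_nat_finite[OF assms(1)] by (auto simp: atLeast0LessThan)
  have "(\<Sum>i\<in>I. a i x * b i y) = (\<Sum>i<card I. a (\<sigma> i) x * b (\<sigma> i) y)" for x y
    using sum.reindex_bij_betw[OF \<sigma>, of "\<lambda>i. a i x * b i y"] by simp
  moreover have "\<forall>i<card I. a (\<sigma> i) \<in> regular X U \<and> b (\<sigma> i) \<in> regular Y V"
    using bij_betwE[OF \<sigma>] assms(2,3) by simp
  ultimately show ?thesis unfolding tensor_functions_def assms(4)
    by (intro CollectI exI[of _ "card I"] exI[of _ "\<lambda>i. a (\<sigma> i)"] exI[of _ "\<lambda>i. b (\<sigma> i)"]) auto
qed

lemma tensor_functionsE:
  assumes "h \<in> tensor_functions X Y U V"
  obtains s :: nat and a b where "\<And>i. i < s \<Longrightarrow> a i \<in> regular X U" "\<And>i. i < s \<Longrightarrow> b i \<in> regular Y V"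
    "h = (\<lambda>(x, y). \<Sum>i<s. a i x * b i y)"
  using assms by (auto simp: tensor_functions_def)

lemma tensor_functions_times:
  assumes "f \<in> regular X U" "g \<in> regular Y V"
  shows "(\<lambda>(x, y). f x * g y) \<in> tensor_functions X Y U V"
  by (rule tensor_functionsI[of "{()}" "\<lambda>_. f" _ _ "\<lambda>_. g"]) (use assms in auto)

lemma tensor_functions_add:
  assumes "h \<in> tensor_functions X Y U V" "h' \<in> tensor_functions X Y U V"
  shows "(\<lambda>w. h w + h' w) \<in> tensor_functions X Y U V"
proof -
  obtain s a b where 1: "\<And>i. i < s \<Longrightarrow> a i \<in> regular X U" "\<And>i. i < s \<Longrightarrow> b i \<in> regular Y V"
    "h = (\<lambda>(x, y). \<Sum>i<(s::nat). a i x * b i y)" by (rule tensor_functionsE[OF assms(1)]) auto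
  obtain s' a' b' where 2: "\<And>i. i < s' \<Longrightarrow> a' i \<in> regular X U" "\<And>i. i < s' \<Longrightarrow> b' i \<in> regular Y V"
    "h' = (\<lambda>(x, y). \<Sum>i<(s'::nat). a' i x * b' i y)" by (rule tensor_functionsE[OF assms(2)]) auto
  show ?thesis
    by (rule tensor_functionsI[of "{..<s} <+> {..<s'}" "case_sum a a'" _ _ "case_sum b b'"])
       (use 1 2 in \<open>auto simp: sum.Plus\<close>)
qed

lemma tensor_functions_mult:
  assumes X: "function_sheaf X" "openin (zar X) U" and Y: "function_sheaf Y" "openin (zar Y) V"
    and "h \<in> tensor_functions X Y U V" "h' \<in> tensor_functions X Y U V"
  shows "(\<lambda>w. h w * h' w) \<in> tensor_functions X Y U V"
proof -
  obtain s a b where 1: "\<And>i. i < s \<Longrightarrow> a i \<in> regular X U" "\<And>i. i < s \<Longrightarrow> b i \<in> regular Y V"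
    "h = (\<lambda>(x, y). \<Sum>i<(s::nat). a i x * b i y)" by (rule tensor_functionsE[OF assms(5)]) auto
  obtain s' a' b' where 2: "\<And>i. i < s' \<Longrightarrow> a' i \<in> regular X U" "\<And>i. i < s' \<Longrightarrow> b' i \<in> regular Y V"
    "h' = (\<lambda>(x, y). \<Sum>i<(s'::nat). a' i x * b' i y)" by (rule tensor_functionsE[OF assms(6)]) auto
  have "(\<lambda>w. h w * h' w) = (\<lambda>(x, y). \<Sum>u\<in>{..<s} \<times> {..<s'}.
      (a (fst u) x * a' (snd u) x) * (b (fst u) y * b' (snd u) y))"
  proof
    fix w
    have "h w * h' w = (\<Sum>i<s. \<Sum>j<s'. (a i (fst w) * b i (snd w)) * (a' j (fst w) * b' j (snd w)))"
      by (simp add: 1(3) 2(3) split_beta sum_product)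
    also have "\<dots> = (\<Sum>u\<in>{..<s} \<times> {..<s'}.
      (a (fst u) (fst w) * a' (snd u) (fst w)) * (b (fst u) (snd w) * b' (snd u) (snd w)))"
      by (simp add: sum.cartesian_product split_beta mult_ac)
    finally show "h w * h' w = (case w of (x, y) \<Rightarrow> \<Sum>u\<in>{..<s} \<times> {..<s'}.
      (a (fst u) x * a' (snd u) x) * (b (fst u) y * b' (snd u) y))" by (simp add: split_beta)
  qed
  then show ?thesis
    by (rule tensor_functionsI[of "{..<s} \<times> {..<s'}" "\<lambda>u x. a (fst u) x * a' (snd u) x" _ _
        "\<lambda>u y. b (fst u) y * b' (snd u) y", rotated -1])
       (auto intro!: sheaf_mult X Y 1 2)
qed

lemma tensor_functions_restrict:
  assumes X: "function_sheaf X" "openin (zar X) U" "openin (zar X) U'" "U' \<subseteq> U"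
    and Y: "function_sheaf Y" "openin (zar Y) V" "openin (zar Y) V'" "V' \<subseteq> V"
    and "h \<in> tensor_functions X Y U V"
  shows "h \<in> tensor_functions X Y U' V'"
proof -
  obtain s a b where 1: "\<And>i. i < s \<Longrightarrow> a i \<in> regular X U" "\<And>i. i < s \<Longrightarrow> b i \<in> regular Y V"
    "h = (\<lambda>(x, y). \<Sum>i<(s::nat). a i x * b i y)" by (rule tensor_functionsE[OF assms(9)]) auto
  show ?thesis
  proof (rule tensor_functionsI[of "{..<s}" a _ _ b, OF _ _ _ 1(3)])
    show "a i \<in> regular X U'" if "i \<in> {..<s}" for i
      by (rule sheaf_restrict[OF X(1,3,2) 1(1)]) (use that X in auto)
    show "b i \<in> regular Y V'" if "i \<in> {..<s}" for i
      by (rule sheaf_restrict[OF Y(1,3,2) 1(2)]) (use that Y in auto)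
  qed simp
qed

lemma openin_product_fspace_basic:
  assumes "openin (zar X) U" "openin (zar Y) V" "h \<in> tensor_functions X Y U V"
  shows "openin (zar (product_fspace X Y)) {w \<in> U \<times> V. h w \<noteq> 0}"
  unfolding product_fspace_def using assms by (auto intro!: topology_generated_by_Basis)

lemma openin_product_fspace_Times:
  assumes "function_sheaf X" "function_sheaf Y" "openin (zar X) U" "openin (zar Y) V"
  shows "openin (zar (product_fspace X Y)) (U \<times> V)"
  using openin_product_fspace_basic[OF assms(3,4) tensor_functions_times[OF sheaf_const[OF assms(1,3), of 1] sheaf_const[OF assms(2,4), of 1]]]
  by (simp add: split_beta)

lemma points_product_fspace:
  assumes "function_sheaf X" "function_sheaf Y"
  shows "points (product_fspace X Y) = points X \<times> points Y"
proof
  show "points (product_fspace X Y) \<subseteq> points X \<times> points Y"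
    unfolding product_fspace_def fspace.simps topology_generated_by_topspace
    by (auto dest: openin_subset)
  show "points X \<times> points Y \<subseteq> points (product_fspace X Y)"
    by (rule openin_subset[OF openin_product_fspace_Times[OF assms openin_topspace openin_topspace]])
qed

text \<open>Two defining tensors are first restricted to the common rectangle and then multiplied;
  this makes the generating sets a basis.\<close>

lemma openin_product_fspace_basis:
  assumes X: "function_sheaf X" and Y: "function_sheaf Y"
    and "openin (zar (product_fspace X Y)) W" "w \<in> W"
  shows "\<exists>U V h. openin (zar X) U \<and> openin (zar Y) V \<and> h \<in> tensor_functions X Y U V \<and>
    w \<in> U \<times> V \<and> h w \<noteq> 0 \<and> {w' \<in> U \<times> V. h w' \<noteq> 0} \<subseteq> W"
proof -
  have "generate_topology_on {{w \<in> U \<times> V. h w \<noteq> 0} | U V h.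
             openin (zar X) U \<and> openin (zar Y) V \<and> h \<in> tensor_functions X Y U V} W"
    using assms(3) unfolding product_fspace_def by (simp add: openin_topology_generated_by_iff)
  then show ?thesis using assms(4)
  proof (induction arbitrary: w)
    case Empty
    then show ?case by simp
  next
    case (Int a b)
    have wab: "w \<in> a" "w \<in> b" using Int.prems by auto
    obtain U V h where 1: "openin (zar X) U" "openin (zar Y) V" "h \<in> tensor_functions X Y U V"
      "w \<in> U \<times> V" "h w \<noteq> 0" "{w' \<in> U \<times> V. h w' \<noteq> 0} \<subseteq> a" using Int.IH(1)[OF wab(1)] by blast
    obtain U' V' h' where 2: "openin (zar X) U'" "openin (zar Y) V'" "h' \<in> tensor_functions X Y U' V'"
      "w \<in> U' \<times> V'" "h' w \<noteq> 0" "{w' \<in> U' \<times> V'. h' w' \<noteq> 0} \<subseteq> b" using Int.IH(2)[OF wab(2)] by blast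
    have o: "openin (zar X) (U \<inter> U')" "openin (zar Y) (V \<inter> V')" using 1 2 by blast+
    have "h \<in> tensor_functions X Y (U \<inter> U') (V \<inter> V')"
      by (rule tensor_functions_restrict[OF X 1(1) o(1) _ Y 1(2) o(2) _ 1(3)]) auto
    moreover have "h' \<in> tensor_functions X Y (U \<inter> U') (V \<inter> V')"
      by (rule tensor_functions_restrict[OF X 2(1) o(1) _ Y 2(2) o(2) _ 2(3)]) auto
    ultimately have "(\<lambda>w. h w * h' w) \<in> tensor_functions X Y (U \<inter> U') (V \<inter> V')"
      by (rule tensor_functions_mult[OF X o(1) Y o(2)])
    then show ?case using 1 2 o
      by (intro exI[of _ "U \<inter> U'"] exI[of _ "V \<inter> V'"] exI[of _ "\<lambda>w. h w * h' w"]) auto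
  next
    case (UN K)
    then obtain k where k: "k \<in> K" "w \<in> k" by blast
    from UN.IH[OF k] obtain U V h where "openin (zar X) U" "openin (zar Y) V" "h \<in> tensor_functions X Y U V"
      "w \<in> U \<times> V" "h w \<noteq> 0" "{w' \<in> U \<times> V. h w' \<noteq> 0} \<subseteq> k" by blast
    moreover from this(6) k have "{w' \<in> U \<times> V. h w' \<noteq> 0} \<subseteq> \<Union>K" by blast
    ultimately show ?case by blast
  next
    case (Basis s)
    then show ?case by blast
  qed
qed

lemma product_fspace_function_tensor:
  assumes X: "function_sheaf X" and Y: "function_sheaf Y" and Z: "function_sheaf Z"
    and Q: "openin (zar Z) Q" "openin (zar X) U" "openin (zar Y) V"
    and h: "h \<in> tensor_functions X Y U V"
    and l: "\<And>f. f \<in> regular X U \<Longrightarrow> (\<lambda>w. f (l w)) \<in> regular Z Q"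
    and m: "\<And>f. f \<in> regular Y V \<Longrightarrow> (\<lambda>w. f (m w)) \<in> regular Z Q"
  shows "(\<lambda>w. h (l w, m w)) \<in> regular Z Q"
proof -
  obtain s a b where 1: "\<And>i. i < s \<Longrightarrow> a i \<in> regular X U" "\<And>i. i < s \<Longrightarrow> b i \<in> regular Y V"
    "h = (\<lambda>(x, y). \<Sum>i<(s::nat). a i x * b i y)" by (rule tensor_functionsE[OF h]) auto
  have "(\<lambda>w. \<Sum>i\<in>{..<s}. a i (l w) * b i (m w)) \<in> regular Z Q"
    by (intro sheaf_sum sheaf_mult l m Z Q) (use 1 in auto)
  then show ?thesis by (simp add: 1(3))
qed

lemma regular_product_fspaceI:
  assumes "\<And>w. w \<in> W \<Longrightarrow> \<exists>U V. openin (zar X) U \<and> openin (zar Y) V \<and> w \<in> U \<times> V \<and>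
             (\<exists>p \<in> tensor_functions X Y U V. \<exists>q \<in> tensor_functions X Y U V. q w \<noteq> 0 \<and>
                (\<forall>w' \<in> W \<inter> (U \<times> V). q w' \<noteq> 0 \<longrightarrow> f w' = p w' / q w'))"
  shows "f \<in> regular (product_fspace X Y) W"
  using assms by (simp add: product_fspace_def)

lemma regular_product_fspaceE:
  assumes "f \<in> regular (product_fspace X Y) W" "w \<in> W"
  obtains U V p q where "openin (zar X) U" "openin (zar Y) V" "w \<in> U \<times> V"
    "p \<in> tensor_functions X Y U V" "q \<in> tensor_functions X Y U V" "q w \<noteq> 0"
    "\<And>w'. w' \<in> W \<Longrightarrow> w' \<in> U \<times> V \<Longrightarrow> q w' \<noteq> 0 \<Longrightarrow> f w' = p w' / q w'"
proof -
  have "\<exists>U V. openin (zar X) U \<and> openin (zar Y) V \<and> w \<in> U \<times> V \<and>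
             (\<exists>p \<in> tensor_functions X Y U V. \<exists>q \<in> tensor_functions X Y U V. q w \<noteq> 0 \<and>
                (\<forall>w' \<in> W \<inter> (U \<times> V). q w' \<noteq> 0 \<longrightarrow> f w' = p w' / q w'))"
    using assms by (simp add: product_fspace_def)
  then show ?thesis using that by (metis Int_iff)
qed

lemma function_sheaf_product_fspace:
  assumes X: "function_sheaf X" and Y: "function_sheaf Y"
  shows "function_sheaf (product_fspace X Y)"
  unfolding function_sheaf_def
proof (intro conjI allI impI)
  let ?Z = "product_fspace X Y"
  note tm = tensor_functions_mult[OF X _ Y]
  have t1: "(\<lambda>w. c) \<in> tensor_functions X Y U V" if "openin (zar X) U" "openin (zar Y) V" for U V c
  proof -
    have "(\<lambda>w. c) = (\<lambda>(x, y). c * 1)" by auto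
    then show ?thesis
      using tensor_functions_times[OF sheaf_const[OF X that(1), of c] sheaf_const[OF Y that(2), of 1]] by metis
  qed
  fix W assume W: "openin (zar ?Z) W"
  then have WP: "W \<subseteq> points X \<times> points Y" using openin_subset[OF W] by (simp add: points_product_fspace X Y)
  show "(\<lambda>x. c) \<in> regular ?Z W" for c
    by (rule regular_product_fspaceI, rule exI[of _ "points X"], rule exI[of _ "points Y"],
        intro conjI openin_topspace bexI[of _ "\<lambda>w. c"] bexI[of _ "\<lambda>w. 1"] t1)
       (use WP in auto)
  fix f assume f: "f \<in> regular ?Z W"
  { fix g assume g: "g \<in> regular ?Z W"
    have loc: "\<exists>U V p q p' q'. openin (zar X) U \<and> openin (zar Y) V \<and> w \<in> U \<times> V \<and>
      p \<in> tensor_functions X Y U V \<and> q \<in> tensor_functions X Y U V \<and> q w \<noteq> 0 \<and>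
      p' \<in> tensor_functions X Y U V \<and> q' \<in> tensor_functions X Y U V \<and> q' w \<noteq> 0 \<and>
      (\<forall>w' \<in> W \<inter> (U \<times> V). q w' \<noteq> 0 \<and> q' w' \<noteq> 0 \<longrightarrow> f w' = p w' / q w' \<and> g w' = p' w' / q' w')"
      if w: "w \<in> W" for w
    proof -
      obtain U V p q where 1: "openin (zar X) U" "openin (zar Y) V" "w \<in> U \<times> V"
        "p \<in> tensor_functions X Y U V" "q \<in> tensor_functions X Y U V" "q w \<noteq> 0"
        "\<And>w'. w' \<in> W \<Longrightarrow> w' \<in> U \<times> V \<Longrightarrow> q w' \<noteq> 0 \<Longrightarrow> f w' = p w' / q w'"
        by (rule regular_product_fspaceE[OF f w]) blast
      obtain U' V' p' q' where 2: "openin (zar X) U'" "openin (zar Y) V'" "w \<in> U' \<times> V'"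
        "p' \<in> tensor_functions X Y U' V'" "q' \<in> tensor_functions X Y U' V'" "q' w \<noteq> 0"
        "\<And>w'. w' \<in> W \<Longrightarrow> w' \<in> U' \<times> V' \<Longrightarrow> q' w' \<noteq> 0 \<Longrightarrow> g w' = p' w' / q' w'"
        by (rule regular_product_fspaceE[OF g w]) blast
      have o: "openin (zar X) (U \<inter> U')" "openin (zar Y) (V \<inter> V')" using 1 2 by blast+
      note r1 = tensor_functions_restrict[OF X 1(1) o(1) Int_lower1 Y 1(2) o(2) Int_lower1]
      note r2 = tensor_functions_restrict[OF X 2(1) o(1) Int_lower2 Y 2(2) o(2) Int_lower2]
      show ?thesis
        by (rule exI[of _ "U \<inter> U'"], rule exI[of _ "V \<inter> V'"], rule exI[of _ p], rule exI[of _ q],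
            rule exI[of _ p'], rule exI[of _ q'])
           (use o r1[OF 1(4)] r1[OF 1(5)] r2[OF 2(4)] r2[OF 2(5)] 1 2 in auto)
    qed
    show "(\<lambda>x. f x + g x) \<in> regular ?Z W"
    proof (rule regular_product_fspaceI)
      fix w assume "w \<in> W"
      from loc[OF this] obtain U V p q p' q' where 1: "openin (zar X) U" "openin (zar Y) V" "w \<in> U \<times> V"
      "p \<in> tensor_functions X Y U V" "q \<in> tensor_functions X Y U V" "q w \<noteq> 0"
      "p' \<in> tensor_functions X Y U V" "q' \<in> tensor_functions X Y U V" "q' w \<noteq> 0"
      "\<forall>w' \<in> W \<inter> (U \<times> V). q w' \<noteq> 0 \<and> q' w' \<noteq> 0 \<longrightarrow> f w' = p w' / q w' \<and> g w' = p' w' / q' w'" by blast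
      show "\<exists>U V. openin (zar X) U \<and> openin (zar Y) V \<and> w \<in> U \<times> V \<and>
             (\<exists>p \<in> tensor_functions X Y U V. \<exists>q \<in> tensor_functions X Y U V. q w \<noteq> 0 \<and>
                (\<forall>w' \<in> W \<inter> (U \<times> V). q w' \<noteq> 0 \<longrightarrow> f w' + g w' = p w' / q w'))"
        by (intro exI[of _ U] exI[of _ V] conjI 1 bexI[of _ "\<lambda>w. p w * q' w + p' w * q w"]
            bexI[of _ "\<lambda>w. q w * q' w"] tm tensor_functions_add)
           (use 1(6,9,10) in \<open>auto simp: add_frac_eq\<close>)
    qed
    show "(\<lambda>x. f x * g x) \<in> regular ?Z W"
    proof (rule regular_product_fspaceI)
      fix w assume "w \<in> W"
      from loc[OF this] obtain U V p q p' q' where 1: "openin (zar X) U" "openin (zar Y) V" "w \<in> U \<times> V"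
      "p \<in> tensor_functions X Y U V" "q \<in> tensor_functions X Y U V" "q w \<noteq> 0"
      "p' \<in> tensor_functions X Y U V" "q' \<in> tensor_functions X Y U V" "q' w \<noteq> 0"
      "\<forall>w' \<in> W \<inter> (U \<times> V). q w' \<noteq> 0 \<and> q' w' \<noteq> 0 \<longrightarrow> f w' = p w' / q w' \<and> g w' = p' w' / q' w'" by blast
      show "\<exists>U V. openin (zar X) U \<and> openin (zar Y) V \<and> w \<in> U \<times> V \<and>
             (\<exists>p \<in> tensor_functions X Y U V. \<exists>q \<in> tensor_functions X Y U V. q w \<noteq> 0 \<and>
                (\<forall>w' \<in> W \<inter> (U \<times> V). q w' \<noteq> 0 \<longrightarrow> f w' * g w' = p w' / q w'))"
        by (intro exI[of _ U] exI[of _ V] conjI 1 bexI[of _ "\<lambda>w. p w * p' w"]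
            bexI[of _ "\<lambda>w. q w * q' w"] tm)
           (use 1(6,9,10) in auto)
    qed }
  show "openin (zar ?Z) {x \<in> W. f x \<noteq> 0}"
  proof (subst openin_subopen, intro ballI)
    fix w assume w: "w \<in> {x \<in> W. f x \<noteq> 0}"
    then have wW: "w \<in> W" by simp
    obtain U V p q where 1: "openin (zar X) U" "openin (zar Y) V" "w \<in> U \<times> V"
      "p \<in> tensor_functions X Y U V" "q \<in> tensor_functions X Y U V" "q w \<noteq> 0"
      "\<And>w'. w' \<in> W \<Longrightarrow> w' \<in> U \<times> V \<Longrightarrow> q w' \<noteq> 0 \<Longrightarrow> f w' = p w' / q w'"
      by (rule regular_product_fspaceE[OF f wW]) blast
    have "openin (zar ?Z) (W \<inter> {w \<in> U \<times> V. p w * q w \<noteq> 0})"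
      by (intro openin_Int W openin_product_fspace_basic tm 1)
    moreover have "w \<in> W \<inter> {w \<in> U \<times> V. p w * q w \<noteq> 0}" using w 1 by auto
    moreover have "W \<inter> {w \<in> U \<times> V. p w * q w \<noteq> 0} \<subseteq> {x \<in> W. f x \<noteq> 0}" using 1(7) by auto
    ultimately show "\<exists>T. openin (zar ?Z) T \<and> w \<in> T \<and> T \<subseteq> {x \<in> W. f x \<noteq> 0}" by blast
  qed
  show "(\<lambda>x. inverse (f x)) \<in> regular ?Z {x \<in> W. f x \<noteq> 0}"
  proof (rule regular_product_fspaceI)
    fix w assume w: "w \<in> {x \<in> W. f x \<noteq> 0}"
    then have wW: "w \<in> W" by simp
    obtain U V p q where 1: "openin (zar X) U" "openin (zar Y) V" "w \<in> U \<times> V"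
      "p \<in> tensor_functions X Y U V" "q \<in> tensor_functions X Y U V" "q w \<noteq> 0"
      "\<And>w'. w' \<in> W \<Longrightarrow> w' \<in> U \<times> V \<Longrightarrow> q w' \<noteq> 0 \<Longrightarrow> f w' = p w' / q w'"
      by (rule regular_product_fspaceE[OF f wW]) blast
    show "\<exists>U V. openin (zar X) U \<and> openin (zar Y) V \<and> w \<in> U \<times> V \<and>
             (\<exists>p \<in> tensor_functions X Y U V. \<exists>q \<in> tensor_functions X Y U V. q w \<noteq> 0 \<and>
                (\<forall>w' \<in> {x \<in> W. f x \<noteq> 0} \<inter> (U \<times> V). q w' \<noteq> 0 \<longrightarrow> inverse (f w') = p w' / q w'))"
      by (intro exI[of _ U] exI[of _ V] conjI 1 bexI[of _ "\<lambda>w. q w * q w"]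
            bexI[of _ "\<lambda>w. p w * q w"] tm)
         (use 1(3,6,7) w in auto)
  qed
next
  let ?Z = "product_fspace X Y"
  note tm = tensor_functions_mult[OF X _ Y]
  fix W f assume W: "openin (zar ?Z) W"
    and loc: "\<forall>x\<in>W. \<exists>V g. openin (zar ?Z) V \<and> x \<in> V \<and> g \<in> regular ?Z V \<and> (\<forall>y \<in> W \<inter> V. f y = g y)"
  show "f \<in> regular ?Z W"
  proof (rule regular_product_fspaceI)
    fix w assume w: "w \<in> W"
    then obtain Q g where Q: "openin (zar ?Z) Q" "w \<in> Q" and g: "g \<in> regular ?Z Q" and fg: "\<forall>y \<in> W \<inter> Q. f y = g y"
      using loc by blast
    obtain U V p q where 1: "openin (zar X) U" "openin (zar Y) V" "w \<in> U \<times> V"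
      "p \<in> tensor_functions X Y U V" "q \<in> tensor_functions X Y U V" "q w \<noteq> 0"
      "\<And>w'. w' \<in> Q \<Longrightarrow> w' \<in> U \<times> V \<Longrightarrow> q w' \<noteq> 0 \<Longrightarrow> g w' = p w' / q w'"
      by (rule regular_product_fspaceE[OF g Q(2)]) blast
    obtain U' V' h where 2: "openin (zar X) U'" "openin (zar Y) V'" "h \<in> tensor_functions X Y U' V'"
      "w \<in> U' \<times> V'" "h w \<noteq> 0" "{w' \<in> U' \<times> V'. h w' \<noteq> 0} \<subseteq> Q"
      using openin_product_fspace_basis[OF X Y Q] by blast
    have o: "openin (zar X) (U \<inter> U')" "openin (zar Y) (V \<inter> V')" using 1 2 by blast+
    note r1 = tensor_functions_restrict[OF X 1(1) o(1) Int_lower1 Y 1(2) o(2) Int_lower1]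
    note r2 = tensor_functions_restrict[OF X 2(1) o(1) Int_lower2 Y 2(2) o(2) Int_lower2]
    have "f w' = p w' * h w' / (q w' * h w')" if "w' \<in> W" "w' \<in> (U \<inter> U') \<times> (V \<inter> V')" "q w' * h w' \<noteq> 0" for w'
    proof -
      have "w' \<in> Q" using that 2(6) by auto
      then show ?thesis using that 1(7)[of w'] fg by auto
    qed
    then show "\<exists>U V. openin (zar X) U \<and> openin (zar Y) V \<and> w \<in> U \<times> V \<and>
             (\<exists>p \<in> tensor_functions X Y U V. \<exists>q \<in> tensor_functions X Y U V. q w \<noteq> 0 \<and>
                (\<forall>w' \<in> W \<inter> (U \<times> V). q w' \<noteq> 0 \<longrightarrow> f w' = p w' / q w'))"
      by (intro exI[of _ "U \<inter> U'"] exI[of _ "V \<inter> V'"] conjI o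
          bexI[of _ "\<lambda>w. p w * h w"] bexI[of _ "\<lambda>w. q w * h w"] tm r1 r2 1 2)
         (use 1 2 in auto)
  qed
qed

subsection \<open>Morphisms\<close>

lemma morphism_continuous: "morphism X Y \<phi> \<Longrightarrow> continuous_map (zar X) (zar Y) \<phi>"
  by (simp add: morphism_def)

lemma morphism_points: "morphism X Y \<phi> \<Longrightarrow> x \<in> points X \<Longrightarrow> \<phi> x \<in> points Y"
  by (meson morphism_continuous continuous_map_image_subset_topspace image_subset_iff)

lemma morphism_open:
  "morphism X Y \<phi> \<Longrightarrow> openin (zar Y) V \<Longrightarrow> openin (zar X) {x \<in> points X. \<phi> x \<in> V}"
  using openin_continuous_map_preimage[of "zar X" "zar Y" \<phi> V] by (simp add: morphism_def)

lemma morphism_regular: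
  "morphism X Y \<phi> \<Longrightarrow> openin (zar Y) V \<Longrightarrow> g \<in> regular Y V \<Longrightarrow>
    (\<lambda>x. g (\<phi> x)) \<in> regular X {x \<in> points X. \<phi> x \<in> V}"
  by (simp add: morphism_def o_def)

lemma morphism_regular_points:
  assumes "morphism X Y \<phi>" "g \<in> regular Y (points Y)"
  shows "(\<lambda>x. g (\<phi> x)) \<in> regular X (points X)"
proof -
  have "{x \<in> points X. \<phi> x \<in> points Y} = points X" using morphism_points[OF assms(1)] by blast
  then show ?thesis using morphism_regular[OF assms(1) openin_topspace assms(2)] by simp
qed

text \<open>Both requirements are local on the source by the sheaf axioms, so \<phi> may be given by
  a different formula near each point.\<close>

lemma morphism_localI:
  assumes X: "function_sheaf X" and im: "\<And>x. x \<in> points X \<Longrightarrow> \<phi> x \<in> points Y"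
    and loc: "\<And>x. x \<in> points X \<Longrightarrow> \<exists>U. openin (zar X) U \<and> x \<in> U \<and>
      (\<forall>V. openin (zar Y) V \<longrightarrow> openin (zar X) {y \<in> U. \<phi> y \<in> V} \<and>
        (\<forall>g \<in> regular Y V. (\<lambda>y. g (\<phi> y)) \<in> regular X {y \<in> U. \<phi> y \<in> V}))"
  shows "morphism X Y \<phi>"
proof -
  have op: "openin (zar X) {x \<in> points X. \<phi> x \<in> V}" if V: "openin (zar Y) V" for V
  proof (subst openin_subopen, intro ballI)
    fix x assume x: "x \<in> {x \<in> points X. \<phi> x \<in> V}"
    then obtain U where "openin (zar X) U" "x \<in> U" "openin (zar X) {y \<in> U. \<phi> y \<in> V}" using loc V by blast
    then show "\<exists>T. openin (zar X) T \<and> x \<in> T \<and> T \<subseteq> {x \<in> points X. \<phi> x \<in> V}"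
      using x openin_subset by (intro exI[of _ "{y \<in> U. \<phi> y \<in> V}"]) fastforce
  qed
  have "g \<circ> \<phi> \<in> regular X {x \<in> points X. \<phi> x \<in> V}" if V: "openin (zar Y) V" and g: "g \<in> regular Y V" for V g
  proof (rule sheaf_local[OF X op[OF V]])
    fix x assume x: "x \<in> {x \<in> points X. \<phi> x \<in> V}"
    then obtain U where "openin (zar X) U" "x \<in> U" "openin (zar X) {y \<in> U. \<phi> y \<in> V}"
      "(\<lambda>y. g (\<phi> y)) \<in> regular X {y \<in> U. \<phi> y \<in> V}" using loc V g by blast
    then show "\<exists>W h. openin (zar X) W \<and> x \<in> W \<and> h \<in> regular X W \<and> (\<forall>y\<in>{x \<in> points X. \<phi> x \<in> V} \<inter> W. (g \<circ> \<phi>) y = h y)"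
      using x by (intro exI[of _ "{y \<in> U. \<phi> y \<in> V}"] exI[of _ "\<lambda>y. g (\<phi> y)"]) auto
  qed
  then show ?thesis unfolding morphism_def continuous_map_def using op im by auto
qed

lemma morphism_comp:
  assumes "morphism X Y \<phi>" "morphism Y Z \<psi>"
  shows "morphism X Z (\<lambda>x. \<psi> (\<phi> x))"
proof -
  have "continuous_map (zar X) (zar Z) (\<psi> \<circ> \<phi>)"
    using assms by (auto intro: continuous_map_compose simp: morphism_def)
  moreover have "g \<circ> (\<psi> \<circ> \<phi>) \<in> regular X {x \<in> points X. (\<psi> \<circ> \<phi>) x \<in> V}" if V: "openin (zar Z) V" "g \<in> regular Z V" for V g
  proof -
    let ?W = "{y \<in> points Y. \<psi> y \<in> V}"
    have "openin (zar Y) ?W" "g \<circ> \<psi> \<in> regular Y ?W"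
      using assms(2) V morphism_open by (auto simp: morphism_def)
    then have "g \<circ> \<psi> \<circ> \<phi> \<in> regular X {x \<in> points X. \<phi> x \<in> ?W}" using assms(1) by (auto simp: morphism_def)
    moreover have "{x \<in> points X. \<phi> x \<in> ?W} = {x \<in> points X. (\<psi> \<circ> \<phi>) x \<in> V}"
      using morphism_points[OF assms(1)] by auto
    ultimately show ?thesis by (simp add: o_assoc)
  qed
  ultimately have "morphism X Z (\<psi> \<circ> \<phi>)" by (auto simp: morphism_def)
  then show ?thesis by (simp add: o_def)
qed

lemma morphism_into_induced:
  assumes X: "function_sheaf X" and m: "morphism X Y \<phi>" and im: "\<And>x. x \<in> points X \<Longrightarrow> \<phi> x \<in> S"
  shows "morphism X (induced Y S) \<phi>"
proof (rule morphism_localI[OF X])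
  show "\<phi> x \<in> points (induced Y S)" if "x \<in> points X" for x
    using morphism_points[OF m that] im[OF that] by simp
  fix x assume x: "x \<in> points X"
  show "\<exists>U. openin (zar X) U \<and> x \<in> U \<and>
      (\<forall>V. openin (zar (induced Y S)) V \<longrightarrow> openin (zar X) {y \<in> U. \<phi> y \<in> V} \<and>
        (\<forall>g \<in> regular (induced Y S) V. (\<lambda>y. g (\<phi> y)) \<in> regular X {y \<in> U. \<phi> y \<in> V}))"
  proof (intro exI[of _ "points X"] conjI allI impI ballI)
    fix V assume V: "openin (zar (induced Y S)) V"
    then obtain T where T: "openin (zar Y) T" "V = T \<inter> S" by (auto simp: openin_induced)
    have eq: "{y \<in> points X. \<phi> y \<in> V} = {y \<in> points X. \<phi> y \<in> T}" using T im by auto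
    show o: "openin (zar X) {y \<in> points X. \<phi> y \<in> V}" unfolding eq by (rule morphism_open[OF m T(1)])
    fix g assume g: "g \<in> regular (induced Y S) V"
    show "(\<lambda>y. g (\<phi> y)) \<in> regular X {y \<in> points X. \<phi> y \<in> V}"
    proof (rule sheaf_local[OF X o])
      fix y assume y: "y \<in> {y \<in> points X. \<phi> y \<in> V}"
      then have yV: "\<phi> y \<in> V" by simp
      obtain V' h where 1: "openin (zar Y) V'" "\<phi> y \<in> V'" "h \<in> regular Y V'" "\<And>y. y \<in> V \<Longrightarrow> y \<in> V' \<Longrightarrow> g y = h y"
        by (rule regular_inducedE[OF g yV]) auto
      show "\<exists>W h. openin (zar X) W \<and> y \<in> W \<and> h \<in> regular X W \<and> (\<forall>y\<in>{y \<in> points X. \<phi> y \<in> V} \<inter> W. g (\<phi> y) = h y)"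
        by (rule exI[of _ "{y \<in> points X. \<phi> y \<in> V'}"], rule exI[of _ "\<lambda>y. h (\<phi> y)"])
           (use morphism_open[OF m 1(1)] morphism_regular[OF m 1(1,3)] 1 y in auto)
    qed
  qed (use x in auto)
qed

lemma morphism_inclusion:
  assumes "function_sheaf X"
  shows "morphism (induced X S) X (\<lambda>x. x)"
proof (rule morphism_localI[OF function_sheaf_induced[OF assms]])
  fix x assume x: "x \<in> points (induced X S)"
  show "\<exists>U. openin (zar (induced X S)) U \<and> x \<in> U \<and>
      (\<forall>V. openin (zar X) V \<longrightarrow> openin (zar (induced X S)) {y \<in> U. y \<in> V} \<and>
        (\<forall>g \<in> regular X V. g \<in> regular (induced X S) {y \<in> U. y \<in> V}))"
  proof (intro exI[of _ "points (induced X S)"] conjI allI impI ballI)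
    fix V assume V: "openin (zar X) V"
    have "{y \<in> points (induced X S). y \<in> V} = V \<inter> S" using openin_subset[OF V] by auto
    then show "openin (zar (induced X S)) {y \<in> points (induced X S). y \<in> V}"
      using V by (auto simp: openin_induced)
    fix g assume "g \<in> regular X V"
    then show "g \<in> regular (induced X S) {y \<in> points (induced X S). y \<in> V}"
      by (intro regular_inducedI exI[of _ V] exI[of _ g]) (use V in auto)
  qed (use x openin_topspace[of "zar (induced X S)"] in auto)
qed auto

lemma morphism_from_induced:
  "function_sheaf X \<Longrightarrow> morphism X Y \<phi> \<Longrightarrow> morphism (induced X S) Y \<phi>"
  using morphism_comp[OF morphism_inclusion] by blast

lemma morphism_const:
  assumes X: "function_sheaf X" and Y: "function_sheaf Y" and y: "y \<in> points Y"
  shows "morphism X Y (\<lambda>x. y)"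
proof (rule morphism_localI[OF X])
  have eq: "{x' \<in> points X. y \<in> V} = (if y \<in> V then points X else {})" for V by auto
  show "\<exists>U. openin (zar X) U \<and> x \<in> U \<and>
      (\<forall>V. openin (zar Y) V \<longrightarrow> openin (zar X) {x \<in> U. y \<in> V} \<and>
        (\<forall>g \<in> regular Y V. (\<lambda>x. g y) \<in> regular X {x \<in> U. y \<in> V}))" if "x \<in> points X" for x
    by (rule exI[of _ "points X"]) (use that in \<open>auto simp: eq intro!: sheaf_const X\<close>)
qed (use y in auto)

lemma morphism_coordinate_spaceI:
  assumes X: "function_sheaf X" and "\<And>x. x \<in> points X \<Longrightarrow> l x \<in> P"
    and "\<And>c. c \<in> C \<Longrightarrow> (\<lambda>x. c (l x)) \<in> regular X (points X)"
  shows "morphism X (coordinate_space C P) l"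
proof (rule morphism_localI[OF X])
  fix x assume "x \<in> points X"
  then show "\<exists>U. openin (zar X) U \<and> x \<in> U \<and>
      (\<forall>V. openin (zar (coordinate_space C P)) V \<longrightarrow> openin (zar X) {y \<in> U. l y \<in> V} \<and>
        (\<forall>g \<in> regular (coordinate_space C P) V. (\<lambda>y. g (l y)) \<in> regular X {y \<in> U. l y \<in> V}))"
    by (intro exI[of _ "points X"] conjI allI impI ballI openin_topspace
        coordinate_space_pull[where l = l and P = P and C = C, OF X openin_topspace assms(2,3)])
qed (use assms in auto)

lemma morphism_fst:
  assumes X: "function_sheaf X" and Y: "function_sheaf Y"
  shows "morphism (product_fspace X Y) X fst"
proof (rule morphism_localI[OF function_sheaf_product_fspace[OF assms]])
  let ?Z = "product_fspace X Y"
  fix w assume w: "w \<in> points ?Z"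
  show "\<exists>U. openin (zar ?Z) U \<and> w \<in> U \<and>
      (\<forall>V. openin (zar X) V \<longrightarrow> openin (zar ?Z) {y \<in> U. fst y \<in> V} \<and>
        (\<forall>g \<in> regular X V. (\<lambda>y. g (fst y)) \<in> regular ?Z {y \<in> U. fst y \<in> V}))"
  proof (intro exI[of _ "points ?Z"] conjI allI impI ballI)
    fix V assume V: "openin (zar X) V"
    have eq: "{y \<in> points ?Z. fst y \<in> V} = V \<times> points Y" using openin_subset[OF V] by (auto simp: points_product_fspace X Y)
    show "openin (zar ?Z) {y \<in> points ?Z. fst y \<in> V}"
      unfolding eq by (rule openin_product_fspace_Times[OF X Y V openin_topspace])
    fix g assume g: "g \<in> regular X V"
    show "(\<lambda>y. g (fst y)) \<in> regular ?Z {y \<in> points ?Z. fst y \<in> V}" unfolding eq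
      by (rule regular_product_fspaceI, rule exI[of _ V], rule exI[of _ "points Y"], intro conjI V openin_topspace,
          assumption, rule bexI[OF _ tensor_functions_times[OF g sheaf_const[OF Y openin_topspace, of 1]]],
          rule bexI[OF _ tensor_functions_times[OF sheaf_const[OF X V, of 1] sheaf_const[OF Y openin_topspace, of 1]]])
         (auto simp: split_beta)
  qed (use w in auto)
qed (use X Y in \<open>auto simp: points_product_fspace\<close>)

lemma morphism_snd:
  assumes X: "function_sheaf X" and Y: "function_sheaf Y"
  shows "morphism (product_fspace X Y) Y snd"
proof (rule morphism_localI[OF function_sheaf_product_fspace[OF assms]])
  let ?Z = "product_fspace X Y"
  fix w assume w: "w \<in> points ?Z"
  show "\<exists>U. openin (zar ?Z) U \<and> w \<in> U \<and>
      (\<forall>V. openin (zar Y) V \<longrightarrow> openin (zar ?Z) {y \<in> U. snd y \<in> V} \<and>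
        (\<forall>g \<in> regular Y V. (\<lambda>y. g (snd y)) \<in> regular ?Z {y \<in> U. snd y \<in> V}))"
  proof (intro exI[of _ "points ?Z"] conjI allI impI ballI)
    fix V assume V: "openin (zar Y) V"
    have eq: "{y \<in> points ?Z. snd y \<in> V} = points X \<times> V" using openin_subset[OF V] by (auto simp: points_product_fspace X Y)
    show "openin (zar ?Z) {y \<in> points ?Z. snd y \<in> V}"
      unfolding eq by (rule openin_product_fspace_Times[OF X Y openin_topspace V])
    fix g assume g: "g \<in> regular Y V"
    show "(\<lambda>y. g (snd y)) \<in> regular ?Z {y \<in> points ?Z. snd y \<in> V}" unfolding eq
      by (rule regular_product_fspaceI, rule exI[of _ "points X"], rule exI[of _ V], intro conjI V openin_topspace,
          assumption, rule bexI[OF _ tensor_functions_times[OF sheaf_const[OF X openin_topspace, of 1] g]],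
          rule bexI[OF _ tensor_functions_times[OF sheaf_const[OF X openin_topspace, of 1] sheaf_const[OF Y V, of 1]]])
         (auto simp: split_beta)
  qed (use w in auto)
qed (use X Y in \<open>auto simp: points_product_fspace\<close>)

text \<open>The topology on the product is finer than the product topology, so continuity of the
  components does not settle continuity of the pair. Nonvanishing loci of tensors are pulled back as
  well, and these are open because the pulled back tensors are regular.\<close>

lemma morphism_Pair:
  assumes X: "function_sheaf X" and Y: "function_sheaf Y" and Z: "function_sheaf Z"
    and l: "morphism Z X l" and m: "morphism Z Y m"
  shows "morphism Z (product_fspace X Y) (\<lambda>x. (l x, m x))"
proof (rule morphism_localI[OF Z])
  let ?P = "product_fspace X Y"
  show "(l x, m x) \<in> points ?P" if "x \<in> points Z" for x
    using that morphism_points[OF l] morphism_points[OF m] by (simp add: points_product_fspace X Y)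
  have pull: "\<exists>Q. openin (zar Z) Q \<and> Q = {x \<in> points Z. l x \<in> U \<and> m x \<in> V} \<and>
      (\<forall>h \<in> tensor_functions X Y U V. (\<lambda>x. h (l x, m x)) \<in> regular Z Q)"
    if UV: "openin (zar X) U" "openin (zar Y) V" for U V
  proof -
    let ?U = "{x \<in> points Z. l x \<in> U}" and ?V = "{x \<in> points Z. m x \<in> V}"
    let ?Q = "{x \<in> points Z. l x \<in> U \<and> m x \<in> V}"
    have o: "openin (zar Z) ?U" "openin (zar Z) ?V" by (rule morphism_open[OF l UV(1)], rule morphism_open[OF m UV(2)])
    then have "openin (zar Z) (?U \<inter> ?V)" by blast
    moreover have "?U \<inter> ?V = ?Q" by blast
    ultimately have oO: "openin (zar Z) ?Q" by simp
    have "(\<lambda>x. h (l x, m x)) \<in> regular Z ?Q" if h: "h \<in> tensor_functions X Y U V" for h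
    proof (rule product_fspace_function_tensor[OF X Y Z oO UV h])
      show "(\<lambda>w. f (l w)) \<in> regular Z ?Q" if "f \<in> regular X U" for f
        by (rule sheaf_restrict[OF Z oO o(1) morphism_regular[OF l UV(1) that]]) auto
      show "(\<lambda>w. f (m w)) \<in> regular Z ?Q" if "f \<in> regular Y V" for f
        by (rule sheaf_restrict[OF Z oO o(2) morphism_regular[OF m UV(2) that]]) auto
    qed
    then show ?thesis using oO by blast
  qed
  fix x assume x: "x \<in> points Z"
  show "\<exists>U. openin (zar Z) U \<and> x \<in> U \<and>
      (\<forall>V. openin (zar ?P) V \<longrightarrow> openin (zar Z) {y \<in> U. (l y, m y) \<in> V} \<and>
        (\<forall>g \<in> regular ?P V. (\<lambda>y. g (l y, m y)) \<in> regular Z {y \<in> U. (l y, m y) \<in> V}))"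
  proof (intro exI[of _ "points Z"] conjI allI impI ballI)
    fix W assume W: "openin (zar ?P) W"
    show o: "openin (zar Z) {y \<in> points Z. (l y, m y) \<in> W}"
    proof (subst openin_subopen, intro ballI)
      fix y assume y: "y \<in> {y \<in> points Z. (l y, m y) \<in> W}"
      then have yW: "(l y, m y) \<in> W" by simp
      obtain U V h where 1: "openin (zar X) U" "openin (zar Y) V" "h \<in> tensor_functions X Y U V"
        "(l y, m y) \<in> U \<times> V" "h (l y, m y) \<noteq> 0" "{w' \<in> U \<times> V. h w' \<noteq> 0} \<subseteq> W"
        using openin_product_fspace_basis[OF X Y W yW] by blast
      obtain Q where Q: "openin (zar Z) Q" "Q = {x \<in> points Z. l x \<in> U \<and> m x \<in> V}"
        "(\<lambda>x. h (l x, m x)) \<in> regular Z Q" using pull[OF 1(1,2)] 1(3) by blast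
      show "\<exists>T. openin (zar Z) T \<and> y \<in> T \<and> T \<subseteq> {y \<in> points Z. (l y, m y) \<in> W}"
        by (rule exI[of _ "{x \<in> Q. h (l x, m x) \<noteq> 0}"])
           (use sheaf_nonzero_open[OF Z Q(1,3)] Q(2) 1 y in auto)
    qed
    fix g assume g: "g \<in> regular ?P W"
    show "(\<lambda>y. g (l y, m y)) \<in> regular Z {y \<in> points Z. (l y, m y) \<in> W}"
    proof (rule sheaf_local[OF Z o])
      fix y assume y: "y \<in> {y \<in> points Z. (l y, m y) \<in> W}"
      then have yW: "(l y, m y) \<in> W" by simp
      obtain U V p q where 1: "openin (zar X) U" "openin (zar Y) V" "(l y, m y) \<in> U \<times> V"
        "p \<in> tensor_functions X Y U V" "q \<in> tensor_functions X Y U V" "q (l y, m y) \<noteq> 0"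
        "\<And>w'. w' \<in> W \<Longrightarrow> w' \<in> U \<times> V \<Longrightarrow> q w' \<noteq> 0 \<Longrightarrow> g w' = p w' / q w'"
        by (rule regular_product_fspaceE[OF g yW]) blast
      obtain Q where Q: "openin (zar Z) Q" "Q = {x \<in> points Z. l x \<in> U \<and> m x \<in> V}"
        "(\<lambda>x. p (l x, m x)) \<in> regular Z Q" "(\<lambda>x. q (l x, m x)) \<in> regular Z Q" using pull[OF 1(1,2)] 1(4,5) by blast
      let ?Q = "{x \<in> Q. q (l x, m x) \<noteq> 0}"
      have oO: "openin (zar Z) ?Q" by (rule sheaf_nonzero_open[OF Z Q(1,4)])
      have "(\<lambda>x. p (l x, m x) / q (l x, m x)) \<in> regular Z ?Q"
        by (rule sheaf_divide[OF Z oO]) (auto intro: sheaf_restrict[OF Z oO Q(1,3)] sheaf_restrict[OF Z oO Q(1,4)])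
      then show "\<exists>V h. openin (zar Z) V \<and> y \<in> V \<and> h \<in> regular Z V \<and> (\<forall>y \<in> {y \<in> points Z. (l y, m y) \<in> W} \<inter> V. g (l y, m y) = h y)"
        by (intro exI[of _ ?Q] exI[of _ "\<lambda>x. p (l x, m x) / q (l x, m x)"]) (use oO Q(2) 1 y in auto)
    qed
  qed (use x in auto)
qed

section \<open>The flag variety\<close>

subsection \<open>Frames and Gaussian elimination\<close>

text \<open>The sequential form of linear independence, which elimination processes vector by
  vector.\<close>

lemma frames_iff:
  "vs \<in> frames r \<longleftrightarrow> length vs = r \<and> (\<forall>i<r. vs ! i \<notin> vec.span (set (take i vs)))"
proof (induction vs arbitrary: r rule: rev_induct)
  case Nil
  then show ?case by (auto simp: frames_def vec.independent_empty)
next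
  case (snoc x vs)
  show ?case
  proof (cases "r = Suc (length vs)")
    case True
    have "vs @ [x] \<in> frames r \<longleftrightarrow> vs \<in> frames (length vs) \<and> x \<notin> vec.span (set vs)"
      using True by (auto simp: frames_def vec.independent_insert vec.span_base)
    also have "\<dots> \<longleftrightarrow> length (vs @ [x]) = r \<and> (\<forall>i<r. (vs @ [x]) ! i \<notin> vec.span (set (take i (vs @ [x]))))"
      using True snoc.IH[of "length vs"] by (auto simp: nth_append less_Suc_eq)
    finally show ?thesis .
  qed (auto simp: frames_def)
qed

lemma frames_nth: "vs \<in> frames r \<Longrightarrow> i < r \<Longrightarrow> vs ! i \<notin> vec.span (set (take i vs))"
  by (simp add: frames_iff)

lemma frames_length: "vs \<in> frames r \<Longrightarrow> length vs = r"
  by (simp add: frames_iff)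

text \<open>Clears from w, for i < p in turn, the entry in column \<open>cs i\<close> by means of
  the reduced i-th vector. The result is linear in w and rational in the entries, with the pivots as
  denominators.\<close>

fun gauss_reduce :: "(nat \<Rightarrow> 'd) \<Rightarrow> (complex ^ 'd::finite) list \<Rightarrow> nat \<Rightarrow> complex ^ 'd \<Rightarrow> complex ^ 'd" where
  "gauss_reduce cs vs 0 w = w"
| "gauss_reduce cs vs (Suc p) w = gauss_reduce cs vs p w -
     (gauss_reduce cs vs p w $ cs p / gauss_reduce cs vs p (vs ! p) $ cs p) *s gauss_reduce cs vs p (vs ! p)"

definition pivots :: "(nat \<Rightarrow> 'd) \<Rightarrow> (complex ^ 'd::finite) list \<Rightarrow> nat \<Rightarrow> bool" where
  "pivots cs vs p \<longleftrightarrow> (\<forall>i<p. gauss_reduce cs vs i (vs ! i) $ cs i \<noteq> 0)"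

lemma pivots_Suc: "pivots cs vs (Suc p) \<longleftrightarrow> pivots cs vs p \<and> gauss_reduce cs vs p (vs ! p) $ cs p \<noteq> 0"
  by (auto simp: pivots_def less_Suc_eq)

lemma pivots_le: "pivots cs vs p \<Longrightarrow> i \<le> p \<Longrightarrow> pivots cs vs i"
  by (auto simp: pivots_def)

lemma gauss_reduce_add: "gauss_reduce cs vs p (x + y) = gauss_reduce cs vs p x + gauss_reduce cs vs p y"
  by (induction p arbitrary: x y) (simp_all add: add_divide_distrib vec.scale_left_distrib)

lemma gauss_reduce_scale: "gauss_reduce cs vs p (c *s x) = c *s gauss_reduce cs vs p x"
  by (induction p arbitrary: x) (simp_all add: vec.scale_right_diff_distrib)

lemma gauss_reduce_diff: "gauss_reduce cs vs p (x - y) = gauss_reduce cs vs p x - gauss_reduce cs vs p y"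
  using gauss_reduce_add[of cs vs p "x - y" y] by simp

lemma gauss_reduce_cong:
  "(\<And>i. i < p \<Longrightarrow> cs i = cs' i) \<Longrightarrow> gauss_reduce cs vs p w = gauss_reduce cs' vs p w"
  by (induction p arbitrary: w) simp_all

lemma set_take_Suc: "i < length vs \<Longrightarrow> set (take (Suc i) vs) = insert (vs ! i) (set (take i vs))"
  by (simp add: take_Suc_conv_app_nth)

lemma gauss_reduce_span:
  "p \<le> length vs \<Longrightarrow> w - gauss_reduce cs vs p w \<in> vec.span (set (take p vs))"
proof (induction p arbitrary: w)
  case 0
  then show ?case by simp
next
  case (Suc p)
  let ?S = "vec.span (set (take (Suc p) vs))"
  have sub: "vec.span (set (take p vs)) \<subseteq> ?S"
    by (intro vec.span_mono) (simp add: set_take_subset_set_take)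
  have IH: "w - gauss_reduce cs vs p w \<in> ?S" for w
    using Suc.IH[of w] Suc.prems sub by auto
  have "vs ! p \<in> ?S" using Suc.prems by (simp add: set_take_Suc vec.span_base)
  then have "gauss_reduce cs vs p (vs ! p) \<in> ?S"
    using IH[of "vs ! p"] vec.span_diff[of "vs ! p" _ "vs ! p - gauss_reduce cs vs p (vs ! p)"] by simp
  then have "w - gauss_reduce cs vs p w + c *s gauss_reduce cs vs p (vs ! p) \<in> ?S" for c
    by (intro vec.span_add IH vec.span_scale)
  then show ?case by (simp add: algebra_simps)
qed

lemma gauss_reduce_eq_0:
  "pivots cs vs p \<Longrightarrow> p \<le> length vs \<Longrightarrow> w \<in> vec.span (set (take p vs)) \<Longrightarrow> gauss_reduce cs vs p w = 0"
proof (induction p arbitrary: w)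
  case (Suc p)
  let ?u = "gauss_reduce cs vs p (vs ! p)"
  obtain k where "w - k *s vs ! p \<in> vec.span (set (take p vs) - {vs ! p})"
    using vec.span_breakdown[of "vs ! p" "set (take (Suc p) vs)" w] Suc.prems
    by (auto simp: set_take_Suc)
  then have "w - k *s vs ! p \<in> vec.span (set (take p vs))"
    using vec.span_mono[of "set (take p vs) - {vs ! p}" "set (take p vs)"] by blast
  then have "gauss_reduce cs vs p (w - k *s vs ! p) = 0"
    using Suc by (simp add: pivots_Suc)
  then have "gauss_reduce cs vs p w = k *s ?u"
    by (simp add: gauss_reduce_diff gauss_reduce_scale)
  then show ?case using Suc.prems by (simp add: pivots_Suc)
qed simp

text \<open>Turns membership in a span that varies with the frame into the vanishing of rational
  functions of the frame.\<close>

lemma gauss_reduce_eq_0_iff: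
  "pivots cs vs p \<Longrightarrow> p \<le> length vs \<Longrightarrow> gauss_reduce cs vs p w = 0 \<longleftrightarrow> w \<in> vec.span (set (take p vs))"
  using gauss_reduce_eq_0 gauss_reduce_span[of p vs w cs] by fastforce

lemma pivots_exist:
  assumes "vs \<in> frames r"
  shows "\<exists>cs. pivots cs vs r"
proof -
  have "\<exists>cs. pivots cs vs p" if "p \<le> r" for p
    using that
  proof (induction p)
    case 0
    then show ?case by (simp add: pivots_def)
  next
    case (Suc p)
    then obtain cs where cs: "pivots cs vs p" by auto
    have "gauss_reduce cs vs p (vs ! p) \<noteq> 0"
      using gauss_reduce_eq_0_iff[OF cs, of "vs ! p"] frames_nth[OF assms, of p] Suc.prems frames_length[OF assms] by simp
    then obtain c where c: "gauss_reduce cs vs p (vs ! p) $ c \<noteq> 0" by (auto simp: vec_eq_iff)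
    \<comment> \<open>Reduction through stage i \<le> p consults only the columns before stage i, so
      choosing the column for stage p disturbs nothing earlier.\<close>
    have eq: "gauss_reduce (cs(p := c)) vs i w = gauss_reduce cs vs i w" if "i \<le> p" for i w
      by (rule gauss_reduce_cong) (use that in auto)
    have "pivots (cs(p := c)) vs (Suc p)"
      unfolding pivots_Suc using cs c by (auto simp: pivots_def eq simp del: fun_upd_apply) (auto simp: eq)
    then show ?case by blast
  qed
  then show ?thesis by blast
qed

definition same_flag :: "(complex ^ 'd::finite) list \<Rightarrow> (complex ^ 'd) list \<Rightarrow> nat \<Rightarrow> bool" where
  "same_flag vs ws r \<longleftrightarrow> (\<forall>i\<le>r. vec.span (set (take i vs)) = vec.span (set (take i ws)))"

lemma flag_of_frame_eq_iff:
  assumes "length vs = r" "length ws = r"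
  shows "flag_of_frame vs = flag_of_frame ws \<longleftrightarrow> same_flag vs ws r"
proof
  assume eq: "flag_of_frame vs = flag_of_frame ws"
  show "same_flag vs ws r" unfolding same_flag_def
  proof (intro allI impI)
    fix i assume "i \<le> r"
    then show "vec.span (set (take i vs)) = vec.span (set (take i ws))"
      using flag_part_of_frame[of i vs] flag_part_of_frame[of i ws] eq assms by simp
  qed
qed (auto simp: flag_of_frame_def assms same_flag_def simp del: upt_Suc)

lemma frames_span_Suc:
  assumes "vs \<in> frames r" "p < r" "vec.span (set (take p vs)) = vec.span (set (take p ws))"
    "x \<in> vec.span (set (take (Suc p) vs))" "x \<notin> vec.span (set (take p vs))"
  obtains k where "k \<noteq> 0" "x - k *s vs ! p \<in> vec.span (set (take p vs))"
proof -
  obtain k where "x - k *s vs ! p \<in> vec.span (set (take p vs) - {vs ! p})"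
    using vec.span_breakdown[of "vs ! p" "set (take (Suc p) vs)" x] assms frames_length[OF assms(1)]
    by (auto simp: set_take_Suc)
  then have k: "x - k *s vs ! p \<in> vec.span (set (take p vs))"
    using vec.span_mono[of "set (take p vs) - {vs ! p}" "set (take p vs)"] by blast
  moreover have "k \<noteq> 0" using k assms(5) by auto
  ultimately show ?thesis using that by blast
qed

text \<open>Two frames of one flag have p-th vectors that are proportional modulo the earlier span.
  The factor k cancels in the quotient of the recursion, so the reduction depends on the flag
  alone.\<close>

lemma gauss_reduce_flag:
  assumes vs: "vs \<in> frames r" and ws: "ws \<in> frames r" and sf: "same_flag vs ws r"
  shows "p \<le> r \<Longrightarrow> pivots cs vs p \<Longrightarrow> pivots cs ws p \<and> gauss_reduce cs ws p = gauss_reduce cs vs p"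
proof (induction p)
  case 0
  then show ?case by (auto simp: pivots_def)
next
  case (Suc p)
  then have IH: "pivots cs ws p" "gauss_reduce cs ws p = gauss_reduce cs vs p" and cs: "pivots cs vs p"
    by (auto simp: pivots_Suc)
  have len: "length vs = r" "length ws = r" using vs ws by (auto simp: frames_length)
  have sp: "vec.span (set (take i vs)) = vec.span (set (take i ws))" if "i \<le> r" for i
    using sf that by (simp add: same_flag_def)
  have "ws ! p \<in> vec.span (set (take (Suc p) ws))" using Suc.prems len by (simp add: set_take_Suc vec.span_base)
  then have "ws ! p \<in> vec.span (set (take (Suc p) vs))" using sp[of "Suc p"] Suc.prems by simp
  moreover have "ws ! p \<notin> vec.span (set (take p vs))"
    using frames_nth[OF ws, of p] sp[of p] Suc.prems by simp
  ultimately obtain k where k: "k \<noteq> 0" "ws ! p - k *s vs ! p \<in> vec.span (set (take p vs))"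
    using frames_span_Suc[OF vs, of p vs "ws ! p"] Suc.prems by auto
  then have "gauss_reduce cs vs p (ws ! p - k *s vs ! p) = 0"
    using gauss_reduce_eq_0[OF cs] Suc.prems len by simp
  then have "gauss_reduce cs ws p (ws ! p) = k *s gauss_reduce cs vs p (vs ! p)"
    by (simp add: gauss_reduce_diff gauss_reduce_scale IH)
  with k(1) show ?case using Suc.prems IH by (auto simp: pivots_Suc fun_eq_iff)
qed

text \<open>When all pivots are nonzero, the i-th vector has entry 0 in the earlier pivot columns
  and entry 1 in its own. This singles out one frame for each flag.\<close>

definition normal_frame :: "(nat \<Rightarrow> 'd) \<Rightarrow> nat \<Rightarrow> (complex ^ 'd::finite) list \<Rightarrow> (complex ^ 'd) list" where
  "normal_frame cs r vs =
     map (\<lambda>i. inverse (gauss_reduce cs vs i (vs ! i) $ cs i) *s gauss_reduce cs vs i (vs ! i)) [0..<r]"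

lemma normal_frame_span:
  assumes vs: "vs \<in> frames r" and cs: "pivots cs vs r"
  shows "p \<le> r \<Longrightarrow> vec.span (set (take p (normal_frame cs r vs))) = vec.span (set (take p vs))"
proof (induction p)
  case 0
  then show ?case by simp
next
  case (Suc p)
  let ?ns = "normal_frame cs r vs" and ?u = "gauss_reduce cs vs p (vs ! p)"
  have len: "length ?ns = r" "length vs = r" by (auto simp: normal_frame_def frames_length[OF vs])
  have nth: "?ns ! p = inverse (?u $ cs p) *s ?u" using Suc.prems by (simp add: normal_frame_def)
  have nz: "?u $ cs p \<noteq> 0" using cs Suc.prems by (simp add: pivots_def)
  have d: "vs ! p - ?u \<in> vec.span (set (take p vs))"
    by (rule gauss_reduce_span) (use Suc.prems len in simp)
  let ?S = "set (take p vs)"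
  have span1: "vec.span (insert (?ns ! p) ?S) = vec.span (insert ?u ?S)"
  proof (rule vec.span_eq[THEN iffD2], intro conjI)
    show "insert (?ns ! p) ?S \<subseteq> vec.span (insert ?u ?S)"
      by (auto simp: nth intro: vec.span_base vec.span_scale)
    have "(?u $ cs p) *s (?ns ! p) \<in> vec.span (insert (?ns ! p) ?S)"
      by (intro vec.span_scale vec.span_base) simp
    then show "insert ?u ?S \<subseteq> vec.span (insert (?ns ! p) ?S)"
      using nz by (auto simp: nth intro: vec.span_base)
  qed
  have span2: "vec.span (insert ?u ?S) = vec.span (insert (vs ! p) ?S)"
    by (rule vec.eq_span_insert_eq) (use vec.span_neg[OF d] in simp)
  have "vec.span (set (take (Suc p) ?ns)) = vec.span (insert (?ns ! p) (vec.span (set (take p ?ns))))"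
    using Suc.prems len by (simp add: set_take_Suc vec.span_insert vec.span_span)
  also have "\<dots> = vec.span (insert (?ns ! p) ?S)"
    using Suc.IH Suc.prems by (simp add: vec.span_insert vec.span_span)
  also have "\<dots> = vec.span (set (take (Suc p) vs))"
    using Suc.prems len by (simp add: span1 span2 set_take_Suc)
  finally show ?case .
qed

lemma normal_frame_frames:
  assumes vs: "vs \<in> frames r" and cs: "pivots cs vs r"
  shows "normal_frame cs r vs \<in> frames r" "flag_of_frame (normal_frame cs r vs) = flag_of_frame vs"
proof -
  let ?ns = "normal_frame cs r vs"
  have len: "length ?ns = r" "length vs = r" by (auto simp: normal_frame_def frames_length[OF vs])
  have "?ns ! p \<notin> vec.span (set (take p ?ns))" if p: "p < r" for p
  proof
    let ?u = "gauss_reduce cs vs p (vs ! p)"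
    have nz: "?u $ cs p \<noteq> 0" using cs p by (simp add: pivots_def)
    assume "?ns ! p \<in> vec.span (set (take p ?ns))"
    then have "?u $ cs p *s ?ns ! p \<in> vec.span (set (take p vs))"
      using normal_frame_span[OF vs cs, of p] p by (intro vec.span_scale) simp
    then have "?u \<in> vec.span (set (take p vs))" using nz p by (simp add: normal_frame_def)
    then have "vs ! p - ?u + ?u \<in> vec.span (set (take p vs))"
      by (intro vec.span_add gauss_reduce_span) (use p len in auto)
    then show False using frames_nth[OF vs p] by simp
  qed
  then show "?ns \<in> frames r" by (simp add: frames_iff len)
  show "flag_of_frame ?ns = flag_of_frame vs"
    by (simp add: flag_of_frame_eq_iff[OF len] same_flag_def normal_frame_span[OF vs cs])
qed

lemma normal_frame_flag:
  assumes vs: "vs \<in> frames r" and ws: "ws \<in> frames r" and sf: "flag_of_frame vs = flag_of_frame ws"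
    and cs: "pivots cs vs r"
  shows "pivots cs ws r" "normal_frame cs r ws = normal_frame cs r vs"
proof -
  have len: "length vs = r" "length ws = r" using vs ws by (auto simp: frames_length)
  have sf': "same_flag vs ws r" using sf by (simp add: flag_of_frame_eq_iff[OF len])
  note gr = gauss_reduce_flag[OF vs ws sf']
  show cw: "pivots cs ws r" using gr cs by blast
  have "inverse (gauss_reduce cs ws p (ws ! p) $ cs p) *s gauss_reduce cs ws p (ws ! p) =
        inverse (gauss_reduce cs vs p (vs ! p) $ cs p) *s gauss_reduce cs vs p (vs ! p)" if p: "p < r" for p
  proof -
    have "pivots cs vs p" using pivots_le[OF cs] p by simp
    with gr[of p cs] p have eq: "gauss_reduce cs ws p = gauss_reduce cs vs p" by simp
    have sp: "vec.span (set (take i vs)) = vec.span (set (take i ws))" if "i \<le> r" for i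
      using sf' that by (simp add: same_flag_def)
    have "ws ! p \<in> vec.span (set (take (Suc p) ws))" using p len by (simp add: set_take_Suc vec.span_base)
    then have "ws ! p \<in> vec.span (set (take (Suc p) vs))" using sp[of "Suc p"] p by simp
    moreover have "ws ! p \<notin> vec.span (set (take p vs))"
      using frames_nth[OF ws, of p] sp[of p] p by simp
    ultimately obtain k where k: "k \<noteq> 0" "ws ! p - k *s vs ! p \<in> vec.span (set (take p vs))"
      using frames_span_Suc[OF vs p, of vs "ws ! p"] by auto
    then have "gauss_reduce cs vs p (ws ! p - k *s vs ! p) = 0"
      using gauss_reduce_eq_0[OF \<open>pivots cs vs p\<close>] p len by simp
    then have "gauss_reduce cs vs p (ws ! p) = k *s gauss_reduce cs vs p (vs ! p)"
      by (simp add: gauss_reduce_diff gauss_reduce_scale)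
    with k(1) show ?thesis by (simp add: eq)
  qed
  then show "normal_frame cs r ws = normal_frame cs r vs" by (simp add: normal_frame_def)
qed

subsection \<open>Local sections of the frame bundle\<close>

lemma regular_linear:
  assumes X: "function_sheaf X" "openin (zar X) U" and A: "Vector_Spaces.linear (*s) (*s) A"
    and w: "\<And>j. (\<lambda>x. w x $ j) \<in> regular X U"
  shows "(\<lambda>x. A (w x) $ (j::'d::finite)) \<in> regular X U"
proof -
  have "A (w x) $ j = (\<Sum>i\<in>UNIV. matrix A $ j $ i * w x $ i)" for x
    using arg_cong[OF matrix_works[OF A, of "w x"], of "\<lambda>v. v $ j"]
    by (simp add: matrix_vector_mult_def del: matrix_works)
  then show ?thesis
    by (simp only:, intro sheaf_sum X sheaf_mult sheaf_const w)
qed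

lemma function_sheaf_frame_space: "function_sheaf (frame_space r)"
  by (simp add: frame_space_def function_sheaf_coordinate_space)

lemma function_sheaf_flag_variety: "function_sheaf (flag_variety r)"
  by (simp add: flag_variety_def function_sheaf_quotient_fspace function_sheaf_frame_space)

lemma points_frame_space: "points (frame_space r) = frames r"
  by (simp add: frame_space_def)

lemma regular_frame_coord:
  "i < r \<Longrightarrow> (\<lambda>vs. vs ! i $ j) \<in> regular (frame_space r) U"
  unfolding frame_space_def by (intro regular_coordinate_space_poly poly_functions.coord) auto

text \<open>Openness and regularity are proved together: the locus at stage p + 1 is where a pivot,
  regular on the locus at stage p, does not vanish, and the recursion divides by that pivot. The
  vector w to be reduced may itself vary with the frame.\<close>

lemma gauss_reduce_regular:
  fixes cs :: "nat \<Rightarrow> 'd::finite"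
  shows "p \<le> r \<Longrightarrow> openin (zar (frame_space r)) {vs \<in> frames r. pivots cs vs p} \<and>
    (\<forall>U w. openin (zar (frame_space r)) U \<longrightarrow> U \<subseteq> {vs \<in> frames r. pivots cs vs p} \<longrightarrow>
       (\<forall>j. (\<lambda>vs. w vs $ j) \<in> regular (frame_space r) U) \<longrightarrow>
       (\<forall>j. (\<lambda>vs. gauss_reduce cs vs p (w vs) $ j) \<in> regular (frame_space r) U))"
proof (induction p)
  case 0
  have "openin (zar (frame_space r)) (frames r :: (complex ^ 'd) list set)"
    using openin_topspace[of "zar (frame_space r)"] by (simp add: points_frame_space)
  then show ?case by (simp add: pivots_def)
next
  case (Suc p)
  let ?X = "frame_space r :: (complex ^ 'd) list fspace"
  let ?Q = "{vs \<in> frames r. pivots cs vs p}" and ?Q' = "{vs \<in> frames r. pivots cs vs (Suc p)}"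
  note X = function_sheaf_frame_space[of r]
  have Q: "openin (zar ?X) ?Q"
    and reg: "\<And>U w j. openin (zar ?X) U \<Longrightarrow> U \<subseteq> ?Q \<Longrightarrow> (\<And>j. (\<lambda>vs. w vs $ j) \<in> regular ?X U) \<Longrightarrow>
      (\<lambda>vs. gauss_reduce cs vs p (w vs) $ j) \<in> regular ?X U"
    using Suc by auto
  have eq: "?Q' = {vs \<in> ?Q. gauss_reduce cs vs p (vs ! p) $ cs p \<noteq> 0}" by (auto simp: pivots_Suc)
  have Q': "openin (zar ?X) ?Q'" unfolding eq
    by (rule sheaf_nonzero_open[OF X Q], rule reg[OF Q]) (use Suc.prems in \<open>auto intro: regular_frame_coord\<close>)
  have "(\<lambda>vs. gauss_reduce cs vs (Suc p) (w vs) $ j) \<in> regular ?X U"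
    if U: "openin (zar ?X) U" "U \<subseteq> ?Q'" and w: "\<And>j. (\<lambda>vs. w vs $ j) \<in> regular ?X U" for U w j
  proof -
    have U': "U \<subseteq> ?Q" using U(2) eq by blast
    have pp: "(\<lambda>vs. gauss_reduce cs vs p (vs ! p) $ j) \<in> regular ?X U" for j
      by (rule reg[OF U(1) U']) (use Suc.prems in \<open>auto intro: regular_frame_coord\<close>)
    show ?thesis
      by (simp, intro sheaf_diff sheaf_mult sheaf_divide X U(1) pp reg[OF U(1) U' w])
         (use U(2) in \<open>auto simp: pivots_Suc\<close>)
  qed
  then show ?case using Q' by blast
qed

lemma flag_of_frame_image: "flag_of_frame ` frames r = (partial_flags r :: ('d::finite) flag set)"
  by (simp add: points_flag_variety[symmetric] flag_variety_def points_quotient_fspace points_frame_space)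

lemma openin_flag_variety:
  "openin (zar (flag_variety r)) U \<longleftrightarrow> U \<subseteq> partial_flags r \<and>
     openin (zar (frame_space r)) {vs \<in> frames r. flag_of_frame vs \<in> U}"
  by (simp add: flag_variety_def openin_quotient_fspace points_frame_space flag_of_frame_image)

lemma flag_of_frame_partial_flags: "vs \<in> frames r \<Longrightarrow> flag_of_frame vs \<in> partial_flags r"
  by (auto simp: flag_of_frame_image[symmetric])

lemma partial_flags_frame: "F \<in> partial_flags r \<Longrightarrow> \<exists>vs\<in>frames r. flag_of_frame vs = F"
  by (auto simp: flag_of_frame_image[symmetric])

text \<open>The normal frame does not depend on the frame chosen for its flag, and its entries are
  quotients of regular functions by pivots, so it descends to the quotient.\<close>

lemma flag_variety_local_section:
  fixes F :: "'d::finite flag"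
  assumes "F \<in> partial_flags r"
  shows "\<exists>Q s. openin (zar (flag_variety r)) Q \<and> F \<in> Q \<and>
    (\<forall>F\<in>Q. s F \<in> frames r \<and> flag_of_frame (s F) = F) \<and>
    (\<forall>i<r. \<forall>j. (\<lambda>F. s F ! i $ j) \<in> regular (flag_variety r) Q)"
proof -
  let ?X = "frame_space r :: (complex ^ 'd) list fspace"
  note X = function_sheaf_frame_space[of r]
  obtain vs0 where vs0: "vs0 \<in> frames r" "flag_of_frame vs0 = F" using partial_flags_frame[OF assms] by blast
  obtain cs where cs: "pivots cs vs0 r" using pivots_exist[OF vs0(1)] by blast
  define P where "P = {vs \<in> frames r. pivots cs vs r}"
  define Q where "Q = flag_of_frame ` P"
  define s where "s F = normal_frame cs r (SOME vs. vs \<in> frames r \<and> flag_of_frame vs = F)" for F :: "'d flag"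
  \<comment> \<open>For fixed columns the pivot condition depends only on the flag, so P is
    saturated and its image is open in the quotient.\<close>
  have pre: "{vs \<in> frames r. flag_of_frame vs \<in> Q} = P"
  proof (intro equalityI subsetI)
    fix vs assume "vs \<in> {vs \<in> frames r. flag_of_frame vs \<in> Q}"
    then obtain ws where "vs \<in> frames r" "ws \<in> P" "flag_of_frame ws = flag_of_frame vs"
      by (auto simp: Q_def)
    then show "vs \<in> P" using normal_frame_flag(1)[of ws r vs cs] by (simp add: P_def)
  qed (auto simp: P_def Q_def)
  have P: "openin (zar ?X) P" using gauss_reduce_regular[of r r cs] by (simp add: P_def)
  have Q: "openin (zar (flag_variety r)) Q"
    unfolding openin_flag_variety pre using P by (auto simp: Q_def P_def flag_of_frame_partial_flags)
  have s: "s (flag_of_frame vs) = normal_frame cs r vs" if vs: "vs \<in> P" for vs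
  proof -
    have v: "vs \<in> frames r" "pivots cs vs r" using vs by (auto simp: P_def)
    define ws where "ws = (SOME ws. ws \<in> frames r \<and> flag_of_frame ws = flag_of_frame vs)"
    have "ws \<in> frames r \<and> flag_of_frame ws = flag_of_frame vs"
      unfolding ws_def by (rule someI[of _ vs]) (use v in simp)
    then have "normal_frame cs r ws = normal_frame cs r vs"
      using normal_frame_flag(2)[of vs r ws cs] v by simp
    then show ?thesis by (simp add: s_def ws_def)
  qed
  show ?thesis
  proof (intro exI[of _ Q] exI[of _ s] conjI ballI allI impI Q)
    show "F \<in> Q" using vs0 cs by (auto simp: Q_def P_def)
    show "s F \<in> frames r" "flag_of_frame (s F) = F" if FQ: "F \<in> Q" for F
    proof -
      obtain vs where vs: "vs \<in> P" "F = flag_of_frame vs" using FQ by (auto simp: Q_def)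
      then have "vs \<in> frames r" "pivots cs vs r" by (auto simp: P_def)
      then show "s F \<in> frames r" "flag_of_frame (s F) = F"
        using s[OF vs(1)] vs(2) normal_frame_frames by simp_all
    qed
    fix i j assume i: "i < r"
    define Pi where "Pi = {vs \<in> frames r. pivots cs vs i}"
    have PPi: "P \<subseteq> Pi" using pivots_le i by (fastforce simp: P_def Pi_def)
    have g: "(\<lambda>vs. gauss_reduce cs vs i (vs ! i) $ j) \<in> regular ?X P" for j
    proof -
      have "(\<forall>j. (\<lambda>vs. vs ! i $ j) \<in> regular ?X P) \<longrightarrow>
          (\<forall>j. (\<lambda>vs. gauss_reduce cs vs i (vs ! i) $ j) \<in> regular ?X P)"
        using conjunct2[OF gauss_reduce_regular[of i r cs], THEN spec[of _ P], THEN spec[of _ "\<lambda>vs. vs ! i"]]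
          i P PPi by (simp add: Pi_def)
      then show ?thesis using regular_frame_coord[OF i] by blast
    qed
    have "(\<lambda>vs. gauss_reduce cs vs i (vs ! i) $ j / gauss_reduce cs vs i (vs ! i) $ cs i) \<in> regular ?X P"
      by (rule sheaf_divide[OF X P g g]) (use i in \<open>auto simp: P_def pivots_def\<close>)
    then have "(\<lambda>vs. s (flag_of_frame vs) ! i $ j) \<in> regular ?X P"
      by (rule sheaf_restrict[OF X P P]) (use i in \<open>auto simp: s normal_frame_def divide_inverse\<close>)
    then show "(\<lambda>F. s F ! i $ j) \<in> regular (flag_variety r) Q"
      using pre by (simp add: flag_variety_def quotient_fspace_def o_def points_frame_space)
  qed
qed

text \<open>A map into a quotient is a morphism once it lifts locally: everything is pulled back
  along the lift l, for which only the entries of the vectors have to be regular.\<close>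

lemma morphism_flag_varietyI:
  fixes \<phi> :: "'a \<Rightarrow> 'd::finite flag"
  assumes X: "function_sheaf X"
    and loc: "\<And>x. x \<in> points X \<Longrightarrow> \<exists>U l. openin (zar X) U \<and> x \<in> U \<and>
      (\<forall>y\<in>U. l y \<in> frames r \<and> flag_of_frame (l y) = \<phi> y) \<and>
      (\<forall>i<r. \<forall>j. (\<lambda>y. l y ! i $ j) \<in> regular X U)"
  shows "morphism X (flag_variety r) \<phi>"
proof (rule morphism_localI[OF X])
  let ?Y = "flag_variety r :: 'd flag fspace"
  let ?C = "{\<lambda>vs. vs ! i $ j | i j. i < r} :: ((complex ^ 'd) list \<Rightarrow> complex) set"
  show "\<phi> x \<in> points ?Y" if "x \<in> points X" for x
    using loc[OF that] flag_of_frame_partial_flags by (fastforce simp: points_flag_variety)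
  fix x assume "x \<in> points X"
  then obtain U l where U: "openin (zar X) U" "x \<in> U"
    and l: "\<And>y. y \<in> U \<Longrightarrow> l y \<in> frames r \<and> flag_of_frame (l y) = \<phi> y"
    and reg: "\<And>i j. i < r \<Longrightarrow> (\<lambda>y. l y ! i $ j) \<in> regular X U"
    using loc by metis
  have C: "(\<lambda>x. c (l x)) \<in> regular X U" if "c \<in> ?C" for c using that reg by auto
  have lU: "l y \<in> frames r" if "y \<in> U" for y using l[OF that] by simp
  show "\<exists>U. openin (zar X) U \<and> x \<in> U \<and>
      (\<forall>V. openin (zar ?Y) V \<longrightarrow> openin (zar X) {y \<in> U. \<phi> y \<in> V} \<and>
        (\<forall>g \<in> regular ?Y V. (\<lambda>y. g (\<phi> y)) \<in> regular X {y \<in> U. \<phi> y \<in> V}))"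
  proof (intro exI[of _ U] conjI allI impI ballI U)
    fix V assume V: "openin (zar ?Y) V"
    let ?V = "{vs \<in> frames r. flag_of_frame vs \<in> V}"
    have V': "openin (zar (coordinate_space ?C (frames r))) ?V"
      using V by (simp add: openin_flag_variety frame_space_def)
    have eq: "{y \<in> U. \<phi> y \<in> V} = {y \<in> U. l y \<in> ?V}" using l by auto
    note pull = coordinate_space_pull[where l = l and C = ?C and P = "frames r" and V = ?V, OF X U(1) lU C V']
    show o: "openin (zar X) {y \<in> U. \<phi> y \<in> V}" unfolding eq by (rule pull(1)) auto
    fix g assume g: "g \<in> regular ?Y V"
    then have "(\<lambda>vs. g (flag_of_frame vs)) \<in> regular (coordinate_space ?C (frames r)) ?V"
      by (simp add: flag_variety_def quotient_fspace_def o_def frame_space_def)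
    from pull(2)[OF _ _ this] have "(\<lambda>y. g (flag_of_frame (l y))) \<in> regular X {y \<in> U. \<phi> y \<in> V}"
      unfolding eq by simp
    then show "(\<lambda>y. g (\<phi> y)) \<in> regular X {y \<in> U. \<phi> y \<in> V}"
      by (rule sheaf_restrict[OF X o o]) (use l in auto)
  qed
qed

text \<open>All conditions that cut out the components are brought to this form. On frames the
  complement says that \<open>A (vs ! l)\<close> leaves the span of the first i vectors for some l <
  j; with pivots chosen at a given frame, this is detected nearby by a regular function that does
  not vanish.\<close>

lemma closedin_flag_variety_image_subset:
  assumes A: "Vector_Spaces.linear (*s) (*s) A" and ij: "i \<le> r" "j \<le> r"
  shows "closedin (zar (flag_variety r)) {F \<in> partial_flags r. A ` flag_part F j \<subseteq> flag_part F (i::nat)}"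
    (is "closedin _ ?S")
  unfolding closedin_def points_flag_variety
proof (intro conjI)
  let ?X = "frame_space r :: (complex ^ 'a) list fspace"
  note X = function_sheaf_frame_space[of r]
  show "openin (zar (flag_variety r)) (partial_flags r - ?S)"
    unfolding openin_flag_variety
  proof (intro conjI)
    have eq: "{vs \<in> frames r. flag_of_frame vs \<in> partial_flags r - ?S} =
        {vs \<in> frames r. \<exists>l<j. A (vs ! l) \<notin> vec.span (set (take i vs))}"
    proof -
      have "A ` flag_part (flag_of_frame vs) j \<subseteq> flag_part (flag_of_frame vs) i \<longleftrightarrow>
          (\<forall>l<j. A (vs ! l) \<in> vec.span (set (take i vs)))" if vs: "vs \<in> frames r" for vs
      proof -
        have "A ` vec.span (set (take j vs)) = vec.span (A ` set (take j vs))"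
          by (rule vec.linear_span_image[OF A, symmetric])
        moreover have "set (take j vs) = (\<lambda>l. vs ! l) ` {..<j}"
          using frames_length[OF vs] ij by (simp add: nth_image[symmetric] atLeast0LessThan)
        moreover have "vec.span T \<subseteq> vec.span (set (take i vs)) \<longleftrightarrow> T \<subseteq> vec.span (set (take i vs))" for T
          by (metis vec.span_minimal vec.span_superset vec.subspace_span subset_trans)
        ultimately show ?thesis
          using frames_length[OF vs] ij by (auto simp: flag_part_of_frame)
      qed
      then show ?thesis using flag_of_frame_partial_flags by blast
    qed
    show "openin (zar ?X) {vs \<in> frames r. flag_of_frame vs \<in> partial_flags r - ?S}"
      unfolding eq
    proof (subst openin_subopen, intro ballI)
      fix vs assume "vs \<in> {vs \<in> frames r. \<exists>l<j. A (vs ! l) \<notin> vec.span (set (take i vs))}"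
      then obtain l where vs: "vs \<in> frames r" and l: "l < j" "A (vs ! l) \<notin> vec.span (set (take i vs))" by blast
      obtain cs where cs: "pivots cs vs r" using pivots_exist[OF vs] by blast
      then have csi: "pivots cs vs i" using pivots_le ij by blast
      let ?P = "{vs \<in> frames r. pivots cs vs i}"
      have iff: "gauss_reduce cs vs i w = 0 \<longleftrightarrow> w \<in> vec.span (set (take i vs))" if "vs \<in> ?P" for vs w
        using that gauss_reduce_eq_0_iff[of cs vs i w] frames_length ij by auto
      obtain c where c: "gauss_reduce cs vs i (A (vs ! l)) $ c \<noteq> 0"
        using iff[of vs "A (vs ! l)"] vs csi l by (auto simp: vec_eq_iff)
      have P: "openin (zar ?X) ?P" using gauss_reduce_regular[of i r cs] ij by simp
      have "(\<lambda>vs. A (vs ! l) $ c) \<in> regular ?X ?P" for c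
        by (rule regular_linear[OF X P A]) (use l ij in \<open>auto intro: regular_frame_coord\<close>)
      then have "(\<lambda>vs. gauss_reduce cs vs i (A (vs ! l)) $ c) \<in> regular ?X ?P"
        using conjunct2[OF gauss_reduce_regular[of i r cs], THEN spec[of _ ?P], THEN spec[of _ "\<lambda>vs. A (vs ! l)"]]
          ij P by simp
      then have "openin (zar ?X) {vs \<in> ?P. gauss_reduce cs vs i (A (vs ! l)) $ c \<noteq> 0}"
        by (rule sheaf_nonzero_open[OF X P])
      moreover have "{vs \<in> ?P. gauss_reduce cs vs i (A (vs ! l)) $ c \<noteq> 0} \<subseteq>
          {vs \<in> frames r. \<exists>l<j. A (vs ! l) \<notin> vec.span (set (take i vs))}"
        using iff l(1) by (auto simp: vec_eq_iff)
      ultimately show "\<exists>T. openin (zar ?X) T \<and> vs \<in> T \<and>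
          T \<subseteq> {vs \<in> frames r. \<exists>l<j. A (vs ! l) \<notin> vec.span (set (take i vs))}"
        using vs csi c by blast
    qed
  qed auto
qed auto

section \<open>Linear algebra of the nilpotent endomorphism\<close>

text \<open>Rank-nullity for the restriction of A to H: a basis C of the kernel is extended to a
  basis D of H, and A is injective on the span of \<open>D - C\<close>.\<close>

lemma dim_image_plus_dim_kernel:
  fixes A :: "complex ^ 'd::finite \<Rightarrow> complex ^ 'd"
  assumes A: "Vector_Spaces.linear (*s) (*s) A" and H: "vec.subspace H"
  shows "vec.dim (A ` H) + vec.dim (H \<inter> {v. A v = 0}) = vec.dim H"
proof -
  let ?K = "H \<inter> {v. A v = 0}"
  have K: "vec.subspace ?K"
    by (intro vec.subspace_inter H vec.linear_subspace_kernel A)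
  obtain C where C: "C \<subseteq> ?K" "vec.independent C" "?K \<subseteq> vec.span C" "card C = vec.dim ?K"
    by (rule vec.basis_exists[of ?K])
  have "C \<subseteq> H" using C(1) by blast
  from vec.maximal_independent_subset_extend[OF this C(2)]
  obtain D where D: "C \<subseteq> D" "D \<subseteq> H" "vec.independent D" "H \<subseteq> vec.span D" .
  let ?T = "vec.span (D - C)"
  have fin: "finite D" using D(3) vec.independent_bound_general by blast
  have spC: "vec.span C = ?K" using C K by (metis vec.span_minimal subset_antisym)
  have spD: "vec.span D = H" using D H by (metis vec.span_minimal subset_antisym)
  have DC: "vec.independent (D - C)" using D(3) vec.independent_mono by blast
  have sums: "{x + y |x y. x \<in> vec.span C \<and> y \<in> ?T} = H"
    using vec.span_Un[of C "D - C"] D(1) spD by (simp add: Un_absorb1)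
  have "vec.dim H + vec.dim (vec.span C \<inter> ?T) = vec.dim (vec.span C) + vec.dim ?T"
    using vec.dim_sums_Int[of "vec.span C" ?T] sums by simp
  moreover have "vec.dim H = card D" using vec.dim_span_eq_card_independent[OF D(3)] spD by simp
  moreover have "vec.dim (vec.span C) = card C" "vec.dim ?T = card (D - C)"
    using vec.dim_eq_card_independent C(2) DC by auto
  moreover have "card D = card C + card (D - C)" using fin D(1)
    by (metis card_Diff_subset card_mono finite_subset le_add_diff_inverse)
  ultimately have "vec.dim (vec.span C \<inter> ?T) = 0" by simp
  then have int: "vec.span C \<inter> ?T \<subseteq> {0}" by simp
  have TH: "?T \<subseteq> H" using spD vec.span_mono[of "D - C" D] by auto
  have inj: "inj_on A ?T"
  proof (rule inj_onI)
    fix x y assume xy: "x \<in> ?T" "y \<in> ?T" "A x = A y"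
    then have "x - y \<in> ?T" "A (x - y) = 0" by (auto intro: vec.span_diff simp: vec.linear_diff[OF A])
    then have "x - y \<in> vec.span C \<inter> ?T" using TH spC by auto
    then show "x = y" using int by auto
  qed
  have "A ` H = A ` ?T"
  proof
    show "A ` H \<subseteq> A ` ?T"
    proof
      fix u assume "u \<in> A ` H"
      then obtain x y where "u = A (x + y)" "x \<in> vec.span C" "y \<in> ?T" using sums by blast
      moreover from this have "A x = 0" using spC by auto
      ultimately show "u \<in> A ` ?T" by (simp add: vec.linear_add[OF A])
    qed
  qed (use TH in auto)
  then have "vec.dim (A ` H) = vec.dim ?T"
    using vec.dim_image_eq[OF A, of "?T"] inj by (simp add: vec.span_span)
  then show ?thesis
    using \<open>vec.dim H = card D\<close> \<open>vec.dim ?T = card (D - C)\<close> \<open>card D = card C + _\<close> C(4) by simp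
qed

lemma linear_funpow:
  "Vector_Spaces.linear (*s) (*s) A \<Longrightarrow> Vector_Spaces.linear (*s) (*s) ((A :: complex ^ 'd::finite \<Rightarrow> complex ^ 'd) ^^ l)"
proof (induction l)
  case 0
  show ?case using vec.linear_id by (simp add: id_def)
next
  case (Suc l)
  then show ?case using Vector_Spaces.linear_compose[of "(*s)" "(*s)" "A ^^ l" "(*s)" A] by (simp add: o_def)
qed

section \<open>Coordinates with respect to the two Jordan blocks, and coordinate subspaces\<close>

locale two_row =
  fixes N :: nat and e f :: "nat \<Rightarrow> complex ^ 'd::finite" and z :: "complex ^ 'd \<Rightarrow> complex ^ 'd"
  assumes inj_e: "inj_on e {1..N}" and inj_f: "inj_on f {1..N}" and disj: "e ` {1..N} \<inter> f ` {1..N} = {}"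
    and indep: "vec.independent (e ` {1..N} \<union> f ` {1..N})"
    and spans: "vec.span (e ` {1..N} \<union> f ` {1..N}) = UNIV"
    and lin: "Vector_Spaces.linear (*s) (*s) z"
    and e0: "e 0 = 0" and f0: "f 0 = 0"
    and ze: "\<And>i. i \<in> {1..N} \<Longrightarrow> z (e i) = e (i - 1)" and zf: "\<And>i. i \<in> {1..N} \<Longrightarrow> z (f i) = f (i - 1)"
begin

abbreviation "E \<equiv> E_space e f"

definition basis :: "(complex ^ 'd) set" where
  "basis = e ` {1..N} \<union> f ` {1..N}"

lemma independent_basis: "vec.independent basis" and span_basis: "vec.span basis = UNIV"
  using indep spans by (simp_all add: basis_def)

text \<open>The value 0 outside 1, ..., N makes the shift rule \<open>coord_z\<close> hold for every
  i \<ge> 1, in particular at i = N, where the next basis vector is absent.\<close>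

definition ec :: "nat \<Rightarrow> complex ^ 'd \<Rightarrow> complex" where
  "ec i v = (if i \<in> {1..N} then vec.representation basis v (e i) else 0)"

definition fc :: "nat \<Rightarrow> complex ^ 'd \<Rightarrow> complex" where
  "fc i v = (if i \<in> {1..N} then vec.representation basis v (f i) else 0)"

definition mk :: "(nat \<Rightarrow> complex) \<Rightarrow> (nat \<Rightarrow> complex) \<Rightarrow> complex ^ 'd" where
  "mk a b = (\<Sum>i=1..N. a i *s e i) + (\<Sum>i=1..N. b i *s f i)"

lemma coord_out [simp]: "i = 0 \<or> N < i \<Longrightarrow> ec i v = 0" "i = 0 \<or> N < i \<Longrightarrow> fc i v = 0"
  by (auto simp: ec_def fc_def)

lemma coord_add [simp]: "ec i (v + w) = ec i v + ec i w" "fc i (v + w) = fc i v + fc i w"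
  by (simp_all add: ec_def fc_def vec.representation_add[OF independent_basis] span_basis)

lemma coord_scale [simp]: "ec i (c *s v) = c * ec i v" "fc i (c *s v) = c * fc i v"
  by (simp_all add: ec_def fc_def vec.representation_scale[OF independent_basis] span_basis)

lemma coord_zero [simp]: "ec i 0 = 0" "fc i 0 = 0"
  using coord_scale[of i 0 0] by simp_all

lemma coord_diff [simp]: "ec i (v - w) = ec i v - ec i w" "fc i (v - w) = fc i v - fc i w"
  by (simp_all add: ec_def fc_def vec.representation_diff[OF independent_basis] span_basis)

lemma coord_sum [simp]: "ec i (sum g I) = (\<Sum>j\<in>I. ec i (g j))" "fc i (sum g I) = (\<Sum>j\<in>I. fc i (g j))"
  by (induction I rule: infinite_finite_induct) simp_all

lemma coord_basis:
  assumes "j \<in> {1..N}"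
  shows "ec i (e j) = (if i = j then 1 else 0)" "fc i (e j) = 0"
    "ec i (f j) = 0" "fc i (f j) = (if i = j then 1 else 0)"
proof -
  let ?B = basis
  have re: "vec.representation ?B (e j) = (\<lambda>v. if v = e j then 1 else 0)"
    by (rule vec.representation_basis[OF independent_basis]) (use assms in \<open>auto simp: basis_def\<close>)
  have rf: "vec.representation ?B (f j) = (\<lambda>v. if v = f j then 1 else 0)"
    by (rule vec.representation_basis[OF independent_basis]) (use assms in \<open>auto simp: basis_def\<close>)
  have "e i \<noteq> f j" if "i \<in> {1..N}" for i using disj that assms by blast
  moreover have "e j \<noteq> f i" if "i \<in> {1..N}" for i using disj that assms by blast
  ultimately have "e i \<noteq> f j" "f i \<noteq> e j" if "i \<in> {1..N}" for i using that by metis+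
  then show "ec i (e j) = (if i = j then 1 else 0)" "fc i (e j) = 0"
    "ec i (f j) = 0" "fc i (f j) = (if i = j then 1 else 0)"
    using assms inj_on_eq_iff[OF inj_e _ assms, of i] inj_on_eq_iff[OF inj_f _ assms, of i]
    by (auto simp: ec_def fc_def re rf)
qed

lemma coord_e: "j \<le> N \<Longrightarrow> ec i (e j) = (if i = j \<and> 1 \<le> j then 1 else 0)" "j \<le> N \<Longrightarrow> fc i (e j) = 0"
  using coord_basis(1,2)[of j i] e0 by (cases j; simp)+

lemma coord_f: "j \<le> N \<Longrightarrow> fc i (f j) = (if i = j \<and> 1 \<le> j then 1 else 0)" "j \<le> N \<Longrightarrow> ec i (f j) = 0"
  using coord_basis(3,4)[of j i] f0 by (cases j; simp)+

lemma coord_mk [simp]: "ec i (mk a b) = (if i \<in> {1..N} then a i else 0)" "fc i (mk a b) = (if i \<in> {1..N} then b i else 0)"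
  by (auto simp: mk_def coord_basis if_distrib[of "\<lambda>x. _ * x"] sum.delta' cong: if_cong)

lemma mk_coord: "mk (\<lambda>i. ec i v) (\<lambda>i. fc i v) = v"
proof -
  let ?B = basis
  have "v = (\<Sum>b\<in>?B. vec.representation ?B v b *s b)"
    by (rule vec.sum_representation_eq[OF independent_basis, symmetric]) (simp_all add: span_basis, simp add: basis_def)
  also have "\<dots> = (\<Sum>b\<in>e ` {1..N}. vec.representation ?B v b *s b) + (\<Sum>b\<in>f ` {1..N}. vec.representation ?B v b *s b)"
    unfolding basis_def[symmetric] by (subst basis_def, rule sum.union_disjoint) (use disj in auto)
  also have "\<dots> = mk (\<lambda>i. ec i v) (\<lambda>i. fc i v)"
    unfolding sum.reindex[OF inj_e] sum.reindex[OF inj_f] mk_def ec_def fc_def by simp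
  finally show ?thesis by simp
qed

lemma coord_eqI:
  assumes "\<And>i. i \<in> {1..N} \<Longrightarrow> ec i v = ec i w" "\<And>i. i \<in> {1..N} \<Longrightarrow> fc i v = fc i w"
  shows "v = w"
proof -
  have "mk (\<lambda>i. ec i v) (\<lambda>i. fc i v) = mk (\<lambda>i. ec i w) (\<lambda>i. fc i w)"
    unfolding mk_def using assms by simp
  then show ?thesis by (simp add: mk_coord)
qed

lemma linear_coordI:
  assumes "\<And>i v w. ec i (A (v + w)) = ec i (A v) + ec i (A w)" "\<And>i v w. fc i (A (v + w)) = fc i (A v) + fc i (A w)"
    "\<And>i c v. ec i (A (c *s v)) = c * ec i (A v)" "\<And>i c v. fc i (A (c *s v)) = c * fc i (A v)"
  shows "Vector_Spaces.linear (*s) (*s) A"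
  by unfold_locales (auto intro!: coord_eqI simp: assms)

lemma coord_z:
  assumes "1 \<le> i"
  shows "ec i (z v) = ec (Suc i) v" "fc i (z v) = fc (Suc i) v"
proof -
  have zv: "z v = (\<Sum>j=1..N. ec j v *s e (j - 1)) + (\<Sum>j=1..N. fc j v *s f (j - 1))"
    using arg_cong[OF mk_coord[of v], of z, symmetric]
    by (simp add: mk_def vec.linear_add[OF lin] vec.linear_sum[OF lin] vec.linear_scale[OF lin] ze zf)
  have iff: "(i = j - 1 \<and> 1 \<le> j - 1) = (j = Suc i)" if "j \<in> {1..N}" for j using that assms by auto
  have "(\<Sum>j=1..N. ec j v * ec i (e (j - 1))) = (\<Sum>j=1..N. if j = Suc i then ec j v else 0)"
    "(\<Sum>j=1..N. fc j v * fc i (f (j - 1))) = (\<Sum>j=1..N. if j = Suc i then fc j v else 0)"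
    by (rule sum.cong; use iff in \<open>force simp: coord_e coord_f\<close>)+
  moreover have "(\<Sum>j=1..N. fc j v * ec i (f (j - 1))) = 0" "(\<Sum>j=1..N. ec j v * fc i (e (j - 1))) = 0"
    by (rule sum.neutral; force simp: coord_e coord_f)+
  ultimately show "ec i (z v) = ec (Suc i) v" "fc i (z v) = fc (Suc i) v"
    unfolding zv coord_add coord_sum coord_scale by (auto simp: sum.delta)
qed

lemma coord_z_pow: "1 \<le> i \<Longrightarrow> ec i ((z ^^ l) v) = ec (i + l) v" "1 \<le> i \<Longrightarrow> fc i ((z ^^ l) v) = fc (i + l) v"
  by (induction l arbitrary: i) (simp_all add: coord_z)

lemma mem_E:
  assumes "a \<le> N" "b \<le> N"
  shows "v \<in> E a b \<longleftrightarrow> (\<forall>i>a. ec i v = 0) \<and> (\<forall>i>b. fc i v = 0)"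
proof
  let ?H = "{v. (\<forall>i>a. ec i v = 0) \<and> (\<forall>i>b. fc i v = 0)}"
  have "vec.subspace ?H" by (auto simp: vec.subspace_def)
  moreover have "e ` {1..a} \<union> f ` {1..b} \<subseteq> ?H" using assms by (auto simp: coord_e coord_f)
  ultimately have "E a b \<subseteq> ?H" unfolding E_space_def by (intro vec.span_minimal) auto
  then show "v \<in> E a b \<Longrightarrow> (\<forall>i>a. ec i v = 0) \<and> (\<forall>i>b. fc i v = 0)" by blast
next
  assume v: "(\<forall>i>a. ec i v = 0) \<and> (\<forall>i>b. fc i v = 0)"
  have "ec i v *s e i \<in> E a b" "fc i v *s f i \<in> E a b" if i: "i \<in> {1..N}" for i
  proof -
    show "ec i v *s e i \<in> E a b"
    proof (cases "i \<le> a")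
      case True
      then have "e i \<in> E a b" unfolding E_space_def using i by (intro vec.span_base) auto
      then show ?thesis unfolding E_space_def by (rule vec.span_scale)
    qed (use v in \<open>simp add: E_space_def vec.span_zero\<close>)
    show "fc i v *s f i \<in> E a b"
    proof (cases "i \<le> b")
      case True
      then have "f i \<in> E a b" unfolding E_space_def using i by (intro vec.span_base) auto
      then show ?thesis unfolding E_space_def by (rule vec.span_scale)
    qed (use v in \<open>simp add: E_space_def vec.span_zero\<close>)
  qed
  then have "mk (\<lambda>i. ec i v) (\<lambda>i. fc i v) \<in> E a b"
    unfolding mk_def E_space_def by (intro vec.span_add vec.span_sum)
  then show "v \<in> E a b" by (simp add: mk_coord)
qed

lemma subspace_E [simp]: "vec.subspace (E a b)"
  by (simp add: E_space_def)

lemma E_mono: "a \<le> a' \<Longrightarrow> b \<le> b' \<Longrightarrow> E a b \<subseteq> E a' b'"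
  unfolding E_space_def by (intro vec.span_mono) auto

lemma E_0_0 [simp]: "E 0 0 = {0}"
  by (simp add: E_space_def)

lemma dim_E:
  assumes "a \<le> N" "b \<le> N"
  shows "vec.dim (E a b) = a + b"
proof -
  have sub: "{1..a} \<subseteq> {1..N}" "{1..b} \<subseteq> {1..N}" using assms by auto
  have ind: "vec.independent (e ` {1..a} \<union> f ` {1..b})"
    by (rule vec.independent_mono[OF indep]) (use sub in blast)
  have "card (e ` {1..a} \<union> f ` {1..b}) = card (e ` {1..a}) + card (f ` {1..b})"
    by (rule card_Un_disjoint) (use disj sub in blast)+
  also have "\<dots> = a + b"
    using card_image[OF inj_on_subset[OF inj_e sub(1)]] card_image[OF inj_on_subset[OF inj_f sub(2)]] by simp
  finally show ?thesis using vec.dim_span_eq_card_independent[OF ind] by (simp add: E_space_def)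
qed

lemma E_eq_iff:
  assumes "a \<le> N" "b \<le> N" "a' \<le> N" "b' \<le> N" "E a b = E a' b'"
  shows "a = a'" "b = b'"
proof -
  have e: "e i \<in> E x y \<longleftrightarrow> i \<le> x" "f i \<in> E x y \<longleftrightarrow> i \<le> y" if "x \<le> N" "y \<le> N" "i \<in> {1..N}" for x y i
    using that by (auto simp: mem_E coord_basis)
  have iff: "i \<le> a \<longleftrightarrow> i \<le> a'" "i \<le> b \<longleftrightarrow> i \<le> b'" if "i \<in> {1..N}" for i
    using e[of a b i] e[of a' b' i] assms that by auto
  have "a \<le> a'" using iff(1)[of a] assms by (cases "a = 0") auto
  moreover have "a' \<le> a" using iff(1)[of a'] assms by (cases "a' = 0") auto
  ultimately show "a = a'" by simp
  have "b \<le> b'" using iff(2)[of b] assms by (cases "b = 0") auto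
  moreover have "b' \<le> b" using iff(2)[of b'] assms by (cases "b' = 0") auto
  ultimately show "b = b'" by simp
qed

text \<open>\<open>z\<close> shifts coordinates down by one index, so a bound on the support rises
  by l under the preimage. The hypotheses keep the new bounds inside the basis; past N nothing is
  known of \<open>e\<close> and \<open>f\<close>.\<close>

lemma z_pow_mem_E:
  assumes "a + l \<le> N" "b + l \<le> N"
  shows "(z ^^ l) v \<in> E a b \<longleftrightarrow> v \<in> E (a + l) (b + l)"
proof -
  have "(\<forall>i>a. g (i + l)) \<longleftrightarrow> (\<forall>i>a + l. g i)" for g :: "nat \<Rightarrow> bool" and a
  proof safe
    fix i assume "\<forall>i>a. g (i + l)" "a + l < i"
    then show "g i" using spec[of "\<lambda>i. a < i \<longrightarrow> g (i + l)" "i - l"] by auto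
  qed auto
  from this[of a "\<lambda>i. ec i v = 0"] this[of b "\<lambda>i. fc i v = 0"] show ?thesis
    using assms by (simp add: mem_E coord_z_pow)
qed

lemma z_pow_vimage_E: "a + l \<le> N \<Longrightarrow> b + l \<le> N \<Longrightarrow> (z ^^ l) -` E a b = E (a + l) (b + l)"
  by (auto simp: z_pow_mem_E)

lemma z_pow_linear: "Vector_Spaces.linear (*s) (*s) (z ^^ l)"
  by (rule linear_funpow[OF lin])

lemma z_pow_ker: "l \<le> N \<Longrightarrow> {v. (z ^^ l) v = 0} = E l l"
  using z_pow_mem_E[of 0 l 0] by auto

text \<open>A right inverse of \<open>z ^^ l\<close> on vectors whose indices stay at most N - l;
  here the room at the top of the Jordan blocks is spent.\<close>

definition raise :: "nat \<Rightarrow> complex ^ 'd \<Rightarrow> complex ^ 'd" where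
  "raise l v = mk (\<lambda>i. if l < i then ec (i - l) v else 0) (\<lambda>i. if l < i then fc (i - l) v else 0)"

lemma z_pow_raise: "l \<le> N \<Longrightarrow> v \<in> E (N - l) (N - l) \<Longrightarrow> (z ^^ l) (raise l v) = v"
  by (rule coord_eqI) (auto simp: raise_def coord_z_pow mem_E)

lemma z_pow_image_vimage:
  assumes "l \<le> N" "H \<subseteq> E (N - l) (N - l)"
  shows "(z ^^ l) ` ((z ^^ l) -` H) = H"
proof
  show "H \<subseteq> (z ^^ l) ` ((z ^^ l) -` H)"
  proof
    fix v assume v: "v \<in> H"
    then have "(z ^^ l) (raise l v) = v" using z_pow_raise assms by blast
    then show "v \<in> (z ^^ l) ` ((z ^^ l) -` H)" using v by (metis imageI vimageI)
  qed
qed auto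

lemma subspace_vimage: "vec.subspace H \<Longrightarrow> vec.subspace ((z ^^ l) -` H)"
  using vec.linear_subspace_linear_preimage[OF z_pow_linear, of H l] by (simp add: vimage_def)

lemma dim_z_pow_vimage:
  assumes "l \<le> N" "vec.subspace H" "H \<subseteq> E (N - l) (N - l)"
  shows "vec.dim ((z ^^ l) -` H) = vec.dim H + 2 * l"
proof -
  have "(z ^^ l) -` H \<inter> {v. (z ^^ l) v = 0} = E l l"
    using z_pow_ker[OF assms(1)] vec.subspace_0[OF assms(2)] by auto
  then show ?thesis
    using dim_image_plus_dim_kernel[OF z_pow_linear[of l] subspace_vimage[OF assms(2), of l]]
    unfolding z_pow_image_vimage[OF assms(1,3)] by (simp add: dim_E assms(1))
qed

lemma z_pow_image_E:
  assumes "a \<le> N" "b \<le> N"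
  shows "(z ^^ l) ` E a b = E (a - l) (b - l)"
proof
  show "(z ^^ l) ` E a b \<subseteq> E (a - l) (b - l)"
    using assms by (auto simp: mem_E coord_z_pow)
  show "E (a - l) (b - l) \<subseteq> (z ^^ l) ` E a b"
  proof
    fix v assume v: "v \<in> E (a - l) (b - l)"
    have "(z ^^ l) (raise l v) = v"
      by (rule coord_eqI) (use v assms in \<open>auto simp: raise_def coord_z_pow mem_E\<close>)
    moreover have "raise l v \<in> E a b" using v assms by (auto simp: raise_def mem_E)
    ultimately show "v \<in> (z ^^ l) ` E a b" by (metis imageI)
  qed
qed

text \<open>A linear map with kernel \<open>E a b\<close>, for indices up to N. Equality of a flag
  term with a coordinate subspace becomes the condition that this map sends the term into {0}, the
  zeroth term.\<close>

definition drop_E :: "nat \<Rightarrow> nat \<Rightarrow> complex ^ 'd \<Rightarrow> complex ^ 'd" where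
  "drop_E a b v = mk (\<lambda>i. if a < i then ec i v else 0) (\<lambda>i. if b < i then fc i v else 0)"

lemma drop_E_linear: "Vector_Spaces.linear (*s) (*s) (drop_E a b)"
  by (rule linear_coordI) (auto simp: drop_E_def)

lemma drop_E_eq_0: "a \<le> N \<Longrightarrow> b \<le> N \<Longrightarrow> drop_E a b v = 0 \<longleftrightarrow> v \<in> E a b"
proof
  assume ab: "a \<le> N" "b \<le> N" and 0: "drop_E a b v = 0"
  have "ec i v = 0" if "a < i" for i
  proof (cases "i \<le> N")
    case True
    then show ?thesis using arg_cong[OF 0, of "ec i"] that by (simp add: drop_E_def)
  qed simp
  moreover have "fc i v = 0" if "b < i" for i
  proof (cases "i \<le> N")
    case True
    then show ?thesis using arg_cong[OF 0, of "fc i"] that by (simp add: drop_E_def)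
  qed simp
  ultimately show "v \<in> E a b" using ab by (simp add: mem_E)
qed (auto intro!: coord_eqI simp: drop_E_def mem_E)

subsection \<open>Flags in $Y_r$\<close>

lemma partial_flags_part:
  assumes "F \<in> partial_flags r" "i \<le> r"
  shows "vec.subspace (flag_part F i)" "vec.dim (flag_part F i) = i"
  using assms by (cases "i = 0"; auto simp: partial_flags_def flag_part_def)+

lemma partial_flags_mono:
  assumes "F \<in> partial_flags r" "j \<le> r" "i \<le> j"
  shows "flag_part F i \<subseteq> flag_part F j"
  using assms(3,2)
proof (induction j rule: dec_induct)
  case (step n)
  have "flag_part F n \<subseteq> flag_part F (Suc n)" using assms(1) step by (fastforce simp: partial_flags_def)
  with step show ?case by auto
qed simp

lemma partial_flags_eqI:
  assumes "F \<in> partial_flags r" "F' \<in> partial_flags r" "\<And>i. 1 \<le> i \<Longrightarrow> i \<le> r \<Longrightarrow> flag_part F i = flag_part F' i"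
  shows "F = F'"
proof (rule nth_equalityI)
  show len: "length F = length F'" using assms by (simp add: partial_flags_def)
  fix i assume "i < length F"
  then show "F ! i = F' ! i" using assms(3)[of "Suc i"] assms(1) by (simp add: partial_flags_def flag_part_def)
qed

lemma partial_flags_subset_eq:
  assumes "F \<in> partial_flags r" "i \<le> r" "vec.subspace H" "vec.dim H = i"
  shows "flag_part F i \<subseteq> H \<Longrightarrow> flag_part F i = H" "H \<subseteq> flag_part F i \<Longrightarrow> flag_part F i = H"
  using vec.subspace_dim_equal[of "flag_part F i" H] vec.subspace_dim_equal[of H "flag_part F i"]
    partial_flags_part[OF assms(1,2)] assms by auto

lemma flag_part_0 [simp]: "flag_part F 0 = {0}" by (simp add: flag_part_def)

lemma Y_flags_partial: "F \<in> Y_flags z r \<Longrightarrow> F \<in> partial_flags r"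
  by (simp add: Y_flags_def)

lemma Y_flags_step: "F \<in> Y_flags z r \<Longrightarrow> 1 \<le> i \<Longrightarrow> i \<le> r \<Longrightarrow> z ` flag_part F i \<subseteq> flag_part F (i - 1)"
  by (simp add: Y_flags_def)

lemma Y_flags_pow:
  assumes F: "F \<in> Y_flags z r"
  shows "i \<le> r \<Longrightarrow> l \<le> i \<Longrightarrow> (z ^^ l) ` flag_part F i \<subseteq> flag_part F (i - l)"
proof (induction l)
  case (Suc l)
  have "(z ^^ Suc l) ` flag_part F i = z ` ((z ^^ l) ` flag_part F i)" by (simp add: image_comp)
  also have "\<dots> \<subseteq> z ` flag_part F (i - l)" using Suc by (intro image_mono) simp
  also have "\<dots> \<subseteq> flag_part F (i - l - 1)" using Suc by (intro Y_flags_step[OF F]) auto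
  finally show ?case by simp
qed simp

lemma Y_flags_subset_E:
  assumes F: "F \<in> Y_flags z r" and i: "i \<le> r" "i \<le> N"
  shows "flag_part F i \<subseteq> E i i"
  using Y_flags_pow[OF F i(1) order_refl] z_pow_ker[OF i(2)] by auto

text \<open>Both sides of the equality have dimension i + 2 l, because the i-th term lies in
  \<open>E i i\<close> with i \<le> N - l and is therefore in the image of \<open>z ^^ l\<close>. So
  one inclusion is enough, and this inclusion is a closed condition.\<close>

lemma Y_flags_vimage_iff:
  assumes F: "F \<in> Y_flags z r" and i: "i + 2 * l \<le> r" "r \<le> N"
  shows "flag_part F (i + 2 * l) = (z ^^ l) -` flag_part F i \<longleftrightarrow> (z ^^ l) ` flag_part F (i + 2 * l) \<subseteq> flag_part F i"
proof
  assume s: "(z ^^ l) ` flag_part F (i + 2 * l) \<subseteq> flag_part F i"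
  have Fp: "F \<in> partial_flags r" by (rule Y_flags_partial[OF F])
  have sub: "flag_part F i \<subseteq> E (N - l) (N - l)"
  proof -
    have "i \<le> N - l" using i by linarith
    then show ?thesis using Y_flags_subset_E[OF F, of i] i E_mono[of i "N - l" i "N - l"] by auto
  qed
  have "vec.dim ((z ^^ l) -` flag_part F i) = i + 2 * l"
    using dim_z_pow_vimage[OF _ _ sub] partial_flags_part[OF Fp, of i] i by simp
  then show "flag_part F (i + 2 * l) = (z ^^ l) -` flag_part F i"
    using s i by (intro partial_flags_subset_eq(1)[OF Fp i(1)] subspace_vimage partial_flags_part[OF Fp]) auto
qed auto

end

section \<open>Cup diagrams and words\<close>

lemma cup_diagramD:
  assumes "cup_diagram n a" "(i, j) \<in> a"
  shows "1 \<le> i" "i < j" "j \<le> n"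
  using bspec[OF conjunct1[OF assms(1)[unfolded cup_diagram_def]] assms(2)] by auto

lemma cup_diagram_disjoint:
  assumes "cup_diagram n a" "(i, j) \<in> a" "(i', j') \<in> a" "x \<in> {i, j}" "x \<in> {i', j'}"
  shows "i = i' \<and> j = j'"
  using bspec[OF bspec[OF conjunct1[OF conjunct2[OF assms(1)[unfolded cup_diagram_def]]] assms(2), simplified] assms(3)]
    assms(4,5) by auto

lemma cup_diagram_crossing:
  assumes "cup_diagram n a" "(i, j) \<in> a" "(i', j') \<in> a" "i < i'" "i' < j"
  shows "j' < j"
proof -
  have "\<not> j < j'"
    using bspec[OF bspec[OF conjunct1[OF conjunct2[OF conjunct2[OF assms(1)[unfolded cup_diagram_def]]]] assms(2), simplified] assms(3)]
      assms(4,5) by auto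
  moreover have "j \<noteq> j'" using cup_diagram_disjoint[OF assms(1-3), of j] assms(4) by auto
  ultimately show ?thesis by simp
qed

lemma cup_diagram_ray:
  assumes "cup_diagram n a" "(i, j) \<in> a" "v \<in> ray_vertices n a"
  shows "v < i \<or> j < v"
proof -
  have "\<not> (i < v \<and> v < j)"
    using bspec[OF bspec[OF conjunct2[OF conjunct2[OF conjunct2[OF assms(1)[unfolded cup_diagram_def]]]] assms(2), simplified] assms(3)]
    by auto
  moreover have "v \<noteq> i" "v \<noteq> j" using assms(2,3) by (auto simp: ray_vertices_def)
  ultimately show ?thesis by linarith
qed

lemma finite_cup_diagram: "cup_diagram n a \<Longrightarrow> finite a"
proof (rule finite_subset[of _ "{1..n} \<times> {1..n}"])
  assume a: "cup_diagram n a"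
  show "a \<subseteq> {1..n} \<times> {1..n}" using cup_diagramD[OF a] by fastforce
qed simp

lemma vertex_cases:
  assumes "v \<in> {1..n}"
  obtains "v \<in> ray_vertices n a" | j where "(v, j) \<in> a" | i where "(i, v) \<in> a"
  using assms by (auto simp: ray_vertices_def)

lemma ray_vertices_range: "v \<in> ray_vertices n a \<Longrightarrow> v \<in> {1..n}"
  by (simp add: ray_vertices_def)

text \<open>A word in the letters \<open>e\<close>, \<open>f\<close> is a predicate on positions that holds where the letter is \<open>e\<close>.\<close>

definition admissible :: "nat \<Rightarrow> nat \<Rightarrow> (nat \<times> nat) set \<Rightarrow> (nat \<Rightarrow> bool) \<Rightarrow> bool" where
  "admissible n r a w \<longleftrightarrow> (\<forall>(i, j)\<in>a. j \<le> r \<longrightarrow> w i \<noteq> w j) \<and> (\<forall>v\<in>ray_vertices n a. v \<le> r \<longrightarrow> w v)"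

lemma admissible_cup: "admissible n r a w \<Longrightarrow> (i, j) \<in> a \<Longrightarrow> j \<le> r \<Longrightarrow> w i \<noteq> w j"
  by (fastforce simp: admissible_def)

lemma admissible_ray: "admissible n r a w \<Longrightarrow> v \<in> ray_vertices n a \<Longrightarrow> v \<le> r \<Longrightarrow> w v"
  by (simp add: admissible_def)

definition right_endpoint :: "(nat \<times> nat) set \<Rightarrow> nat \<Rightarrow> bool" where
  "right_endpoint a v \<longleftrightarrow> (\<exists>i. (i, v) \<in> a)"

lemma cup_left_not_right:
  "cup_diagram n a \<Longrightarrow> (i, j) \<in> a \<Longrightarrow> \<not> right_endpoint a i"
  using cup_diagram_disjoint[of n a i j _ i i] cup_diagramD(2)[of n a] by (fastforce simp: right_endpoint_def)

lemma admissible_standard: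
  assumes "cup_diagram n a"
  shows "admissible n r a (\<lambda>v. \<not> right_endpoint a v)"
  unfolding admissible_def using cup_left_not_right[OF assms]
  by (fastforce simp: right_endpoint_def ray_vertices_def)

text \<open>No cup passes below the gap between p and p + 1. At such positions the term of a flag in
  K_a is forced.\<close>

definition uncovered :: "(nat \<times> nat) set \<Rightarrow> nat \<Rightarrow> bool" where
  "uncovered a p \<longleftrightarrow> (\<forall>(i, j)\<in>a. \<not> (i \<le> p \<and> p < j))"

definition cups_in :: "(nat \<times> nat) set \<Rightarrow> nat \<Rightarrow> nat \<Rightarrow> (nat \<times> nat) set" where
  "cups_in a x y = {(i, j) \<in> a. x \<le> i \<and> j \<le> y}"

text \<open>Splits an interval that separates no cup into rays and cups, each cup contributing d
  vertices with property P. With P constantly true and d = 2 this computes the length; with P a word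
  and d = 1 it counts the letters \<open>e\<close>.\<close>

lemma interval_count:
  assumes a: "cup_diagram n a" and xy: "1 \<le> x" "y \<le> n"
    and cl: "\<And>i j. (i, j) \<in> a \<Longrightarrow> i \<in> {x..y} \<longleftrightarrow> j \<in> {x..y}"
    and d: "\<And>i j. (i, j) \<in> cups_in a x y \<Longrightarrow> card ({i, j} \<inter> {v. P v}) = d"
  shows "card {v \<in> {x..y}. P v} = card {v \<in> ray_vertices n a. v \<in> {x..y} \<and> P v} + d * card (cups_in a x y)"
proof -
  let ?C = "cups_in a x y" and ?R = "{v \<in> ray_vertices n a. v \<in> {x..y} \<and> P v}"
  let ?S = "\<lambda>c. {fst c, snd c} \<inter> {v. P v}"
  have fin: "finite ?C" by (rule finite_subset[OF _ finite_cup_diagram[OF a]]) (auto simp: cups_in_def)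
  have un: "{v \<in> {x..y}. P v} = ?R \<union> (\<Union>c\<in>?C. ?S c)"
  proof (intro equalityI subsetI)
    fix v assume v: "v \<in> {v \<in> {x..y}. P v}"
    then have "v \<in> {1..n}" using xy by auto
    then show "v \<in> ?R \<union> (\<Union>c\<in>?C. ?S c)"
    proof (cases rule: vertex_cases[where a = a])
      case 1
      then show ?thesis using v by auto
    next
      case (2 j)
      then have "(v, j) \<in> ?C" using cl[OF 2] v by (auto simp: cups_in_def)
      then show ?thesis using v by force
    next
      case (3 i)
      then have "(i, v) \<in> ?C" using cl[OF 3] v by (auto simp: cups_in_def)
      then show ?thesis using v by force
    qed
  next
    fix v assume "v \<in> ?R \<union> (\<Union>c\<in>?C. ?S c)"
    then show "v \<in> {v \<in> {x..y}. P v}" using cup_diagramD(2)[OF a] by (fastforce simp: cups_in_def)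
  qed
  have dis: "?R \<inter> (\<Union>c\<in>?C. ?S c) = {}" by (auto simp: cups_in_def ray_vertices_def)
  have finR: "finite ?R" by (simp add: ray_vertices_def)
  have finS: "finite (\<Union>c\<in>?C. ?S c)" using fin by auto
  have "card {v \<in> {x..y}. P v} = card ?R + card (\<Union>c\<in>?C. ?S c)"
    by (rule trans[OF arg_cong[OF un, of card] card_Un_disjoint[OF finR finS dis]])
  also have "card (\<Union>c\<in>?C. ?S c) = (\<Sum>c\<in>?C. card (?S c))"
  proof (rule card_UN_disjoint[OF fin])
    show "\<forall>c\<in>?C. \<forall>c'\<in>?C. c \<noteq> c' \<longrightarrow> ?S c \<inter> ?S c' = {}"
    proof (intro ballI impI, rule ccontr)
      fix c c' assume c: "c \<in> ?C" "c' \<in> ?C" "c \<noteq> c'" "?S c \<inter> ?S c' \<noteq> {}"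
      then obtain u where "u \<in> {fst c, snd c}" "u \<in> {fst c', snd c'}" by blast
      moreover have "(fst c, snd c) \<in> a" "(fst c', snd c') \<in> a" using c by (auto simp: cups_in_def)
      ultimately have "fst c = fst c' \<and> snd c = snd c'" using cup_diagram_disjoint[OF a] by blast
      then show False using c(3) by (simp add: prod_eq_iff)
    qed
  qed auto
  also have "\<dots> = (\<Sum>c\<in>?C. d)" by (rule sum.cong) (use d in auto)
  finally show ?thesis by (simp add: mult.commute)
qed

lemma interval_card:
  assumes a: "cup_diagram n a" and xy: "1 \<le> x" "y \<le> n"
    and cl: "\<And>i j. (i, j) \<in> a \<Longrightarrow> i \<in> {x..y} \<longleftrightarrow> j \<in> {x..y}"
  shows "Suc y - x = card {v \<in> ray_vertices n a. v \<in> {x..y}} + 2 * card (cups_in a x y)"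
proof -
  have "card ({i, j} \<inter> {v. True}) = 2" if "(i, j) \<in> cups_in a x y" for i j
  proof -
    have "i \<noteq> j" using cup_diagramD(2)[OF a, of i j] that by (auto simp: cups_in_def)
    then show ?thesis by simp
  qed
  from interval_count[OF a xy cl this]
  have "card {v \<in> {x..y}. True} = card {v \<in> ray_vertices n a. v \<in> {x..y}} + 2 * card (cups_in a x y)" by simp
  moreover have "{v \<in> {x..y}. True} = {x..y}" by blast
  ultimately show ?thesis by simp
qed

lemma interval_word:
  assumes a: "cup_diagram n a" and xy: "1 \<le> x" "y \<le> n" "y \<le> r" and w: "admissible n r a w"
    and cl: "\<And>i j. (i, j) \<in> a \<Longrightarrow> i \<in> {x..y} \<longleftrightarrow> j \<in> {x..y}"
  shows "card {v \<in> {x..y}. w v} = card {v \<in> ray_vertices n a. v \<in> {x..y}} + card (cups_in a x y)"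
proof -
  have "card ({i, j} \<inter> {v. w v}) = 1" if ij: "(i, j) \<in> cups_in a x y" for i j
  proof -
    have "w i \<noteq> w j" using admissible_cup[OF w, of i j] ij xy by (auto simp: cups_in_def)
    then have "{i, j} \<inter> {v. w v} = (if w i then {i} else {j})" by auto
    then show ?thesis by simp
  qed
  from interval_count[OF a xy(1,2) cl this]
  have "card {v \<in> {x..y}. w v} = card {v \<in> ray_vertices n a. v \<in> {x..y} \<and> w v} + card (cups_in a x y)" by simp
  moreover have "{v \<in> ray_vertices n a. v \<in> {x..y} \<and> w v} = {v \<in> ray_vertices n a. v \<in> {x..y}}"
    using admissible_ray[OF w] xy by auto
  ultimately show ?thesis by simp
qed

definition count_e :: "(nat \<Rightarrow> bool) \<Rightarrow> nat \<Rightarrow> nat" where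
  "count_e w p = card {v \<in> {1..p}. w v}"

lemma count_e_0 [simp]: "count_e w 0 = 0" by (simp add: count_e_def)

lemma count_e_Suc: "count_e w (Suc p) = count_e w p + (if w (Suc p) then 1 else 0)"
proof -
  have "{v \<in> {1..Suc p}. w v} = (if w (Suc p) then insert (Suc p) {v \<in> {1..p}. w v} else {v \<in> {1..p}. w v})"
    by (auto simp: le_Suc_eq)
  then show ?thesis by (simp add: count_e_def)
qed

lemma count_e_le: "count_e w p \<le> p"
  by (induction p) (auto simp: count_e_Suc)

lemma count_e_diff:
  assumes "1 \<le> x" "x \<le> Suc y"
  shows "count_e w y = count_e w (x - 1) + card {v \<in> {x..y}. w v}"
proof -
  have "{v \<in> {1..y}. w v} = {v \<in> {1..x - 1}. w v} \<union> {v \<in> {x..y}. w v}" using assms by auto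
  moreover have "card ({v \<in> {1..x - 1}. w v} \<union> {v \<in> {x..y}. w v}) = card {v \<in> {1..x - 1}. w v} + card {v \<in> {x..y}. w v}"
    by (rule card_Un_disjoint) (use assms in auto)
  ultimately show ?thesis by (simp add: count_e_def)
qed

lemma cup_interval_closed:
  assumes a: "cup_diagram n a" and ij: "(i, j) \<in> a" and xy: "(x, y) \<in> a"
  shows "x \<in> {i..j} \<longleftrightarrow> y \<in> {i..j}"
proof (cases "x = i \<and> y = j")
  case True
  then show ?thesis using cup_diagramD[OF a ij] by auto
next
  case False
  then have ne: "x \<noteq> i" "x \<noteq> j" "y \<noteq> i" "y \<noteq> j"
    using cup_diagram_disjoint[OF a ij xy] by blast+
  have "x < y" "i < j" using cup_diagramD[OF a] ij xy by auto
  then show ?thesis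
    using cup_diagram_crossing[OF a ij xy] cup_diagram_crossing[OF a xy ij] ne by fastforce
qed

lemma cup_no_rays:
  assumes a: "cup_diagram n a" and ij: "(i, j) \<in> a"
  shows "{v \<in> ray_vertices n a. v \<in> {i..j}} = {}"
  using cup_diagram_ray[OF a ij] by fastforce

text \<open>No ray lies below a cup, so its interval is perfectly matched. The halving in the
  definition of K_a is therefore exact, and it counts the cups in the interval, the outer one
  included.\<close>

lemma cup_length:
  assumes a: "cup_diagram n a" and ij: "(i, j) \<in> a"
  shows "(j - i + 1) div 2 = card (cups_in a i j)" "j = (i - 1) + 2 * ((j - i + 1) div 2)"
proof -
  note b = cup_diagramD[OF a ij]
  have "Suc j - i = 2 * card (cups_in a i j)"
    using interval_card[OF a b(1,3) cup_interval_closed[OF a ij]] cup_no_rays[OF a ij] by simp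
  then have *: "j - i + 1 = 2 * card (cups_in a i j)" using b by simp
  then show "(j - i + 1) div 2 = card (cups_in a i j)" by simp
  then show "j = (i - 1) + 2 * ((j - i + 1) div 2)" using * b by linarith
qed

lemma cup_word:
  assumes a: "cup_diagram n a" and ij: "(i, j) \<in> a" "j \<le> r" and w: "admissible n r a w"
  shows "count_e w j = count_e w (i - 1) + (j - i + 1) div 2"
proof -
  note b = cup_diagramD[OF a ij(1)]
  have "card {v \<in> {i..j}. w v} = card (cups_in a i j)"
    using interval_word[OF a b(1,3) ij(2) w cup_interval_closed[OF a ij(1)]] cup_no_rays[OF a ij(1)] by simp
  then show ?thesis using count_e_diff[of i j w] b cup_length(1)[OF a ij(1)] by simp
qed

lemma uncovered_closed:
  assumes a: "cup_diagram n a" and p: "uncovered a p" and ij: "(i, j) \<in> a"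
  shows "i \<in> {1..p} \<longleftrightarrow> j \<in> {1..p}"
  using cup_diagramD[OF a ij] p ij by (fastforce simp: uncovered_def)

lemma ray_count_alt: "ray_count n a p = card {v \<in> ray_vertices n a. v \<in> {1..p}}"
  unfolding ray_count_def by (rule arg_cong[of _ _ card]) (auto simp: ray_vertices_def)

lemma uncovered_count:
  assumes a: "cup_diagram n a" and p: "uncovered a p" "p \<le> n"
  shows "p = ray_count n a p + 2 * card (cups_in a 1 p)"
  using interval_card[OF a _ p(2) uncovered_closed[OF a p(1)]] by (simp add: ray_count_alt)

text \<open>Up to an uncovered position each cup contributes one letter of each kind and each ray an
  \<open>e\<close>, so all admissible words have reached the same coordinate subspace there.\<close>

lemma uncovered_word:
  assumes a: "cup_diagram n a" and p: "uncovered a p" "p \<le> n" "p \<le> r" and w: "admissible n r a w"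
  shows "count_e w p = (p + ray_count n a p) div 2" "p - count_e w p = (p - ray_count n a p) div 2"
proof -
  have "count_e w p = ray_count n a p + card (cups_in a 1 p)"
    unfolding count_e_def using interval_word[OF a _ p(2,3) w uncovered_closed[OF a p(1)]] by (simp add: ray_count_alt)
  then show "count_e w p = (p + ray_count n a p) div 2" "p - count_e w p = (p - ray_count n a p) div 2"
    using uncovered_count[OF a p(1,2)] by linarith+
qed

lemma ray_uncovered: "cup_diagram n a \<Longrightarrow> v \<in> ray_vertices n a \<Longrightarrow> uncovered a v"
proof -
  assume a: "cup_diagram n a" and v: "v \<in> ray_vertices n a"
  have "\<not> (i \<le> v \<and> v < j)" if "(i, j) \<in> a" for i j
    using cup_diagram_ray[OF a that v] by linarith
  then show ?thesis by (auto simp: uncovered_def)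
qed

lemma ray_uncovered_pred:
  assumes "cup_diagram n a" "v \<in> ray_vertices n a"
  shows "uncovered a (v - 1)"
  unfolding uncovered_def
proof safe
  fix i j assume "(i, j) \<in> a" "i \<le> v - 1" "v - 1 < j"
  then show False using cup_diagram_ray[OF assms(1) _ assms(2)] ray_vertices_range[OF assms(2)]
      cup_diagramD[OF assms(1)] by fastforce
qed

lemma right_uncovered_pred:
  assumes a: "cup_diagram n a" and ij: "(i, j) \<in> a" and j: "uncovered a j"
  shows "uncovered a (i - 1)"
  unfolding uncovered_def
proof safe
  fix x y assume xy: "(x, y) \<in> a" "x \<le> i - 1" "i - 1 < y"
  have b: "1 \<le> i" "i < j" "1 \<le> x" using cup_diagramD[OF a] ij xy by auto
  have "y \<noteq> i" using cup_diagram_disjoint[OF a ij xy(1), of i] xy b by auto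
  then have "j < y" using cup_diagram_crossing[OF a xy(1) ij] xy b by auto
  then show False using j xy b by (fastforce simp: uncovered_def)
qed

subsection \<open>The flags attached to words\<close>

context two_row
begin

text \<open>For r \<le> N these are the flags in \<open>Y_flags z r\<close> that are fixed by the
  torus scaling the two Jordan blocks independently.\<close>

definition word_flag :: "nat \<Rightarrow> (nat \<Rightarrow> bool) \<Rightarrow> 'd flag" where
  "word_flag r w = map (\<lambda>p. E (count_e w p) (p - count_e w p)) [1..<Suc r]"

lemma word_flag_part: "p \<le> r \<Longrightarrow> flag_part (word_flag r w) p = E (count_e w p) (p - count_e w p)"
  by (auto simp: word_flag_def flag_part_def simp del: upt_Suc)

lemma word_flag_Y:
  assumes "r \<le> N"
  shows "word_flag r w \<in> Y_flags z r"
  unfolding Y_flags_def partial_flags_def mem_Collect_eq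
proof (intro conjI ballI)
  show "length (word_flag r w) = r" by (simp add: word_flag_def)
  fix i assume i: "i \<in> {1..r}"
  then obtain p where p: "i = Suc p" "p < r" by (cases i) auto
  have le: "count_e w i \<le> N" "i - count_e w i \<le> N" "count_e w i \<le> i" using i assms count_e_le[of w i] by auto
  show "vec.subspace (flag_part (word_flag r w) i)" using i by (simp add: word_flag_part)
  show "vec.dim (flag_part (word_flag r w) i) = i" using i le by (simp add: word_flag_part dim_E)
  show "flag_part (word_flag r w) (i - 1) \<subseteq> flag_part (word_flag r w) i"
  proof -
    have "E (count_e w p) (p - count_e w p) \<subseteq> E (count_e w i) (i - count_e w i)"
      using p count_e_le[of w p] by (intro E_mono) (auto simp: count_e_Suc)
    then show ?thesis using p by (simp add: word_flag_part)
  qed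
  have "z ` E (count_e w i) (i - count_e w i) = E (count_e w i - 1) (i - count_e w i - 1)"
    using z_pow_image_E[OF le(1,2), of 1] by simp
  also have "\<dots> \<subseteq> E (count_e w p) (p - count_e w p)" using p by (intro E_mono) (auto simp: count_e_Suc)
  finally show "z ` flag_part (word_flag r w) i \<subseteq> flag_part (word_flag r w) (i - 1)"
    using i p by (simp add: word_flag_part)
qed

lemma E_Suc_left: "{x + y | x y. x \<in> E a b \<and> y \<in> vec.span {e (Suc a)}} = E (Suc a) b"
proof -
  have "e ` {1..Suc a} \<union> f ` {1..b} = (e ` {1..a} \<union> f ` {1..b}) \<union> {e (Suc a)}"
    by (auto simp: atLeastAtMostSuc_conv)
  then show ?thesis unfolding E_space_def using vec.span_Un[of "e ` {1..a} \<union> f ` {1..b}" "{e (Suc a)}"] by simp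
qed

text \<open>The term at an uncovered position is computed from an earlier uncovered one: a ray adds
  one dimension, a closing cup takes a preimage. The ray hypothesis is conditional on the preceding
  term, so that either description of a ray condition can be supplied.\<close>

lemma flag_part_uncovered:
  assumes a: "cup_diagram n a" and r: "r \<le> n" "r \<le> N"
    and cups: "\<And>i j. (i, j) \<in> a \<Longrightarrow> j \<le> r \<Longrightarrow> flag_part F j = (z ^^ ((j - i + 1) div 2)) -` flag_part F (i - 1)"
    and rays: "\<And>v. v \<in> ray_vertices n a \<Longrightarrow> v \<le> r \<Longrightarrow>
       flag_part F (v - 1) = E (((v - 1) + ray_count n a (v - 1)) div 2) (((v - 1) - ray_count n a (v - 1)) div 2) \<Longrightarrow>
       flag_part F v = E ((v + ray_count n a v) div 2) ((v - ray_count n a v) div 2)"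
  shows "uncovered a p \<Longrightarrow> p \<le> r \<Longrightarrow>
    flag_part F p = E ((p + ray_count n a p) div 2) ((p - ray_count n a p) div 2)"
proof (induction p rule: less_induct)
  case (less p)
  let ?w = "\<lambda>v. \<not> right_endpoint a v"
  note w = admissible_standard[OF a, of r]
  show ?case
  proof (cases "p = 0")
    case True
    moreover have "{v \<in> ray_vertices n a. v \<le> 0} = {}" by (auto simp: ray_vertices_def)
    then have "ray_count n a 0 = 0" by (simp only: ray_count_def card.empty)
    ultimately show ?thesis by simp
  next
    case False
    then have "p \<in> {1..n}" using less r by auto
    then show ?thesis
    proof (cases rule: vertex_cases[where a = a])
      case 1
      then show ?thesis using rays[OF 1 less.prems(2)] less.IH[of "p - 1"] ray_uncovered_pred[OF a 1] False less.prems by auto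
    next
      case (2 j)
      then show ?thesis using less.prems(1) cup_diagramD[OF a 2] by (auto simp: uncovered_def)
    next
      case (3 i)
      let ?l = "(p - i + 1) div 2"
      have un: "uncovered a (i - 1)" by (rule right_uncovered_pred[OF a 3 less.prems(1)])
      have b: "i - 1 < p" "i - 1 \<le> n" "i - 1 \<le> r" "p \<le> n" using cup_diagramD[OF a 3] less.prems r by auto
      have IH: "flag_part F (i - 1) = E (count_e ?w (i - 1)) ((i - 1) - count_e ?w (i - 1))"
        using less.IH[OF b(1) un b(3)] uncovered_word[OF a un b(2,3) w] by simp
      have cw: "count_e ?w p = count_e ?w (i - 1) + ?l" by (rule cup_word[OF a 3 less.prems(2) w])
      have pl: "p = (i - 1) + 2 * ?l" by (rule cup_length(2)[OF a 3])
      have "flag_part F p = E (count_e ?w (i - 1) + ?l) ((i - 1) - count_e ?w (i - 1) + ?l)"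
        unfolding cups[OF 3 less.prems(2)] IH
        by (rule z_pow_vimage_E) (use pl cw less.prems r count_e_le[of ?w "i - 1"] in linarith)+
      moreover have "(i - 1) - count_e ?w (i - 1) + ?l = p - count_e ?w p"
        using pl cw count_e_le[of ?w "i - 1"] by linarith
      ultimately show ?thesis using cw uncovered_word[OF a less.prems(1) b(4) less.prems(2) w] by simp
    qed
  qed
qed

text \<open>A ray adds one letter \<open>e\<close> and no \<open>f\<close>. Comparing the letter
  counts of the standard word just before and at v gives both equations and settles the rounding in
  the halves.\<close>

lemma ray_position:
  assumes a: "cup_diagram n a" and v: "v \<in> ray_vertices n a"
  shows "(v + ray_count n a v) div 2 = Suc ((v - 1 + ray_count n a (v - 1)) div 2)"
    "(v - ray_count n a v) div 2 = (v - 1 - ray_count n a (v - 1)) div 2"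
proof -
  let ?w = "\<lambda>v. \<not> right_endpoint a v"
  note w = admissible_standard[OF a, of v]
  have vn: "1 \<le> v" "v \<le> n" using ray_vertices_range[OF v] by auto
  have "\<not> right_endpoint a v" using v by (auto simp: right_endpoint_def ray_vertices_def)
  then have c: "count_e ?w v = Suc (count_e ?w (v - 1))" using count_e_Suc[of ?w "v - 1"] vn by simp
  note u = uncovered_word[OF a ray_uncovered[OF a v] vn(2) order_refl w]
  have v': "v - 1 \<le> n" "v - 1 \<le> v" using vn by auto
  note u' = uncovered_word[OF a ray_uncovered_pred[OF a v] v' w]
  show "(v + ray_count n a v) div 2 = Suc ((v - 1 + ray_count n a (v - 1)) div 2)"
    using u(1) u'(1) c by linarith
  show "(v - ray_count n a v) div 2 = (v - 1 - ray_count n a (v - 1)) div 2"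
    using u(2) u'(2) c by linarith
qed

text \<open>The two descriptions of a ray condition are exchanged with the help of the cup
  conditions, since the term before a ray is known only through the cups and rays to its left. The
  result has the form needed for closedness.\<close>

lemma K_component_iff:
  assumes a: "cup_diagram n a" and N: "n \<le> N"
  shows "F \<in> K_component e z n m a \<longleftrightarrow> F \<in> Y_flags z (n - m) \<and>
    (\<forall>i j. (i, j) \<in> a \<longrightarrow> j \<le> n - m \<longrightarrow> (z ^^ ((j - i + 1) div 2)) ` flag_part F j \<subseteq> flag_part F (i - 1)) \<and>
    (\<forall>v \<in> ray_vertices n a. v \<le> n - m \<longrightarrow> flag_part F v = E ((v + ray_count n a v) div 2) ((v - ray_count n a v) div 2))"
    (is "_ \<longleftrightarrow> _ \<and> ?cups \<and> ?rays")
proof (cases "F \<in> Y_flags z (n - m)")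
  case F: True
  have r: "n - m \<le> n" "n - m \<le> N" using N by auto
  have cup: "flag_part F j = (z ^^ ((j - i + 1) div 2)) -` flag_part F (i - 1) \<longleftrightarrow>
      (z ^^ ((j - i + 1) div 2)) ` flag_part F j \<subseteq> flag_part F (i - 1)" if "(i, j) \<in> a" "j \<le> n - m" for i j
    using Y_flags_vimage_iff[OF F, of "i - 1" "(j - i + 1) div 2"] cup_length(2)[OF a that(1)] that N by simp
  have Kiff: "F \<in> K_component e z n m a \<longleftrightarrow> ?cups \<and>
      (\<forall>v \<in> ray_vertices n a. v \<le> n - m \<longrightarrow> flag_part F v = {x + y | x y. x \<in> flag_part F (v - 1) \<and>
                      y \<in> vec.span {e ((v + ray_count n a v) div 2)}})" (is "_ \<longleftrightarrow> _ \<and> ?rays'")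
    using F cup by (fastforce simp: K_component_def)
  have unc: "flag_part F p = E ((p + ray_count n a p) div 2) ((p - ray_count n a p) div 2)"
    if "?cups" "?rays \<or> ?rays'" "uncovered a p" "p \<le> n - m" for p
  proof (rule flag_part_uncovered[OF a r _ _ that(3,4)])
    show "flag_part F j = (z ^^ ((j - i + 1) div 2)) -` flag_part F (i - 1)" if "(i, j) \<in> a" "j \<le> n - m" for i j
      using cup that \<open>?cups\<close> by blast
    fix v assume v: "v \<in> ray_vertices n a" "v \<le> n - m"
      and pre: "flag_part F (v - 1) = E (((v - 1) + ray_count n a (v - 1)) div 2) (((v - 1) - ray_count n a (v - 1)) div 2)"
    show "flag_part F v = E ((v + ray_count n a v) div 2) ((v - ray_count n a v) div 2)"
      using that(2)
    proof
      assume ?rays'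
      then have "flag_part F v = {x + y | x y. x \<in> flag_part F (v - 1) \<and> y \<in> vec.span {e ((v + ray_count n a v) div 2)}}"
        using v by blast
      then show ?thesis unfolding pre ray_position[OF a v(1)] E_Suc_left .
    qed (use v in blast)
  qed
  have "?rays \<longleftrightarrow> ?rays'" if c: "?cups"
  proof
    assume ?rays'
    then show ?rays using unc[OF c] ray_uncovered[OF a] by blast
  next
    assume R: ?rays
    show ?rays'
    proof (intro ballI impI)
      fix v assume v: "v \<in> ray_vertices n a" "v \<le> n - m"
      have pre: "flag_part F (v - 1) = E (((v - 1) + ray_count n a (v - 1)) div 2) (((v - 1) - ray_count n a (v - 1)) div 2)"
        using unc[OF c disjI1[OF R] ray_uncovered_pred[OF a v(1)]] v by auto
      show "flag_part F v = {x + y | x y. x \<in> flag_part F (v - 1) \<and> y \<in> vec.span {e ((v + ray_count n a v) div 2)}}"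
        unfolding pre ray_position(1)[OF a v(1)] E_Suc_left using R v ray_position[OF a v(1)] by auto
    qed
  qed
  then show ?thesis using F Kiff by blast
qed (simp add: K_component_def)

lemma K_component_uncovered:
  assumes a: "cup_diagram n a" and N: "n \<le> N" and F: "F \<in> K_component e z n m a"
    and p: "uncovered a p" "p \<le> n - m"
  shows "flag_part F p = E ((p + ray_count n a p) div 2) ((p - ray_count n a p) div 2)"
proof (rule flag_part_uncovered[OF a _ _ _ _ p])
  show "flag_part F j = (z ^^ ((j - i + 1) div 2)) -` flag_part F (i - 1)" if "(i, j) \<in> a" "j \<le> n - m" for i j
    using F that by (fastforce simp: K_component_def)
  show "flag_part F v = E ((v + ray_count n a v) div 2) ((v - ray_count n a v) div 2)"
    if "v \<in> ray_vertices n a" "v \<le> n - m" for v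
    using F that by (simp add: K_component_iff[OF a N])
qed (use N in auto)

lemma word_flag_in_K:
  assumes a: "cup_diagram n a" and N: "n \<le> N" and w: "admissible n (n - m) a w"
  shows "word_flag (n - m) w \<in> K_component e z n m a"
  unfolding K_component_iff[OF a N]
proof (intro conjI allI impI ballI)
  show "word_flag (n - m) w \<in> Y_flags z (n - m)" using N by (intro word_flag_Y) simp
  fix i j assume ij: "(i, j) \<in> a" "j \<le> n - m"
  let ?l = "(j - i + 1) div 2"
  have j: "j = (i - 1) + 2 * ?l" by (rule cup_length(2)[OF a ij(1)])
  have c: "count_e w j = count_e w (i - 1) + ?l" by (rule cup_word[OF a ij w])
  have N': "count_e w j \<le> N" "j - count_e w j \<le> N" using count_e_le[of w j] ij N by linarith+
  have "count_e w j - ?l = count_e w (i - 1)" "j - count_e w j - ?l = (i - 1) - count_e w (i - 1)"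
    using j c count_e_le[of w "i - 1"] by linarith+
  then have "(z ^^ ?l) ` E (count_e w j) (j - count_e w j) = E (count_e w (i - 1)) ((i - 1) - count_e w (i - 1))"
    using z_pow_image_E[OF N', of ?l] by simp
  moreover have "i - 1 \<le> n - m" using ij cup_diagramD[OF a ij(1)] by simp
  ultimately show "(z ^^ ?l) ` flag_part (word_flag (n - m) w) j \<subseteq> flag_part (word_flag (n - m) w) (i - 1)"
    using ij(2) by (simp only: word_flag_part subset_refl)
next
  fix v assume v: "v \<in> ray_vertices n a" "v \<le> n - m"
  show "flag_part (word_flag (n - m) w) v = E ((v + ray_count n a v) div 2) ((v - ray_count n a v) div 2)"
    using uncovered_word[OF a ray_uncovered[OF a v(1)] _ v(2) w] v by (simp add: word_flag_part)
qed

text \<open>Comparing indices of coordinate subspaces shows that a cup spanning 2 l vertices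
  contains l letters \<open>e\<close>. By induction each cup strictly inside contributes exactly
  one, which leaves one for the two endpoints.\<close>

lemma word_flag_K_admissible:
  assumes a: "cup_diagram n a" and N: "n \<le> N" and K: "word_flag (n - m) w \<in> K_component e z n m a"
  shows "admissible n (n - m) a w"
proof -
  have "w i \<noteq> w j" if "(i, j) \<in> a" "j \<le> n - m" for i j
    using that
  proof (induction "j - i" arbitrary: i j rule: less_induct)
    case less
    let ?l = "(j - i + 1) div 2" and ?c = "count_e w"
    note ij = less.prems
    have b: "1 \<le> i" "i < j" "j \<le> n" using cup_diagramD[OF a ij(1)] by auto
    have jl: "j = (i - 1) + 2 * ?l" by (rule cup_length(2)[OF a ij(1)])
    have "flag_part (word_flag (n - m) w) j = (z ^^ ?l) -` flag_part (word_flag (n - m) w) (i - 1)"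
      using K ij by (fastforce simp: K_component_def)
    then have "E (?c j) (j - ?c j) = (z ^^ ?l) -` E (?c (i - 1)) ((i - 1) - ?c (i - 1))"
      using ij b by (simp add: word_flag_part)
    also have "\<dots> = E (?c (i - 1) + ?l) ((i - 1) - ?c (i - 1) + ?l)"
      by (rule z_pow_vimage_E) (use jl ij N count_e_le[of w "i - 1"] in linarith)+
    finally have "?c j = ?c (i - 1) + ?l"
      by (intro E_eq_iff(1)[of "?c j" "j - ?c j" "?c (i - 1) + ?l" "(i - 1) - ?c (i - 1) + ?l"])
         (use jl ij N count_e_le[of w "i - 1"] count_e_le[of w j] in linarith)+
    moreover have "?c j = ?c (i - 1) + card {v \<in> {i..j}. w v}" by (rule count_e_diff) (use b in auto)
    ultimately have cij: "card {v \<in> {i..j}. w v} = ?l" by simp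
    have cl: "x \<in> {i + 1..j - 1} \<longleftrightarrow> y \<in> {i + 1..j - 1}" if xy: "(x, y) \<in> a" for x y
    proof (cases "x = i \<and> y = j")
      case False
      then have "x \<noteq> i" "x \<noteq> j" "y \<noteq> i" "y \<noteq> j" using cup_diagram_disjoint[OF a ij(1) xy] by blast+
      then show ?thesis using cup_interval_closed[OF a ij(1) xy] by auto
    qed (use b in auto)
    have card1: "card ({x, y} \<inter> {v. w v}) = 1" if xy: "(x, y) \<in> cups_in a (i + 1) (j - 1)" for x y
    proof -
      have "(x, y) \<in> a" "i + 1 \<le> x" "y \<le> j - 1" using xy by (auto simp: cups_in_def)
      moreover from this have "y - x < j - i" "y \<le> n - m" using b ij by auto
      ultimately have "w x \<noteq> w y" using less.hyps by blast
      then have "{x, y} \<inter> {v. w v} = (if w x then {x} else {y})" by auto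
      then show ?thesis by simp
    qed
    have ray: "{v \<in> ray_vertices n a. v \<in> {i + 1..j - 1} \<and> w v} = {}" "{v \<in> ray_vertices n a. v \<in> {i + 1..j - 1}} = {}"
      using cup_no_rays[OF a ij(1)] by fastforce+
    have bb: "1 \<le> i + 1" "j - 1 \<le> n" using b by auto
    have "Suc (j - 1) - (i + 1) = 2 * card (cups_in a (i + 1) (j - 1))"
      using interval_card[OF a bb cl] ray(2) by simp
    moreover have "card {v \<in> {i + 1..j - 1}. w v} = card (cups_in a (i + 1) (j - 1))"
      using interval_count[OF a bb cl card1] ray(1) by simp
    ultimately have inner: "card {v \<in> {i + 1..j - 1}. w v} = ?l - 1" using jl b by linarith
    have "{v \<in> {i..j}. w v} = ({i, j} \<inter> {v. w v}) \<union> {v \<in> {i + 1..j - 1}. w v}" using b by auto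
    moreover have "card (({i, j} \<inter> {v. w v}) \<union> {v \<in> {i + 1..j - 1}. w v}) =
        card ({i, j} \<inter> {v. w v}) + card {v \<in> {i + 1..j - 1}. w v}"
      by (rule card_Un_disjoint) (use b in auto)
    ultimately have "card {v \<in> {i..j}. w v} = card ({i, j} \<inter> {v. w v}) + card {v \<in> {i + 1..j - 1}. w v}"
      by (simp only:)
    then have "card ({i, j} \<inter> {v. w v}) = 1" using cij inner jl b by linarith
    then show ?case using b by (cases "w i"; cases "w j") auto
  qed
  \<comment> \<open>A letter \<open>f\<close> at a ray would leave the number of letters
    \<open>e\<close> unchanged across v, against \<open>ray_position\<close>.\<close>
  moreover have "w v" if v: "v \<in> ray_vertices n a" "v \<le> n - m" for v
  proof (rule ccontr)
    assume nw: "\<not> w v"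
    have v1: "1 \<le> v" "v \<le> n" using ray_vertices_range[OF v(1)] by auto
    have "count_e w v = count_e w (v - 1)" using nw count_e_Suc[of w "v - 1"] v1 by simp
    moreover have "flag_part (word_flag (n - m) w) p = E ((p + ray_count n a p) div 2) ((p - ray_count n a p) div 2)"
      if "uncovered a p" "p \<le> n - m" for p by (rule K_component_uncovered[OF a N K that])
    from this[OF ray_uncovered[OF a v(1)] v(2)] this[OF ray_uncovered_pred[OF a v(1)]] v(2)
    have eqs: "E (count_e w v) (v - count_e w v) = E ((v + ray_count n a v) div 2) ((v - ray_count n a v) div 2)"
      "E (count_e w (v - 1)) ((v - 1) - count_e w (v - 1)) = E ((v - 1 + ray_count n a (v - 1)) div 2) ((v - 1 - ray_count n a (v - 1)) div 2)"
      by (auto simp: word_flag_part)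
    have rc: "ray_count n a p \<le> p" for p
      unfolding ray_count_alt by (rule order_trans[OF card_mono[of "{1..p}"]]) auto
    have h: "(p + ray_count n a p) div 2 \<le> p" "(p - ray_count n a p) div 2 \<le> p" for p
      using rc[of p] by linarith+
    have b: "v \<le> N" "v - 1 \<le> N" using v1 N by auto
    have "count_e w v = (v + ray_count n a v) div 2"
      by (rule E_eq_iff(1)[OF _ _ _ _ eqs(1)]) (use b count_e_le[of w v] h[of v] in linarith)+
    moreover have "count_e w (v - 1) = (v - 1 + ray_count n a (v - 1)) div 2"
      by (rule E_eq_iff(1)[OF _ _ _ _ eqs(2)]) (use b count_e_le[of w "v - 1"] h[of "v - 1"] in linarith)+
    ultimately show False using ray_position(1)[OF a v(1)] \<open>count_e w v = count_e w (v - 1)\<close> by linarith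
  qed
  ultimately show ?thesis by (auto simp: admissible_def)
qed

end

section \<open>The sets $K_a$ cover the $\Delta$-Springer variety irredundantly\<close>

lemma delta_cup_diagramsD:
  assumes "a \<in> delta_cup_diagrams n k m"
  shows "cup_diagram n a" "card a = k"
    "\<And>v. n - m < v \<Longrightarrow> v \<le> n \<Longrightarrow> v \<in> ray_vertices n a \<or> right_endpoint a v"
  using assms by (auto simp: delta_cup_diagrams_def right_endpoint_def)

lemma delta_left_endpoint:
  assumes "a \<in> delta_cup_diagrams n k m" "(i, j) \<in> a"
  shows "i \<le> n - m"
proof (rule ccontr)
  note a = delta_cup_diagramsD[OF assms(1)]
  assume "\<not> i \<le> n - m"
  then have "i \<in> ray_vertices n a \<or> right_endpoint a i"
    using a(3)[of i] cup_diagramD[OF a(1) assms(2)] by auto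
  then show False using cup_left_not_right[OF a(1) assms(2)] assms(2) by (auto simp: ray_vertices_def)
qed

text \<open>With r = n - m, the cups that end left of the cut line; only these impose conditions on
  flags.\<close>

definition closed_cups :: "nat \<Rightarrow> (nat \<times> nat) set \<Rightarrow> (nat \<times> nat) set" where
  "closed_cups r a = {(i, j) \<in> a. j \<le> r}"

lemma inj_on_fst_cups:
  assumes "cup_diagram n a"
  shows "inj_on fst a"
proof (rule inj_onI)
  fix u v assume uv: "u \<in> a" "v \<in> a" "fst u = fst v"
  from uv(1,2) have "(fst u, snd u) \<in> a" "(fst v, snd v) \<in> a" by (simp_all only: prod.collapse)
  then show "u = v"
    using cup_diagram_disjoint[OF assms, of "fst u" "snd u" "fst v" "snd v" "fst u"] uv(3)
    by (metis insertI1 prod_eqI)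
qed

lemma inj_on_snd_cups:
  assumes "cup_diagram n a"
  shows "inj_on snd a"
proof (rule inj_onI)
  fix u v assume uv: "u \<in> a" "v \<in> a" "snd u = snd v"
  from uv(1,2) have "(fst u, snd u) \<in> a" "(fst v, snd v) \<in> a" by (simp_all only: prod.collapse)
  then show "u = v"
    using cup_diagram_disjoint[OF assms, of "fst u" "snd u" "fst v" "snd v" "snd u"] uv(3)
    by (metis insertI1 insertI2 prod_eqI)
qed

text \<open>No left endpoint is right of the cut line, so the first n - m vertices consist of rays,
  all k left endpoints and the right endpoints of closed cups. The inequalities come from the total
  of n - 2 k rays and from the at most m cups that cross the line.\<close>

lemma delta_count:
  assumes a: "a \<in> delta_cup_diagrams n k m"
  shows "n - m = ray_count n a (n - m) + k + card (closed_cups (n - m) a)"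
    "card {v \<in> {1..n - m}. right_endpoint a v} = card (closed_cups (n - m) a)"
    "ray_count n a (n - m) + 2 * k \<le> n"
    "k - m \<le> card (closed_cups (n - m) a)"
proof -
  let ?r = "n - m" and ?C = "closed_cups (n - m) a"
  note D = delta_cup_diagramsD[OF a]
  note cd = cup_diagramD[OF D(1)]
  have fin: "finite a" by (rule finite_cup_diagram[OF D(1)])
  have CA: "?C \<subseteq> a" by (auto simp: closed_cups_def)
  have finC: "finite ?C" using fin CA finite_subset by blast
  let ?R = "{v \<in> ray_vertices n a. v \<le> ?r}"
  have finR: "finite ?R" by (auto simp: ray_vertices_def)
  have left: "card (fst ` a) = k" using card_image[OF inj_on_fst_cups[OF D(1)]] D(2) by simp
  have right: "card (snd ` ?C) = card ?C"
    by (rule card_image) (rule inj_on_subset[OF inj_on_snd_cups[OF D(1)] CA])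
  have rs: "{v \<in> {1..?r}. right_endpoint a v} = snd ` ?C"
  proof (intro equalityI subsetI)
    fix v assume "v \<in> {v \<in> {1..?r}. right_endpoint a v}"
    then obtain i where "(i, v) \<in> ?C" by (auto simp: right_endpoint_def closed_cups_def)
    then show "v \<in> snd ` ?C" by force
  next
    fix v assume "v \<in> snd ` ?C"
    then obtain i where "(i, v) \<in> a" "v \<le> ?r" by (auto simp: closed_cups_def)
    then show "v \<in> {v \<in> {1..?r}. right_endpoint a v}" using cd[of i v] by (auto simp: right_endpoint_def)
  qed
  then show "card {v \<in> {1..?r}. right_endpoint a v} = card ?C" using right by simp
  have un: "{1..?r} = (?R \<union> fst ` a) \<union> snd ` ?C"
  proof (intro equalityI subsetI)
    fix v assume v: "v \<in> {1..?r}"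
    then have "v \<in> {1..n}" by auto
    then show "v \<in> (?R \<union> fst ` a) \<union> snd ` ?C"
    proof (cases rule: vertex_cases[where a = a])
      case 3
      then have "v \<in> {v \<in> {1..?r}. right_endpoint a v}" using v by (auto simp: right_endpoint_def)
      then show ?thesis unfolding rs by simp
    qed (use v in force)+
  next
    fix v assume "v \<in> (?R \<union> fst ` a) \<union> snd ` ?C"
    then consider "v \<in> ?R" | "v \<in> fst ` a" | "v \<in> {v \<in> {1..?r}. right_endpoint a v}" unfolding rs by blast
    then show "v \<in> {1..?r}"
    proof cases
      case 2
      then obtain j where "(v, j) \<in> a" by auto
      then show ?thesis using delta_left_endpoint[OF a] cd(1) by simp
    qed (auto simp: ray_vertices_def)
  qed
  have d1: "?R \<inter> fst ` a = {}" by (auto simp: ray_vertices_def)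
  have d2: "(?R \<union> fst ` a) \<inter> snd ` ?C = {}"
  proof (rule ccontr)
    assume "(?R \<union> fst ` a) \<inter> snd ` ?C \<noteq> {}"
    then obtain v where v: "v \<in> snd ` ?C" "v \<in> ?R \<or> v \<in> fst ` a" by blast
    then obtain i where iv: "(i, v) \<in> a" by (auto simp: closed_cups_def)
    from v(2) show False
    proof
      assume "v \<in> fst ` a"
      then obtain j where "(v, j) \<in> a" by auto
      then show False using cup_left_not_right[OF D(1), of v j] iv by (auto simp: right_endpoint_def)
    qed (use iv in \<open>auto simp: ray_vertices_def\<close>)
  qed
  have "card {1..?r} = card (?R \<union> fst ` a) + card (snd ` ?C)"
    unfolding un by (rule card_Un_disjoint) (use finR fin finC d2 in auto)
  also have "card (?R \<union> fst ` a) = card ?R + card (fst ` a)"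
    by (rule card_Un_disjoint) (use finR fin d1 in auto)
  finally show "?r = ray_count n a ?r + k + card ?C"
    using left right by (simp add: ray_count_def)
  have "n = ray_count n a n + 2 * card (cups_in a 1 n)"
    by (rule uncovered_count[OF D(1)]) (use cd in \<open>fastforce simp: uncovered_def\<close>)+
  moreover have "cups_in a 1 n = a" using cd by (fastforce simp: cups_in_def)
  moreover have "ray_count n a ?r \<le> ray_count n a n"
    unfolding ray_count_def by (rule card_mono) (auto simp: ray_vertices_def)
  ultimately show "ray_count n a ?r + 2 * k \<le> n" using D(2) by simp
  have "card (snd ` (a - ?C)) \<le> card {?r + 1..n}"
    by (rule card_mono) (use cd in \<open>force simp: closed_cups_def\<close>)+
  also have "\<dots> \<le> m" by simp
  finally have "card (a - ?C) \<le> m"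
    using card_image[OF inj_on_subset[OF inj_on_snd_cups[OF D(1)], of "a - ?C"]] by simp
  moreover have "card (a - ?C) = k - card ?C" using card_Diff_subset[OF finC CA] D(2) by simp
  ultimately show "k - m \<le> card ?C" by simp
qed

text \<open>The letter \<open>e\<close> can be prescribed on any T that contains no whole cup:
  partners of vertices in T receive \<open>f\<close>, and the other cups keep the standard word.
  Such words probe which pairs are cups.\<close>

lemma admissible_choice:
  assumes a: "cup_diagram n a" and T: "\<And>x y. (x, y) \<in> a \<Longrightarrow> x \<in> T \<Longrightarrow> y \<notin> T"
  shows "admissible n r a (\<lambda>v. v \<in> T \<or> (\<not> right_endpoint a v \<and> (\<forall>u\<in>T. (v, u) \<notin> a)))" (is "admissible n r a ?w")
proof -
  have "?w x \<noteq> ?w y" if xy: "(x, y) \<in> a" for x y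
  proof (cases "y \<in> T")
    case True
    then show ?thesis using T[OF xy] xy by blast
  next
    case False
    have "\<not> right_endpoint a x" by (rule cup_left_not_right[OF a xy])
    moreover have "u = y" if "(x, u) \<in> a" for u using cup_diagram_disjoint[OF a xy that, of x] by simp
    moreover have "right_endpoint a y" using xy by (auto simp: right_endpoint_def)
    ultimately show ?thesis using False by blast
  qed
  moreover have "?w v" if "v \<in> ray_vertices n a" for v
    using that by (auto simp: ray_vertices_def right_endpoint_def)
  ultimately show ?thesis by (auto simp: admissible_def)
qed

text \<open>Cups across the cut line are nested, and below such a cup there is neither a ray nor,
  right of the line, a left endpoint. Their right endpoints therefore fill the vertices directly
  after the line, and the position of j is the number of crossing cups that start at i or
  later.\<close>

lemma open_cup_endpoint:
  assumes a: "a \<in> delta_cup_diagrams n k m" and ij: "(i, j) \<in> a" "n - m < j"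
  shows "j - (n - m) = card {x \<in> fst ` a - fst ` closed_cups (n - m) a. i \<le> x}"
proof -
  let ?r = "n - m"
  note D = delta_cup_diagramsD[OF a]
  note cd = cup_diagramD[OF D(1)]
  let ?O = "{(x, y) \<in> a. ?r < y \<and> i \<le> x}"
  have "snd ` ?O = {?r + 1..j}"
  proof (intro equalityI subsetI)
    fix u assume "u \<in> snd ` ?O"
    then obtain x where x: "(x, u) \<in> a" "?r < u" "i \<le> x" by auto
    have "u \<le> j"
    proof (cases "x = i")
      case True
      then show ?thesis using cup_diagram_disjoint[OF D(1) ij(1) x(1), of i] by simp
    next
      case False
      then show ?thesis
        using cup_diagram_crossing[OF D(1) ij(1) x(1)] x delta_left_endpoint[OF a x(1)] ij(2) by auto
    qed
    then show "u \<in> {?r + 1..j}" using x by simp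
  next
    fix u assume u: "u \<in> {?r + 1..j}"
    have ir: "i \<le> ?r" by (rule delta_left_endpoint[OF a ij(1)])
    show "u \<in> snd ` ?O"
    proof (cases "u = j")
      case True
      then show ?thesis using ij by force
    next
      case False
      then have "u \<notin> ray_vertices n a" using cup_diagram_ray[OF D(1) ij(1), of u] u ir by auto
      then obtain x where x: "(x, u) \<in> a"
        using D(3)[of u] u cd(3)[OF ij(1)] by (auto simp: right_endpoint_def)
      have "i \<le> x"
      proof (rule ccontr)
        assume "\<not> i \<le> x"
        then have "j < u" using cup_diagram_crossing[OF D(1) x ij(1)] u ir by auto
        then show False using u by simp
      qed
      then show ?thesis using x u by force
    qed
  qed
  then have "j - ?r = card (snd ` ?O)" by simp
  also have "\<dots> = card ?O" by (rule card_image) (rule inj_on_subset[OF inj_on_snd_cups[OF D(1)]], auto)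
  also have "\<dots> = card (fst ` ?O)" by (rule card_image[symmetric]) (rule inj_on_subset[OF inj_on_fst_cups[OF D(1)]], auto)
  also have "fst ` ?O = {x \<in> fst ` a - fst ` closed_cups ?r a. i \<le> x}"
  proof (intro equalityI subsetI)
    fix x assume "x \<in> fst ` ?O"
    then obtain y where y: "(x, y) \<in> a" "?r < y" "i \<le> x" by auto
    have "x \<notin> fst ` closed_cups ?r a"
    proof
      assume "x \<in> fst ` closed_cups ?r a"
      then obtain y' where "(x, y') \<in> a" "y' \<le> ?r" by (auto simp: closed_cups_def)
      then show False using cup_diagram_disjoint[OF D(1) y(1), of x y' x] y by simp
    qed
    then show "x \<in> {x \<in> fst ` a - fst ` closed_cups ?r a. i \<le> x}" using y by force
  next
    fix x assume x: "x \<in> {x \<in> fst ` a - fst ` closed_cups ?r a. i \<le> x}"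
    then obtain y where "(x, y) \<in> a" by auto
    moreover from this have "\<not> y \<le> ?r" using x by (force simp: closed_cups_def)
    ultimately show "x \<in> fst ` ?O" using x by force
  qed
  finally show ?thesis .
qed

text \<open>The left endpoints are the vertices before the cut that are neither rays nor right
  endpoints of closed cups. Once they are known, \<open>open_cup_endpoint\<close> recovers the
  crossing cups.\<close>

lemma delta_determined:
  assumes a: "a \<in> delta_cup_diagrams n k m" and b: "b \<in> delta_cup_diagrams n k m"
    and C: "closed_cups (n - m) a = closed_cups (n - m) b"
    and R: "{v \<in> ray_vertices n a. v \<le> n - m} = {v \<in> ray_vertices n b. v \<le> n - m}"
  shows "a = b"
proof -
  let ?r = "n - m"
  have fst_sub: "fst ` a \<subseteq> fst ` b"
    if a: "a \<in> delta_cup_diagrams n k m" and b: "b \<in> delta_cup_diagrams n k m"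
      and C: "closed_cups ?r a = closed_cups ?r b"
      and R: "{v \<in> ray_vertices n a. v \<le> ?r} = {v \<in> ray_vertices n b. v \<le> ?r}" for a b
  proof
    fix v assume "v \<in> fst ` a"
    then obtain j where j: "(v, j) \<in> a" by auto
    note Da = delta_cup_diagramsD[OF a]
    have v: "v \<le> ?r" "v \<in> {1..n}" using delta_left_endpoint[OF a j] cup_diagramD[OF Da(1) j] by auto
    show "v \<in> fst ` b" using v(2)
    proof (cases rule: vertex_cases[where a = b])
      case 1
      then have "v \<in> ray_vertices n a" using R v by auto
      then show ?thesis using j by (auto simp: ray_vertices_def)
    next
      case (2 j)
      then show ?thesis by force
    next
      case (3 i)
      then have "(i, v) \<in> closed_cups ?r a" using v C by (auto simp: closed_cups_def)
      then show ?thesis using cup_left_not_right[OF Da(1) j] by (auto simp: closed_cups_def right_endpoint_def)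
    qed
  qed
  have F: "fst ` a = fst ` b" using fst_sub[OF a b C R] fst_sub[OF b a C[symmetric] R[symmetric]] by blast
  have "a \<subseteq> b"
  proof safe
    fix i j assume ij: "(i, j) \<in> a"
    show "(i, j) \<in> b"
    proof (cases "j \<le> ?r")
      case True
      then show ?thesis using ij C by (auto simp: closed_cups_def)
    next
      case False
      obtain j' where j': "(i, j') \<in> b" using F ij by force
      have "?r < j'"
      proof (rule ccontr)
        assume "\<not> ?r < j'"
        then have "(i, j') \<in> a" using j' C by (auto simp: closed_cups_def)
        then have "j' = j" using cup_diagram_disjoint[OF delta_cup_diagramsD(1)[OF a] ij, of i j' i] by simp
        then show False using False \<open>\<not> ?r < j'\<close> by simp
      qed
      then have "j - ?r = j' - ?r"
        using open_cup_endpoint[OF a ij] open_cup_endpoint[OF b j'] False F C by simp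
      then have "j = j'" using \<open>?r < j'\<close> False by linarith
      then show ?thesis using j' by simp
    qed
  qed
  then show ?thesis
    using card_subset_eq[OF finite_cup_diagram[OF delta_cup_diagramsD(1)[OF b]]]
      delta_cup_diagramsD(2)[OF a] delta_cup_diagramsD(2)[OF b] by simp
qed

section \<open>No K_a is contained in another\<close>

context two_row
begin

text \<open>A diagram is recovered from the coordinate flags that \<open>K_a\<close> contains: a pair of vertices is a
  cup exactly when the letters there differ in every word, and a vertex carries a ray exactly when
  its letter is constant.\<close>

lemma K_component_antichain:
  assumes a: "a \<in> delta_cup_diagrams n k m" and b: "b \<in> delta_cup_diagrams n k m" and N: "n \<le> N"
    and sub: "K_component e z n m a \<subseteq> K_component e z n m b"
  shows "a = b"
proof -
  let ?r = "n - m"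
  note Da = delta_cup_diagramsD[OF a] and Db = delta_cup_diagramsD[OF b]
  have adm: "admissible n ?r b w" if "admissible n ?r a w" for w
    using word_flag_in_K[OF Da(1) N that] sub word_flag_K_admissible[OF Db(1) N] by blast
  have C: "closed_cups ?r b \<subseteq> closed_cups ?r a"
  proof safe
    fix i j assume "(i, j) \<in> closed_cups ?r b"
    then have ij: "(i, j) \<in> b" "j \<le> ?r" by (auto simp: closed_cups_def)
    have "(i, j) \<in> a"
    proof (rule ccontr)
      assume nin: "(i, j) \<notin> a"
      have T: "y \<notin> {i, j}" if "(x, y) \<in> a" "x \<in> {i, j}" for x y
      proof
        assume "y \<in> {i, j}"
        then have "x = i \<and> y = j" using that cup_diagramD(2)[OF Da(1) that(1)] cup_diagramD(2)[OF Db(1) ij(1)] by auto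
        then show False using that nin by simp
      qed
      \<comment> \<open>A word with \<open>e\<close> at both i and j is admissible for a, hence for
        b, where (i, j) is a cup.\<close>
      from admissible_cup[OF adm[OF admissible_choice[OF Da(1) T]] ij] show False by simp
    qed
    then show "(i, j) \<in> closed_cups ?r a" using ij by (simp add: closed_cups_def)
  qed
  have R: "{v \<in> ray_vertices n b. v \<le> ?r} \<subseteq> {v \<in> ray_vertices n a. v \<le> ?r}"
  proof safe
    fix v assume v: "v \<in> ray_vertices n b" "v \<le> ?r"
    show "v \<in> ray_vertices n a" using ray_vertices_range[OF v(1)]
    proof (cases rule: vertex_cases[where a = a])
      case (2 j)
      have T: "y \<notin> {j}" if "(x, y) \<in> a" "x \<in> {j}" for x y
        using that cup_diagramD(2)[OF Da(1) that(1)] by auto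
      have "v \<noteq> j" using cup_diagramD(2)[OF Da(1) 2] by simp
      \<comment> \<open>Here v is the left endpoint of a cup of a. Prescribing \<open>e\<close> at
        the right endpoint j puts \<open>f\<close> at v, although b has a ray there.\<close>
      have "admissible n ?r a (\<lambda>v. v \<in> {j} \<or> (\<not> right_endpoint a v \<and> (\<forall>u\<in>{j}. (v, u) \<notin> a)))"
        by (rule admissible_choice[OF Da(1)]) (use T in blast)
      from admissible_ray[OF adm[OF this] v] show ?thesis using 2 \<open>v \<noteq> j\<close> by blast
    next
      case (3 i)
      then show ?thesis using admissible_ray[OF adm[OF admissible_standard[OF Da(1)]] v] by (auto simp: right_endpoint_def)
    qed
  qed
  have finC: "finite (closed_cups ?r a)"
    by (rule finite_subset[OF _ finite_cup_diagram[OF Da(1)]]) (auto simp: closed_cups_def)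
  have finR: "finite {v \<in> ray_vertices n a. v \<le> ?r}" by (auto simp: ray_vertices_def)
  \<comment> \<open>By \<open>delta_count\<close> the rays before the cut and the closed cups add up
    to n - m - k for both diagrams, so the two inclusions are equalities.\<close>
  have le: "card (closed_cups ?r b) \<le> card (closed_cups ?r a)" "ray_count n b ?r \<le> ray_count n a ?r"
    using card_mono[OF finC C] card_mono[OF finR R] by (simp_all add: ray_count_def)
  then have "card (closed_cups ?r b) = card (closed_cups ?r a)" "ray_count n b ?r = ray_count n a ?r"
    using delta_count(1)[OF a] delta_count(1)[OF b] by linarith+
  then have "closed_cups ?r b = closed_cups ?r a"
    "{v \<in> ray_vertices n b. v \<le> ?r} = {v \<in> ray_vertices n a. v \<le> ?r}"
    using card_subset_eq[OF finC C] card_subset_eq[OF finR R] by (simp_all add: ray_count_def)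
  then show ?thesis using delta_determined[OF a b] by simp
qed

section \<open>Each K_a lies in the Delta-Springer variety\<close>

lemma delta_springer_iff:
  assumes "k \<le> n" "n \<le> N"
  shows "F \<in> delta_springer e f z n k m \<longleftrightarrow> F \<in> Y_flags z (n - m) \<and>
     E (n - k - m) (k - m) \<subseteq> flag_part F (n - m) \<and> flag_part F (n - m) \<subseteq> E (n - k) k"
  using z_pow_image_E[of "n - k" k m] assms by (simp add: delta_springer_def)

text \<open>After the last ray before the cut, each term is squeezed between two coordinate
  subspaces. A left endpoint enlarges the upper one by one in both blocks, because \<open>z\<close>
  maps the new term into the previous one, and keeps the lower one. A closed cup on 2 l vertices
  raises the bounds of the term before it by l in each block. The bounds at n - m then follow from
  \<open>delta_count\<close>.\<close>

lemma K_component_subset_springer: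
  assumes a: "a \<in> delta_cup_diagrams n k m" and N: "n < N" and k: "2 * k \<le> n"
  shows "K_component e z n m a \<subseteq> delta_springer e f z n k m"
proof
  fix F assume FK: "F \<in> K_component e z n m a"
  let ?r = "n - m" and ?w = "\<lambda>v. \<not> right_endpoint a v"
  note D = delta_cup_diagramsD[OF a]
  have N': "n \<le> N" using N by simp
  \<comment> \<open>The arithmetic of the final bounds: \<rho> rays and C closed cups before the
    cut, X letters \<open>e\<close> up to the cut, S letters \<open>e\<close> and T letters
    \<open>f\<close> up to the last ray.\<close>
  have numeric: "X \<le> n - k \<and> T + (X - S) \<le> k \<and> n - k - m \<le> S + (C - T) \<and> k - m \<le> C"
    if "n - m = \<rho> + k + C" "n - m = X + C" "S = T + \<rho>" "\<rho> + 2 * k \<le> n" "S \<le> X" "T \<le> C" "k - m \<le> C"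
    for \<rho> X S T C
  proof -
    have X: "X = \<rho> + k" using that by simp
    then have "X - S = k - T" "T \<le> k" using that by simp_all
    moreover have "S + (C - T) = \<rho> + C" using that by simp
    moreover have "n - k - m = \<rho> + C" using that(1) by simp
    ultimately show ?thesis using X that(4,7) by simp
  qed
  have FY: "F \<in> Y_flags z ?r" using FK by (simp add: K_component_def)
  have Fp: "F \<in> partial_flags ?r" by (rule Y_flags_partial[OF FY])
  have w: "admissible n ?r a ?w" by (rule admissible_standard[OF D(1)])
  define c where "c = count_e ?w"
  have cle: "c p \<le> p" for p unfolding c_def by (rule count_e_le)
  have cS: "c (Suc p) = c p + (if right_endpoint a (Suc p) then 0 else 1)" for p
    by (simp add: c_def count_e_Suc)
  \<comment> \<open>The last ray before the cut, or 0 when there is none; at s the term of the flag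
    is a known coordinate subspace.\<close>
  define s where "s = Max (insert 0 {v \<in> ray_vertices n a. v \<le> ?r})"
  have fin: "finite (insert 0 {v \<in> ray_vertices n a. v \<le> ?r})" by (auto simp: ray_vertices_def)
  have s_in: "s = 0 \<or> (s \<in> ray_vertices n a \<and> s \<le> ?r)" using Max_in[OF fin] by (auto simp: s_def)
  have s_max: "v \<le> s" if "v \<in> ray_vertices n a" "v \<le> ?r" for v
    unfolding s_def by (rule Max_ge[OF fin]) (use that in simp)
  have us: "uncovered a s" using s_in ray_uncovered[OF D(1)] cup_diagramD(1)[OF D(1)]
    by (fastforce simp: uncovered_def)
  have sr: "s \<le> ?r" "s \<le> n" using s_in by auto
  have rc: "ray_count n a s = ray_count n a ?r"
    unfolding ray_count_def by (rule arg_cong[of _ _ card]) (use s_max sr in auto)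
  have us': "c s = (s + ray_count n a s) div 2" "s - c s = (s - ray_count n a s) div 2"
    using uncovered_word[OF D(1) us sr(2) sr(1) w] by (simp_all add: c_def)
  have Fs: "flag_part F s = E (c s) (s - c s)"
    using K_component_uncovered[OF D(1) N' FK us sr(1)] us' by simp
  have sc: "c s = (s - c s) + ray_count n a s"
    using us'(1) uncovered_count[OF D(1) us sr(2)] by presburger
  have main: "flag_part F p \<subseteq> E (c p) (s - c s + (c p - c s)) \<and>
      E (c s + ((p - c p) - (s - c s))) (p - c p) \<subseteq> flag_part F p \<and> c s \<le> c p \<and> s - c s \<le> p - c p"
    if "s \<le> p" "p \<le> ?r" for p
    using that
  proof (induction p rule: less_induct)
    case (less p)
    show ?case
    proof (cases "p = s")
      case True
      then show ?thesis using Fs cle[of s] by simp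
    next
      case False
      then obtain p' where p': "p = Suc p'" "s \<le> p'" using less.prems by (cases p) auto
      have pn: "p \<in> {1..n}" using less.prems p' by auto
      then show ?thesis
      proof (cases rule: vertex_cases[where a = a])
        case 1
        then show ?thesis using s_max[OF 1 less.prems(2)] p' by simp
      next
        case (2 j)
        then have "\<not> right_endpoint a p" by (rule cup_left_not_right[OF D(1)])
        then have cp: "c p = Suc (c p')" using cS[of p'] p' by simp
        have IH: "flag_part F p' \<subseteq> E (c p') (s - c s + (c p' - c s))"
          "E (c s + ((p' - c p') - (s - c s))) (p' - c p') \<subseteq> flag_part F p'" "c s \<le> c p'" "s - c s \<le> p' - c p'"
          using less.IH[of p'] p' less.prems by auto
        have b: "c p' + 1 \<le> N" "s - c s + (c p' - c s) + 1 \<le> N"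
          using cle[of p'] IH(3,4) p' less.prems N by linarith+
        have "flag_part F p \<subseteq> E (c p' + 1) (s - c s + (c p' - c s) + 1)"
        proof
          fix v assume "v \<in> flag_part F p"
          then have "z v \<in> flag_part F p'" using Y_flags_step[OF FY, of p] p' less.prems by auto
          then have "(z ^^ 1) v \<in> E (c p') (s - c s + (c p' - c s))" using IH(1) by auto
          then show "v \<in> E (c p' + 1) (s - c s + (c p' - c s) + 1)" using z_pow_mem_E[OF b] by blast
        qed
        moreover have "flag_part F p' \<subseteq> flag_part F p"
          by (rule partial_flags_mono[OF Fp]) (use p' less.prems in auto)
        moreover have "p - c p = p' - c p'" using cp p' by simp
        ultimately show ?thesis using IH cp by (auto simp: Suc_diff_le)
      next
        case (3 i)
        let ?l = "(p - i + 1) div 2"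
        note bi = cup_diagramD[OF D(1) 3]
        have si: "s \<le> i - 1"
        proof (rule ccontr)
          assume "\<not> s \<le> i - 1"
          then have "i \<le> s" "s < p" using bi p' by auto
          then show False using us 3 by (fastforce simp: uncovered_def)
        qed
        have cp: "c p = c (i - 1) + ?l" unfolding c_def by (rule cup_word[OF D(1) 3 less.prems(2) w])
        have pl: "p = (i - 1) + 2 * ?l" by (rule cup_length(2)[OF D(1) 3])
        have IH: "flag_part F (i - 1) \<subseteq> E (c (i - 1)) (s - c s + (c (i - 1) - c s))"
          "E (c s + ((i - 1 - c (i - 1)) - (s - c s))) (i - 1 - c (i - 1)) \<subseteq> flag_part F (i - 1)"
          "c s \<le> c (i - 1)" "s - c s \<le> i - 1 - c (i - 1)"
        proof -
          have "i - 1 < p" "i - 1 \<le> ?r" using bi less.prems by linarith+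
          from less.IH[OF this(1) si this(2)] show "flag_part F (i - 1) \<subseteq> E (c (i - 1)) (s - c s + (c (i - 1) - c s))"
            "E (c s + ((i - 1 - c (i - 1)) - (s - c s))) (i - 1 - c (i - 1)) \<subseteq> flag_part F (i - 1)"
            "c s \<le> c (i - 1)" "s - c s \<le> i - 1 - c (i - 1)" by blast+
        qed
        have Fpp: "flag_part F p = (z ^^ ?l) -` flag_part F (i - 1)"
          using FK 3 less.prems(2) by (fastforce simp: K_component_def)
        have b1: "c (i - 1) + ?l \<le> N" "s - c s + (c (i - 1) - c s) + ?l \<le> N"
          using cle[of "i - 1"] IH(3,4) pl less.prems N by linarith+
        have b2: "c s + ((i - 1 - c (i - 1)) - (s - c s)) + ?l \<le> N" "i - 1 - c (i - 1) + ?l \<le> N"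
          using cle[of "i - 1"] cle[of s] IH(3,4) pl less.prems N by linarith+
        have sub1: "flag_part F p \<subseteq> E (c (i - 1) + ?l) (s - c s + (c (i - 1) - c s) + ?l)"
          unfolding Fpp z_pow_vimage_E[OF b1, symmetric] by (rule vimage_mono[OF IH(1)])
        have sub2: "E (c s + ((i - 1 - c (i - 1)) - (s - c s)) + ?l) (i - 1 - c (i - 1) + ?l) \<subseteq> flag_part F p"
          unfolding Fpp z_pow_vimage_E[OF b2, symmetric] by (rule vimage_mono[OF IH(2)])
        have gen: "A \<le> x \<Longrightarrow> x - A + l = x + 2 * l - (A + l)" "A \<le> x \<Longrightarrow> y + (x - A) + l = y + (x + l - A)"
          for A x y l :: nat by linarith+
        have eq1: "s - c s + (c (i - 1) - c s) + ?l = s - c s + (c p - c s)"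
          unfolding cp by (rule gen(2)[OF IH(3)])
        have eq2: "i - 1 - c (i - 1) + ?l = p - c p"
          using gen(1)[OF cle[of "i - 1"], of ?l] unfolding cp pl[symmetric] .
        have eq3: "c s + ((i - 1 - c (i - 1)) - (s - c s)) + ?l = c s + ((p - c p) - (s - c s))"
          unfolding eq2[symmetric] by (rule gen(2)[OF IH(4)])
        have "c s \<le> c p" using IH(3) unfolding cp by (rule trans_le_add1)
        moreover have "s - c s \<le> p - c p" using IH(4) unfolding eq2[symmetric] by (rule trans_le_add1)
        ultimately show ?thesis
          by (intro conjI sub1[unfolded eq1, folded cp] sub2[unfolded eq2 eq3])
      qed
    qed
  qed
  have rcr: "?r - c ?r = card (closed_cups ?r a)"
  proof -
    have "{1..?r} = {v \<in> {1..?r}. ?w v} \<union> {v \<in> {1..?r}. right_endpoint a v}" by auto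
    moreover have "card ({v \<in> {1..?r}. ?w v} \<union> {v \<in> {1..?r}. right_endpoint a v}) =
        card {v \<in> {1..?r}. ?w v} + card {v \<in> {1..?r}. right_endpoint a v}"
      by (rule card_Un_disjoint) auto
    ultimately have "card {1..?r} = card {v \<in> {1..?r}. ?w v} + card {v \<in> {1..?r}. right_endpoint a v}" by (simp only:)
    then show ?thesis using delta_count(2)[OF a] by (simp add: c_def count_e_def)
  qed
  from main[OF sr(1) order_refl] have M: "flag_part F ?r \<subseteq> E (c ?r) (s - c s + (c ?r - c s))"
    "E (c s + ((?r - c ?r) - (s - c s))) (?r - c ?r) \<subseteq> flag_part F ?r" "c s \<le> c ?r" "s - c s \<le> ?r - c ?r" by auto
  have num: "c ?r \<le> n - k" "s - c s + (c ?r - c s) \<le> k" "n - k - m \<le> c s + ((?r - c ?r) - (s - c s))" "k - m \<le> ?r - c ?r"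
  proof -
    have "n - m = c ?r + card (closed_cups ?r a)" using rcr cle[of ?r] by linarith
    from numeric[OF delta_count(1)[OF a] this sc[unfolded rc] delta_count(3)[OF a] M(3) M(4)[unfolded rcr] delta_count(4)[OF a]]
    show "c ?r \<le> n - k" "s - c s + (c ?r - c s) \<le> k" "n - k - m \<le> c s + ((?r - c ?r) - (s - c s))" "k - m \<le> ?r - c ?r"
      unfolding rcr by blast+
  qed
  have "k \<le> n" using k by simp
  then show "F \<in> delta_springer e f z n k m"
    using FY M(1,2) E_mono[OF num(1,2)] E_mono[OF num(3,4)] delta_springer_iff[OF _ N'] by blast
qed


end

lemma cup_diagramI:
  assumes range: "\<And>i j. (i, j) \<in> a \<Longrightarrow> 1 \<le> i \<and> i < j \<and> j \<le> n"
    and disj: "\<And>i j i' j' u. (i, j) \<in> a \<Longrightarrow> (i', j') \<in> a \<Longrightarrow> u \<in> {i, j} \<Longrightarrow> u \<in> {i', j'} \<Longrightarrow> i = i' \<and> j = j'"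
    and cross: "\<And>i j i' j'. (i, j) \<in> a \<Longrightarrow> (i', j') \<in> a \<Longrightarrow> i < i' \<Longrightarrow> i' < j \<Longrightarrow> j < j' \<Longrightarrow> False"
    and ray: "\<And>i j v. (i, j) \<in> a \<Longrightarrow> v \<in> ray_vertices n a \<Longrightarrow> i < v \<Longrightarrow> v < j \<Longrightarrow> False"
  shows "cup_diagram n a"
proof -
  have "{i, j} \<inter> {i', j'} = {}" if "(i, j) \<in> a" "(i', j') \<in> a" "(i, j) \<noteq> (i', j')" for i j i' j'
  proof (rule ccontr)
    assume "{i, j} \<inter> {i', j'} \<noteq> {}"
    then obtain u where "u \<in> {i, j}" "u \<in> {i', j'}" by blast
    from disj[OF that(1,2) this] that(3) show False by simp
  qed
  then have "\<forall>(i, j)\<in>a. \<forall>(i', j')\<in>a. (i, j) \<noteq> (i', j') \<longrightarrow> {i, j} \<inter> {i', j'} = {}"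
    by (simp only: Ball_def split_paired_All prod.case) blast
  moreover have "\<forall>(i, j)\<in>a. \<forall>(i', j')\<in>a. \<not> (i < i' \<and> i' < j \<and> j < j')" using cross by blast
  moreover have "\<forall>(i, j)\<in>a. \<forall>v \<in> ray_vertices n a. \<not> (i < v \<and> v < j)" using ray by blast
  moreover have "\<forall>(i, j)\<in>a. 1 \<le> i \<and> i < j \<and> j \<le> n" using range by blast
  ultimately show ?thesis unfolding cup_diagram_def by blast
qed

section \<open>Every flag of the Delta-Springer variety lies in some K_a\<close>

context two_row
begin

lemma z_ker: "1 \<le> N \<Longrightarrow> {v. z v = 0} = E 1 1"
  using z_pow_ker[of 1] by simp

text \<open>A subspace that contains the kernel of \<open>z\<close> is the full preimage of its
  image.\<close>

lemma image_subset_kernel_cancel: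
  assumes "1 \<le> N" "vec.subspace H" "E 1 1 \<subseteq> H" "z v \<in> z ` H"
  shows "v \<in> H"
proof -
  obtain h where h: "h \<in> H" "z v = z h" using assms(4) by blast
  then have "z (v - h) = 0" by (simp add: vec.linear_diff[OF lin])
  then have "v - h \<in> H" using z_ker assms(1,3) by blast
  from vec.subspace_add[OF assms(2) this h(1)] show ?thesis by simp
qed

lemma subspace_image: "vec.subspace H \<Longrightarrow> vec.subspace (z ` H)"
  by (rule vec.linear_subspace_image[OF lin])

lemma cover_base:
  assumes F: "F \<in> Y_flags z (n - m)" and N: "n < N" and mn: "m \<le> n" and k: "k \<le> n - m" "k \<le> m"
    and rays: "\<And>v. 1 \<le> v \<Longrightarrow> v \<le> n - m - k \<Longrightarrow> flag_part F v = E v 0"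
  shows "\<exists>a \<in> delta_cup_diagrams n k m. F \<in> K_component e z n m a"
proof
  let ?r = "n - m"
  \<comment> \<open>These are k nested cups around the cut line, with t counting outwards. Left
    endpoints fit because k \<le> n - m and right endpoints because k \<le> m; every other vertex is
    a ray.\<close>
  define a where "a = (\<lambda>t. (?r - t, ?r + 1 + t)) ` {..<k}"
  have aD: "(i, j) \<in> a \<longleftrightarrow> (\<exists>t<k. i = ?r - t \<and> j = ?r + 1 + t)" for i j by (auto simp: a_def)
  have rv: "v \<in> ray_vertices n a \<longleftrightarrow> v \<in> {1..n} \<and> \<not> (?r - k < v \<and> v \<le> ?r + k)" for v
  proof -
    have "(\<exists>t<k. v = ?r - t \<or> v = ?r + 1 + t) \<longleftrightarrow> ?r - k < v \<and> v \<le> ?r + k" if v: "1 \<le> v"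
    proof
      assume "\<exists>t<k. v = ?r - t \<or> v = ?r + 1 + t"
      then show "?r - k < v \<and> v \<le> ?r + k" using k v by auto
    next
      assume *: "?r - k < v \<and> v \<le> ?r + k"
      show "\<exists>t<k. v = ?r - t \<or> v = ?r + 1 + t"
      proof (cases "v \<le> ?r")
        case True
        then show ?thesis using * v k by (intro exI[of _ "?r - v"]) auto
      next
        case False
        then show ?thesis using * v k by (intro exI[of _ "v - ?r - 1"]) auto
      qed
    qed
    then show ?thesis by (auto simp: ray_vertices_def a_def)
  qed
  have cd: "cup_diagram n a"
    unfolding cup_diagram_def
  proof (intro conjI)
    show "\<forall>(i, j)\<in>a. 1 \<le> i \<and> i < j \<and> j \<le> n" using k mn by (auto simp: a_def)
    show "\<forall>(i, j)\<in>a. \<forall>(i', j')\<in>a. (i, j) \<noteq> (i', j') \<longrightarrow> {i, j} \<inter> {i', j'} = {}"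
      using k by (auto simp: a_def)
    show "\<forall>(i, j)\<in>a. \<forall>(i', j')\<in>a. \<not> (i < i' \<and> i' < j \<and> j < j')" using k by (auto simp: a_def)
    show "\<forall>(i, j)\<in>a. \<forall>v\<in>ray_vertices n a. \<not> (i < v \<and> v < j)"
    proof safe
      fix i j v assume "(i, j) \<in> a" "v \<in> ray_vertices n a" "i < v" "v < j"
      then show False using rv[of v] k by (auto simp: aD)
    qed
  qed
  have "inj_on (\<lambda>t. (?r - t, ?r + 1 + t)) {..<k}" by (auto simp: inj_on_def)
  then have "card a = k" by (simp add: a_def card_image)
  moreover have "v \<in> ray_vertices n a \<or> (\<exists>i. (i, v) \<in> a)" if v: "v \<in> {n - m + 1..n}" for v
  proof (cases "v \<le> ?r + k")
    case True
    then have "(?r - (v - ?r - 1), v) \<in> a" unfolding a_def using v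
      by (intro image_eqI[of _ _ "v - ?r - 1"]) auto
    then show ?thesis by blast
  qed (use v rv in auto)
  ultimately show "a \<in> delta_cup_diagrams n k m" using cd by (simp add: delta_cup_diagrams_def)
  have N': "n \<le> N" using N by simp
  have rc: "ray_count n a v = v" if "v \<le> ?r - k" for v
  proof -
    have "{u \<in> ray_vertices n a. u \<le> v} = {1..v}" using that by (auto simp: rv)
    then show ?thesis by (simp add: ray_count_def)
  qed
  show "F \<in> K_component e z n m a"
    unfolding K_component_iff[OF cd N']
  proof (intro conjI allI impI ballI F)
    fix i j assume "(i, j) \<in> a" "j \<le> ?r"
    then show "(z ^^ ((j - i + 1) div 2)) ` flag_part F j \<subseteq> flag_part F (i - 1)" by (auto simp: a_def)
  next
    fix v assume v: "v \<in> ray_vertices n a" "v \<le> ?r"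
    then have v': "v \<le> ?r - k" "1 \<le> v" by (auto simp: rv)
    show "flag_part F v = E ((v + ray_count n a v) div 2) ((v - ray_count n a v) div 2)"
      unfolding rc[OF v'(1)] using rays[OF v'(2,1)] by simp
  qed
qed

text \<open>Let q be the first index whose term contains the kernel of \<open>z\<close>. The term at
  q - 1 meets the kernel in dimension at most one, so its image has dimension at least q - 2 and
  equals the term at q - 2. The term at q contains the whole kernel, so its image has the same
  dimension and is again the term at q - 2. Hence i = q - 1 works.\<close>

lemma first_kernel:
  assumes F: "F \<in> Y_flags z r" and N: "r < N" and E: "E 1 1 \<subseteq> flag_part F r"
  obtains i where "1 \<le> i" "i + 1 \<le> r" "flag_part F (i + 1) = z -` flag_part F (i - 1)"
proof -
  note Fp = Y_flags_partial[OF F]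
  note part = partial_flags_part[OF Fp]
  define q where "q = (LEAST q. E 1 1 \<subseteq> flag_part F q)"
  have q: "E 1 1 \<subseteq> flag_part F q" unfolding q_def by (rule LeastI[of _ r]) (rule E)
  have qr: "q \<le> r" unfolding q_def by (rule Least_le) (rule E)
  have N1: "1 \<le> N" using N by simp
  have "vec.dim (E 1 1) \<le> vec.dim (flag_part F q)" by (rule vec.dim_subset[OF q])
  then have q2: "2 \<le> q" using dim_E[OF N1 N1] part(2)[OF qr] by simp
  have nq: "\<not> E 1 1 \<subseteq> flag_part F (q - 1)"
    using not_less_Least[of "q - 1" "\<lambda>q. E 1 1 \<subseteq> flag_part F q"] q2 by (simp add: q_def)
  have q1: "q - 1 \<le> r" "q - 2 \<le> r" using qr by auto
  have K: "{v. z v = 0} = E 1 1" by (rule z_ker[OF N1])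
  have "vec.dim (flag_part F (q - 1) \<inter> E 1 1) < 2"
  proof (rule ccontr)
    assume "\<not> vec.dim (flag_part F (q - 1) \<inter> E 1 1) < 2"
    then have "flag_part F (q - 1) \<inter> E 1 1 = E 1 1"
      by (intro vec.subspace_dim_equal vec.subspace_inter part(1)[OF q1(1)])
         (use dim_E[OF N1 N1] in simp_all)
    then show False using nq by blast
  qed
  then have d1: "q - 2 \<le> vec.dim (z ` flag_part F (q - 1))"
    using dim_image_plus_dim_kernel[OF lin part(1)[OF q1(1)]] part(2)[OF q1(1)] by (simp add: K)
  have "z ` flag_part F (q - 1) \<subseteq> flag_part F (q - 2)"
    using Y_flags_step[OF F, of "q - 1"] q2 qr by (simp add: numeral_2_eq_2)
  then have e1: "z ` flag_part F (q - 1) = flag_part F (q - 2)"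
    by (rule vec.subspace_dim_equal[OF subspace_image[OF part(1)[OF q1(1)]] part(1)[OF q1(2)]]) (use d1 part(2)[OF q1(2)] in simp)
  have "flag_part F q \<inter> E 1 1 = E 1 1" using q by blast
  then have "vec.dim (z ` flag_part F q) = q - 2"
    using dim_image_plus_dim_kernel[OF lin part(1)[OF qr]] part(2)[OF qr] dim_E[OF N1 N1] by (simp add: K)
  moreover have "flag_part F (q - 2) \<subseteq> z ` flag_part F q"
    using e1 partial_flags_mono[OF Fp qr, of "q - 1"] by auto
  ultimately have "flag_part F (q - 2) = z ` flag_part F q"
    by (intro vec.subspace_dim_equal subspace_image part(1) q1 qr) (use part(2)[OF q1(2)] in simp_all)
  moreover have qq: "q - 2 + 2 * 1 = q" using q2 by simp
  ultimately have "flag_part F q = (z ^^ 1) -` flag_part F (q - 2)"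
    using Y_flags_vimage_iff[OF F, of "q - 2" 1] qr N unfolding qq by simp
  then have "flag_part F q = z -` flag_part F (q - 2)" by simp
  then show ?thesis using that[of "q - 1"] q2 qr by (simp add: numeral_2_eq_2)
qed

text \<open>The last term meets the kernel of \<open>z\<close> only in the line F_1, so
  \<open>z\<close> acts on it as a single Jordan block, whose invariant subspaces form one chain.
  Containing \<open>E s 0\<close> pins down the beginning of that chain.\<close>

lemma regular_flag_part:
  assumes F: "F \<in> Y_flags z r" and N: "r < N" and nE: "\<not> E 1 1 \<subseteq> flag_part F r" and s: "E s 0 \<subseteq> flag_part F r"
  shows "v \<le> s \<Longrightarrow> s \<le> r \<Longrightarrow> flag_part F v = E v 0"
proof (induction v)
  case 0
  then show ?case by simp
next
  case (Suc v)
  note Fp = Y_flags_partial[OF F]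
  note part = partial_flags_part[OF Fp]
  have N1: "1 \<le> N" using N by simp
  have K: "{v. z v = 0} = E 1 1" by (rule z_ker[OF N1])
  have p: "Suc v \<le> r" "v \<le> r" using Suc.prems by auto
  have IH: "flag_part F v = E v 0" using Suc by simp
  have ker: "vec.dim (H \<inter> E 1 1) \<le> 1" if "H \<subseteq> flag_part F r" "vec.subspace H" for H
  proof (rule ccontr)
    assume "\<not> vec.dim (H \<inter> E 1 1) \<le> 1"
    then have "H \<inter> E 1 1 = E 1 1"
      by (intro vec.subspace_dim_equal vec.subspace_inter that) (use dim_E[OF N1 N1] in simp_all)
    then show False using nE that by blast
  qed
  have sub: "flag_part F (Suc v) \<subseteq> flag_part F r" by (rule partial_flags_mono[OF Fp _ p(1)]) simp
  have "v \<le> vec.dim (z ` flag_part F (Suc v))"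
    using dim_image_plus_dim_kernel[OF lin part(1)[OF p(1)]] part(2)[OF p(1)] ker[OF sub part(1)[OF p(1)]] by (simp add: K)
  moreover have "z ` flag_part F (Suc v) \<subseteq> flag_part F v" using Y_flags_step[OF F _ p(1)] by simp
  ultimately have im: "z ` flag_part F (Suc v) = flag_part F v"
    by (intro vec.subspace_dim_equal subspace_image part(1) p) (use part(2)[OF p(2)] in simp_all)
  have r1: "1 \<le> r" using p by simp
  have F1: "flag_part F 1 = flag_part F r \<inter> E 1 1"
  proof (rule vec.subspace_dim_equal)
    have "flag_part F 1 \<subseteq> flag_part F r" by (rule partial_flags_mono[OF Fp _ r1]) simp
    moreover have "flag_part F 1 \<subseteq> E 1 1" by (rule Y_flags_subset_E[OF F r1 N1])
    ultimately show "flag_part F 1 \<subseteq> flag_part F r \<inter> E 1 1" by blast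
    show "vec.dim (flag_part F r \<inter> E 1 1) \<le> vec.dim (flag_part F 1)"
      using ker[OF subset_refl part(1)[OF order_refl]] part(2)[OF r1] by simp
    show "vec.subspace (flag_part F 1)" by (rule part(1)[OF r1])
    show "vec.subspace (flag_part F r \<inter> E 1 1)" by (intro vec.subspace_inter part(1)) simp_all
  qed
  have vN: "Suc v \<le> N" using p N by simp
  have "e (Suc v) \<in> E s 0" unfolding E_space_def using Suc.prems by (intro vec.span_base) auto
  then have eF: "e (Suc v) \<in> flag_part F r" using s by blast
  have "z (e (Suc v)) = e v" using ze[of "Suc v"] vN by simp
  also have "e v \<in> E v 0"
    using e0 unfolding E_space_def by (cases v) (auto intro: vec.span_base simp: vec.span_zero)
  finally have "z (e (Suc v)) \<in> z ` flag_part F (Suc v)" using IH im by simp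
  \<comment> \<open>Both y and \<open>e (Suc v)\<close> lie in the last term and have the same image
    under \<open>z\<close>, so they differ by an element of F_1, which the term at v + 1
    contains.\<close>
  then obtain y where y: "y \<in> flag_part F (Suc v)" "z (e (Suc v)) = z y" by blast
  then have "z (e (Suc v) - y) = 0" by (simp add: vec.linear_diff[OF lin])
  moreover have "e (Suc v) - y \<in> flag_part F r" using eF y sub vec.subspace_diff[OF part(1)[OF order_refl]] by blast
  ultimately have "e (Suc v) - y \<in> flag_part F 1" using F1 K by blast
  moreover have "flag_part F 1 \<subseteq> flag_part F (Suc v)" by (rule partial_flags_mono[OF Fp p(1)]) simp
  ultimately have eS: "e (Suc v) \<in> flag_part F (Suc v)"
    using vec.subspace_add[OF part(1)[OF p(1)] _ y(1), of "e (Suc v) - y"] by auto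
  have "E v 0 \<subseteq> flag_part F (Suc v)" using IH partial_flags_mono[OF Fp p(1), of v] by simp
  moreover have "vec.span {e (Suc v)} \<subseteq> flag_part F (Suc v)" by (rule vec.span_minimal) (use eS part(1)[OF p(1)] in auto)
  ultimately have "E (Suc v) 0 \<subseteq> flag_part F (Suc v)"
    unfolding E_Suc_left[symmetric] using vec.subspace_add[OF part(1)[OF p(1)]] by blast
  then show ?case
    by (intro partial_flags_subset_eq(2)[OF Fp p(1)]) (use vN in \<open>auto simp: dim_E\<close>)
qed


text \<open>Applied when \<open>F\<^bsub>i+1\<^esub> = z\<^sup>-\<^sup>1 F\<^bsub>i-1\<^esub>\<close>: then \<open>z\<close> maps \<open>F\<^bsub>i+1\<^esub>\<close> onto \<open>F\<^bsub>i-1\<^esub>\<close>, so the images of the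
  later terms continue \<open>F\<^sub>1, \<dots>, F\<^bsub>i-1\<^esub>\<close>.\<close>

definition contract :: "nat \<Rightarrow> 'd flag \<Rightarrow> 'd flag" where
  "contract i F = take (i - 1) F @ map ((`) z) (drop (i + 1) F)"

lemma contract_part:
  assumes F: "F \<in> partial_flags r" and i: "1 \<le> i" "i + 1 \<le> r" and p: "p \<le> r - 2"
    and v: "flag_part F (i + 1) = z -` flag_part F (i - 1)" and N: "i \<le> N" "flag_part F (i - 1) \<subseteq> E (N - 1) (N - 1)"
  shows "p < i \<Longrightarrow> flag_part (contract i F) p = flag_part F p"
    "i \<le> Suc p \<Longrightarrow> flag_part (contract i F) p = z ` flag_part F (p + 2)"
proof -
  have len: "length F = r" using F by (simp add: partial_flags_def)
  have im: "z ` flag_part F (i + 1) = flag_part F (i - 1)"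
    using z_pow_image_vimage[of 1 "flag_part F (i - 1)"] N i unfolding v by simp
  show 1: "flag_part (contract i F) p = flag_part F p" if "p < i"
    using that len i by (auto simp: flag_part_def contract_def nth_append)
  show "flag_part (contract i F) p = z ` flag_part F (p + 2)" if ip: "i \<le> Suc p"
  proof (cases "i = Suc p")
    case True
    then show ?thesis using 1 im by simp
  next
    case False
    then have "i \<le> p" using ip by simp
    then have "contract i F ! (p - 1) = z ` (F ! (i + 1 + (p - 1 - (i - 1))))"
      using len i p by (auto simp: contract_def nth_append)
    also have "i + 1 + (p - 1 - (i - 1)) = p + 1" using \<open>i \<le> p\<close> i by simp
    finally show ?thesis using \<open>i \<le> p\<close> i by (simp add: flag_part_def)
  qed
qed

text \<open>Undoes the removal of a cup between neighbours: vertices from i on move right by two and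
  make room for i and i + 1.\<close>

definition insert_cup :: "nat \<Rightarrow> (nat \<times> nat) set \<Rightarrow> (nat \<times> nat) set" where
  "insert_cup i a = insert (i, i + 1) ((\<lambda>(x, y). (if x < i then x else x + 2, if y < i then y else y + 2)) ` a)"

lemma insert_cup_cases:
  assumes "(x, y) \<in> insert_cup i a"
  obtains "x = i" "y = i + 1"
  | x' y' where "(x', y') \<in> a" "x = (if x' < i then x' else x' + 2)" "y = (if y' < i then y' else y' + 2)"
  using assms by (auto simp: insert_cup_def)

lemma ray_vertices_insert_cup:
  assumes i: "1 \<le> i" "i + 1 \<le> n"
  shows "v \<in> ray_vertices n (insert_cup i a) \<longleftrightarrow>
    (v < i \<and> v \<in> ray_vertices (n - 2) a) \<or> (i + 2 \<le> v \<and> v - 2 \<in> ray_vertices (n - 2) a)"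
proof -
  consider "v < i" | "v = i \<or> v = i + 1" | "i + 2 \<le> v" by linarith
  then show ?thesis
  proof cases
    case 1
    then have "(\<forall>(x, y)\<in>insert_cup i a. v \<noteq> x \<and> v \<noteq> y) \<longleftrightarrow> (\<forall>(x, y)\<in>a. v \<noteq> x \<and> v \<noteq> y)"
      by (auto simp: insert_cup_def split: if_splits)
    then show ?thesis using 1 i by (auto simp: ray_vertices_def)
  next
    case 2
    then show ?thesis by (auto simp: ray_vertices_def insert_cup_def)
  next
    case 3
    define u where "u = v - 2"
    have u: "v = u + 2" "i \<le> u" using 3 by (auto simp: u_def)
    have "(\<forall>(x, y)\<in>insert_cup i a. v \<noteq> x \<and> v \<noteq> y) \<longleftrightarrow> (\<forall>(x, y)\<in>a. u \<noteq> x \<and> u \<noteq> y)"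
      using u by (auto simp: insert_cup_def split: if_splits)
    then show ?thesis using u i by (auto simp: ray_vertices_def)
  qed
qed

text \<open>The relabelling is strictly increasing and omits i and i + 1, between which nothing
  lies, so every condition on diagrams transfers. As i + 1 \<le> n - m, the vertices right of the
  cut are only relabelled.\<close>

lemma delta_insert_cup:
  assumes a: "a \<in> delta_cup_diagrams (n - 2) (k - 1) m" and i: "1 \<le> i" "i + 1 \<le> n - m" and k: "1 \<le> k"
  shows "insert_cup i a \<in> delta_cup_diagrams n k m"
proof -
  note D = delta_cup_diagramsD[OF a]
  note cd = cup_diagramD[OF D(1)]
  let ?\<sigma> = "\<lambda>v. if v < i then v else v + 2"
  have n: "i + 1 \<le> n" using i by simp
  note rv = ray_vertices_insert_cup[OF i(1) n]
  have inj: "?\<sigma> x = ?\<sigma> y \<longleftrightarrow> x = y" "?\<sigma> x < ?\<sigma> y \<longleftrightarrow> x < y" for x y by auto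
  have range: "?\<sigma> x \<noteq> i" "?\<sigma> x \<noteq> i + 1" for x by auto
  have "cup_diagram n (insert_cup i a)"
  proof (rule cup_diagramI)
    fix x y assume xy: "(x, y) \<in> insert_cup i a"
    from xy show "1 \<le> x \<and> x < y \<and> y \<le> n"
    proof (cases rule: insert_cup_cases)
      case (2 s t)
      then show ?thesis using cd[OF 2(1)] n by auto
    qed (use i n in auto)
    { fix x' y' u assume xy': "(x', y') \<in> insert_cup i a" and u: "u \<in> {x, y}" "u \<in> {x', y'}"
      from xy show "x = x' \<and> y = y'"
      proof (cases rule: insert_cup_cases)
        case 1
        note 1 = this
        from xy' show ?thesis
        proof (cases rule: insert_cup_cases)
          case (2 s t)
          then show ?thesis using 1 u range[of s] range[of t] by auto
        qed (use 1 in simp)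
      next
        case (2 s t)
        note st = this
        from xy' show ?thesis
        proof (cases rule: insert_cup_cases)
          case 1
          then show ?thesis using st u range[of s] range[of t] by auto
        next
          case (2 s' t')
          obtain w where w: "u = ?\<sigma> w" "w \<in> {s, t}" using u(1) st by auto
          obtain w' where w': "u = ?\<sigma> w'" "w' \<in> {s', t'}" using u(2) 2 by auto
          have "w = w'" using inj(1)[of w w'] w(1) w'(1) by metis
          then have "s = s' \<and> t = t'" using cup_diagram_disjoint[OF D(1) st(1) 2(1)] w(2) w'(2) by blast
          then show ?thesis using st 2 by simp
        qed
      qed }
    { fix x' y' assume xy': "(x', y') \<in> insert_cup i a" and c: "x < x'" "x' < y" "y < y'"
      from xy show False
      proof (cases rule: insert_cup_cases)
        case (2 s t)
        note st = this
        from xy' show False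
        proof (cases rule: insert_cup_cases)
          case (2 s' t')
          have "s < s'" "s' < t" "t < t'"
            using c inj(2)[of s s'] inj(2)[of s' t] inj(2)[of t t'] unfolding st(2,3) 2(2,3) by blast+
          then show False using cup_diagram_crossing[OF D(1) st(1) 2(1)] by simp
        qed (use c in auto)
      qed (use c in auto) }
    fix v assume v: "v \<in> ray_vertices n (insert_cup i a)" and c: "x < v" "v < y"
    have "\<exists>u. v = ?\<sigma> u \<and> u \<in> ray_vertices (n - 2) a"
      using v unfolding rv
    proof
      assume "i + 2 \<le> v \<and> v - 2 \<in> ray_vertices (n - 2) a"
      then show ?thesis by (intro exI[of _ "v - 2"]) auto
    qed auto
    then obtain u where u: "v = ?\<sigma> u" "u \<in> ray_vertices (n - 2) a" by blast
    from xy show False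
    proof (cases rule: insert_cup_cases)
      case (2 s t)
      have "s < u" "u < t" using c inj(2)[of s u] inj(2)[of u t] unfolding u(1) 2(2,3) by blast+
      then show ?thesis using cup_diagram_ray[OF D(1) 2(1) u(2)] by simp
    qed (use c in auto)
  qed
  moreover have "card (insert_cup i a) = k"
  proof -
    let ?g = "\<lambda>(x, y). (?\<sigma> x, ?\<sigma> y)"
    have "inj_on ?g a" by (rule inj_onI) (auto split: if_splits)
    from card_image[OF this] have "card (?g ` a) = k - 1" using D(2) by simp
    moreover have "(i, i + 1) \<notin> ?g ` a" by (auto split: if_splits)
    moreover have "finite (?g ` a)" using finite_cup_diagram[OF D(1)] by simp
    ultimately show ?thesis using k by (simp add: insert_cup_def)
  qed
  moreover have "v \<in> ray_vertices n (insert_cup i a) \<or> (\<exists>x. (x, v) \<in> insert_cup i a)" if v: "v \<in> {n - m + 1..n}" for v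
  proof -
    have v2: "i + 2 \<le> v" using v i by simp
    then have "n - 2 - m < v - 2" "v - 2 \<le> n - 2" using v i by auto
    from D(3)[OF this] consider "v - 2 \<in> ray_vertices (n - 2) a" | "right_endpoint a (v - 2)" by blast
    then show ?thesis
    proof cases
      case 2
      then obtain x where "(x, v - 2) \<in> a" by (auto simp: right_endpoint_def)
      then have "(?\<sigma> x, ?\<sigma> (v - 2)) \<in> insert_cup i a" by (force simp: insert_cup_def)
      moreover have "?\<sigma> (v - 2) = v" using v2 by auto
      ultimately have "(?\<sigma> x, v) \<in> insert_cup i a" by (simp only:)
      then show ?thesis by blast
    qed (use rv v2 in blast)
  qed
  ultimately show ?thesis by (simp add: delta_cup_diagrams_def)
qed


text \<open>The terms from i + 1 on contain the kernel of \<open>z\<close>, so inclusions between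
  their images lift back. This allows the conditions on the contracted flag to be read as conditions
  on F.\<close>

lemma cover_contract:
  assumes F: "F \<in> Y_flags z (n - m)" and N: "n < N" and i: "1 \<le> i" "i + 1 \<le> n - m"
    and v: "flag_part F (i + 1) = z -` flag_part F (i - 1)"
  shows "contract i F \<in> Y_flags z (n - 2 - m)"
    "a \<in> delta_cup_diagrams (n - 2) (k - 1) m \<Longrightarrow> 1 \<le> k \<Longrightarrow> contract i F \<in> K_component e z (n - 2) m a \<Longrightarrow>
      F \<in> K_component e z n m (insert_cup i a)"
proof -
  let ?r = "n - m" and ?G = "contract i F"
  note Fp = Y_flags_partial[OF F]
  note part = partial_flags_part[OF Fp]
  have r2: "n - 2 - m = ?r - 2" by simp
  have N1: "1 \<le> N" "i \<le> N" using N i by auto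
  have K: "{v. z v = 0} = E 1 1" by (rule z_ker[OF N1(1)])
  have sub: "flag_part F (i - 1) \<subseteq> E (N - 1) (N - 1)"
    proof -
    have "i - 1 \<le> n - m" "i - 1 \<le> N" "i - 1 \<le> N - 1" using i N by auto
    then show ?thesis using Y_flags_subset_E[OF F, of "i - 1"] E_mono[of "i - 1" "N - 1" "i - 1" "N - 1"] by blast
  qed
  note cp = contract_part[OF Fp i _ v N1(2) sub]
  have ker: "E 1 1 \<subseteq> flag_part F p" if "i + 1 \<le> p" "p \<le> ?r" for p
  proof -
    have "E 1 1 \<subseteq> flag_part F (i + 1)" unfolding v K[symmetric] using vec.subspace_0[OF part(1)[of "i - 1"]] i by auto
    also have "\<dots> \<subseteq> flag_part F p" by (rule partial_flags_mono[OF Fp that(2,1)])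
    finally show ?thesis .
  qed
  have dim: "vec.dim (z ` flag_part F (p + 2)) = p" if "i \<le> p + 1" "p + 2 \<le> ?r" for p
  proof -
    have "flag_part F (p + 2) \<inter> E 1 1 = E 1 1" using ker[of "p + 2"] that by auto
    then show ?thesis
      using dim_image_plus_dim_kernel[OF lin part(1)[OF that(2)]] part(2)[OF that(2)] dim_E[OF N1(1) N1(1)] by (simp add: K)
  qed
  show G: "?G \<in> Y_flags z (n - 2 - m)"
    unfolding Y_flags_def partial_flags_def mem_Collect_eq r2
  proof (intro conjI ballI)
    show "length ?G = ?r - 2" using Fp i by (auto simp: contract_def partial_flags_def)
    fix p assume p: "p \<in> {1..?r - 2}"
    have "vec.subspace (flag_part ?G p) \<and> vec.dim (flag_part ?G p) = p \<and>
        flag_part ?G (p - 1) \<subseteq> flag_part ?G p \<and> z ` flag_part ?G p \<subseteq> flag_part ?G (p - 1)"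
    proof (cases "p < i")
      case True
      then have "flag_part ?G p = flag_part F p" "flag_part ?G (p - 1) = flag_part F (p - 1)" using cp(1) p by auto
      moreover have pr: "p \<le> ?r" "1 \<le> p" "p - 1 \<le> p" using p by auto
      ultimately show ?thesis
        using part[OF pr(1)] partial_flags_mono[OF Fp pr(1,3)] Y_flags_step[OF F pr(2,1)] by simp
    next
      case False
      then have eq: "flag_part ?G p = z ` flag_part F (p + 2)" "flag_part ?G (p - 1) = z ` flag_part F (p + 1)"
        using cp(2)[of p] cp(2)[of "p - 1"] p by auto
      have "flag_part F (p + 1) \<subseteq> flag_part F (p + 2)" by (rule partial_flags_mono[OF Fp]) (use p in auto)
      moreover have "p + 2 \<le> ?r" using p by auto
      then have "z ` flag_part F (p + 2) \<subseteq> flag_part F (p + 1)" using Y_flags_step[OF F, of "p + 2"] by simp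
      ultimately show ?thesis unfolding eq using dim[of p] subspace_image[OF part(1)[of "p + 2"]] False p by auto
    qed
    then show "vec.subspace (flag_part ?G p)" "vec.dim (flag_part ?G p) = p"
      "flag_part ?G (p - 1) \<subseteq> flag_part ?G p" "z ` flag_part ?G p \<subseteq> flag_part ?G (p - 1)" by auto
  qed
  assume a: "a \<in> delta_cup_diagrams (n - 2) (k - 1) m" and k: "1 \<le> k" and GK: "?G \<in> K_component e z (n - 2) m a"
  note D = delta_cup_diagramsD[OF a]
  note cd = cup_diagramD[OF D(1)]
  have N': "n \<le> N" "n - 2 \<le> N" using N by auto
  have n: "i + 1 \<le> n" using i by simp
  have Dn: "cup_diagram n (insert_cup i a)" using delta_cup_diagramsD(1)[OF delta_insert_cup[OF a i k]] .
  note GK' = GK[unfolded K_component_iff[OF D(1) N'(2)]]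
  show "F \<in> K_component e z n m (insert_cup i a)"
    unfolding K_component_iff[OF Dn N'(1)]
  proof (intro conjI allI impI ballI F)
    fix x y assume xy: "(x, y) \<in> insert_cup i a" and y: "y \<le> ?r"
    from xy show "(z ^^ ((y - x + 1) div 2)) ` flag_part F y \<subseteq> flag_part F (x - 1)"
    proof (cases rule: insert_cup_cases)
      case 1
      then show ?thesis using v by auto
    next
      case (2 s t)
      let ?l = "(t - s + 1) div 2"
      have st: "1 \<le> s" "s < t" "t \<le> ?r - 2" using cd[OF 2(1)] y 2 i by (auto split: if_splits)
      have G': "(z ^^ ?l) ` flag_part ?G t \<subseteq> flag_part ?G (s - 1)" using GK' 2(1) st by auto
      consider "t < i" | "i \<le> s" | "s < i" "i \<le> t" by linarith
      then show ?thesis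
      proof cases
        case 1
        then show ?thesis using G' cp(1)[of t] cp(1)[of "s - 1"] 2 st by auto
      next
        \<comment> \<open>The cup starts after the new one: both terms are images, and
          \<open>z\<close> is cancelled because the target contains the kernel.\<close>
        case c: 2
        have "flag_part ?G t = z ` flag_part F (t + 2)" using cp(2)[of t] c st by simp
        moreover have "flag_part ?G (s - 1) = z ` flag_part F (s + 1)" using cp(2)[of "s - 1"] c st by simp
        ultimately have G'': "(z ^^ ?l) ` (z ` flag_part F (t + 2)) \<subseteq> z ` flag_part F (s + 1)" using G' by simp
        have "(z ^^ ?l) u \<in> flag_part F (s + 1)" if "u \<in> flag_part F (t + 2)" for u
        proof (rule image_subset_kernel_cancel[OF N1(1) part(1) ker])
          have "z ((z ^^ ?l) u) = (z ^^ ?l) (z u)" by (simp add: funpow_swap1)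
          then show "z ((z ^^ ?l) u) \<in> z ` flag_part F (s + 1)" using G'' that by auto
        qed (use c st in auto)
        then show ?thesis using 2 c st by auto
      next
        \<comment> \<open>The cup encloses the new one: only the term at its right end is an image,
          and the extra \<open>z\<close> is the additional half-length of the longer cup.\<close>
        case c: 3
        have "flag_part ?G t = z ` flag_part F (t + 2)" using cp(2)[of t] c st by simp
        moreover have "flag_part ?G (s - 1) = flag_part F (s - 1)" using cp(1)[of "s - 1"] c st by simp
        ultimately have "(z ^^ ?l) ` (z ` flag_part F (t + 2)) \<subseteq> flag_part F (s - 1)" using G' by simp
        then have "(z ^^ (?l + 1)) ` flag_part F (t + 2) \<subseteq> flag_part F (s - 1)"
          by (auto simp: funpow_swap1)
        moreover have "(y - x + 1) div 2 = ?l + 1" using 2 c st by auto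
        ultimately show ?thesis using 2 c by auto
      qed
    qed
  next
    fix u assume u: "u \<in> ray_vertices n (insert_cup i a)" and ur: "u \<le> ?r"
    let ?a = "insert_cup i a"
    note rv = ray_vertices_insert_cup[OF i(1) n, of _ a]
    show "flag_part F u = E ((u + ray_count n ?a u) div 2) ((u - ray_count n ?a u) div 2)"
    proof (cases "u < i")
      case True
      then have "{v \<in> ray_vertices n ?a. v \<le> u} = {v \<in> ray_vertices (n - 2) a. v \<le> u}" by (auto simp: rv)
      then have rc: "ray_count n ?a u = ray_count (n - 2) a u" by (simp add: ray_count_def)
      have ua: "u \<in> ray_vertices (n - 2) a" using u True by (auto simp: rv)
      have "u \<le> ?r - 2" using True i by simp
      then have "flag_part ?G u = E ((u + ray_count (n - 2) a u) div 2) ((u - ray_count (n - 2) a u) div 2)"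
        using GK' ua by auto
      then show ?thesis using cp(1)[OF \<open>u \<le> ?r - 2\<close> True] rc by simp
    next
      case False
      then have u2: "i + 2 \<le> u" "u - 2 \<in> ray_vertices (n - 2) a" using u by (auto simp: rv)
      define t where "t = u - 2"
      have t: "u = t + 2" "t \<in> ray_vertices (n - 2) a" "i \<le> t" "t \<le> ?r - 2" using u2 ur by (auto simp: t_def)
      let ?\<rho> = "ray_count (n - 2) a t"
      \<comment> \<open>The new cup carries no ray, so the ray count at u = t + 2 is the one at t.
        The half-sum and the half-difference both grow by one, matching a preimage under
        \<open>z\<close>.\<close>
      have "{v \<in> ray_vertices n ?a. v \<le> u} = (\<lambda>v. if v < i then v else v + 2) ` {v \<in> ray_vertices (n - 2) a. v \<le> t}"
      proof (intro equalityI subsetI)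
        fix w assume w: "w \<in> {v \<in> ray_vertices n ?a. v \<le> u}"
        show "w \<in> (\<lambda>v. if v < i then v else v + 2) ` {v \<in> ray_vertices (n - 2) a. v \<le> t}"
        proof (cases "w < i")
          case True
          then show ?thesis using w t by (intro image_eqI[of _ _ w]) (auto simp: rv)
        next
          case False
          then show ?thesis using w t by (intro image_eqI[of _ _ "w - 2"]) (auto simp: rv)
        qed
      next
        fix w assume "w \<in> (\<lambda>v. if v < i then v else v + 2) ` {v \<in> ray_vertices (n - 2) a. v \<le> t}"
        then show "w \<in> {v \<in> ray_vertices n ?a. v \<le> u}" using t by (auto simp: rv)
      qed
      moreover have "inj_on (\<lambda>v. if v < i then v else v + 2) X" for X by (auto simp: inj_on_def)
      ultimately have "card {v \<in> ray_vertices n ?a. v \<le> u} = card {v \<in> ray_vertices (n - 2) a. v \<le> t}"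
        by (simp only: card_image)
      then have rc: "ray_count n ?a u = ?\<rho>" by (simp only: ray_count_def)
      have un: "uncovered a t" by (rule ray_uncovered[OF D(1) t(2)])
      have tn: "t \<le> n - 2" using t by simp
      have tr: "t = ?\<rho> + 2 * card (cups_in a 1 t)" by (rule uncovered_count[OF D(1) un tn])
      let ?x = "(t + ?\<rho>) div 2" and ?y = "(t - ?\<rho>) div 2"
      have xy: "?x \<le> t" "?y \<le> t" "(u + ?\<rho>) div 2 = ?x + 1" "(u - ?\<rho>) div 2 = ?y + 1"
      proof -
        have gen: "(t + \<rho>) div 2 \<le> t \<and> (t - \<rho>) div 2 \<le> t \<and> (t + 2 + \<rho>) div 2 = (t + \<rho>) div 2 + 1 \<and>
            (t + 2 - \<rho>) div 2 = (t - \<rho>) div 2 + 1" if "t = \<rho> + 2 * X" for t \<rho> X :: nat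
          using that by simp
        note g = gen[OF tr]
        show "?x \<le> t" by (rule conjunct1[OF g])
        show "?y \<le> t" by (rule conjunct1[OF conjunct2[OF g]])
        show "(u + ?\<rho>) div 2 = ?x + 1" unfolding t(1) by (rule conjunct1[OF conjunct2[OF conjunct2[OF g]]])
        show "(u - ?\<rho>) div 2 = ?y + 1" unfolding t(1) by (rule conjunct2[OF conjunct2[OF conjunct2[OF g]]])
      qed
      have "flag_part ?G t = E ?x ?y" using GK' t by auto
      then have zF: "z ` flag_part F u = E ?x ?y" using cp(2)[OF t(4)] t by simp
      have tN: "t + 1 \<le> N" using t(4) N i by linarith
      have b: "?x + 1 \<le> N" "?y + 1 \<le> N"
        by (rule order_trans[OF add_right_mono[OF xy(1)] tN], rule order_trans[OF add_right_mono[OF xy(2)] tN])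
      have "flag_part F u = (z ^^ 1) -` E ?x ?y"
      proof (intro equalityI subsetI)
        fix w assume "w \<in> (z ^^ 1) -` E ?x ?y"
        then have "z w \<in> z ` flag_part F u" using zF by simp
        then show "w \<in> flag_part F u"
          by (intro image_subset_kernel_cancel[OF N1(1) part(1) ker]) (use t ur in auto)
      qed (use zF in auto)
      then show ?thesis using z_pow_vimage_E[OF b] rc xy by simp
    qed
  qed
qed

text \<open>Each contraction lowers n by two and k by one but keeps m, so m \<le> k would not
  survive the induction; m \<le> n and k \<le> n - m take its place.\<close>

lemma springer_cover:
  assumes "n < N" "m \<le> n" "2 * k \<le> n" "k \<le> n - m" "F \<in> Y_flags z (n - m)"
    "flag_part F (n - m) \<subseteq> E (n - k) k" "E (n - k - m) (k - m) \<subseteq> flag_part F (n - m)"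
  shows "\<exists>a \<in> delta_cup_diagrams n k m. F \<in> K_component e z n m a"
  using assms
proof (induction n arbitrary: k F rule: less_induct)
  case (less n)
  let ?r = "n - m"
  note F = less.prems(5)
  have rN: "?r < N" using less.prems by simp
  have N1: "1 \<le> N" using less.prems by simp
  show ?case
  proof (cases "k = ?r")
    \<comment> \<open>Here 2 k \<le> n gives k \<le> m, and k = n - m leaves no vertex for a ray
      before the cut.\<close>
    case True
    then show ?thesis using less.prems by (intro cover_base[OF F]) auto
  next
    case kr: False
    show ?thesis
    proof (cases "E 1 1 \<subseteq> flag_part F ?r")
      case False
      \<comment> \<open>Otherwise both indices of \<open>E (n - k - m) (k - m)\<close> would be
        positive, and the last term would contain the kernel of \<open>z\<close>.\<close>
      have "k \<le> m"
      proof (rule ccontr)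
        assume "\<not> k \<le> m"
        then have "E 1 1 \<subseteq> E (n - k - m) (k - m)" using kr less.prems by (intro E_mono) auto
        then show False using False less.prems by blast
      qed
      moreover have "flag_part F v = E v 0" if "1 \<le> v" "v \<le> ?r - k" for v
      proof (rule regular_flag_part[OF F rN False _ that(2)])
        show "E (?r - k) 0 \<subseteq> flag_part F ?r"
          using less.prems(7) \<open>k \<le> m\<close> by (simp add: add.commute)
      qed simp
      ultimately show ?thesis using less.prems by (intro cover_base[OF F]) auto
    next
      case True
      from first_kernel[OF F rN True] obtain i where i: "1 \<le> i" "i + 1 \<le> ?r"
        and v: "flag_part F (i + 1) = z -` flag_part F (i - 1)" .
      \<comment> \<open>For k = 0 the last term lies in the block of the vectors \<open>e i\<close>,
        which does not contain the kernel vector \<open>f 1\<close>.\<close>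
      have k1: "1 \<le> k"
      proof (rule ccontr)
        assume "\<not> 1 \<le> k"
        then have "k = 0" by simp
        then have "E 1 1 \<subseteq> E n 0" using True less.prems(6) by auto
        moreover have "f 1 \<in> E 1 1" unfolding E_space_def by (intro vec.span_base) auto
        ultimately have "f 1 \<in> E n 0" by blast
        then have "fc 1 (f 1) = 0" using mem_E[of n 0 "f 1"] less.prems(1) by auto
        then show False using coord_basis(4)[of 1 1] N1 by simp
      qed
      let ?G = "contract i F"
      note cc = cover_contract[OF F less.prems(1) i v]
      have Fp: "F \<in> partial_flags ?r" by (rule Y_flags_partial[OF F])
      have sub: "flag_part F (i - 1) \<subseteq> E (N - 1) (N - 1)"
        proof -
    have "i - 1 \<le> n - m" "i - 1 \<le> N" "i - 1 \<le> N - 1" using i rN by auto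
    then show ?thesis using Y_flags_subset_E[OF F, of "i - 1"] E_mono[of "i - 1" "N - 1" "i - 1" "N - 1"] by blast
  qed
      have "flag_part ?G (?r - 2) = z ` flag_part F (?r - 2 + 2)"
        by (rule contract_part(2)[OF Fp i order_refl v _ sub]) (use i rN in auto)
      moreover have "?r - 2 + 2 = ?r" "n - 2 - m = ?r - 2" using i by auto
      ultimately have last: "flag_part ?G (n - 2 - m) = z ` flag_part F ?r" by (simp only:)
      have nk: "n - k \<le> N" "k \<le> N" "n - k - m \<le> N" "k - m \<le> N" using less.prems by auto
      have "\<exists>a \<in> delta_cup_diagrams (n - 2) (k - 1) m. ?G \<in> K_component e z (n - 2) m a"
      proof (rule less.IH)
        have "z ` flag_part F ?r \<subseteq> z ` E (n - k) k" using less.prems(6) by (rule image_mono)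
        also have "\<dots> = E (n - k - 1) (k - 1)" using z_pow_image_E[OF nk(1,2), of 1] by simp
        also have "n - k - 1 = n - 2 - (k - 1)" using k1 less.prems(3) by simp
        finally show "flag_part ?G (n - 2 - m) \<subseteq> E (n - 2 - (k - 1)) (k - 1)" unfolding last .
        have "E (n - 2 - (k - 1) - m) (k - 1 - m) = E (n - k - m - 1) (k - m - 1)"
          using k1 less.prems(3) by (intro arg_cong2[of _ _ _ _ E]) auto
        also have "\<dots> = z ` E (n - k - m) (k - m)" using z_pow_image_E[OF nk(3,4), of 1] by simp
        also have "\<dots> \<subseteq> z ` flag_part F ?r" using less.prems(7) by (rule image_mono)
        finally show "E (n - 2 - (k - 1) - m) (k - 1 - m) \<subseteq> flag_part ?G (n - 2 - m)" unfolding last .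
        show "n - 2 < n" "m \<le> n - 2" "k - 1 \<le> n - 2 - m" using i kr less.prems(4) by auto
      qed (use less.prems cc(1) k1 in auto)
      then obtain a where "a \<in> delta_cup_diagrams (n - 2) (k - 1) m" "?G \<in> K_component e z (n - 2) m a" by blast
      then show ?thesis using cc(2)[OF _ k1] delta_insert_cup[OF _ i k1] by blast
    qed
  qed
qed

end

section \<open>The fibration of a component by its left endpoints\<close>

lemma closedin_flag_variety_conditions:
  assumes "\<And>A j i. (A, j, i) \<in> C \<Longrightarrow> Vector_Spaces.linear (*s) (*s) A \<and> j \<le> r \<and> i \<le> r"
  shows "closedin (zar (flag_variety r))
    {F \<in> partial_flags r. \<forall>(A, j, i) \<in> C. A ` flag_part F j \<subseteq> flag_part (F :: 'd::finite flag) i}"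
proof -
  \<comment> \<open>The set of all flags is added so that the family is nonempty even when C is
    empty.\<close>
  let ?S = "insert (partial_flags r) ((\<lambda>(A, j, i). {F \<in> partial_flags r. A ` flag_part F j \<subseteq> flag_part (F :: 'd flag) i}) ` C)"
  have "closedin (zar (flag_variety r)) (\<Inter>?S)"
  proof (rule closedin_Inter)
    fix S assume "S \<in> ?S"
    then consider "S = partial_flags r"
      | A j i where "(A, j, i) \<in> C" "S = {F \<in> partial_flags r. A ` flag_part F j \<subseteq> flag_part F i}" by auto
    then show "closedin (zar (flag_variety r)) S"
    proof cases
      case 1
      then show ?thesis using closedin_topspace[of "zar (flag_variety r)"] by (simp add: points_flag_variety)
    next
      case 2
      then show ?thesis using closedin_flag_variety_image_subset assms[OF 2(1)] by blast
    qed
  qed simp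
  moreover have "\<Inter>?S = {F \<in> partial_flags r. \<forall>(A, j, i) \<in> C. A ` flag_part F j \<subseteq> flag_part F i}"
    by (rule set_eqI) (simp add: split_beta; blast)
  ultimately show ?thesis by simp
qed

section \<open>The decreasing chain of closed sets from K_a to a point\<close>

locale component = two_row N e f z for N e f and z :: "complex ^ 'd::finite \<Rightarrow> complex ^ 'd" +
  fixes n k m :: nat and a :: "(nat \<times> nat) set"
  assumes delta: "a \<in> delta_cup_diagrams n k m" and nN: "n < N"
begin

abbreviation "r \<equiv> n - m"
abbreviation "K \<equiv> K_component e z n m a"

lemmas cupd = delta_cup_diagramsD(1)[OF delta]

text \<open>The standard word: \<open>f\<close> exactly at right endpoints. Its flag
  \<open>W\<close> is the common base point of all stages.\<close>

definition w0 :: "nat \<Rightarrow> bool" where "w0 v \<longleftrightarrow> \<not> right_endpoint a v"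

definition W :: "'d flag" where "W = word_flag r w0"

text \<open>The candidates for the total spaces of the tower; consecutive members coincide except at
  left endpoints.\<close>

definition Z :: "nat \<Rightarrow> 'd flag set" where
  "Z p = {F \<in> K. \<forall>i\<le>p. flag_part F i = flag_part W i}"

lemma n_le_N: "n \<le> N" using nN by simp

lemma W_in_K: "W \<in> K"
  unfolding W_def using word_flag_in_K[OF cupd n_le_N admissible_standard[OF cupd]] by (simp add: w0_def[abs_def])

lemma W_part: "i \<le> r \<Longrightarrow> flag_part W i = E (count_e w0 i) (i - count_e w0 i)"
  by (simp add: W_def word_flag_part)

lemma K_Y: "F \<in> K \<Longrightarrow> F \<in> Y_flags z r" by (simp add: K_component_def)

lemma K_partial: "F \<in> K \<Longrightarrow> F \<in> partial_flags r" using K_Y Y_flags_partial by blast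

lemmas K_iff = K_component_iff[OF cupd n_le_N]

lemma Z_K: "F \<in> Z p \<Longrightarrow> F \<in> K" by (simp add: Z_def)

lemma Z_partial: "F \<in> Z p \<Longrightarrow> F \<in> partial_flags r" using Z_K K_partial by blast

lemma Z_part: "F \<in> Z p \<Longrightarrow> i \<le> p \<Longrightarrow> flag_part F i = flag_part W i" by (simp add: Z_def)

lemma W_in_Z: "W \<in> Z p" using W_in_K by (simp add: Z_def)

lemma Z_0: "Z 0 = K" by (auto simp: Z_def)

lemma Z_mono: "Z (Suc p) \<subseteq> Z p" by (auto simp: Z_def)

lemma Z_r: "Z r = {W}"
proof -
  have "F = W" if "F \<in> Z r" for F
    by (rule partial_flags_eqI[OF Z_partial[OF that] K_partial[OF W_in_K]]) (use Z_part[OF that] in auto)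
  then show ?thesis using W_in_Z by blast
qed

text \<open>At a ray the next term is a fixed coordinate subspace, and at a right endpoint it is the
  preimage of an earlier term, so agreement with \<open>W\<close> propagates.\<close>

lemma Z_Suc_eq:
  assumes p: "p < r" and nl: "\<And>j. (Suc p, j) \<notin> a"
  shows "Z (Suc p) = Z p"
proof -
  have "flag_part F (Suc p) = flag_part W (Suc p)" if F: "F \<in> Z p" for F
  proof -
    have "Suc p \<in> {1..n}" using p by auto
    then show ?thesis
    proof (cases rule: vertex_cases[where a = a])
      case 1
      then show ?thesis using Z_K[OF F] W_in_K p by (simp add: K_iff)
    next
      case (3 i)
      have "flag_part G (Suc p) = (z ^^ ((Suc p - i + 1) div 2)) -` flag_part G (i - 1)" if "G \<in> K" for G
        using that 3 p by (fastforce simp: K_component_def)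
      moreover have "flag_part F (i - 1) = flag_part W (i - 1)"
        using Z_part[OF F] cup_diagramD[OF cupd 3] by simp
      ultimately show ?thesis using Z_K[OF F] W_in_K by simp
    qed (use nl in simp)
  qed
  then show ?thesis unfolding Z_def by (auto simp: le_Suc_eq)
qed

lemma flag_part_eq_E_iff:
  assumes "F \<in> partial_flags r" "i \<le> r" "x \<le> N" "y \<le> N" "x + y = i"
  shows "flag_part F i = E x y \<longleftrightarrow> drop_E x y ` flag_part F i \<subseteq> flag_part F 0"
proof -
  have "drop_E x y ` flag_part F i \<subseteq> flag_part F 0 \<longleftrightarrow> flag_part F i \<subseteq> E x y"
    using drop_E_eq_0[OF assms(3,4)] by auto
  then show ?thesis
    using partial_flags_subset_eq(1)[OF assms(1,2) subspace_E, of x y] dim_E[OF assms(3,4)] assms(5) by auto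
qed

lemma closedin_Z:
  assumes p: "p \<le> r"
  shows "closedin (zar (flag_variety r)) (Z p)"
proof -
  \<comment> \<open>The four families encode the condition for \<open>Y_flags\<close>, the closed
    cups, the rays, and the agreement with \<open>W\<close> up to p. The last two are expressed by
    \<open>drop_E\<close> with target the zeroth term.\<close>
  let ?c = "count_e w0"
  let ?C1 = "(\<lambda>i. (z, i, i - 1)) ` {1..r}"
  let ?C2 = "(\<lambda>(i, j). (z ^^ ((j - i + 1) div 2), j, i - 1)) ` closed_cups r a"
  let ?C3 = "(\<lambda>v. (drop_E ((v + ray_count n a v) div 2) ((v - ray_count n a v) div 2), v, 0)) ` {v \<in> ray_vertices n a. v \<le> r}"
  let ?C4 = "(\<lambda>i. (drop_E (?c i) (i - ?c i), i, 0)) ` {..p}"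
  let ?C = "?C1 \<union> ?C2 \<union> ?C3 \<union> ?C4"
  have "Z p = {F \<in> partial_flags r. \<forall>(A, j, i) \<in> ?C. A ` flag_part F j \<subseteq> flag_part F i}"
  proof (intro equalityI subsetI)
    have ray: "flag_part F v = E ((v + ray_count n a v) div 2) ((v - ray_count n a v) div 2) \<longleftrightarrow>
        drop_E ((v + ray_count n a v) div 2) ((v - ray_count n a v) div 2) ` flag_part F v \<subseteq> flag_part F 0"
      if "F \<in> partial_flags r" "v \<in> ray_vertices n a" "v \<le> r" for F v
    proof (rule flag_part_eq_E_iff[OF that(1,3)])
      let ?X = "card (cups_in a 1 v)" and ?\<rho> = "ray_count n a v"
      have v: "v \<le> n" using ray_vertices_range[OF that(2)] by simp
      have tr: "v = ?\<rho> + 2 * ?X" by (rule uncovered_count[OF cupd ray_uncovered[OF cupd that(2)] v])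
      have gen: "(v + \<rho>) div 2 + (v - \<rho>) div 2 = v" if "v = \<rho> + 2 * X" for v \<rho> X :: nat using that by simp
      show s: "(v + ?\<rho>) div 2 + (v - ?\<rho>) div 2 = v" by (rule gen[OF tr])
      have "x \<le> N \<and> y \<le> N" if "x + y = v" for x y using that v n_le_N by linarith
      from this[OF s] show "(v + ?\<rho>) div 2 \<le> N" "(v - ?\<rho>) div 2 \<le> N" by blast+
    qed
    have coord: "flag_part F i = flag_part W i \<longleftrightarrow> drop_E (?c i) (i - ?c i) ` flag_part F i \<subseteq> flag_part F 0"
      if "F \<in> partial_flags r" "i \<le> p" for F i
    proof -
      have "i \<le> r" "?c i \<le> i" "i \<le> N" using that p n_le_N count_e_le[of w0 i] by auto
      then show ?thesis unfolding W_part[OF \<open>i \<le> r\<close>] by (intro flag_part_eq_E_iff[OF that(1)]) auto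
    qed
    { fix F assume F: "F \<in> Z p"
      have Fp: "F \<in> partial_flags r" by (rule Z_partial[OF F])
      have "A ` flag_part F j \<subseteq> flag_part F i" if "(A, j, i) \<in> ?C" for A j i
        using that
      proof (elim UnE)
        assume "(A, j, i) \<in> ?C1"
        then have "A = z" "i = j - 1" "1 \<le> j" "j \<le> r" by auto
        then show ?thesis using Y_flags_step[OF K_Y[OF Z_K[OF F]], of j] by simp
      next
        assume "(A, j, i) \<in> ?C2"
        then show ?thesis using Z_K[OF F] unfolding K_iff closed_cups_def by auto
      next
        assume "(A, j, i) \<in> ?C3"
        then have j: "j \<in> ray_vertices n a" "j \<le> r" "i = 0"
          "A = drop_E ((j + ray_count n a j) div 2) ((j - ray_count n a j) div 2)" by auto
        have "flag_part F j = E ((j + ray_count n a j) div 2) ((j - ray_count n a j) div 2)"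
          using Z_K[OF F] j(1,2) unfolding K_iff by blast
        then show ?thesis unfolding ray[OF Fp j(1,2)] j(3,4) .
      next
        assume "(A, j, i) \<in> ?C4"
        then have j: "j \<le> p" "i = 0" "A = drop_E (?c j) (j - ?c j)" by auto
        have "flag_part F j = flag_part W j" by (rule Z_part[OF F j(1)])
        then show ?thesis unfolding coord[OF Fp j(1)] j(2,3) .
      qed
      then show "F \<in> {F \<in> partial_flags r. \<forall>(A, j, i) \<in> ?C. A ` flag_part F j \<subseteq> flag_part F i}" using Fp by blast }
    { fix F assume "F \<in> {F \<in> partial_flags r. \<forall>(A, j, i) \<in> ?C. A ` flag_part F j \<subseteq> flag_part F i}"
      then have Fp: "F \<in> partial_flags r" and all: "\<forall>(A, j, i) \<in> ?C. A ` flag_part F j \<subseteq> flag_part F i" by blast+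
      have C: "A ` flag_part F j \<subseteq> flag_part F i" if "(A, j, i) \<in> ?C" for A j i using bspec[OF all that] by simp
      have "z ` flag_part F i \<subseteq> flag_part F (i - 1)" if "i \<in> {1..r}" for i by (rule C) (use that in blast)
      then have "F \<in> Y_flags z r" unfolding Y_flags_def using Fp by blast
      moreover have "(z ^^ ((j - i + 1) div 2)) ` flag_part F j \<subseteq> flag_part F (i - 1)" if "(i, j) \<in> a" "j \<le> r" for i j
      proof (rule C)
        show "(z ^^ ((j - i + 1) div 2), j, i - 1) \<in> ?C" using that by (force simp: closed_cups_def)
      qed
      moreover have "flag_part F v = E ((v + ray_count n a v) div 2) ((v - ray_count n a v) div 2)"
        if "v \<in> ray_vertices n a" "v \<le> r" for v
        unfolding ray[OF Fp that] by (rule C) (use that in force)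
      ultimately have "F \<in> K" unfolding K_iff by blast
      moreover have "flag_part F i = flag_part W i" if "i \<le> p" for i
        unfolding coord[OF Fp that] by (rule C) (use that in force)
      ultimately show "F \<in> Z p" by (simp add: Z_def) }
  qed
  moreover have "closedin (zar (flag_variety r)) {F \<in> partial_flags r. \<forall>(A, j, i) \<in> ?C. A ` flag_part F j \<subseteq> flag_part F i}"
  proof (rule closedin_flag_variety_conditions)
    fix A j i assume "(A, j, i) \<in> ?C"
    then show "Vector_Spaces.linear (*s) (*s) A \<and> j \<le> r \<and> i \<le> r"
    proof (elim UnE)
      assume "(A, j, i) \<in> ?C2"
      then show ?thesis using cup_diagramD(2)[OF cupd] z_pow_linear by (fastforce simp: closed_cups_def)
    qed (use lin drop_E_linear p in auto)
  qed
  ultimately show ?thesis by simp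
qed

end

subsection \<open>Moving the line chosen at a left endpoint\<close>

locale left_step = component N e f z n k m a
  for N e f and z :: "complex ^ 'd::finite \<Rightarrow> complex ^ 'd" and n k m a +
  fixes p q :: nat
  assumes cup: "(Suc p, q) \<in> a"
begin

definition \<alpha> :: nat where "\<alpha> = count_e w0 p"
definition \<beta> :: nat where "\<beta> = p - count_e w0 p"

lemma cup_range: "Suc p < q" "q \<le> n" "Suc p \<le> r"
  using cup_diagramD[OF cupd cup] delta_left_endpoint[OF delta cup] by auto

lemma p_eq: "\<alpha> + \<beta> = p" using count_e_le[of w0 p] by (simp add: \<alpha>_def \<beta>_def)

lemma W_p: "flag_part W p = E \<alpha> \<beta>" using cup_range by (simp add: W_part \<alpha>_def \<beta>_def)

lemma W_Suc_p: "flag_part W (Suc p) = E (Suc \<alpha>) \<beta>"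
proof -
  have "w0 (Suc p)" using cup_left_not_right[OF cupd cup] by (simp add: w0_def)
  then have c: "count_e w0 (Suc p) = Suc \<alpha>" by (simp add: count_e_Suc \<alpha>_def)
  have "flag_part W (Suc p) = E (count_e w0 (Suc p)) (Suc p - count_e w0 (Suc p))" by (rule W_part[OF cup_range(3)])
  moreover have "Suc p - Suc \<alpha> = \<beta>" using p_eq by simp
  ultimately show ?thesis by (simp only: c)
qed

text \<open>\<open>M\<close> is square-zero, kills \<open>E \<alpha> \<beta>\<close> and commutes with \<open>z\<close> modulo \<open>E \<alpha> \<beta>\<close> as long as the
  indices stay in range. On the plane spanned by \<open>e\<close> and \<open>f\<close> modulo \<open>E \<alpha> \<beta>\<close> its image is the line through \<open>c e + f\<close>,
  so \<open>1 + t M\<close> moves the line through \<open>e\<close> to every line except that one.\<close>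

definition M :: "complex \<Rightarrow> complex ^ 'd \<Rightarrow> complex ^ 'd" where
  "M c v = mk (\<lambda>i. if \<alpha> < i then c * (ec i v - c * fc (\<beta> + (i - \<alpha>)) v) else 0)
              (\<lambda>i. if \<beta> < i then ec (\<alpha> + (i - \<beta>)) v - c * fc i v else 0)"

definition g :: "complex \<Rightarrow> complex \<Rightarrow> complex ^ 'd \<Rightarrow> complex ^ 'd" where
  "g c t v = v + t *s M c v"

text \<open>When \<open>fits s\<close> holds, this is the preimage under \<open>z ^^ s\<close> of
  the common p-th term of the flags in \<open>Z p\<close>, so it contains their terms at p +
  s.\<close>

definition B :: "nat \<Rightarrow> (complex ^ 'd) set" where "B s = E (\<alpha> + s) (\<beta> + s)"

definition fits :: "nat \<Rightarrow> bool" where "fits s \<longleftrightarrow> \<alpha> + s \<le> N \<and> \<beta> + s \<le> N"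

lemma M_linear: "Vector_Spaces.linear (*s) (*s) (M c)"
  by (rule linear_coordI) (auto simp: M_def algebra_simps)

lemma g_linear: "Vector_Spaces.linear (*s) (*s) (g c t)"
  by (rule linear_coordI) (auto simp: g_def M_def algebra_simps)

lemma B_iff: "fits s \<Longrightarrow> v \<in> B s \<longleftrightarrow> (\<forall>i>\<alpha> + s. ec i v = 0) \<and> (\<forall>i>\<beta> + s. fc i v = 0)"
  unfolding B_def fits_def by (intro mem_E) auto

lemma fits_0: "fits 0" using p_eq cup_range nN by (simp add: fits_def)

lemma fits_le: "fits s \<Longrightarrow> s' \<le> s \<Longrightarrow> fits s'" by (auto simp: fits_def)

lemma fits_index: "i \<le> r \<Longrightarrow> fits (i - p)"
  using p_eq cup_range nN by (auto simp: fits_def)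

lemma B_0: "B 0 = E \<alpha> \<beta>" by (simp add: B_def)

lemma subspace_B: "vec.subspace (B s)" by (simp add: B_def)

lemma coord_M:
  assumes s: "fits s" and v: "v \<in> B s"
  shows "ec i (M c v) = (if \<alpha> < i then c * (ec i v - c * fc (\<beta> + (i - \<alpha>)) v) else 0)"
    "fc i (M c v) = (if \<beta> < i then ec (\<alpha> + (i - \<beta>)) v - c * fc i v else 0)"
  using v s by (auto simp: M_def B_iff fits_def)

lemma M_B:
  assumes s: "fits s" and v: "v \<in> B s"
  shows "M c v \<in> B s"
  using v unfolding B_iff[OF s] coord_M[OF s v] by auto

text \<open>On each pair e_(\<alpha>+j), f_(\<beta>+j) the map is the matrix with rows (c, -c^2) and
  (1, -c), whose trace and determinant vanish.\<close>

lemma M_M: "fits s \<Longrightarrow> v \<in> B s \<Longrightarrow> M c (M c v) = 0"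
  by (rule coord_eqI) (auto simp: coord_M M_B algebra_simps)

lemma M_B_0: "v \<in> B 0 \<Longrightarrow> M c v = 0"
  by (rule coord_eqI) (auto simp: coord_M[OF fits_0] B_iff[OF fits_0])

lemma z_B: "fits s \<Longrightarrow> v \<in> B s \<Longrightarrow> z v \<in> B s"
  by (auto simp: B_iff coord_z)

lemma z_B_0: "v \<in> B 0 \<Longrightarrow> z v \<in> B 0" by (rule z_B[OF fits_0])

text \<open>\<open>z\<close> lowers both indices of a pair together and so respects the pairing. The
  only discrepancy arises where \<open>z\<close> pushes the lowest pair into
  \<open>B 0\<close>.\<close>

lemma M_z_commute:
  assumes s: "fits s" and v: "v \<in> B s"
  shows "z (M c v) - M c (z v) \<in> B 0"
proof -
  have zv: "z v \<in> B s" by (rule z_B[OF s v])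
  have "ec i (z (M c v)) = ec i (M c (z v))" if "\<alpha> < i" for i
    using that by (simp add: coord_M[OF s v] coord_M[OF s zv] coord_z Suc_diff_le)
  moreover have "fc i (z (M c v)) = fc i (M c (z v))" if "\<beta> < i" for i
    using that by (simp add: coord_M[OF s v] coord_M[OF s zv] coord_z Suc_diff_le)
  ultimately show ?thesis by (simp add: B_iff[OF fits_0])
qed

lemma M_z_pow_commute:
  assumes s: "fits s"
  shows "v \<in> B s \<Longrightarrow> (z ^^ j) v \<in> B s \<and> (z ^^ j) (M c v) - M c ((z ^^ j) v) \<in> B 0"
proof (induction j)
  case 0
  then show ?case using vec.subspace_0[OF subspace_B] by simp
next
  case (Suc j)
  let ?u = "(z ^^ j) v"
  have u: "?u \<in> B s" "(z ^^ j) (M c v) - M c ?u \<in> B 0" using Suc by auto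
  have "z ((z ^^ j) (M c v) - M c ?u) \<in> B 0" by (rule z_B_0[OF u(2)])
  from vec.subspace_add[OF subspace_B this M_z_commute[OF s u(1), of c]]
  show ?case using z_B[OF s u(1)] by (simp add: vec.linear_diff[OF lin])
qed

lemma g_B: "fits s \<Longrightarrow> v \<in> B s \<Longrightarrow> g c t v \<in> B s"
  unfolding g_def by (intro vec.subspace_add[OF subspace_B] vec.subspace_scale[OF subspace_B] M_B)

lemma g_B_0: "v \<in> B 0 \<Longrightarrow> g c t v = v" by (simp add: g_def M_B_0)

lemma g_inverse: "fits s \<Longrightarrow> v \<in> B s \<Longrightarrow> g c (- t) (g c t v) = v"
  by (simp add: g_def vec.linear_add[OF M_linear] vec.linear_scale[OF M_linear] M_M)

lemma g_image_B_0:
  assumes "H \<subseteq> B 0"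
  shows "g c t ` H = H"
proof -
  have "g c t ` H = (\<lambda>v. v) ` H" by (rule image_cong) (use assms g_B_0 in blast)+
  then show ?thesis by simp
qed

lemma g_image_inverse:
  assumes "fits s" "H \<subseteq> B s"
  shows "g c (- t) ` g c t ` H = H"
proof -
  have "(\<lambda>v. g c (- t) (g c t v)) ` H = (\<lambda>v. v) ` H"
    by (rule image_cong) (use assms g_inverse in blast)+
  then show ?thesis by (simp add: image_image)
qed

lemma g_image_fixed:
  assumes s: "fits s" and H: "H \<subseteq> B s" and M: "\<And>v. v \<in> H \<Longrightarrow> M c v \<in> H" "vec.subspace H"
  shows "g c t ` H = H"
proof -
  have sub: "g c t ` H \<subseteq> H" for t
    unfolding g_def by (auto intro!: vec.subspace_add[OF M(2)] vec.subspace_scale[OF M(2)] M(1))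
  have "H = g c t ` g c (- t) ` H" using g_image_inverse[OF s H, of c "- t"] by simp
  then show ?thesis using sub[of t] sub[of "- t"] by blast
qed

lemma g_subspace: "vec.subspace H \<Longrightarrow> vec.subspace (g c t ` H)"
  by (rule vec.linear_subspace_image[OF g_linear])

lemma g_dim:
  assumes s: "fits s" and H: "H \<subseteq> B s" "vec.subspace H"
  shows "vec.dim (g c t ` H) = vec.dim H"
proof (rule antisym)
  show "vec.dim (g c t ` H) \<le> vec.dim H" by (rule vec.dim_image_le[OF g_linear])
  have "vec.dim (g c (- t) ` g c t ` H) \<le> vec.dim (g c t ` H)" by (rule vec.dim_image_le[OF g_linear])
  then show "vec.dim H \<le> vec.dim (g c t ` H)" using g_image_inverse[OF s H(1)] by simp
qed

text \<open>Moving \<open>z ^^ j\<close> past \<open>g c t\<close> leaves an error in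
  \<open>B 0\<close>, which H' contains and \<open>g c t\<close> fixes pointwise.\<close>

lemma g_z_pow:
  assumes s: "fits s" and H: "H \<subseteq> B s" and H': "B 0 \<subseteq> H'" "vec.subspace H'" and zH: "(z ^^ j) ` H \<subseteq> H'"
  shows "(z ^^ j) ` g c t ` H \<subseteq> g c t ` H'"
proof safe
  fix h assume h: "h \<in> H"
  have "(z ^^ j) h \<in> H'" using zH h by blast
  then have 1: "g c t ((z ^^ j) h) \<in> g c t ` H'" by blast
  have "(z ^^ j) (M c h) - M c ((z ^^ j) h) \<in> B 0" using M_z_pow_commute[OF s] H h by blast
  then have "t *s ((z ^^ j) (M c h) - M c ((z ^^ j) h)) \<in> B 0" by (rule vec.subspace_scale[OF subspace_B])
  then have "t *s ((z ^^ j) (M c h) - M c ((z ^^ j) h)) \<in> g c t ` H'"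
    using g_image_B_0[of "B 0" c t] H'(1) by blast
  from vec.subspace_add[OF g_subspace[OF H'(2)] 1 this]
  show "(z ^^ j) (g c t h) \<in> g c t ` H'"
    by (simp add: g_def vec.linear_add[OF z_pow_linear] vec.linear_scale[OF z_pow_linear] algebra_simps vec.scale_right_diff_distrib)
qed

text \<open>Stopping at the right endpoint q protects the conditions beyond it, which involve
  coordinate subspaces that \<open>g c t\<close> need not preserve. The two halves fit because the
  term at q is some \<open>B s\<close>, mapped to itself. If q lies beyond the cut,
  \<open>g c t\<close> is applied to every term.\<close>

definition T :: "complex \<Rightarrow> complex \<Rightarrow> 'd flag \<Rightarrow> 'd flag" where
  "T c t F = map (\<lambda>i. if i \<le> q then g c t ` flag_part F i else flag_part F i) [1..<Suc r]"

lemma T_part: "i \<le> r \<Longrightarrow> flag_part (T c t F) i = (if i \<le> q then g c t ` flag_part F i else flag_part F i)"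
  by (cases "i = 0") (auto simp: T_def flag_part_def g_B_0[OF vec.subspace_0[OF subspace_B]] simp del: upt_Suc)

lemma Z_bounds:
  assumes F: "F \<in> Z p" and i: "p \<le> i" "i \<le> r"
  shows "B 0 \<subseteq> flag_part F i" "flag_part F i \<subseteq> B (i - p)" "fits (i - p)"
proof -
  have Fp: "flag_part F p = E \<alpha> \<beta>" using Z_part[OF F, of p] W_p by simp
  show fit: "fits (i - p)" by (rule fits_index[OF i(2)])
  show "B 0 \<subseteq> flag_part F i" using partial_flags_mono[OF Z_partial[OF F] i(2,1)] Fp by (simp add: B_0)
  have "(z ^^ (i - p)) ` flag_part F i \<subseteq> flag_part F p"
    using Y_flags_pow[OF K_Y[OF Z_K[OF F]] i(2), of "i - p"] i by simp
  then show "flag_part F i \<subseteq> B (i - p)"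
    using z_pow_mem_E[of \<alpha> "i - p" \<beta>] fit unfolding Fp B_def fits_def by blast
qed

lemma Z_low: "F \<in> Z p \<Longrightarrow> i \<le> p \<Longrightarrow> flag_part F i \<subseteq> B 0"
  using Z_bounds(2)[of F p] partial_flags_mono[OF Z_partial, of F p p i] cup_range by auto

lemma Z_fixed_low: "F \<in> Z p \<Longrightarrow> i \<le> p \<Longrightarrow> g c t ` flag_part F i = flag_part F i"
  by (rule g_image_B_0[OF Z_low])

lemma Z_q:
  assumes F: "F \<in> Z p" and q: "q \<le> r"
  shows "\<exists>s. fits s \<and> flag_part F q = B s"
proof -
  let ?l = "(q - Suc p + 1) div 2"
  have ql: "q = p + 2 * ?l" using cup_length(2)[OF cupd cup] by simp
  have "flag_part F q = (z ^^ ?l) -` flag_part F p"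
    using Z_K[OF F] cup q by (fastforce simp: K_component_def)
  also have "flag_part F p = E \<alpha> \<beta>" using Z_part[OF F, of p] W_p by simp
  also have "fits ?l" by (rule fits_le[OF fits_index[OF q]]) (use ql in linarith)
  then have "(z ^^ ?l) -` E \<alpha> \<beta> = B ?l" unfolding B_def fits_def by (intro z_pow_vimage_E) auto
  finally show ?thesis using \<open>fits ?l\<close> by blast
qed

lemma Z_fixed_q:
  assumes F: "F \<in> Z p" and q: "q \<le> r"
  shows "g c t ` flag_part F q = flag_part F q"
proof -
  obtain s where "fits s" "flag_part F q = B s" using Z_q[OF F q] by blast
  then show ?thesis using g_image_fixed[of s "B s"] M_B subspace_B by simp
qed

lemma T_part_fixed:
  assumes F: "F \<in> Z p" and i: "i \<le> r" "i \<le> p \<or> q \<le> i"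
  shows "flag_part (T c t F) i = flag_part F i"
proof (cases "i \<le> q")
  case True
  then have "i \<le> p \<or> i = q" using i by auto
  then have "g c t ` flag_part F i = flag_part F i"
    using Z_fixed_low[OF F, of i c t] Z_fixed_q[OF F, of c t] i by blast
  then show ?thesis using i True by (simp add: T_part)
qed (use i in \<open>simp add: T_part\<close>)

lemma T_part_moved:
  assumes F: "F \<in> Z p" and i: "i \<le> r" "i \<le> q"
  shows "flag_part (T c t F) i = g c t ` flag_part F i"
  using i by (simp add: T_part)

lemma T_partial:
  assumes F: "F \<in> Z p"
  shows "T c t F \<in> partial_flags r"
  unfolding partial_flags_def mem_Collect_eq
proof (intro conjI ballI)
  show "length (T c t F) = r" by (simp add: T_def del: upt_Suc)
  note Fp = Z_partial[OF F]
  fix i assume i: "i \<in> {1..r}"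
  then have ir: "i \<le> r" by simp
  note part = partial_flags_part[OF Fp ir]
  have mono: "flag_part F (i - 1) \<subseteq> flag_part F i" by (rule partial_flags_mono[OF Fp ir]) simp
  show "vec.subspace (flag_part (T c t F) i)" using part(1) g_subspace ir by (simp add: T_part)
  show "vec.dim (flag_part (T c t F) i) = i"
  proof (cases "p \<le> i")
    case True
    then show ?thesis using g_dim[OF Z_bounds(3,2)[OF F True ir] part(1)] part(2) ir by (simp add: T_part)
  qed (use T_part_fixed[OF F ir] part in simp)
  show "flag_part (T c t F) (i - 1) \<subseteq> flag_part (T c t F) i"
  proof (cases "i \<le> q")
    case True
    then show ?thesis using mono ir by (auto simp: T_part)
  next
    case False
    then have "i - 1 \<le> r" "q \<le> i - 1" "q \<le> i" using ir by auto
    then show ?thesis using T_part_fixed[OF F ir, of c t] T_part_fixed[OF F, of "i - 1" c t] mono by simp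
  qed
qed

lemma T_move_z:
  assumes F: "F \<in> Z p" and ij: "p \<le> i" "i \<le> r" "i \<le> q" "p \<le> j" "j \<le> r" "j \<le> q"
    and zj: "(z ^^ l) ` flag_part F j \<subseteq> flag_part F i"
  shows "(z ^^ l) ` flag_part (T c t F) j \<subseteq> flag_part (T c t F) i"
  unfolding T_part_moved[OF F ij(2,3)] T_part_moved[OF F ij(5,6)]
  by (rule g_z_pow[OF Z_bounds(3)[OF F ij(4,5)] Z_bounds(2)[OF F ij(4,5)] Z_bounds(1)[OF F ij(1,2)]
        partial_flags_part(1)[OF Z_partial[OF F] ij(2)] zj])

lemma T_K:
  assumes F: "F \<in> Z p"
  shows "T c t F \<in> K"
  unfolding K_iff
proof (intro conjI allI impI ballI)
  note FK = Z_K[OF F]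
  note fix' = T_part_fixed[OF F]
  show "T c t F \<in> Y_flags z r"
    unfolding Y_flags_def mem_Collect_eq
  proof (intro conjI ballI T_partial[OF F])
    fix i assume i: "i \<in> {1..r}"
    have st: "z ` flag_part F i \<subseteq> flag_part F (i - 1)" using Y_flags_step[OF K_Y[OF FK], of i] i by simp
    consider "i \<le> p" | "p < i" "i \<le> q" | "q < i" by linarith
    then show "z ` flag_part (T c t F) i \<subseteq> flag_part (T c t F) (i - 1)"
    proof cases
      case 1
      then have "i \<le> r" "i - 1 \<le> r" "i - 1 \<le> p" using i by auto
      then show ?thesis using fix'[of i c t] fix'[of "i - 1" c t] 1 st by simp
    next
      case 2
      then show ?thesis using T_move_z[OF F, of "i - 1" i 1 c t] i st by auto
    next
      case 3
      then have "i \<le> r" "i - 1 \<le> r" "q \<le> i - 1" "q \<le> i" using i by auto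
      then show ?thesis using fix'[of i c t] fix'[of "i - 1" c t] st by simp
    qed
  qed
  { fix i j assume ij: "(i, j) \<in> a" "j \<le> r"
    let ?l = "(j - i + 1) div 2"
    have b: "1 \<le> i" "i < j" using cup_diagramD[OF cupd ij(1)] by auto
    have st: "(z ^^ ?l) ` flag_part F j \<subseteq> flag_part F (i - 1)" using FK ij unfolding K_iff by blast
    \<comment> \<open>The cup (i, j) is to the left of (p + 1, q), around it, equal to it, inside
      it, starting at q, or to its right. Only for a cup inside are the terms at both ends really
      moved; a start at q contradicts disjointness.\<close>
    consider "j \<le> p" | "p < j" "i \<le> p" | "i = Suc p" | "Suc p < i" "i < q" | "i = q" | "q < i" using b by linarith
    then show "(z ^^ ?l) ` flag_part (T c t F) j \<subseteq> flag_part (T c t F) (i - 1)"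
    proof cases
      case 1
      then have "i - 1 \<le> r" "i - 1 \<le> p" using ij b by auto
      then show ?thesis using fix'[of j c t] fix'[of "i - 1" c t] 1 ij st by simp
    next
      case 2
      have "j \<noteq> Suc p" using cup_diagram_disjoint[OF cupd ij(1) cup, of "Suc p"] 2 by auto
      then have "q < j" using cup_diagram_crossing[OF cupd ij(1) cup] 2 by auto
      moreover have "i - 1 \<le> r" "i - 1 \<le> p" using ij b 2 by auto
      ultimately show ?thesis using fix'[of j c t] fix'[of "i - 1" c t] ij st by simp
    next
      case 3
      then have "j = q" using cup_diagram_disjoint[OF cupd ij(1) cup, of i] by simp
      moreover have "p \<le> r" using cup_range by simp
      ultimately show ?thesis using fix'[of j c t] fix'[of p c t] ij 3 st by simp
    next
      case 4
      then have "j < q" using cup_diagram_crossing[OF cupd cup ij(1)] by simp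
      then show ?thesis using 4 ij b by (intro T_move_z[OF F _ _ _ _ _ _ st]) auto
    next
      case 5
      then show ?thesis using cup_left_not_right[OF cupd ij(1)] cup by (auto simp: right_endpoint_def)
    next
      case 6
      then have "i - 1 \<le> r" "q \<le> i - 1" "q \<le> j" using ij b by auto
      then show ?thesis using fix'[of j c t] fix'[of "i - 1" c t] ij st by simp
    qed }
  fix v assume v: "v \<in> ray_vertices n a" "v \<le> r"
  \<comment> \<open>No ray lies below the cup, so the term at a ray is not changed.\<close>
  have "v \<le> p \<or> q \<le> v" using cup_diagram_ray[OF cupd cup v(1)] by auto
  from fix'[OF v(2) this]
  show "flag_part (T c t F) v = E ((v + ray_count n a v) div 2) ((v - ray_count n a v) div 2)"
    using FK v unfolding K_iff by simp
qed

lemma T_Z: "F \<in> Z p \<Longrightarrow> T c t F \<in> Z p"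
  using T_K[of F c t] T_part_fixed[of F _ c t] Z_part[of F p] cup_range by (auto simp: Z_def)

lemma T_inverse:
  assumes F: "F \<in> Z p"
  shows "T c (- t) (T c t F) = F"
proof (rule partial_flags_eqI[OF T_partial[OF T_Z[OF F]] Z_partial[OF F]])
  fix i assume i: "1 \<le> i" "i \<le> r"
  show "flag_part (T c (- t) (T c t F)) i = flag_part F i"
  proof (cases "p \<le> i \<and> i \<le> q")
    case True
    then show ?thesis
      using T_part_moved[OF F i(2)] T_part_moved[OF T_Z[OF F] i(2)] g_image_inverse[OF Z_bounds(3,2)[OF F _ i(2)]] by simp
  next
    case False
    then show ?thesis using T_part_fixed[OF F i(2)] T_part_fixed[OF T_Z[OF F] i(2)] by auto
  qed
qed


section \<open>The map to the projective line and its charts\<close>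

definition proj :: "complex ^ 'd \<Rightarrow> complex ^ 2" where
  "proj v = (\<chi> i. if i = 1 then ec (Suc \<alpha>) v else fc (Suc \<beta>) v)"

lemma proj_nth [simp]: "proj v $ 1 = ec (Suc \<alpha>) v" "proj v $ 2 = fc (Suc \<beta>) v"
  by (simp_all add: proj_def)

lemma vec2_eq_iff: "(u :: complex ^ 2) = v \<longleftrightarrow> u $ 1 = v $ 1 \<and> u $ 2 = v $ 2"
  by (auto simp: vec_eq_iff forall_2)

lemma proj_linear: "Vector_Spaces.linear (*s) (*s) proj"
  by unfold_locales (simp_all add: vec2_eq_iff)

lemma proj_B_0: "v \<in> B 0 \<Longrightarrow> proj v = 0"
  by (simp add: vec2_eq_iff B_iff[OF fits_0])

lemma fits_1: "fits 1" using fits_index[OF cup_range(3)] by simp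

lemma B_1D: "v \<in> B 1 \<Longrightarrow> Suc \<alpha> < i \<Longrightarrow> ec i v = 0" "v \<in> B 1 \<Longrightarrow> Suc \<beta> < i \<Longrightarrow> fc i v = 0"
  using B_iff[OF fits_1, of v] by simp_all

lemma proj_eq_0:
  assumes "v \<in> B 1" "proj v = 0"
  shows "v \<in> B 0"
proof -
  have "ec (Suc \<alpha>) v = 0" "fc (Suc \<beta>) v = 0" using assms(2) by (simp_all add: vec2_eq_iff)
  then have "ec i v = 0" if "\<alpha> < i" for i
    using B_1D(1)[OF assms(1), of i] that by (cases "i = Suc \<alpha>") simp_all
  moreover have "fc i v = 0" if "\<beta> < i" for i
    using B_1D(2)[OF assms(1), of i] that \<open>fc (Suc \<beta>) v = 0\<close> by (cases "i = Suc \<beta>") simp_all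
  ultimately show ?thesis by (simp add: B_iff[OF fits_0])
qed

text \<open>The line F_(p+1) / F_p in the plane \<open>B 1\<close> / \<open>B 0\<close>, which
  \<open>proj\<close> identifies with the space of pairs of complex numbers.\<close>

definition pr :: "'d flag \<Rightarrow> 2 flag" where
  "pr F = [proj ` flag_part F (Suc p)]"

text \<open>List positions start at 0, so \<open>vs ! p\<close> is the vector that spans the (p +
  1)-st term modulo the p-th.\<close>

lemma proj_frame:
  assumes F: "F \<in> Z p" and vs: "vs \<in> frames r" "flag_of_frame vs = F"
  shows "[proj (vs ! p)] \<in> frames 1" "flag_of_frame [proj (vs ! p)] = pr F"
proof -
  have len: "length vs = r" using frames_length[OF vs(1)] .
  have pr': "p < r" using cup_range by simp
  have part: "flag_part F i = vec.span (set (take i vs))" if "i \<le> r" for i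
    using flag_part_of_frame[of i vs] that len vs(2) by simp
  have Fp: "vec.span (set (take p vs)) = B 0"
    using part[of p] pr' Z_part[OF F, of p] W_p by (simp add: B_0)
  have FS: "flag_part F (Suc p) = vec.span (insert (vs ! p) (set (take p vs)))"
    using part[of "Suc p"] pr' len by (simp add: set_take_Suc)
  have "vs ! p \<in> flag_part F (Suc p)" unfolding FS by (rule vec.span_base) simp
  then have "vs ! p \<in> B 1" using Z_bounds(2)[OF F _ cup_range(3)] by auto
  moreover have "vs ! p \<notin> B 0" using frames_nth[OF vs(1) pr'] Fp by simp
  ultimately have nz: "proj (vs ! p) \<noteq> 0" using proj_eq_0 by blast
  then show "[proj (vs ! p)] \<in> frames 1" by (simp add: frames_iff)
  have "proj x = 0" if "x \<in> set (take p vs)" for x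
    using proj_B_0 vec.span_base[OF that] Fp by simp
  then have "vec.span (proj ` insert (vs ! p) (set (take p vs))) = vec.span {proj (vs ! p)}"
    by (intro vec.span_eq[THEN iffD2]) (auto intro: vec.span_base simp: vec.span_zero)
  then show "flag_of_frame [proj (vs ! p)] = pr F"
    unfolding pr_def FS vec.linear_span_image[OF proj_linear, symmetric] by (simp add: flag_of_frame_def)
qed

lemma pr_partial: "F \<in> Z p \<Longrightarrow> pr F \<in> partial_flags 1"
  using partial_flags_frame[OF Z_partial] proj_frame flag_of_frame_partial_flags by metis

text \<open>The chart of the projective line away from the line through \<open>(c, 1)\<close>; the line through
  \<open>(1 + t c, t)\<close> has coordinate \<open>t\<close>.\<close>

definition chart :: "complex \<Rightarrow> 2 flag set" where
  "chart c = {L \<in> partial_flags 1. \<exists>v \<in> L ! 0. v $ 1 - c * v $ 2 \<noteq> 0}"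

text \<open>The quotient is homogeneous of degree zero, so any nonzero vector of the line gives the
  same value.\<close>

definition tau :: "complex \<Rightarrow> 2 flag \<Rightarrow> complex" where
  "tau c L = (let v = SOME v. v \<in> L ! 0 \<and> v \<noteq> 0 in v $ 2 / (v $ 1 - c * v $ 2))"

lemma flag_of_frame_single: "flag_of_frame [v] ! 0 = vec.span {v}"
  by (simp add: flag_of_frame_def)

lemma chart_frame:
  assumes "[v] \<in> frames 1"
  shows "flag_of_frame [v] \<in> chart c \<longleftrightarrow> v $ 1 - c * v $ 2 \<noteq> 0"
proof -
  have "(\<exists>u \<in> vec.span {v}. u $ 1 - c * u $ 2 \<noteq> 0) \<longleftrightarrow> v $ 1 - c * v $ 2 \<noteq> 0"
  proof
    assume "\<exists>u \<in> vec.span {v}. u $ 1 - c * u $ 2 \<noteq> 0"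
    then obtain k where "k * v $ 1 - c * (k * v $ 2) \<noteq> 0" by (auto simp: vec.span_singleton)
    then show "v $ 1 - c * v $ 2 \<noteq> 0" by (auto simp: algebra_simps)
  qed (use vec.span_base[of v "{v}"] in blast)
  then show ?thesis using flag_of_frame_partial_flags[OF assms] by (simp add: chart_def flag_of_frame_single)
qed

lemma tau_frame:
  assumes "[v] \<in> frames 1"
  shows "tau c (flag_of_frame [v]) = v $ 2 / (v $ 1 - c * v $ 2)"
proof -
  have nz: "v \<noteq> 0" using assms by (simp add: frames_iff)
  define u where "u = (SOME u. u \<in> vec.span {v} \<and> u \<noteq> 0)"
  have "u \<in> vec.span {v} \<and> u \<noteq> 0"
    unfolding u_def by (rule someI[of _ v]) (use nz vec.span_base[of v "{v}"] in simp)
  then obtain k where k: "u = k *s v" "k \<noteq> 0" by (auto simp: vec.span_singleton)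
  have "tau c (flag_of_frame [v]) = u $ 2 / (u $ 1 - c * u $ 2)"
    by (simp add: tau_def flag_of_frame_single u_def Let_def)
  also have "\<dots> = (k * v $ 2) / (k * (v $ 1 - c * v $ 2))" using k by (simp add: algebra_simps)
  also have "\<dots> = v $ 2 / (v $ 1 - c * v $ 2)" using k by simp
  finally show ?thesis .
qed

lemma chart_cover: "L \<in> partial_flags 1 \<Longrightarrow> L \<in> chart 0 \<or> L \<in> chart 1"
proof -
  assume "L \<in> partial_flags 1"
  then obtain vs where vs: "vs \<in> frames 1" "flag_of_frame vs = L" using partial_flags_frame by blast
  then obtain v where v: "vs = [v]" using frames_length[OF vs(1)] by (cases vs) auto
  have "v \<noteq> 0" using vs(1) v by (simp add: frames_iff)
  then show ?thesis using chart_frame[of v 0] chart_frame[of v 1] vs v by (auto simp: vec2_eq_iff)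
qed

text \<open>On the plane, \<open>1 - t M\<close> changes the second coordinate y into y - t (x - c
  y). The choice t = y / (x - c y) makes it vanish and so moves the line to that of
  \<open>W\<close>.\<close>

lemma T_into_fiber:
  assumes F: "F \<in> Z p" and ch: "pr F \<in> chart c"
  shows "T c (- tau c (pr F)) F \<in> Z (Suc p)"
proof -
  obtain vs where vs: "vs \<in> frames r" "flag_of_frame vs = F" using partial_flags_frame[OF Z_partial[OF F]] by blast
  define u where "u = vs ! p"
  define x where "x = ec (Suc \<alpha>) u"
  define y where "y = fc (Suc \<beta>) u"
  note pf = proj_frame[OF F vs]
  have nz: "x - c * y \<noteq> 0" using chart_frame[OF pf(1), of c] ch pf(2) by (simp add: x_def y_def u_def)
  define t where "t = tau c (pr F)"
  have t: "t = y / (x - c * y)" using tau_frame[OF pf(1), of c] pf(2) by (simp add: x_def y_def u_def t_def)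
  let ?F = "T c (- t) F"
  have FZ: "?F \<in> Z p" by (rule T_Z[OF F])
  have sub: "flag_part ?F (Suc p) \<subseteq> E (Suc \<alpha>) \<beta>"
  proof
    fix v assume "v \<in> flag_part ?F (Suc p)"
    then obtain h where h: "h \<in> flag_part F (Suc p)" "v = g c (- t) h"
      using T_part_moved[OF F cup_range(3)] cup_range by auto
    have hB: "h \<in> B 1" using Z_bounds(2)[OF F _ cup_range(3)] h(1) by auto
    have vB: "v \<in> B 1" unfolding h(2) by (rule g_B[OF fits_1 hB])
    have "proj h \<in> flag_of_frame [proj u] ! 0" using h(1) pf(2) by (simp add: pr_def u_def)
    then obtain k where "proj h = k *s proj u" by (auto simp: flag_of_frame_single vec.span_singleton)
    then have xy: "ec (Suc \<alpha>) h = k * x" "fc (Suc \<beta>) h = k * y" by (simp_all add: vec2_eq_iff x_def y_def)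
    have "fc (Suc \<beta>) v = k * y - t * (k * x - c * (k * y))"
      by (simp add: h(2) g_def coord_M[OF fits_1 hB] xy)
    also have "\<dots> = k * (y - t * (x - c * y))" by (simp add: algebra_simps)
    also have "\<dots> = 0" using nz by (simp add: t)
    finally have "fc (Suc \<beta>) v = 0" .
    then have "fc i v = 0" if "\<beta> < i" for i
      using B_1D(2)[OF vB, of i] that by (cases "i = Suc \<beta>") simp_all
    moreover have "ec i v = 0" if "Suc \<alpha> < i" for i by (rule B_1D(1)[OF vB that])
    ultimately show "v \<in> E (Suc \<alpha>) \<beta>" using fits_1 by (subst mem_E) (auto simp: fits_def)
  qed
  have "vec.dim (E (Suc \<alpha>) \<beta>) = Suc p"
    using dim_E[of "Suc \<alpha>" \<beta>] fits_1 p_eq by (simp add: fits_def)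
  then have "flag_part ?F (Suc p) = E (Suc \<alpha>) \<beta>"
    by (intro partial_flags_subset_eq(1)[OF Z_partial[OF FZ] cup_range(3)] sub) auto
  then show ?thesis using FZ W_Suc_p unfolding t_def by (auto simp: Z_def le_Suc_eq)
qed

text \<open>The line of \<open>W\<close> is moved to the line through (1 + t c, t), here read in the
  chart of a possibly different parameter c'. The case c' = c serves the trivialisation; c = 1 and
  c' = 0 serve to compare the two charts in the proof of irreducibility.\<close>

lemma pr_T:
  assumes F: "F \<in> Z (Suc p)"
  shows "pr (T c t F) \<in> chart c'  \<longleftrightarrow> 1 + t * c - c' * t \<noteq> 0" "tau c' (pr (T c t F)) = t / (1 + t * c - c' * t)"
proof -
  have FZ: "F \<in> Z p" using F Z_mono by blast
  have TZ: "T c t F \<in> Z p" by (rule T_Z[OF FZ])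
  have FS: "flag_part F (Suc p) = E (Suc \<alpha>) \<beta>" using Z_part[OF F, of "Suc p"] W_Suc_p by simp
  have aN: "Suc \<alpha> \<in> {1..N}" using fits_1 by (simp add: fits_def)
  let ?e = "e (Suc \<alpha>)"
  have eE: "?e \<in> E (Suc \<alpha>) \<beta>" unfolding E_space_def by (intro vec.span_base) auto
  have eB: "?e \<in> B 1" using Z_bounds(2)[OF FZ _ cup_range(3)] FS eE by auto
  have pe: "proj (g c t ?e) $ 1 = 1 + t * c" "proj (g c t ?e) $ 2 = t"
    using coord_basis[OF aN] by (simp_all add: g_def coord_M[OF fits_1 eB])
  obtain vs where vs: "vs \<in> frames r" "flag_of_frame vs = T c t F" using partial_flags_frame[OF Z_partial[OF TZ]] by blast
  note pf = proj_frame[OF TZ vs]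
  define u where "u = proj (vs ! p)"
  have "proj (g c t ?e) \<in> pr (T c t F) ! 0"
    using T_part_moved[OF FZ cup_range(3), of c t] cup_range FS eE by (auto simp: pr_def)
  then obtain k where k: "proj (g c t ?e) = k *s u"
    unfolding pf(2)[symmetric] flag_of_frame_single u_def by (auto simp: vec.span_singleton)
  have ku: "k * u $ 1 = 1 + t * c" "k * u $ 2 = t" using pe unfolding k by simp_all
  have k0: "k \<noteq> 0"
  proof
    assume "k = 0"
    then have "1 + t * c = 0" "t = 0" using ku by simp_all
    then show False by simp
  qed
  have lin': "k * (u $ 1 - c' * u $ 2) = 1 + t * c - c' * t" using ku by (simp add: algebra_simps)
  show "pr (T c t F) \<in> chart c' \<longleftrightarrow> 1 + t * c - c' * t \<noteq> 0"
  proof -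
    have "u $ 1 - c' * u $ 2 \<noteq> 0 \<longleftrightarrow> 1 + t * c - c' * t \<noteq> 0"
      unfolding lin'[symmetric] using k0 by simp
    then show ?thesis using chart_frame[OF pf(1), of c'] unfolding pf(2) u_def by simp
  qed
  have "tau c' (pr (T c t F)) = u $ 2 / (u $ 1 - c' * u $ 2)"
    using tau_frame[OF pf(1), of c'] pf(2) by (simp add: u_def)
  also have "\<dots> = (k * u $ 2) / (k * (u $ 1 - c' * u $ 2))" using k0 by simp
  finally show "tau c' (pr (T c t F)) = t / (1 + t * c - c' * t)" using lin' ku by simp
qed

lemma pr_T_chart:
  assumes F: "F \<in> Z (Suc p)"
  shows "pr (T c t F) \<in> chart c" "tau c (pr (T c t F)) = t"
proof -
  have one: "1 + t * c - c * t = 1" by simp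
  show "pr (T c t F) \<in> chart c" "tau c (pr (T c t F)) = t"
    using pr_T(1)[OF F, of c t c] pr_T(2)[OF F, of c c t] unfolding one by simp_all
qed

end

section \<open>Bundle structure, irreducibility and smoothness\<close>

lemma regular_induced_restrict:
  assumes "function_sheaf X" "openin (zar X) V" "f \<in> regular X V"
  shows "f \<in> regular (induced X S) (V \<inter> S)"
  by (rule regular_inducedI) (use assms in blast)

lemma function_sheaf_projective_line: "function_sheaf projective_line"
  by (simp add: projective_line_def function_sheaf_flag_variety)

lemma points_projective_line: "points projective_line = partial_flags 1"
  by (simp add: projective_line_def points_flag_variety)

section \<open>Tools for curves, affine charts and towers\<close>

abbreviation affine_line :: "complex fspace" where
  "affine_line \<equiv> coordinate_space {\<lambda>x. x} UNIV"

lemma poly_functions_affine_line: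
  "p \<in> poly_functions {\<lambda>x. x} \<Longrightarrow> \<exists>P. p = poly P"
proof (induction rule: poly_functions.induct)
  case (const c)
  then show ?case by (intro exI[of _ "[:c:]"]) auto
next
  case (coord f)
  then show ?case by (intro exI[of _ "[:0, 1:]"]) auto
next
  case (add f g)
  then obtain P Q where "f = poly P" "g = poly Q" by blast
  then show ?case by (intro exI[of _ "P + Q"]) auto
next
  case (mult f g)
  then obtain P Q where "f = poly P" "g = poly Q" by blast
  then show ?case by (intro exI[of _ "P * Q"]) auto
qed

lemma closedin_affine_line_infinite:
  assumes "closedin (zar affine_line) S" "infinite S"
  shows "S = UNIV"
proof (rule ccontr)
  assume "S \<noteq> UNIV"
  then obtain x where x: "x \<in> UNIV - S" by blast
  have "openin (zar affine_line) (UNIV - S)" using assms(1) by (simp add: closedin_def)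
  from openin_coordinate_space_basis[OF this x] obtain p where
    p: "p \<in> poly_functions {\<lambda>x. x}" "p x \<noteq> 0" "{y \<in> UNIV. p y \<noteq> 0} \<subseteq> UNIV - S" by blast
  obtain P where P: "p = poly P" using poly_functions_affine_line[OF p(1)] by blast
  then have "P \<noteq> 0" using p(2) by auto
  then have "finite {y. poly P y = 0}" by (rule poly_roots_finite)
  moreover have "S \<subseteq> {y. poly P y = 0}" using p(3) P by auto
  ultimately show False using assms(2) finite_subset by blast
qed

lemma span_singleton_scale:
  assumes "k \<noteq> 0"
  shows "vec.span {k *s v} = vec.span {v}"
proof (rule vec.span_eq[THEN iffD2], intro conjI)
  show "{k *s v} \<subseteq> vec.span {v}" by (simp add: vec.span_scale vec.span_base)
  have "inverse k *s (k *s v) \<in> vec.span {k *s v}" by (intro vec.span_scale vec.span_base) simp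
  then show "{v} \<subseteq> vec.span {k *s v}" using assms by simp
qed

text \<open>One d serves all points, so that adding a coordinate to every chart preserves the form
  of the statement.\<close>

definition locally_affine :: "'a fspace \<Rightarrow> bool" where
  "locally_affine X \<longleftrightarrow> (\<exists>d. \<forall>x \<in> points X. \<exists>U \<phi> \<psi>. openin (zar X) U \<and> x \<in> U \<and>
     morphism (induced X U) (affine_fspace d) \<phi> \<and> morphism (affine_fspace d) (induced X U) \<psi> \<and>
     (\<forall>y\<in>U. \<psi> (\<phi> y) = y) \<and> (\<forall>y \<in> points (affine_fspace d). \<phi> (\<psi> y) = y))"

lemma points_affine_fspace: "points (affine_fspace d) = {a. length a = d}"
  by (simp add: affine_fspace_def)

lemma function_sheaf_affine_fspace: "function_sheaf (affine_fspace d)"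
  by (simp add: affine_fspace_def function_sheaf_coordinate_space)

lemma affine_coord_regular: "i < d \<Longrightarrow> (\<lambda>a. a ! i) \<in> regular (affine_fspace d) U"
  unfolding affine_fspace_def
  by (intro regular_coordinate_space_poly poly_functions.coord) (auto simp: affine_coords_def)

lemma morphism_affine_fspaceI:
  assumes "function_sheaf X" "\<And>x. x \<in> points X \<Longrightarrow> length (l x) = d"
    "\<And>i. i < d \<Longrightarrow> (\<lambda>x. l x ! i) \<in> regular X (points X)"
  shows "morphism X (affine_fspace d) l"
  unfolding affine_fspace_def
  by (rule morphism_coordinate_spaceI[OF assms(1)]) (use assms(2,3) in \<open>auto simp: affine_coords_def\<close>)

lemma locally_affine_smooth:
  assumes X: "function_sheaf X" and la: "locally_affine X"
  shows "smooth_fspace X"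
  unfolding smooth_fspace_def
proof
  fix x assume "x \<in> points X"
  then obtain d U \<phi> \<psi> where U: "openin (zar X) U" "x \<in> U"
    and m: "morphism (induced X U) (affine_fspace d) \<phi>" "morphism (affine_fspace d) (induced X U) \<psi>"
    and inv: "\<forall>y\<in>U. \<psi> (\<phi> y) = y" "\<forall>y \<in> points (affine_fspace d). \<phi> (\<psi> y) = y"
    using la unfolding locally_affine_def by blast
  let ?S = "{a :: complex list. length a = d}"
  let ?A = "affine_fspace d"
  \<comment> \<open>With no equations the gradient condition is vacuous, and the principal open set
    of the constant 1 is the whole affine space.\<close>
  have "smooth_locus d 0 (\<lambda>_. 1) (\<lambda>_ _. 0) ?S"
    by (simp add: smooth_locus_def poly_functions.const)
  moreover have "isomorphism (induced X U) (induced ?A ?S) \<phi>"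
    unfolding isomorphism_def
  proof (intro conjI exI[of _ \<psi>])
    show "morphism (induced X U) (induced ?A ?S) \<phi>"
      by (rule morphism_into_induced[OF function_sheaf_induced[OF X] m(1)])
         (use morphism_points[OF m(1)] in \<open>simp add: points_affine_fspace\<close>)
    show "morphism (induced ?A ?S) (induced X U) \<psi>"
      by (rule morphism_from_induced[OF function_sheaf_affine_fspace m(2)])
  qed (use inv in auto)
  ultimately show "\<exists>U n c g h S \<phi>. openin (zar X) U \<and> x \<in> U \<and> smooth_locus n c g h S \<and>
     isomorphism (induced X U) (induced (affine_fspace n) S) \<phi>" using U by blast
qed

lemma locally_affine_singleton:
  assumes X: "function_sheaf X" and pt: "points X = {x}"
  shows "locally_affine X"
  unfolding locally_affine_def
proof (intro exI[of _ 0] ballI)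
  fix y assume "y \<in> points X"
  then have y: "y = x" using pt by simp
  have "morphism (induced X {x}) (affine_fspace 0) (\<lambda>_. [])"
    by (rule morphism_const[OF function_sheaf_induced[OF X] function_sheaf_affine_fspace]) (simp add: points_affine_fspace)
  moreover have "morphism (affine_fspace 0) (induced X {x}) (\<lambda>_. x)"
    by (rule morphism_const[OF function_sheaf_affine_fspace function_sheaf_induced[OF X]]) (simp add: pt)
  moreover have "openin (zar X) {x}" using openin_topspace[of "zar X"] pt by simp
  ultimately show "\<exists>U \<phi> \<psi>. openin (zar X) U \<and> y \<in> U \<and>
     morphism (induced X U) (affine_fspace 0) \<phi> \<and> morphism (affine_fspace 0) (induced X U) \<psi> \<and>
     (\<forall>y\<in>U. \<psi> (\<phi> y) = y) \<and> (\<forall>y \<in> points (affine_fspace 0). \<phi> (\<psi> y) = y)"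
    by (intro exI[of _ "{x}"] exI[of _ "\<lambda>_. []"] exI[of _ "\<lambda>_. x"]) (auto simp: y points_affine_fspace)
qed

lemma iterated_P1_bundle_point: "closedin (zar A) {x} \<Longrightarrow> iterated_P1_bundle A 0 {x}"
  unfolding iterated_P1_bundle_def by (intro exI[of _ "\<lambda>_. {x}"]) auto

lemma iterated_P1_bundle_step:
  assumes it: "iterated_P1_bundle A d L" and K: "closedin (zar A) K"
    and b: "fiber_bundle (induced A K) projective_line (induced A L) p"
  shows "iterated_P1_bundle A (Suc d) K"
proof -
  obtain X P where X: "X 1 = L" "\<exists>pt. X (d + 1) = {pt}" "\<forall>j\<in>{1..d + 1}. closedin (zar A) (X j)"
    "\<forall>j\<in>{1..d}. fiber_bundle (induced A (X j)) projective_line (induced A (X (j + 1))) (P j)"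
    using it unfolding iterated_P1_bundle_def by blast
  define Y where "Y j = (if j = 1 then K else X (j - 1))" for j
  define Q where "Q j = (if j = 1 then p else P (j - 1))" for j
  have "closedin (zar A) (Y j)" if "j \<in> {1..Suc d + 1}" for j
  proof (cases "j = 1")
    case False
    then have "j - 1 \<in> {1..d + 1}" using that by auto
    then show ?thesis using X(3) False by (simp add: Y_def)
  qed (simp add: Y_def K)
  moreover have "fiber_bundle (induced A (Y j)) projective_line (induced A (Y (j + 1))) (Q j)" if "j \<in> {1..Suc d}" for j
  proof (cases "j = 1")
    case True
    then show ?thesis using b X(1) by (simp add: Y_def Q_def)
  next
    case False
    then have "j - 1 \<in> {1..d}" "j - 1 + 1 = j" using that by auto
    then show ?thesis using bspec[OF X(4), of "j - 1"] False by (simp add: Y_def Q_def)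
  qed
  moreover have "Y 1 = K" "\<exists>pt. Y (Suc d + 1) = {pt}" using X(2) by (auto simp: Y_def)
  ultimately show ?thesis unfolding iterated_P1_bundle_def by blast
qed

section \<open>The trivialisation as a morphism, and what it transports\<close>

context left_step
begin

abbreviation "A \<equiv> flag_variety r :: 'd flag fspace"

lemma A_sheaf: "function_sheaf A" by (rule function_sheaf_flag_variety)

declare points_induced [simp del]

lemma points_Z [simp]: "points (induced A (Z i)) = Z i"
  using Z_partial by (auto simp: points_flag_variety points_induced)

lemma Z_sheaf: "function_sheaf (induced A (Z i))"
  by (rule function_sheaf_induced[OF A_sheaf])

text \<open>The entry at list position i < q completes the term i + 1 \<le> q, to which
  \<open>g c t\<close> is applied. For i \<ge> q the terms i and i + 1 are both unchanged, so the
  entry may stay.\<close>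

lemma T_frame:
  fixes c t :: complex
  assumes F: "F \<in> Z p" and vs: "vs \<in> frames r" "flag_of_frame vs = F"
  defines "ws \<equiv> map (\<lambda>i. if i < q then g c t (vs ! i) else vs ! i) [0..<r]"
  shows "ws \<in> frames r" "flag_of_frame ws = T c t F"
proof -
  have len: "length vs = r" "length ws = r" using frames_length[OF vs(1)] by (simp_all add: ws_def)
  have part: "flag_part F i = vec.span (set (take i vs))" if "i \<le> r" for i
    using flag_part_of_frame[of i vs] that len vs(2) by simp
  have TF: "T c t F \<in> partial_flags r" by (rule T_partial[OF F])
  have sp: "vec.span (set (take i ws)) = flag_part (T c t F) i" if "i \<le> r" for i
    using that
  proof (induction i)
    case 0
    then show ?case by simp
  next
    case (Suc i)
    then have i: "i < r" "i \<le> r" by auto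
    have nth: "ws ! i = (if i < q then g c t (vs ! i) else vs ! i)" using i by (simp add: ws_def)
    have "vec.span (set (take (Suc i) ws)) = vec.span (insert (ws ! i) (vec.span (set (take i ws))))"
      using i len by (simp add: set_take_Suc vec.span_insert vec.span_span)
    also have "\<dots> = vec.span (insert (ws ! i) (flag_part (T c t F) i))" using Suc.IH i by simp
    also have "\<dots> = flag_part (T c t F) (Suc i)"
    proof (cases "i < q")
      case True
      have "vec.span (insert (ws ! i) (flag_part (T c t F) i)) = vec.span (g c t ` insert (vs ! i) (flag_part F i))"
        using True T_part_moved[OF F i(2)] by (simp add: nth)
      also have "\<dots> = g c t ` vec.span (insert (vs ! i) (flag_part F i))"
        by (rule vec.linear_span_image[OF g_linear])
      also have "vec.span (insert (vs ! i) (flag_part F i)) = flag_part F (Suc i)"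
        using part[of i] part[of "Suc i"] i len by (simp add: set_take_Suc vec.span_insert vec.span_span)
      also have "g c t ` flag_part F (Suc i) = flag_part (T c t F) (Suc i)"
        using T_part_moved[OF F Suc.prems] True by simp
      finally show ?thesis .
    next
      case False
      then have "flag_part (T c t F) i = flag_part F i" "flag_part (T c t F) (Suc i) = flag_part F (Suc i)"
        using T_part_fixed[OF F] i Suc.prems by auto
      then show ?thesis using False part[of i] part[of "Suc i"] i len
        by (simp add: nth set_take_Suc vec.span_insert vec.span_span)
    qed
    finally show ?case .
  qed
  show ws: "ws \<in> frames r"
    unfolding frames_iff
  proof (intro conjI allI impI len)
    fix i assume i: "i < r"
    show "ws ! i \<notin> vec.span (set (take i ws))"
    proof
      assume "ws ! i \<in> vec.span (set (take i ws))"
      then have "vec.span (set (take (Suc i) ws)) = vec.span (set (take i ws))"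
        using i len by (simp add: set_take_Suc vec.span_redundant)
      then have "flag_part (T c t F) (Suc i) = flag_part (T c t F) i" using sp i by simp
      then show False using partial_flags_part(2)[OF TF, of i] partial_flags_part(2)[OF TF, of "Suc i"] i by simp
    qed
  qed
  show "flag_of_frame ws = T c t F"
  proof (rule partial_flags_eqI[OF flag_of_frame_partial_flags[OF ws] TF])
    show "flag_part (flag_of_frame ws) i = flag_part (T c t F) i" if "1 \<le> i" "i \<le> r" for i
      using flag_part_of_frame[of i ws] sp[of i] that len by simp
  qed
qed

text \<open>The parameter t may vary with the point: the trivialisation uses the chart coordinate of
  the flag as parameter, and the orbit curves use t itself as the variable.\<close>

lemma T_morphism:
  assumes X: "function_sheaf X" and m: "morphism X A \<phi>" and im: "\<And>x. x \<in> points X \<Longrightarrow> \<phi> x \<in> Z p"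
    and reg: "t \<in> regular X (points X)"
  shows "morphism X A (\<lambda>x. T c (t x) (\<phi> x))"
proof (rule morphism_flag_varietyI[OF X])
  fix x assume x: "x \<in> points X"
  have "\<phi> x \<in> partial_flags r" using Z_partial[OF im[OF x]] .
  then obtain Q s where Q: "openin (zar A) Q" "\<phi> x \<in> Q"
    and s: "\<forall>F\<in>Q. s F \<in> frames r \<and> flag_of_frame (s F) = F"
    and sreg: "\<forall>i<r. \<forall>j. (\<lambda>F. s F ! i $ j) \<in> regular A Q"
    using flag_variety_local_section[of "\<phi> x" r] by blast
  let ?U = "{x \<in> points X. \<phi> x \<in> Q}"
  let ?l = "\<lambda>y. map (\<lambda>i. if i < q then g c (t y) (s (\<phi> y) ! i) else s (\<phi> y) ! i) [0..<r]"
  have U: "openin (zar X) ?U" by (rule morphism_open[OF m Q(1)])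
  have tU: "t \<in> regular X ?U" by (rule sheaf_restrict[OF X U openin_topspace reg]) auto
  have sr: "(\<lambda>y. s (\<phi> y) ! i $ j) \<in> regular X ?U" if "i < r" for i j
    by (rule morphism_regular[OF m Q(1)]) (use sreg that in blast)
  show "\<exists>U l. openin (zar X) U \<and> x \<in> U \<and>
      (\<forall>y\<in>U. l y \<in> frames r \<and> flag_of_frame (l y) = T c (t y) (\<phi> y)) \<and>
      (\<forall>i<r. \<forall>j. (\<lambda>y. l y ! i $ j) \<in> regular X U)"
  proof (intro exI[of _ ?U] exI[of _ ?l] conjI ballI allI impI)
    fix y assume y: "y \<in> ?U"
    have "s (\<phi> y) \<in> frames r" "flag_of_frame (s (\<phi> y)) = \<phi> y" using s y by auto
    from T_frame[OF im this] show "?l y \<in> frames r" "flag_of_frame (?l y) = T c (t y) (\<phi> y)" using y by auto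
  next
    fix i j assume i: "i < r"
    have Mr: "(\<lambda>y. M c (s (\<phi> y) ! i) $ j) \<in> regular X ?U"
      by (rule regular_linear[OF X U M_linear]) (rule sr[OF i])
    show "(\<lambda>y. ?l y ! i $ j) \<in> regular X ?U"
    proof (cases "i < q")
      case True
      have "(\<lambda>y. s (\<phi> y) ! i $ j + t y * M c (s (\<phi> y) ! i) $ j) \<in> regular X ?U"
        by (intro sheaf_add sheaf_mult X U sr i tU Mr)
      then show ?thesis using True i by (simp add: g_def)
    qed (use sr i in simp)
  qed (use x Q U in auto)
qed

lemma T_morphism_Z:
  assumes X: "function_sheaf X" and m: "morphism X A \<phi>" and im: "\<And>x. x \<in> points X \<Longrightarrow> \<phi> x \<in> Z p"
    and reg: "t \<in> regular X (points X)"
  shows "morphism X (induced A (Z p)) (\<lambda>x. T c (t x) (\<phi> x))"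
  by (rule morphism_into_induced[OF X T_morphism[OF assms]]) (auto intro: T_Z im)

lemma pr_morphism: "morphism (induced A (Z p)) projective_line pr"
  unfolding projective_line_def
proof (rule morphism_flag_varietyI[OF Z_sheaf])
  let ?X = "induced A (Z p)"
  fix F0 assume "F0 \<in> points ?X"
  then have F0: "F0 \<in> Z p" by simp
  obtain Q s where Q: "openin (zar A) Q" "F0 \<in> Q"
    and s: "\<forall>F\<in>Q. s F \<in> frames r \<and> flag_of_frame (s F) = F"
    and sreg: "\<forall>i<r. \<forall>j. (\<lambda>F. s F ! i $ j) \<in> regular A Q"
    using flag_variety_local_section[OF Z_partial[OF F0]] by blast
  let ?U = "Q \<inter> Z p" and ?l = "\<lambda>F. [proj (s F ! p)]"
  have U: "openin (zar ?X) ?U" using Q by (auto simp: openin_induced)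
  have pr': "p < r" using cup_range by simp
  have sr: "(\<lambda>F. s F ! p $ j) \<in> regular ?X ?U" for j
    by (rule regular_induced_restrict[OF A_sheaf Q(1)]) (use sreg pr' in blast)
  show "\<exists>U l. openin (zar ?X) U \<and> F0 \<in> U \<and> (\<forall>y\<in>U. l y \<in> frames 1 \<and> flag_of_frame (l y) = pr y) \<and>
      (\<forall>i<1. \<forall>j. (\<lambda>y. l y ! i $ j) \<in> regular ?X U)"
  proof (intro exI[of _ ?U] exI[of _ ?l] conjI ballI allI impI)
    fix F assume F: "F \<in> ?U"
    then have "s F \<in> frames r" "flag_of_frame (s F) = F" using s by auto
    from proj_frame[OF _ this] show "?l F \<in> frames 1" "flag_of_frame (?l F) = pr F" using F by auto
  next
    fix i :: nat and j assume "i < 1"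
    then show "(\<lambda>y. ?l y ! i $ j) \<in> regular ?X ?U"
      using regular_linear[OF Z_sheaf U proj_linear, of "\<lambda>F. s F ! p"] sr by simp
  qed (use U Q F0 in auto)
qed

text \<open>Both claims are tested on frames, where the coordinate is a quotient of linear forms in
  the vector entries.\<close>

lemma chart_pull:
  "openin (zar projective_line) (chart c)" "tau c \<in> regular projective_line (chart c)"
proof -
  let ?X = "frame_space 1 :: (complex ^ 2) list fspace"
  let ?P = "{vs \<in> frames 1. vs ! 0 $ 1 - c * vs ! 0 $ 2 \<noteq> 0} :: (complex ^ 2) list set"
  note X = function_sheaf_frame_space[of 1]
  have single: "\<exists>v. vs = [v]" if "vs \<in> frames 1" for vs :: "(complex ^ 2) list"
    using frames_length[OF that] by (cases vs) auto
  have pre: "{vs \<in> frames 1. flag_of_frame vs \<in> chart c} = ?P"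
  proof (intro set_eqI iffI)
    fix vs :: "(complex ^ 2) list"
    { assume "vs \<in> {vs \<in> frames 1. flag_of_frame vs \<in> chart c}"
      then show "vs \<in> ?P" using single[of vs] chart_frame by auto }
    { assume "vs \<in> ?P"
      then show "vs \<in> {vs \<in> frames 1. flag_of_frame vs \<in> chart c}" using single[of vs] chart_frame by auto }
  qed
  have oX: "openin (zar ?X) (frames 1)" using openin_topspace[of "zar ?X"] by (simp add: points_frame_space)
  have co: "(\<lambda>vs. vs ! 0 $ j) \<in> regular ?X V" for j V by (rule regular_frame_coord) simp
  have dr: "(\<lambda>vs. vs ! 0 $ 1 - c * vs ! 0 $ 2) \<in> regular ?X V" if "openin (zar ?X) V" for V
    by (intro sheaf_diff sheaf_mult sheaf_const X that co)
  have P: "openin (zar ?X) ?P" by (rule sheaf_nonzero_open[OF X oX dr[OF oX]])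
  show "openin (zar projective_line) (chart c)"
    unfolding projective_line_def openin_flag_variety pre using P by (auto simp: chart_def)
  have "(\<lambda>vs. vs ! 0 $ 2 / (vs ! 0 $ 1 - c * vs ! 0 $ 2)) \<in> regular ?X ?P"
    by (rule sheaf_divide[OF X P co dr[OF P]]) simp
  then have "(\<lambda>vs. tau c (flag_of_frame vs)) \<in> regular ?X ?P"
  proof (rule sheaf_restrict[OF X P P])
    fix vs assume "vs \<in> ?P"
    moreover from this obtain v where "vs = [v]" using single by blast
    ultimately show "vs ! 0 $ 2 / (vs ! 0 $ 1 - c * vs ! 0 $ 2) = tau c (flag_of_frame vs)" using tau_frame by simp
  qed simp
  then show "tau c \<in> regular projective_line (chart c)"
    using pre by (simp add: projective_line_def flag_variety_def quotient_fspace_def o_def points_frame_space)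
qed

definition ZU :: "complex \<Rightarrow> 'd flag set" where "ZU c = {F \<in> Z p. pr F \<in> chart c}"

lemma ZU_open: "openin (zar (induced A (Z p))) (ZU c)"
  using morphism_open[OF pr_morphism chart_pull(1)] by (simp add: ZU_def)

abbreviation "XU c \<equiv> induced (induced A (Z p)) (ZU c)"

lemma points_XU: "points (XU c) = ZU c" by (auto simp: ZU_def points_induced[of "induced A (Z p)"])

lemma XU_sheaf: "function_sheaf (XU c)" by (rule function_sheaf_induced[OF Z_sheaf])

lemma tau_pr_regular: "(\<lambda>F. tau c (pr F)) \<in> regular (XU c) (ZU c)"
proof -
  have "(\<lambda>F. tau c (pr F)) \<in> regular (induced A (Z p)) {F \<in> points (induced A (Z p)). pr F \<in> chart c}"
    by (rule morphism_regular[OF pr_morphism chart_pull])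
  then have "(\<lambda>F. tau c (pr F)) \<in> regular (induced A (Z p)) (ZU c)" by (simp add: ZU_def)
  from regular_induced_restrict[OF Z_sheaf ZU_open this, of "ZU c"] show ?thesis by simp
qed

text \<open>The fibre component of the trivialisation over a chart: F corresponds to the pair of
  \<open>pr F\<close> and \<open>fib c F\<close>, and a pair of L and G to
  \<open>T c (tau c L) G\<close>.\<close>

definition fib :: "complex \<Rightarrow> 'd flag \<Rightarrow> 'd flag" where "fib c F = T c (- tau c (pr F)) F"

lemma fib_in: "F \<in> ZU c \<Longrightarrow> fib c F \<in> Z (Suc p)"
  using T_into_fiber by (simp add: fib_def ZU_def)

lemma T_fib: "F \<in> ZU c \<Longrightarrow> T c (tau c (pr F)) (fib c F) = F"
  using T_inverse[of F c "- tau c (pr F)"] by (simp add: fib_def ZU_def)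

lemma T_in_ZU: "F \<in> Z (Suc p) \<Longrightarrow> T c t F \<in> ZU c"
  using T_Z Z_mono pr_T_chart(1) by (fastforce simp: ZU_def)

lemma fib_T: "F \<in> Z (Suc p) \<Longrightarrow> fib c (T c t F) = F"
  using T_inverse[of F c t] pr_T_chart(2)[of F c t] Z_mono by (auto simp: fib_def)

lemma incl_XU: "morphism (XU c) A (\<lambda>F. F)"
  using morphism_comp[OF morphism_inclusion[OF Z_sheaf] morphism_inclusion[OF A_sheaf]] by simp

lemma incl_Z: "morphism (induced A (Z i)) A (\<lambda>F. F)" by (rule morphism_inclusion[OF A_sheaf])

lemma fib_morphism: "morphism (XU c) (induced A (Z (Suc p))) (fib c)"
  unfolding fib_def
proof (rule morphism_into_induced[OF XU_sheaf])
  have o: "openin (zar (XU c)) (ZU c)" using openin_topspace[of "zar (XU c)"] points_XU by metis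
  have "(\<lambda>F. - 1 * tau c (pr F)) \<in> regular (XU c) (ZU c)"
    by (intro sheaf_mult sheaf_const XU_sheaf o tau_pr_regular)
  then have "(\<lambda>F. - tau c (pr F)) \<in> regular (XU c) (points (XU c))" unfolding points_XU by simp
  then show "morphism (XU c) A (\<lambda>F. T c (- tau c (pr F)) F)"
    by (intro T_morphism[OF XU_sheaf incl_XU]) (simp only: points_XU, simp add: ZU_def)
  show "T c (- tau c (pr F)) F \<in> Z (Suc p)" if "F \<in> points (XU c)" for F
    using fib_in[of F c] that unfolding points_XU fib_def by simp
qed

lemma pr_fiber_bundle:
  "fiber_bundle (induced A (Z p)) projective_line (induced A (Z (Suc p))) pr"
  unfolding fiber_bundle_def
proof (intro conjI ballI pr_morphism)
  fix b :: "2 flag" assume "b \<in> points projective_line"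
  then obtain c where b: "b \<in> chart c" using chart_cover by (auto simp: points_projective_line)
  let ?Y = "induced projective_line (chart c)" and ?F = "induced A (Z (Suc p))"
  let ?P = "product_fspace ?Y ?F"
  let ?\<phi> = "\<lambda>F. (pr F, fib c F)" and ?\<psi> = "\<lambda>w. T c (tau c (fst w)) (snd w)"
  note Y = function_sheaf_induced[OF function_sheaf_projective_line, of "chart c"]
  note P = function_sheaf_product_fspace[OF Y Z_sheaf[of "Suc p"]]
  have pY: "points ?Y = chart c" by (auto simp: points_induced points_projective_line chart_def)
  have pP: "points ?P = chart c \<times> Z (Suc p)" by (simp only: points_product_fspace[OF Y Z_sheaf] pY points_Z)
  have m1: "morphism (XU c) ?P ?\<phi>"
  proof (rule morphism_Pair[OF Y Z_sheaf XU_sheaf _ fib_morphism])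
    show "morphism (XU c) ?Y pr"
      by (rule morphism_into_induced[OF XU_sheaf morphism_from_induced[OF Z_sheaf pr_morphism]])
         (simp only: points_XU, simp add: ZU_def)
  qed
  have m2: "morphism ?P (XU c) ?\<psi>"
  proof (rule morphism_into_induced[OF P])
    have "tau c \<in> regular ?Y (points ?Y)"
      using regular_induced_restrict[OF function_sheaf_projective_line chart_pull, of c "chart c"] unfolding pY by simp
    then have t: "(\<lambda>w. tau c (fst w)) \<in> regular ?P (points ?P)"
      by (rule morphism_regular_points[OF morphism_fst[OF Y Z_sheaf]])
    have s: "morphism ?P A snd"
      using morphism_comp[OF morphism_snd[OF Y Z_sheaf] incl_Z] by (simp add: o_def)
    show "morphism ?P (induced A (Z p)) ?\<psi>"
      by (rule T_morphism_Z[OF P s _ t]) (use Z_mono[of p] in \<open>auto simp: pP\<close>)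
    show "?\<psi> w \<in> ZU c" if "w \<in> points ?P" for w
      using that T_in_ZU by (auto simp: pP)
  qed
  have "isomorphism (XU c) ?P ?\<phi>"
    unfolding isomorphism_def
  proof (intro conjI exI[of _ ?\<psi>] m1 m2 ballI)
    show "?\<psi> (?\<phi> F) = F" if "F \<in> points (XU c)" for F
      using that T_fib unfolding points_XU by simp
    show "?\<phi> (?\<psi> w) = w" if w: "w \<in> points ?P" for w
    proof -
      obtain L F where LF: "w = (L, F)" "L \<in> chart c" "F \<in> Z (Suc p)" using w unfolding pP by auto
      \<comment> \<open>Both lines lie in the chart and have the same coordinate there. This
        coordinate is injective, since equality of the two quotients makes the spanning vectors u
        and v proportional.\<close>
      have "pr (T c (tau c L) F) = L"
      proof -
        obtain vs where vs: "vs \<in> frames 1" "flag_of_frame vs = L"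
          using LF(2) partial_flags_frame unfolding chart_def by blast
        obtain us where us: "us \<in> frames 1" "flag_of_frame us = pr (T c (tau c L) F)"
          using partial_flags_frame[OF pr_partial[OF T_Z[of F]]] LF(3) Z_mono by blast
        obtain u v where uv: "us = [u]" "vs = [v]"
          using frames_length[OF vs(1)] frames_length[OF us(1)] by (cases us; cases vs) auto
        have v: "v $ 1 - c * v $ 2 \<noteq> 0" using chart_frame[of v c] vs uv LF(2) by simp
        have u: "u $ 1 - c * u $ 2 \<noteq> 0"
          using chart_frame[of u c] us uv pr_T_chart(1)[OF LF(3), of c "tau c L"] by simp
        have "u $ 2 / (u $ 1 - c * u $ 2) = v $ 2 / (v $ 1 - c * v $ 2)"
          using tau_frame[of u c] tau_frame[of v c] us vs uv pr_T_chart(2)[OF LF(3), of c "tau c L"] by simp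
        then have cross: "u $ 2 * (v $ 1 - c * v $ 2) = v $ 2 * (u $ 1 - c * u $ 2)" using u v by (simp add: frac_eq_eq)
        define x where "x = u $ 1 - c * u $ 2"
        define y where "y = v $ 1 - c * v $ 2"
        have xy: "x \<noteq> 0" "y \<noteq> 0" "u $ 2 * y = v $ 2 * x" "u $ 1 = x + c * u $ 2" "v $ 1 = y + c * v $ 2"
          using u v cross by (simp_all add: x_def y_def)
        have "u = (x / y) *s v"
        proof -
          have u2: "u $ 2 = x / y * v $ 2" using xy(2,3) by (simp add: field_simps)
          moreover have "u $ 1 = x / y * v $ 1" unfolding xy(4,5) u2 using xy(2) by (simp add: field_simps)
          ultimately show ?thesis by (simp add: vec2_eq_iff)
        qed
        then have "vec.span {u} = vec.span {v}" using span_singleton_scale[of "x / y" v] xy(1,2) by simp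
        then have "flag_of_frame us = flag_of_frame vs" by (simp add: uv flag_of_frame_def)
        then show ?thesis using us vs by simp
      qed
      then show ?thesis using fib_T[OF LF(3)] LF(1) by simp
    qed
  qed
  then show "\<exists>U \<phi>. openin (zar projective_line) U \<and> b \<in> U \<and>
        isomorphism (induced (induced A (Z p)) {x \<in> points (induced A (Z p)). pr x \<in> U}) (product_fspace (induced projective_line U) ?F) \<phi> \<and>
        (\<forall>x \<in> points (induced A (Z p)). pr x \<in> U \<longrightarrow> fst (\<phi> x) = pr x)"
    using b chart_pull(1)[of c] by (intro exI[of _ "chart c"] exI[of _ ?\<phi>]) (simp add: ZU_def)
qed

text \<open>Let C1 and C2 cover. For each t, irreducibility of \<open>Z (Suc p)\<close> puts its
  translate by \<open>T 0 t\<close> inside one of them, so one of them receives infinitely many t. A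
  closed set that meets an orbit curve for infinitely many parameters contains the whole curve;
  hence this one contains everything over \<open>chart 0\<close>, and the curves for c = 1 then
  reach the rest.\<close>

lemma Z_irreducible_step:
  assumes irr: "irreducible_in (zar A) (Z (Suc p))"
  shows "irreducible_in (zar A) (Z p)"
  unfolding irreducible_in_def
proof (intro conjI allI impI)
  show "Z p \<subseteq> topspace (zar A)" using Z_partial by (auto simp: points_flag_variety)
  show "Z p \<noteq> {}" using W_in_Z by blast
  fix C1 C2 assume C: "closedin (zar A) C1" "closedin (zar A) C2" "Z p \<subseteq> C1 \<union> C2"
  have A1: "function_sheaf affine_line" by (rule function_sheaf_coordinate_space)
  have curve: "{t. T c t F \<in> C} = UNIV" if C: "closedin (zar A) C" and F: "F \<in> Z p" and inf: "infinite {t. T c t F \<in> C}" for C F c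
  proof (rule closedin_affine_line_infinite[OF _ inf])
    have "morphism affine_line A (\<lambda>t. T c t F)"
    proof (rule T_morphism[OF A1 morphism_const[OF A1 A_sheaf]])
      show "(\<lambda>t. t) \<in> regular affine_line (points affine_line)"
        by (intro regular_coordinate_space_poly poly_functions.coord) simp
    qed (use F Z_partial in \<open>auto simp: points_flag_variety\<close>)
    from closedin_continuous_map_preimage[OF morphism_continuous[OF this] C]
    show "closedin (zar affine_line) {t. T c t F \<in> C}" by simp
  qed
  have one: "(\<forall>F\<in>Z (Suc p). T 0 t F \<in> C1) \<or> (\<forall>F\<in>Z (Suc p). T 0 t F \<in> C2)" for t
  proof -
    have m: "morphism (induced A (Z (Suc p))) A (T 0 t)"
      by (rule T_morphism[OF Z_sheaf incl_Z]) (use Z_mono sheaf_const[OF Z_sheaf openin_topspace] in auto)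
    have cl: "\<exists>D. closedin (zar A) D \<and> (\<forall>F\<in>Z (Suc p). F \<in> D \<longleftrightarrow> T 0 t F \<in> C)" if "closedin (zar A) C" for C
    proof -
      have "closedin (subtopology (zar A) (Z (Suc p))) {F \<in> points (induced A (Z (Suc p))). T 0 t F \<in> C}"
        using closedin_continuous_map_preimage[OF morphism_continuous[OF m] that] by (simp add: induced_def)
      then obtain D where D: "closedin (zar A) D" "{F \<in> points (induced A (Z (Suc p))). T 0 t F \<in> C} = D \<inter> Z (Suc p)"
        unfolding closedin_subtopology by blast
      have "F \<in> D \<longleftrightarrow> T 0 t F \<in> C" if "F \<in> Z (Suc p)" for F
        using eqset_imp_iff[OF D(2), of F] that by simp
      then show ?thesis using D(1) by blast
    qed
    obtain D1 where D1: "closedin (zar A) D1" "\<forall>F\<in>Z (Suc p). F \<in> D1 \<longleftrightarrow> T 0 t F \<in> C1" using cl[OF C(1)] by blast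
    obtain D2 where D2: "closedin (zar A) D2" "\<forall>F\<in>Z (Suc p). F \<in> D2 \<longleftrightarrow> T 0 t F \<in> C2" using cl[OF C(2)] by blast
    have "Z (Suc p) \<subseteq> D1 \<union> D2" using D1(2) D2(2) T_Z[of _ 0 t] Z_mono C(3) by blast
    then have "Z (Suc p) \<subseteq> D1 \<or> Z (Suc p) \<subseteq> D2" using irr D1(1) D2(1) by (simp add: irreducible_in_def)
    then show ?thesis using D1(2) D2(2) by blast
  qed
  have sub: "Z p \<subseteq> C" if C: "closedin (zar A) C" and inf: "infinite {t. \<forall>F\<in>Z (Suc p). T 0 t F \<in> C}" for C
  proof -
    have all: "T 0 t F \<in> C" if F: "F \<in> Z (Suc p)" for F t
    proof -
      have "infinite {t. T 0 t F \<in> C}" by (rule infinite_super[OF _ inf]) (use F in blast)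
      from curve[OF C _ this] F Z_mono show ?thesis by blast
    qed
    have ZU0: "F \<in> C" if "F \<in> ZU 0" for F
      using all[OF fib_in[OF that], of "tau 0 (pr F)"] T_fib[OF that] by simp
    show "Z p \<subseteq> C"
    proof
      fix F assume F: "F \<in> Z p"
      show "F \<in> C"
      proof (cases "F \<in> ZU 0")
        case False
        then have F1: "F \<in> ZU 1" using chart_cover[OF pr_partial[OF F]] F by (auto simp: ZU_def)
        let ?G = "fib 1 F"
        have G: "?G \<in> Z (Suc p)" by (rule fib_in[OF F1])
        \<comment> \<open>The line of \<open>T 1 s ?G\<close> passes through (1 + s, s), which
          leaves \<open>chart 0\<close> only for s = -1.\<close>
        have "UNIV - {-1} \<subseteq> {s. T 1 s ?G \<in> C}"
        proof
          fix s :: complex assume "s \<in> UNIV - {-1}"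
          then have "1 + s * 1 - 0 * s \<noteq> 0" by (auto simp: add_eq_0_iff)
          then have "pr (T 1 s ?G) \<in> chart 0" using pr_T(1)[OF G, of 1 s 0] by blast
          moreover have "T 1 s ?G \<in> Z p" using T_Z G Z_mono by blast
          ultimately show "s \<in> {s. T 1 s ?G \<in> C}" using ZU0 by (simp add: ZU_def)
        qed
        moreover have "infinite (UNIV - {-1} :: complex set)" by (simp add: infinite_UNIV_char_0)
        ultimately have "infinite {s. T 1 s ?G \<in> C}" by (rule infinite_super)
        from curve[OF C _ this] G Z_mono have "T 1 (tau 1 (pr F)) ?G \<in> C" by blast
        then show ?thesis using T_fib[OF F1] by simp
      qed (rule ZU0)
    qed
  qed
  let ?S = "\<lambda>C. {t. \<forall>F\<in>Z (Suc p). T 0 t F \<in> C}"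
  have "?S C1 \<union> ?S C2 = UNIV" using one by blast
  then have "infinite (?S C1 \<union> ?S C2)" by (simp add: infinite_UNIV_char_0)
  then have "infinite (?S C1) \<or> infinite (?S C2)" by simp
  then show "Z p \<subseteq> C1 \<or> Z p \<subseteq> C2" using sub C(1,2) by blast
qed

text \<open>Near F the trivialisation identifies \<open>Z p\<close> with an affine line times the
  fibre. A chart of the fibre at \<open>fib c F\<close> is extended by \<open>tau\<close> as a new
  first coordinate.\<close>

lemma Z_locally_affine_step:
  assumes la: "locally_affine (induced A (Z (Suc p)))"
  shows "locally_affine (induced A (Z p))"
proof -
  let ?X = "induced A (Z p)" and ?X' = "induced A (Z (Suc p))"
  obtain d where d: "\<forall>x \<in> points ?X'. \<exists>U \<phi> \<psi>. openin (zar ?X') U \<and> x \<in> U \<and>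
     morphism (induced ?X' U) (affine_fspace d) \<phi> \<and> morphism (affine_fspace d) (induced ?X' U) \<psi> \<and>
     (\<forall>y\<in>U. \<psi> (\<phi> y) = y) \<and> (\<forall>y \<in> points (affine_fspace d). \<phi> (\<psi> y) = y)"
    using la unfolding locally_affine_def by blast
  have "\<exists>U \<phi> \<psi>. openin (zar ?X) U \<and> F \<in> U \<and>
     morphism (induced ?X U) (affine_fspace (Suc d)) \<phi> \<and> morphism (affine_fspace (Suc d)) (induced ?X U) \<psi> \<and>
     (\<forall>y\<in>U. \<psi> (\<phi> y) = y) \<and> (\<forall>y \<in> points (affine_fspace (Suc d)). \<phi> (\<psi> y) = y)"
    if F: "F \<in> points ?X" for F
  proof -
    have FZ: "F \<in> Z p" using F by simp
    obtain c where c: "F \<in> ZU c" using chart_cover[OF pr_partial[OF FZ]] FZ by (auto simp: ZU_def)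
    have "fib c F \<in> points ?X'" using fib_in[OF c] by simp
    from bspec[OF d this] obtain U' \<phi>' \<psi>' where U': "openin (zar ?X') U'" "fib c F \<in> U'"
      and m': "morphism (induced ?X' U') (affine_fspace d) \<phi>'" "morphism (affine_fspace d) (induced ?X' U') \<psi>'"
      and inv': "\<forall>y\<in>U'. \<psi>' (\<phi>' y) = y" "\<forall>y \<in> points (affine_fspace d). \<phi>' (\<psi>' y) = y"
      by (elim exE conjE) (rule that; assumption)
    have U'Z: "U' \<subseteq> Z (Suc p)" using openin_subset[OF U'(1)] by simp
    let ?U = "{G \<in> ZU c. fib c G \<in> U'}"
    let ?Y = "induced ?X ?U" and ?D = "affine_fspace (Suc d)"
    have UZ: "?U \<subseteq> Z p" by (auto simp: ZU_def)
    have Y: "function_sheaf ?Y" by (rule function_sheaf_induced[OF Z_sheaf])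
    have pY: "points ?Y = ?U" using UZ by (auto simp: points_induced[of ?X])
    have D: "function_sheaf ?D" by (rule function_sheaf_affine_fspace)
    have oXU: "openin (zar (XU c)) ?U" using morphism_open[OF fib_morphism U'(1)] unfolding points_XU .
    have oU: "openin (zar ?X) ?U"
    proof -
      obtain V where "openin (zar ?X) V" "?U = V \<inter> ZU c" using oXU unfolding openin_induced[of ?X] by blast
      then show ?thesis using ZU_open openin_Int by metis
    qed
    have incl: "morphism ?Y (XU c) (\<lambda>G. G)"
      by (rule morphism_into_induced[OF Y morphism_inclusion[OF Z_sheaf]]) (simp add: pY)
    have fibY: "morphism ?Y (induced ?X' U') (fib c)"
      by (rule morphism_into_induced[OF Y morphism_comp[OF incl fib_morphism]]) (simp add: pY)
    have \<tau>: "(\<lambda>G. tau c (pr G)) \<in> regular ?Y (points ?Y)"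
      using morphism_regular_points[OF incl, of "\<lambda>G. tau c (pr G)"] tau_pr_regular unfolding points_XU by blast
    let ?\<phi> = "\<lambda>G. tau c (pr G) # \<phi>' (fib c G)"
    let ?\<psi> = "\<lambda>x. T c (x ! 0) (\<psi>' (tl x))"
    have fY: "morphism ?Y (affine_fspace d) (\<lambda>G. \<phi>' (fib c G))" by (rule morphism_comp[OF fibY m'(1)])
    have m1: "morphism ?Y ?D ?\<phi>"
    proof (rule morphism_affine_fspaceI[OF Y])
      show "length (?\<phi> G) = Suc d" if "G \<in> points ?Y" for G
        using morphism_points[OF fY that] by (simp add: points_affine_fspace)
      fix i assume i: "i < Suc d"
      show "(\<lambda>G. ?\<phi> G ! i) \<in> regular ?Y (points ?Y)"
      proof (cases i)
        case 0
        then show ?thesis using \<tau> by simp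
      next
        case (Suc j)
        then have "(\<lambda>a. a ! j) \<in> regular (affine_fspace d) (points (affine_fspace d))"
          using i by (intro affine_coord_regular) simp
        from morphism_regular_points[OF fY this] show ?thesis using Suc by simp
      qed
    qed
    have tlD: "morphism ?D (affine_fspace d) tl"
    proof (rule morphism_affine_fspaceI[OF D])
      fix i assume i: "i < d"
      have "(\<lambda>a. a ! Suc i) \<in> regular ?D (points ?D)" using i by (intro affine_coord_regular) simp
      then show "(\<lambda>a. tl a ! i) \<in> regular ?D (points ?D)"
        by (rule sheaf_restrict[OF D openin_topspace openin_topspace]) (use i in \<open>auto simp: points_affine_fspace nth_tl\<close>)
    qed (simp add: points_affine_fspace)
    have \<psi>U: "\<psi>' (tl x) \<in> U'" if "x \<in> points ?D" for x
      using morphism_points[OF morphism_comp[OF tlD m'(2)] that] by (simp add: points_induced[of ?X'])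
    have \<psi>A: "morphism ?D A (\<lambda>x. \<psi>' (tl x))"
      using morphism_comp[OF morphism_comp[OF morphism_comp[OF tlD m'(2)] morphism_inclusion[OF Z_sheaf]] incl_Z] by simp
    have m2: "morphism ?D ?Y ?\<psi>"
    proof (rule morphism_into_induced[OF D T_morphism_Z[OF D \<psi>A]])
      show "\<psi>' (tl x) \<in> Z p" if "x \<in> points ?D" for x using \<psi>U[OF that] U'Z Z_mono by blast
      show "(\<lambda>x. x ! 0) \<in> regular ?D (points ?D)" by (rule affine_coord_regular) simp
      show "?\<psi> x \<in> ?U" if "x \<in> points ?D" for x
      proof -
        have 1: "\<psi>' (tl x) \<in> Z (Suc p)" using \<psi>U[OF that] U'Z by blast
        show ?thesis using T_in_ZU[OF 1] fib_T[OF 1] \<psi>U[OF that] by simp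
      qed
    qed
    have inv1: "\<forall>G\<in>?U. ?\<psi> (?\<phi> G) = G"
      using inv'(1) T_fib by simp
    have inv2: "?\<phi> (?\<psi> x) = x" if x: "x \<in> points ?D" for x
    proof -
      have "\<psi>' (tl x) \<in> Z (Suc p)" using \<psi>U[OF x] U'Z by blast
      then have "fib c (?\<psi> x) = \<psi>' (tl x)" "tau c (pr (?\<psi> x)) = x ! 0" using fib_T pr_T_chart(2) by auto
      moreover have "\<phi>' (\<psi>' (tl x)) = tl x" using inv'(2) morphism_points[OF tlD x] by blast
      ultimately show ?thesis using x by (cases x) (simp_all add: points_affine_fspace)
    qed
    show ?thesis
      by (intro exI[of _ ?U] exI[of _ ?\<phi>] exI[of _ ?\<psi>] conjI oU m1 m2 inv1 ballI inv2)
         (use c U'(2) in simp_all)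
  qed
  then show ?thesis unfolding locally_affine_def by blast
qed

end

section \<open>The irreducible components\<close>

lemma irreducible_in_finite_cover:
  assumes "finite I" "irreducible_in T S" "\<And>i. i \<in> I \<Longrightarrow> closedin T (C i)" "S \<subseteq> (\<Union>i\<in>I. C i)"
  shows "\<exists>i\<in>I. S \<subseteq> C i"
  using assms
proof (induction I)
  case empty
  then show ?case by (simp add: irreducible_in_def)
next
  case (insert i I)
  have cl: "closedin T (\<Union>i\<in>I. C i)" by (rule closedin_Union) (use insert in auto)
  have "S \<subseteq> C i \<union> (\<Union>i\<in>I. C i)" using insert.prems(3) by simp
  then have "S \<subseteq> C i \<or> S \<subseteq> (\<Union>i\<in>I. C i)"
    using insert.prems(1) insert.prems(2)[of i] cl unfolding irreducible_in_def by blast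
  then show ?case
  proof
    assume "S \<subseteq> (\<Union>i\<in>I. C i)"
    then have "\<exists>i\<in>I. S \<subseteq> C i" by (intro insert.IH insert.prems) auto
    then show ?thesis by blast
  qed blast
qed

text \<open>Every irreducible set lies in one of the finitely many closed pieces, and no piece lies
  in another, so the maximal irreducible sets are exactly the pieces.\<close>

lemma irreducible_components_antichain:
  assumes I: "finite I" and irr: "\<And>i. i \<in> I \<Longrightarrow> irreducible_in (zar X) (C i)"
    and cl: "\<And>i. i \<in> I \<Longrightarrow> closedin (zar X) (C i)" and cover: "points X \<subseteq> (\<Union>i\<in>I. C i)"
    and anti: "\<And>i j. i \<in> I \<Longrightarrow> j \<in> I \<Longrightarrow> C i \<subseteq> C j \<Longrightarrow> i = j"
  shows "irreducible_components X = C ` I"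
proof -
  have in_some: "\<exists>i\<in>I. S \<subseteq> C i" if "irreducible_in (zar X) S" for S
    by (rule irreducible_in_finite_cover[OF I that cl]) (use that cover in \<open>auto simp: irreducible_in_def\<close>)
  have "C i \<in> irreducible_components X" if i: "i \<in> I" for i
    unfolding irreducible_components_def
  proof (intro CollectI conjI irr[OF i] allI impI)
    fix S assume S: "irreducible_in (zar X) S" "C i \<subseteq> S"
    obtain j where j: "j \<in> I" "S \<subseteq> C j" using in_some[OF S(1)] by blast
    then have "i = j" using anti[OF i] S(2) by blast
    then show "S = C i" using S(2) j(2) by blast
  qed
  moreover have "S \<in> C ` I" if S: "S \<in> irreducible_components X" for S
  proof -
    have irrS: "irreducible_in (zar X) S" using S by (simp add: irreducible_components_def)
    obtain j where j: "j \<in> I" "S \<subseteq> C j" using in_some[OF irrS] by blast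
    then have "C j = S" using S irr[OF j(1)] unfolding irreducible_components_def by blast
    then show ?thesis using j by blast
  qed
  ultimately show ?thesis by blast
qed

lemma irreducible_in_induced:
  assumes "irreducible_in (zar X) S" "S \<subseteq> D"
  shows "irreducible_in (zar (induced X D)) S"
  unfolding irreducible_in_def
proof (intro conjI allI impI)
  show "S \<subseteq> points (induced X D)" "S \<noteq> {}" using assms by (auto simp: irreducible_in_def)
  fix A B assume AB: "closedin (zar (induced X D)) A" "closedin (zar (induced X D)) B" "S \<subseteq> A \<union> B"
  obtain A' where A': "closedin (zar X) A'" "A = A' \<inter> D" using AB(1) by (auto simp: induced_def closedin_subtopology)
  obtain B' where B': "closedin (zar X) B'" "B = B' \<inter> D" using AB(2) by (auto simp: induced_def closedin_subtopology)
  have "S \<subseteq> A' \<union> B'" using AB(3) A'(2) B'(2) by blast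
  then have "S \<subseteq> A' \<or> S \<subseteq> B'" using assms(1) A'(1) B'(1) by (simp add: irreducible_in_def)
  then show "S \<subseteq> A \<or> S \<subseteq> B" using A'(2) B'(2) assms(2) by blast
qed

lemma finite_delta_cup_diagrams: "finite (delta_cup_diagrams n k m)"
proof (rule finite_subset)
  show "delta_cup_diagrams n k m \<subseteq> Pow ({1..n} \<times> {1..n})"
  proof
    fix a assume "a \<in> delta_cup_diagrams n k m"
    then have a: "cup_diagram n a" by (rule delta_cup_diagramsD(1))
    have "u \<in> {1..n} \<times> {1..n}" if "u \<in> a" for u
      using cup_diagramD[OF a, of "fst u" "snd u"] that by (cases u) auto
    then show "a \<in> Pow ({1..n} \<times> {1..n})" by blast
  qed
qed simp

context component
begin

abbreviation "cups_after p \<equiv> {(i, j) \<in> a. p < i}"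

text \<open>The induction runs downwards from the point \<open>Z r\<close>. The number of bundle
  steps grows exactly at left endpoints, all of which precede the cut, so at p = 0 every one of the
  k cups has contributed, those across the cut included.\<close>

lemma Z_tower:
  assumes "p \<le> r"
  shows "irreducible_in (zar (flag_variety r)) (Z p) \<and> locally_affine (induced (flag_variety r) (Z p)) \<and>
    iterated_P1_bundle (flag_variety r) (card (cups_after p)) (Z p)"
  using assms
proof (induction p rule: inc_induct)
  case base
  let ?A = "flag_variety r :: 'd flag fspace"
  have pA: "W \<in> points ?A" using K_partial[OF W_in_K] by (simp add: points_flag_variety)
  have "irreducible_in (zar ?A) (Z r)" using pA by (auto simp: irreducible_in_def Z_r)
  moreover have "locally_affine (induced ?A (Z r))"
    by (rule locally_affine_singleton[OF function_sheaf_induced[OF function_sheaf_flag_variety]]) (use pA in \<open>auto simp: Z_r\<close>)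
  moreover have "cups_after r = {}" using delta_left_endpoint[OF delta] by fastforce
  then have "iterated_P1_bundle ?A (card (cups_after r)) (Z r)"
    using iterated_P1_bundle_point[of ?A W] closedin_Z[OF order_refl] unfolding Z_r by (simp only: card.empty)
  ultimately show ?case by blast
next
  case (step p)
  show ?case
  proof (cases "\<exists>q. (Suc p, q) \<in> a")
    case True
    then obtain q where q: "(Suc p, q) \<in> a" by blast
    interpret left_step N e f z n k m a p q by unfold_locales (rule q)
    have "cups_after p = insert (Suc p, q) (cups_after (Suc p))"
    proof (intro equalityI subsetI)
      fix c assume c: "c \<in> cups_after p"
      obtain i j where ij: "c = (i, j)" by (cases c)
      show "c \<in> insert (Suc p, q) (cups_after (Suc p))"
      proof (cases "i = Suc p")
        case True
        then have "j = q" using c ij cup_diagram_disjoint[OF cupd q, of i j i] by simp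
        then show ?thesis using True ij by simp
      qed (use c ij in auto)
    qed (use q in auto)
    moreover have "finite (cups_after (Suc p))"
      by (rule finite_subset[OF _ finite_cup_diagram[OF cupd]]) auto
    ultimately have "card (cups_after p) = Suc (card (cups_after (Suc p)))" by simp
    then show ?thesis
      using Z_irreducible_step Z_locally_affine_step iterated_P1_bundle_step[OF _ closedin_Z pr_fiber_bundle] step by simp
  next
    case False
    then have "Z (Suc p) = Z p" by (intro Z_Suc_eq[OF step(2)]) blast
    moreover have "cups_after p = cups_after (Suc p)" using False by (auto intro: Suc_lessI)
    ultimately show ?thesis using step by simp
  qed
qed

lemma K_properties:
  "irreducible_in (zar (flag_variety r)) K" "closedin (zar (flag_variety r)) K"
  "iterated_P1_bundle (flag_variety r) k K" "smooth_fspace (induced (flag_variety r) K)"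
proof -
  have "0 < i" if "(i, j) \<in> a" for i j using cup_diagramD(1)[OF cupd that] by simp
  then have "cups_after 0 = a" by auto
  then have "card (cups_after 0) = k" using delta_cup_diagramsD(2)[OF delta] by simp
  then show "irreducible_in (zar (flag_variety r)) K" "iterated_P1_bundle (flag_variety r) k K"
    using Z_tower[of 0] by (simp_all add: Z_0)
  show "closedin (zar (flag_variety r)) K" using closedin_Z[of 0] by (simp add: Z_0)
  show "smooth_fspace (induced (flag_variety r) K)"
    using Z_tower[of 0] by (intro locally_affine_smooth function_sheaf_induced function_sheaf_flag_variety) (simp add: Z_0)
qed

end

theorem theorem1:
  fixes N n k m :: nat
    and e f :: "nat \<Rightarrow> complex ^ 'd::finite"
    and z :: "complex ^ 'd \<Rightarrow> complex ^ 'd"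
  assumes "m \<le> k" and "k \<le> n div 2" and "n < N"
    and "CARD('d) = 2 * N"
    and "inj_on e {1..N}" and "inj_on f {1..N}" and "e ` {1..N} \<inter> f ` {1..N} = {}"
    and "vec.independent (e ` {1..N} \<union> f ` {1..N})"
    and "vec.span (e ` {1..N} \<union> f ` {1..N}) = UNIV"
    and "Vector_Spaces.linear (*s) (*s) z"
    and "e 0 = 0" and "f 0 = 0"
    and "\<forall>i\<in>{1..N}. z (e i) = e (i - 1)" and "\<forall>i\<in>{1..N}. z (f i) = f (i - 1)"
  shows "(\<forall>a \<in> delta_cup_diagrams n k m.
            K_component e z n m a
              \<in> irreducible_components (induced (flag_variety (n - m)) (delta_springer e f z n k m)))
       \<and> (\<forall>a \<in> delta_cup_diagrams n k m.
            iterated_P1_bundle (flag_variety (n - m)) k (K_component e z n m a)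
            \<and> smooth_fspace (induced (flag_variety (n - m)) (K_component e z n m a)))
       \<and> bij_betw (K_component e z n m) (delta_cup_diagrams n k m)
            (irreducible_components (induced (flag_variety (n - m)) (delta_springer e f z n k m)))"
proof -
  interpret two_row N e f z
  proof (rule two_row.intro)
    show "z (e i) = e (i - 1)" "z (f i) = f (i - 1)" if "i \<in> {1..N}" for i
      using assms(13,14) that by blast+
  qed (rule assms)+
  let ?A = "flag_variety (n - m) :: 'd flag fspace" and ?D = "delta_springer e f z n k m"
  let ?X = "induced ?A ?D" and ?K = "K_component e z n m" and ?I = "delta_cup_diagrams n k m"
  \<comment> \<open>From m \<le> k \<le> n / 2 follows k \<le> n - m, the form in which
    \<open>springer_cover\<close> takes the bound.\<close>
  have num: "n \<le> N" "2 * k \<le> n" "m \<le> n" "k \<le> n - m" "k \<le> n" using assms(1-3) by auto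
  note Kprop = component.K_properties[where e = e and f = f and z = z and N = N and n = n and k = k and m = m]
  have comp: "component N e f z n k m a" if "a \<in> ?I" for a
    by unfold_locales (use that assms(3) in auto)
  have sub: "?K a \<subseteq> ?D" if "a \<in> ?I" for a
    by (rule K_component_subset_springer[OF that assms(3) num(2)])
  have anti: "a = b" if "a \<in> ?I" "b \<in> ?I" "?K a \<subseteq> ?K b" for a b
    by (rule K_component_antichain[OF that(1,2) num(1) that(3)])
  have comps: "irreducible_components ?X = ?K ` ?I"
  proof (rule irreducible_components_antichain[OF finite_delta_cup_diagrams])
    fix a assume a: "a \<in> ?I"
    show "irreducible_in (zar ?X) (?K a)" by (rule irreducible_in_induced[OF Kprop(1)[OF comp[OF a]] sub[OF a]])
    have "closedin (zar ?A) (?K a)" by (rule Kprop(2)[OF comp[OF a]])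
    then show "closedin (zar ?X) (?K a)"
      using sub[OF a] by (auto simp: induced_def closedin_subtopology)
  next
    show "points ?X \<subseteq> (\<Union>a\<in>?I. ?K a)"
    proof
      fix F assume "F \<in> points ?X"
      then have "F \<in> ?D" by simp
      then show "F \<in> (\<Union>a\<in>?I. ?K a)"
        using springer_cover[OF assms(3) num(3,2,4), of F] delta_springer_iff[OF num(5,1), of F m] by auto
    qed
  qed (rule anti)
  moreover have "inj_on ?K ?I" by (rule inj_onI) (use anti in blast)
  ultimately have "bij_betw ?K ?I (irreducible_components ?X)" by (simp add: bij_betw_def)
  then show ?thesis using comps Kprop(3,4)[OF comp] by blast
qed

end
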